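(* Let $K$ be an algebraically closed field with $\mathrm{char}(K)=p>0$. Set $k=k'=3$ if $p=2$, and $k=k'=p$ otherwise. Let $\Delta\subset\mathbb R^2$ be the kite with vertices $(0,0)$, $(k,1)$, $(k,-1)$ and $(k+k',0)$. Consider the Severi variety $V^{\mathrm{irr}}_{1,\Delta}$ parametrizing irreducible curves of geometric genus $1$ on $S_\Delta$ with trivial tangency profile. Then there is an irreducible component $V$ of the closure $\overline V^{\mathrm{irr}}_{1,\Delta}$ (in $|\mathscr L_\Delta|$) such that $V\cap V^{\mathrm{irr}}_{0,\Delta}=\emptyset$.
   Context: $(S_\Delta,\mathscr L_\Delta)$ is the polarized toric surface over $K$ associated to the lattice polygon $\Delta$. A curve in $S_\Delta$ is torically transverse if it contains no zero-dimensional orbit of the torus. The Severi variety is $$V^{\mathrm{irr}}_{g,\Delta}=\{[C]\in|\mathscr L_\Delta| : C\text{ is reduced, irreducible, torically transverse, of geometric genus } g\}.$$ "Trivial tangency profile" means that the pullback of each toric boundary divisor $D_i$ to the normalization of the curve is a reduced divisor of degree $D_i\cdot\mathscr L_\Delta$; for a kite this is automatic, since each side has integral length $1$ and hence $D_i\cdot\mathscr L_\Delta=1$. *)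

theory Defs
  imports
    "HOL-Analysis.Analysis"
    "HOL-Library.Poly_Mapping"
    "HOL-Computational_Algebra.Polynomial"
    "HOL-Algebra.Embedded_Algebras"
begin

section \<open>Projective space and its Zariski topology\<close>

type_synonym ('v, 'a) mpoly = "('v \<Rightarrow>\<^sub>0 nat) \<Rightarrow>\<^sub>0 'a"

definition mpoly_eval :: "('v, 'a::field) mpoly \<Rightarrow> ('v \<Rightarrow> 'a) \<Rightarrow> 'a" where
  "mpoly_eval F z = (\<Sum>u \<in> Poly_Mapping.keys F. Poly_Mapping.lookup F u *
     (\<Prod>v \<in> Poly_Mapping.keys u. z v ^ Poly_Mapping.lookup u v))"

definition homogeneous :: "nat \<Rightarrow> ('v, 'a::field) mpoly \<Rightarrow> bool" where
  "homogeneous d F \<longleftrightarrow> (\<forall>u \<in> Poly_Mapping.keys F.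
     (\<Sum>v \<in> Poly_Mapping.keys u. Poly_Mapping.lookup u v) = d)"

text \<open>A point of projective space is the set of all its homogeneous coordinate vectors.  The
  coordinates are indexed by a finite set \<open>A\<close> of arbitrary elements instead of an initial segment
  of the natural numbers; a coordinate vector is \<open>0\<close> off \<open>A\<close>.\<close>

type_synonym ('v, 'a) ppoint = "('v \<Rightarrow> 'a) set"

definition proj_point :: "('v \<Rightarrow> 'a::field) \<Rightarrow> ('v, 'a) ppoint" where
  "proj_point z = {(\<lambda>v. c * z v) | c. c \<noteq> 0}"

definition proj_space :: "'v set \<Rightarrow> ('v, 'a::field) ppoint set" where
  "proj_space A = {proj_point z | z. (\<exists>v. z v \<noteq> 0) \<and> (\<forall>v. v \<notin> A \<longrightarrow> z v = 0)}"

definition vanishes_at :: "('v, 'a::field) mpoly \<Rightarrow> ('v, 'a) ppoint \<Rightarrow> bool" where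
  "vanishes_at F q \<longleftrightarrow> (\<forall>z\<in>q. mpoly_eval F z = 0)"

definition zariski :: "'v set \<Rightarrow> ('v, 'a::field) ppoint topology" where
  "zariski A = topology_generated_by
     {{q \<in> proj_space A. \<not> vanishes_at F q} | F d. homogeneous d F}"

definition irreducible_in :: "'b topology \<Rightarrow> 'b set \<Rightarrow> bool" where
  "irreducible_in X S \<longleftrightarrow> S \<noteq> {} \<and> S \<subseteq> topspace X \<and>
     (\<forall>C1 C2. closedin X C1 \<and> closedin X C2 \<and> S \<subseteq> C1 \<union> C2 \<longrightarrow> S \<subseteq> C1 \<or> S \<subseteq> C2)"

definition irreducible_component :: "'b topology \<Rightarrow> 'b set \<Rightarrow> 'b set \<Rightarrow> bool" where
  "irreducible_component X Z V \<longleftrightarrow> V \<subseteq> Z \<and> irreducible_in X V \<and>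
     (\<forall>W. V \<subseteq> W \<and> W \<subseteq> Z \<and> irreducible_in X W \<longrightarrow> W = V)"

text \<open>Only used for \<open>F\<close>, \<open>G\<close> homogeneous of the same degree, when the value does not depend on the
  choice of the coordinate vector \<open>z\<close>.\<close>

definition ratio :: "('v, 'a::field) mpoly \<Rightarrow> ('v, 'a) mpoly \<Rightarrow> ('v, 'a) ppoint \<Rightarrow> 'a" where
  "ratio F G q = (let z = (SOME z. z \<in> q) in mpoly_eval F z / mpoly_eval G z)"


section \<open>The field of rational functions of an irreducible subset of projective space\<close>

text \<open>A rational function on \<open>Y\<close> is a function given by a quotient of forms of equal degree, up to
  equality on a nonempty open subset of \<open>Y\<close>.\<close>

definition germ ::
    "'v set \<Rightarrow> ('v, 'a::field) ppoint set \<Rightarrow> (('v, 'a) ppoint \<Rightarrow> 'a) \<Rightarrow> (('v, 'a) ppoint \<Rightarrow> 'a) set" where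
  "germ A Y h = {h'. \<exists>U. openin (zariski A) U \<and> U \<inter> Y \<noteq> {} \<and> (\<forall>q \<in> U \<inter> Y. h' q = h q)}"

definition function_field ::
    "'v set \<Rightarrow> ('v, 'a::field) ppoint set \<Rightarrow> (('v, 'a) ppoint \<Rightarrow> 'a) set ring" where
  "function_field A Y =
     \<lparr> carrier = {germ A Y (ratio F G) | F G d.
         homogeneous d F \<and> homogeneous d G \<and> (\<exists>q\<in>Y. \<not> vanishes_at G q)},
       monoid.mult = (\<lambda>X Z. \<Union>x\<in>X. \<Union>z\<in>Z. germ A Y (\<lambda>q. x q * z q)),
       one = germ A Y (\<lambda>q. 1),
       zero = germ A Y (\<lambda>q. 0),
       add = (\<lambda>X Z. \<Union>x\<in>X. \<Union>z\<in>Z. germ A Y (\<lambda>q. x q + z q)) \<rparr>"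

definition constant_functions ::
    "'v set \<Rightarrow> ('v, 'a::field) ppoint set \<Rightarrow> (('v, 'a) ppoint \<Rightarrow> 'a) set set" where
  "constant_functions A Y = {germ A Y (\<lambda>q. c) | c. True}"


section \<open>Genus of an algebraic function field over an algebraically closed field\<close>

text \<open>For the function field \<open>F\<close> of a curve over \<open>k\<close>, the nontrivial valuation rings of \<open>F\<close>
  containing \<open>k\<close> are the closed points of the normalization of (a projective model of) the curve.
  As \<open>k\<close> is algebraically closed, all of them have degree 1.\<close>

definition places :: "'f ring \<Rightarrow> 'f set \<Rightarrow> 'f set set" where
  "places F k = {R. subring R F \<and> k \<subset> R \<and> R \<subset> carrier F \<and>
     (\<forall>x \<in> carrier F - {\<zero>\<^bsub>F\<^esub>}. x \<in> R \<or> inv\<^bsub>F\<^esub> x \<in> R)}"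

text \<open>The left-hand set in the following equation is the maximal ideal of \<open>R\<close>.\<close>

definition uniformizer :: "'f ring \<Rightarrow> 'f set \<Rightarrow> 'f \<Rightarrow> bool" where
  "uniformizer F R t \<longleftrightarrow> t \<in> R \<and>
     {x \<in> R. x = \<zero>\<^bsub>F\<^esub> \<or> inv\<^bsub>F\<^esub> x \<notin> R} = {t \<otimes>\<^bsub>F\<^esub> y | y. y \<in> R}"

definition place_order :: "'f ring \<Rightarrow> 'f set \<Rightarrow> 'f \<Rightarrow> int" where
  "place_order F R x = (THE n. \<exists>t u. uniformizer F R t \<and>
     u \<in> R - {\<zero>\<^bsub>F\<^esub>} \<and> inv\<^bsub>F\<^esub> u \<in> R \<and> x = (t [^]\<^bsub>F\<^esub> (n::int)) \<otimes>\<^bsub>F\<^esub> u)"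

definition is_divisor :: "'f ring \<Rightarrow> 'f set \<Rightarrow> ('f set \<Rightarrow> int) \<Rightarrow> bool" where
  "is_divisor F k D \<longleftrightarrow> finite {R \<in> places F k. D R \<noteq> 0}"

definition divisor_degree :: "'f ring \<Rightarrow> 'f set \<Rightarrow> ('f set \<Rightarrow> int) \<Rightarrow> int" where
  "divisor_degree F k D = (\<Sum>R \<in> {R \<in> places F k. D R \<noteq> 0}. D R)"

definition riemann_roch_space :: "'f ring \<Rightarrow> 'f set \<Rightarrow> ('f set \<Rightarrow> int) \<Rightarrow> 'f set" where
  "riemann_roch_space F k D =
     {x \<in> carrier F. x = \<zero>\<^bsub>F\<^esub> \<or> (\<forall>R \<in> places F k. - D R \<le> place_order F R x)}"

text \<open>The genus is the maximum of \<open>deg D - dim L(D) + 1\<close> over all divisors \<open>D\<close> (Stichtenoth,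
  Algebraic Function Fields and Codes, Definition 1.4.15).\<close>

definition has_genus :: "'f ring \<Rightarrow> 'f set \<Rightarrow> nat \<Rightarrow> bool" where
  "has_genus F k g \<longleftrightarrow>
     (\<exists>D n. is_divisor F k D \<and> ring.dimension F n k (riemann_roch_space F k D) \<and>
        divisor_degree F k D - int n + 1 = int g) \<and>
     (\<forall>D n. is_divisor F k D \<and> ring.dimension F n k (riemann_roch_space F k D) \<longrightarrow>
        divisor_degree F k D - int n + 1 \<le> int g)"


section \<open>The polarized toric surface of a lattice polygon\<close>

definition lattice_points :: "(real \<times> real) set \<Rightarrow> (int \<times> int) set" where
  "lattice_points \<Delta> = {m. (real_of_int (fst m), real_of_int (snd m)) \<in> \<Delta>}"

definition torus_act ::
    "'a::field \<Rightarrow> 'a \<Rightarrow> (int \<times> int \<Rightarrow> 'a) \<Rightarrow> (int \<times> int \<Rightarrow> 'a)" where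
  "torus_act s t z = (\<lambda>m. s powi fst m * t powi snd m * z m)"

definition torus_orbit :: "(int \<times> int, 'a::field) ppoint \<Rightarrow> (int \<times> int, 'a) ppoint set" where
  "torus_orbit q = {torus_act s t ` q | s t. s \<noteq> 0 \<and> t \<noteq> 0}"

text \<open>Lattice polygons are normal, so \<open>\<L>\<^sub>\<Delta>\<close> is very ample, its sections have the basis of monomials
  \<open>x\<^sup>m\<close> with \<open>m\<close> in \<open>\<Delta> \<inter> \<int>\<^sup>2\<close>, and \<open>S\<^sub>\<Delta>\<close> is the closure of the image of the torus in the projective
  space with these monomials as coordinates, with \<open>\<L>\<^sub>\<Delta> = \<O>(1)\<close>.  (The lattice is \<open>\<int>\<^sup>2\<close>.)  The image
  of the torus is the orbit of the point all of whose coordinates are \<open>1\<close>.\<close>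

definition toric_surface :: "(real \<times> real) set \<Rightarrow> (int \<times> int, 'a::field) ppoint set" where
  "toric_surface \<Delta> = zariski (lattice_points \<Delta>) closure_of
     torus_orbit (proj_point (\<lambda>m. if m \<in> lattice_points \<Delta> then 1 else 0))"

text \<open>The linear system \<open>|\<L>\<^sub>\<Delta>|\<close> is the projectivization of the space of sections: an element is the
  class \<open>c\<close> of the coefficient vectors \<open>a\<close> of a nonzero section.\<close>

abbreviation linear_system :: "(real \<times> real) set \<Rightarrow> (int \<times> int, 'a::field) ppoint set" where
  "linear_system \<Delta> \<equiv> proj_space (lattice_points \<Delta>)"

definition section_form ::
    "(real \<times> real) set \<Rightarrow> (int \<times> int \<Rightarrow> 'a::field) \<Rightarrow> (int \<times> int, 'a) mpoly" where
  "section_form \<Delta> a =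
     (\<Sum>m \<in> lattice_points \<Delta>. Poly_Mapping.single (Poly_Mapping.single m 1) (a m))"

definition curve_support ::
    "(real \<times> real) set \<Rightarrow> (int \<times> int, 'a::field) ppoint \<Rightarrow> (int \<times> int, 'a) ppoint set" where
  "curve_support \<Delta> c = {q \<in> toric_surface \<Delta>. \<forall>a\<in>c. vanishes_at (section_form \<Delta> a) q}"

text \<open>On the affine chart of \<open>S\<^sub>\<Delta>\<close> where the coordinate \<open>m\<close> is nonzero, the curve is the closed
  subscheme defined by the regular function \<open>section / m\<close>; the coordinate ring of the chart consists
  of the functions \<open>F / m\<^sup>d\<close> with \<open>F\<close> a form of degree \<open>d\<close>.  The curve is reduced iff this principal
  ideal is radical on every chart.\<close>

definition chart :: "(real \<times> real) set \<Rightarrow> int \<times> int \<Rightarrow> (int \<times> int, 'a::field) ppoint set" where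
  "chart \<Delta> m = {q \<in> toric_surface \<Delta>.
     \<not> vanishes_at (Poly_Mapping.single (Poly_Mapping.single m 1) 1) q}"

definition chart_functions :: "int \<times> int \<Rightarrow> ((int \<times> int, 'a::field) ppoint \<Rightarrow> 'a) set" where
  "chart_functions m =
     {ratio F (Poly_Mapping.single (Poly_Mapping.single m d) 1) | F d. homogeneous d F}"

definition local_equation ::
    "(real \<times> real) set \<Rightarrow> (int \<times> int \<Rightarrow> 'a::field) \<Rightarrow> int \<times> int \<Rightarrow> (int \<times> int, 'a) ppoint \<Rightarrow> 'a" where
  "local_equation \<Delta> a m =
     ratio (section_form \<Delta> a) (Poly_Mapping.single (Poly_Mapping.single m 1) 1)"

definition in_local_ideal ::
    "(real \<times> real) set \<Rightarrow> (int \<times> int \<Rightarrow> 'a::field) \<Rightarrow> int \<times> int \<Rightarrow>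
      ((int \<times> int, 'a) ppoint \<Rightarrow> 'a) \<Rightarrow> bool" where
  "in_local_ideal \<Delta> a m h \<longleftrightarrow>
     (\<exists>g \<in> chart_functions m. \<forall>q \<in> chart \<Delta> m. h q = g q * local_equation \<Delta> a m q)"

definition curve_reduced :: "(real \<times> real) set \<Rightarrow> (int \<times> int, 'a::field) ppoint \<Rightarrow> bool" where
  "curve_reduced \<Delta> c \<longleftrightarrow>
     (\<forall>a \<in> c. \<forall>m \<in> lattice_points \<Delta>. \<forall>h \<in> chart_functions m. \<forall>n.
        in_local_ideal \<Delta> a m (\<lambda>q. h q ^ n) \<longrightarrow> in_local_ideal \<Delta> a m h)"

definition curve_irreducible :: "(real \<times> real) set \<Rightarrow> (int \<times> int, 'a::field) ppoint \<Rightarrow> bool" where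
  "curve_irreducible \<Delta> c \<longleftrightarrow> irreducible_in (zariski (lattice_points \<Delta>)) (curve_support \<Delta> c)"

text \<open>An orbit is an irreducible variety, hence zero-dimensional iff it has finitely many points.\<close>

definition torically_transverse :: "(real \<times> real) set \<Rightarrow> (int \<times> int, 'a::field) ppoint \<Rightarrow> bool" where
  "torically_transverse \<Delta> c \<longleftrightarrow>
     (\<forall>q \<in> toric_surface \<Delta>. finite (torus_orbit q) \<longrightarrow> \<not> torus_orbit q \<subseteq> curve_support \<Delta> c)"

definition geometric_genus ::
    "(real \<times> real) set \<Rightarrow> (int \<times> int, 'a::field) ppoint \<Rightarrow> nat \<Rightarrow> bool" where
  "geometric_genus \<Delta> c g \<longleftrightarrow>
     has_genus (function_field (lattice_points \<Delta>) (curve_support \<Delta> c))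
       (constant_functions (lattice_points \<Delta>) (curve_support \<Delta> c)) g"

definition severi_irr :: "nat \<Rightarrow> (real \<times> real) set \<Rightarrow> (int \<times> int, 'a::field) ppoint set" where
  "severi_irr g \<Delta> = {c \<in> linear_system \<Delta>. curve_reduced \<Delta> c \<and> curve_irreducible \<Delta> c \<and>
     torically_transverse \<Delta> c \<and> geometric_genus \<Delta> c g}"

definition kite :: "nat \<Rightarrow> nat \<Rightarrow> (real \<times> real) set" where
  "kite k k' = convex hull {(0, 0), (real k, 1), (real k, -1), (real k + real k', 0)}"

end

theory Submission
  imports Defs "HOL-Algebra.Algebraic_Closure_Type" "HOL-Library.Product_Plus" "HOL-Library.Function_Algebras"
begin

text \<open>After scaling, a curve in the torus is \<open>x\<^sup>k (a y + b / y) + P(x) = 0\<close>, a double cover of the line; with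
 \<open>Q = a b x\<^sup>2\<^sup>k\<close> its genus is \<open>2 k - 1 - d\<close>, where \<open>d\<close> is the greatest degree of a conductor, that is, of an \<open>S\<close>
 such that \<open>S\<close> divides \<open>P + 2 s\<close> and \<open>S\<^sup>2\<close> divides \<open>s\<^sup>2 + P s + Q\<close> for some \<open>s\<close>. The roots of the conductors are
 integral over the coefficients and hence specialize, so the genus one locus lies in a union of two explicit closed sets. One of
 them contains no genus zero curve, and an explicit genus one curve lies outside the other. Any component through that curve works.\<close>

text \<open>In characteristic \<open>p > 2\<close> the discriminant \<open>PP^2 - 4 * QQ\<close> is
  the product of \<open>f1 = PP - 2 c x^p\<close> and \<open>f2 = PP + 2 c x^p\<close>, where
  \<open>c^2 = a b\<close>. Both have the derivative of \<open>PP\<close>, of degree at most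
  \<open>2 p - 2\<close>. The square of a conductor divides the discriminant, so a conductor splits
  as \<open>E1 * E2\<close> with \<open>E1^2 dvd f1\<close> and \<open>E2^2 dvd f2\<close>, and it
  divides that derivative. In degree \<open>2 p - 2\<close> (genus one) the derivative is zero, or
  \<open>f1\<close> or \<open>f2\<close> is a square, or \<open>E1\<close> and \<open>E2\<close>
  both have degree \<open>p - 1\<close> and \<open>E1 * E2\<close> is the derivative up to a
  constant. In the last case its coefficient at \<open>x^(p - 1)\<close> is zero, as for every
  derivative. In degree \<open>2 p - 1\<close> (genus zero) the derivative is zero and
  \<open>f1\<close> or \<open>f2\<close> is a constant times \<open>(x - r)^(2 p)\<close>, and then
  this coefficient cannot vanish. It separates the two genera and survives in limits. In
  characteristic two the discriminant is \<open>PP^2\<close> and no such splitting exists. A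
  conductor then divides \<open>PP\<close> itself, and two polynomial equations found by elimination
  replace the coefficient.\<close>

hide_const (open) Module.smult Coset.order Divisibility.irreducible Divisibility.prime UnivPoly.monom UnivPoly.deg
  UnivPoly.coeff Polynomials.degree Polynomials.lead_coeff

abbreviation (input) "psingle == Poly_Mapping.single"
abbreviation (input) "pkeys == Poly_Mapping.keys"
abbreviation (input) "plookup == Poly_Mapping.lookup"

section \<open>Subfields of an ambient field: valuation rings and orders at a place\<close>

text \<open>The fields involved live inside one type of class \<open>field\<close>, so that its
  arithmetic applies directly; the record only reconnects them with \<open>places\<close> and
  \<open>has_genus\<close>.\<close>

definition subfield_record :: "'l::field set => 'l ring" where
 "subfield_record F = ring_of_type_algebra\<lparr>carrier := F\<rparr>"

locale field_extension =
 fixes F k :: "'l::field set"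
 assumes F1: "1 \<in> F" and F_diff: "x \<in> F ==> y \<in> F ==> x - y \<in> F" and F_mult: "x \<in> F ==> y \<in> F ==> x * y \<in> F"
  and F_inv: "x \<in> F ==> inverse x \<in> F" and k1: "1 \<in> k" and k_diff: "x \<in> k ==> y \<in> k ==> x - y \<in> k"
  and k_mult: "x \<in> k ==> y \<in> k ==> x * y \<in> k" and k_inv: "x \<in> k ==> inverse x \<in> k" and kF: "k <= F"
begin

abbreviation "FR \<equiv> subfield_record F"

lemma F0: "0 \<in> F" using F_diff[OF F1 F1] by simp

lemma F_uminus: "x \<in> F ==> - x \<in> F" using F_diff[OF F0] by fastforce

lemma F_add: "x \<in> F ==> y \<in> F ==> x + y \<in> F" using F_diff[OF _ F_uminus] by fastforce

lemma F_div: "x \<in> F ==> y \<in> F ==> x / y \<in> F" unfolding divide_inverse by (intro F_mult F_inv)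

lemma F_power: "x \<in> F ==> x ^ n \<in> F" by (induction n) (auto intro: F1 F_mult)

lemma F_powi: "x \<in> F ==> x powi n \<in> F" unfolding power_int_def by (auto intro: F_power F_inv)

lemma sel [simp]:
 "carrier FR = F" "x \<otimes>\<^bsub>FR\<^esub> y = x * y" "x \<oplus>\<^bsub>FR\<^esub> y = x + y" "\<zero>\<^bsub>FR\<^esub> = 0" "\<one>\<^bsub>FR\<^esub> = 1"
 by (simp_all add: subfield_record_def ring_of_type_algebra_def)

lemma field_FR: "field FR"
proof (rule cring.cring_fieldI2)
 show "cring FR"
 proof (intro cringI abelian_groupI comm_monoidI)
  fix x assume "x \<in> carrier FR"
  then show "\<exists>y\<in>carrier FR. y \<oplus>\<^bsub>FR\<^esub> x = \<zero>\<^bsub>FR\<^esub>"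
   by (intro bexI[of _ "- x"]) (auto intro: F_uminus)
 qed (auto simp: algebra_simps F0 F1 F_add F_mult)
 show "\<zero>\<^bsub>FR\<^esub> ~= \<one>\<^bsub>FR\<^esub>" by simp
 fix a assume "a \<in> carrier FR" "a ~= \<zero>\<^bsub>FR\<^esub>"
 then show "\<exists>b\<in>carrier FR. a \<otimes>\<^bsub>FR\<^esub> b = \<one>\<^bsub>FR\<^esub>"
  by (intro bexI[of _ "inverse a"]) (auto intro: F_inv)
qed

lemma ring_FR: "ring FR" using field_FR by (simp add: field.is_ring)

lemma uminus_FR [simp]: assumes "x \<in> F" shows "\<ominus>\<^bsub>FR\<^esub> x = - x"
proof -
 interpret FR: ring FR by (rule ring_FR)
 show ?thesis by (rule FR.minus_equality) (use assms F_uminus in auto)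
qed

lemma inv_FR [simp]: assumes "x \<in> F" "x ~= 0" shows "inv\<^bsub>FR\<^esub> x = inverse x"
proof -
 interpret FR: field FR by (rule field_FR)
 show ?thesis by (rule FR.comm_inv_char) (use assms F_inv in auto)
qed

lemma nat_pow_FR [simp]: "x [^]\<^bsub>FR\<^esub> (n::nat) = x ^ n"
proof (induction n)
 case 0
 show ?case by (metis monoid.nat_pow_0 ring.is_monoid ring_FR power_0 sel(5))
next
 case (Suc n)
 then show ?case by (metis monoid.nat_pow_Suc ring.is_monoid ring_FR power_Suc2 sel(2))
qed

lemma int_pow_FR [simp]: "x \<in> F ==> x ~= 0 ==> x [^]\<^bsub>FR\<^esub> (n::int) = x powi n"
 by (simp add: int_pow_def2 power_int_def F_power power_inverse)

lemma subfield_k: "subfield k FR"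
proof (rule field.subfieldI'[OF field_FR])
 have k0: "0 \<in> k" using k_diff[OF k1 k1] by simp
 show "subring k FR" using kF k1 k_mult k_diff[OF k0] k_diff by (intro ring.subringI[OF ring_FR]) (auto, metis diff_minus_eq_add diff_0)
 fix x assume "x \<in> k - {\<zero>\<^bsub>FR\<^esub>}"
 then show "inv\<^bsub>FR\<^esub> x \<in> k" using kF k_inv by auto
qed

text \<open>Class form of membership in \<open>places\<close>. The valuation condition may range
  over all of \<open>F\<close>, because \<open>0\<close> lies in \<open>R\<close> anyway.\<close>

definition vring :: "'l set => bool" where
 "vring R \<longleftrightarrow> 1 \<in> R & (\<forall>x\<in>R. \<forall>y\<in>R. x - y \<in> R & x * y \<in> R) & k \<subset> R & R \<subset> F &
   (\<forall>x\<in>F. x \<in> R \<or> inverse x \<in> R)"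

lemma vringD:
 assumes "vring R" shows "1 \<in> R" "0 \<in> R" "x \<in> R ==> y \<in> R ==> x - y \<in> R" "x \<in> R ==> y \<in> R ==> x * y \<in> R"
  "x \<in> R ==> - x \<in> R" "x \<in> R ==> y \<in> R ==> x + y \<in> R"
  "x \<in> k ==> x \<in> R" "x \<in> R ==> x \<in> F" "x \<in> F ==> x \<notin> R ==> inverse x \<in> R"
proof -
 show d: "x - y \<in> R" if "x \<in> R" "y \<in> R" for x y using assms that by (auto simp: vring_def)
 show 0: "0 \<in> R" using assms d[of 1 1] by (auto simp: vring_def)
 show m: "- x \<in> R" if "x \<in> R" for x using d[OF 0 that] by simp
 show "x + y \<in> R" if "x \<in> R" "y \<in> R" for x y using d[OF that(1) m[OF that(2)]] by simp
qed (use assms in \<open>auto simp: vring_def\<close>)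

lemma places_iff: "R \<in> places FR k \<longleftrightarrow> vring R"
proof
 assume R: "R \<in> places FR k"
 then have s: "subring R FR" and RF: "R \<subset> F" and kR: "k \<subset> R" and v: "!!x. x \<in> F - {0} ==> x \<in> R \<or> inverse x \<in> R"
  by (auto simp: places_def)
 have c: "1 \<in> R" "0 \<in> R" "!!x y. x \<in> R ==> y \<in> R ==> x * y \<in> R"
  "!!x y. x \<in> R ==> y \<in> R ==> x + y \<in> R" using subringE(2,3,6,7)[OF s] by simp_all
 have c5: "- x \<in> R" if "x \<in> R" for x using subringE(5)[OF s that] uminus_FR[of x] RF that by auto
 have "x - y \<in> R" if "x \<in> R" "y \<in> R" for x y using c(4)[OF that(1) c5[OF that(2)]] by simp
 moreover have "x \<in> R \<or> inverse x \<in> R" if "x \<in> F" for x using v[of x] c(2) that by blast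
 ultimately show "vring R" unfolding vring_def using c RF kR by blast
next
 assume R: "vring R"
 note d = vringD[OF R]
 have RF: "R \<subset> F" "k \<subset> R" using R by (auto simp: vring_def)
 have "subring R FR" using RF d by (intro ring.subringI[OF ring_FR]) (auto simp: subset_iff psubset_eq)
 then show "R \<in> places FR k" using RF d(9) by (auto simp: places_def)
qed

text \<open>A discrete valuation ring with uniformizer \<open>t\<close>, expressed by the
  factorization of nonzero elements of \<open>F\<close>; this is the form in which the local rings
  of the curve are computed.\<close>

definition dvr :: "'l set => 'l => bool" where
 "dvr R t \<longleftrightarrow> vring R & t \<in> R & t ~= 0 & inverse t \<notin> R &
   (\<forall>z\<in>F - {0}. \<exists>n::int. \<exists>u\<in>R - {0}. inverse u \<in> R & z = t powi n * u)"

lemma nonunit_mult: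
 assumes "vring R" "x \<in> R" "inverse x \<notin> R" "y \<in> R" "y ~= 0" shows "inverse (x * y) \<notin> R"
proof
 assume "inverse (x * y) \<in> R"
 then have "inverse (x * y) * y \<in> R" using vringD[OF assms(1)] assms by blast
 then show False using assms by (simp add: field_simps)
qed

text \<open>One of \<open>y / x\<close> and \<open>x / y\<close> lies in \<open>R\<close>, so the
  sum is one of the two nonunits times an element of \<open>R\<close>.\<close>

lemma nonunit_add:
 assumes R: "vring R" and x: "x \<in> R" "inverse x \<notin> R" and y: "y \<in> R" "inverse y \<notin> R" and "x + y ~= 0"
 shows "inverse (x + y) \<notin> R"
proof -
 note d = vringD[OF R]
 have nz: "x ~= 0" "y ~= 0" using x y d(2) by auto
 have *: "inverse (a + b) \<notin> R" if a: "a \<in> R" "inverse a \<notin> R" and b: "b \<in> R" "b / a \<in> R" "a + b ~= 0" "a ~= 0" for a b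
 proof -
  have "a + b = a * (1 + b / a)" using that by (simp add: field_simps)
  moreover have "1 + b / a \<in> R" "1 + b / a ~= 0" using that d(1) d(6)[OF d(1) that(4)] by (auto simp: divide_simps)
  ultimately show ?thesis using nonunit_mult[OF R a] by metis
 qed
 have "y / x \<in> F" using x y d F_div by auto
 then consider "y / x \<in> R" | "x / y \<in> R" using d(9)[of "y / x"] by fastforce
 then show ?thesis
 proof cases
  case 1
  then show ?thesis using *[OF x y(1)] assms nz by auto
 next
  case 2
  then show ?thesis using *[OF y x(1)] assms nz by (auto simp: add.commute)
 qed
qed

lemma dvr_power:
 assumes "dvr R t" "t powi n \<in> R" shows "n \<ge> 0"
proof (rule ccontr)
 note d = vringD[of R]
 have R: "vring R" and t: "t \<in> R" "t ~= 0" "inverse t \<notin> R" using assms by (auto simp: dvr_def)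
 assume "\<not> n \<ge> 0"
 then have "t powi n * t powi (- n - 1) = inverse t" using t by (simp flip: power_int_add add: power_int_minus)
 moreover have "t powi (- n - 1) \<in> R"
 proof -
  have "t ^ m \<in> R" for m by (induction m) (use d[OF R] t in auto)
  then show ?thesis using \<open>\<not> n \<ge> 0\<close> by (auto simp: power_int_def)
 qed
 ultimately show False using d[OF R] assms t by metis
qed

lemma power_in_vring: "vring R ==> t \<in> R ==> n \<ge> 0 ==> t powi n \<in> R"
proof -
 assume a: "vring R" "t \<in> R" "n \<ge> 0"
 have "t ^ m \<in> R" for m by (induction m) (use vringD[OF a(1)] a in auto)
 then show ?thesis using a by (auto simp: power_int_def)
qed

lemma dvr_unit_iff:
 assumes D: "dvr R t" and u: "u \<in> R" "u ~= 0" "inverse u \<in> R" shows "t powi n * u \<in> R \<longleftrightarrow> n \<ge> 0"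
proof -
 have R: "vring R" and t: "t \<in> R" using D by (auto simp: dvr_def)
 note d = vringD[OF R]
 have "t powi n = t powi n * u * inverse u" using u by simp
 then have "t powi n * u \<in> R \<longleftrightarrow> t powi n \<in> R"
  using d(4)[OF _ u(1), of "t powi n"] d(4)[OF _ u(3), of "t powi n * u"] by metis
 then show ?thesis using dvr_power[OF D, of n] power_in_vring[OF R t, of n] by blast
qed

lemma dvr_maximal_ideal:
 assumes D: "dvr R t" shows "{x \<in> R. x = 0 \<or> inverse x \<notin> R} = {t * y | y. y \<in> R}"
proof -
 have R: "vring R" and t: "t \<in> R" "t ~= 0" "inverse t \<notin> R" using D by (auto simp: dvr_def)
 note d = vringD[OF R]
 have "x \<in> {t * y | y. y \<in> R}" if x: "x \<in> R" "inverse x \<notin> R" "x ~= 0" for x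
 proof -
  obtain n u where n: "u \<in> R" "u ~= 0" "inverse u \<in> R" "x = t powi n * u" using D d(8)[OF x(1)] x(3) unfolding dvr_def by blast
  have "n \<ge> 0" using dvr_unit_iff[OF D n(1-3)] n x by auto
  moreover have "n ~= 0" using n x by auto
  ultimately have "t powi (n - 1) * u \<in> R" using dvr_unit_iff[OF D n(1-3)] by simp
  moreover have "x = t * (t powi (n - 1) * u)" using n(4) t by (simp add: power_int_diff)
  ultimately show ?thesis by blast
 qed
 moreover have "0 \<in> {t * y | y. y \<in> R}" using d(2) by force
 moreover have "t * y \<in> {x \<in> R. x = 0 \<or> inverse x \<notin> R}" if "y \<in> R" for y
  using nonunit_mult[OF R t(1,3) that] d(4)[OF t(1) that] by auto
 ultimately show ?thesis by blast
qed

lemma uniformizer_dvr: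
 assumes D: "dvr R t" and t': "uniformizer FR R t'"
 obtains u where "t' = t * u" "u \<in> R" "u ~= 0" "inverse u \<in> R"
proof -
 have R: "vring R" and t: "t \<in> R" "t ~= 0" "inverse t \<notin> R" using D by (auto simp: dvr_def)
 note d = vringD[OF R]
 have tR: "t' \<in> R" and e: "{x \<in> R. x = 0 \<or> inv\<^bsub>FR\<^esub> x \<notin> R} = {t' * y | y. y \<in> R}"
  using t' by (auto simp: uniformizer_def)
 have "{x \<in> R. x = 0 \<or> inv\<^bsub>FR\<^esub> x \<notin> R} = {x \<in> R. x = 0 \<or> inverse x \<notin> R}" using d(8) by auto
 with e dvr_maximal_ideal[OF D] have e': "{t' * y | y. y \<in> R} = {t * y | y. y \<in> R}" by simp
 have "t' \<in> {t' * y | y. y \<in> R}" "t \<in> {t * y | y. y \<in> R}" using d(1) by force+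
 then have "t' \<in> {t * y | y. y \<in> R}" "t \<in> {t' * y | y. y \<in> R}" unfolding e' by simp_all
 then obtain a b where ab: "t' = t * a" "a \<in> R" "t = t' * b" "b \<in> R" by blast
 then have "a * b = 1" using t(2) by (simp add: mult.assoc mult.commute)
 then have "inverse a = b" "a ~= 0" by (auto simp: inverse_unique)
 then show ?thesis using that ab by blast
qed

lemma dvr_uniformizer:
 assumes D: "dvr R t" shows "uniformizer FR R t"
proof -
 have R: "vring R" and t: "t \<in> R" "t ~= 0" "inverse t \<notin> R" using D by (auto simp: dvr_def)
 have "{x \<in> R. x = 0 \<or> inv\<^bsub>FR\<^esub> x \<notin> R} = {x \<in> R. x = 0 \<or> inverse x \<notin> R}" using vringD(8)[OF R] by auto
 then show ?thesis using dvr_maximal_ideal[OF D] t by (simp add: uniformizer_def)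
qed

text \<open>Any other uniformizer is \<open>t\<close> times a unit, so the exponent does not depend
  on the uniformizer used in \<open>place_order\<close>; the two inequalities come from
  \<open>dvr_unit_iff\<close>.\<close>

lemma place_orderI:
 assumes D: "dvr R t" and u: "u \<in> R" "u ~= 0" "inverse u \<in> R" shows "place_order FR R (t powi n * u) = n" unfolding place_order_def
proof (rule the_equality)
 have R: "vring R" and t: "t \<in> R" "t ~= 0" "inverse t \<notin> R" using D by (auto simp: dvr_def)
 note d = vringD[OF R]
 show "\<exists>t' v. uniformizer FR R t' & v \<in> R - {\<zero>\<^bsub>FR\<^esub>} & inv\<^bsub>FR\<^esub> v \<in> R &
   t powi n * u = t' [^]\<^bsub>FR\<^esub> n \<otimes>\<^bsub>FR\<^esub> v"
  using dvr_uniformizer[OF D] u t d(8) by (intro exI[of _ t] exI[of _ u]) auto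
 fix m :: int assume "\<exists>t' v. uniformizer FR R t' & v \<in> R - {\<zero>\<^bsub>FR\<^esub>} & inv\<^bsub>FR\<^esub> v \<in> R &
   t powi n * u = t' [^]\<^bsub>FR\<^esub> m \<otimes>\<^bsub>FR\<^esub> v"
 then obtain t' v where t': "uniformizer FR R t'" and v: "v \<in> R" "v ~= 0" "inverse v \<in> R"
  and e: "t powi n * u = t' [^]\<^bsub>FR\<^esub> m * v" using d(8) by auto
 obtain w where w: "t' = t * w" "w \<in> R" "w ~= 0" "inverse w \<in> R" using uniformizer_dvr[OF D t'] by blast
 have wm: "w powi i \<in> R" for i :: int using power_in_vring[OF R w(2), of i] power_in_vring[OF R w(4), of "- i"]
  by (cases "i \<ge> 0") (auto simp: power_int_minus power_int_inverse)
 have "t' \<in> F" "t' ~= 0" using w t d by auto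
 then have e': "t powi n * u = t powi m * (w powi m * v)" using e w by (simp add: power_int_mult_distrib mult.assoc)
 have y: "w powi m * v \<in> R" "w powi m * v ~= 0" "inverse (w powi m * v) \<in> R"
  using wm[of m] wm[of "- m"] v w d(4) by (auto simp: power_int_minus mult.commute)
 have "t powi (n - m) * u = w powi m * v" using e' t by (simp add: power_int_diff field_simps)
 then have "n \<ge> m" using y dvr_unit_iff[OF D u, of "n - m"] by auto
 moreover have "t powi (m - n) * (w powi m * v) = u" using e' t by (simp add: power_int_diff field_simps)
 then have "m \<ge> n" using u dvr_unit_iff[OF D y, of "m - n"] by auto
 ultimately show "m = n" by simp
qed

lemma dvr_decomp:
 assumes D: "dvr R t" and z: "z \<in> F" "z ~= 0"
 obtains u where "u \<in> R" "u ~= 0" "inverse u \<in> R" "z = t powi place_order FR R z * u"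
proof -
 obtain n u where n: "u \<in> R" "u ~= 0" "inverse u \<in> R" "z = t powi n * u" using D z unfolding dvr_def by blast
 then show ?thesis using place_orderI[OF D n(1-3)] that by metis
qed

lemma order_ge_0_iff:
 assumes D: "dvr R t" and z: "z \<in> F" "z ~= 0" shows "place_order FR R z \<ge> 0 \<longleftrightarrow> z \<in> R"
 using dvr_decomp[OF D z] dvr_unit_iff[OF D] by metis

lemma order_mult:
 assumes D: "dvr R t" and z: "z \<in> F" "z ~= 0" and w: "w \<in> F" "w ~= 0"
 shows "place_order FR R (z * w) = place_order FR R z + place_order FR R w"
proof -
 have R: "vring R" and t: "t ~= 0" using D by (auto simp: dvr_def)
 note d = vringD[OF R]
 obtain u where u: "u \<in> R" "u ~= 0" "inverse u \<in> R" "z = t powi place_order FR R z * u" using dvr_decomp[OF D z] by blast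
 obtain v where v: "v \<in> R" "v ~= 0" "inverse v \<in> R" "w = t powi place_order FR R w * v" using dvr_decomp[OF D w] by blast
 have "z * w = t powi (place_order FR R z + place_order FR R w) * (u * v)" using t by (subst u(4), subst v(4)) (simp add: power_int_add)
 moreover have "u * v \<in> R" "u * v ~= 0" "inverse (u * v) \<in> R" using u v d by auto
 ultimately show ?thesis using place_orderI[OF D] by metis
qed

lemma order_inverse:
 assumes D: "dvr R t" and z: "z \<in> F" "z ~= 0" shows "place_order FR R (inverse z) = - place_order FR R z"
proof -
 have "place_order FR R 1 = 0" using place_orderI[OF D, of 1 0] vringD(1)[of R] D by (simp add: dvr_def)
 then show ?thesis using order_mult[OF D z F_inv[OF z(1)]] z by simp
qed

lemma order_power:
 assumes D: "dvr R t" and z: "z \<in> F" "z ~= 0" shows "place_order FR R (z ^ n) = int n * place_order FR R z"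
proof (induction n)
 case 0
 then show ?case using place_orderI[OF D, of 1 0] vringD(1)[of R] D by (simp add: dvr_def)
next
 case (Suc n)
 then show ?case using order_mult[OF D z F_power[OF z(1)]] z by (simp add: algebra_simps)
qed

lemma order_add:
 assumes D: "dvr R t" and z: "z \<in> F" "z ~= 0" and w: "w \<in> F" "w ~= 0" and "z + w ~= 0"
  and n: "place_order FR R z \<ge> n" "place_order FR R w \<ge> n" shows "place_order FR R (z + w) \<ge> n"
proof -
 have R: "vring R" and t: "t ~= 0" "t \<in> F" using D vringD(8) by (auto simp: dvr_def)
 have tn: "place_order FR R (t powi m) = m" for m :: int using place_orderI[OF D, of 1 m] vringD(1)[OF R] by simp
 have *: "place_order FR R x \<ge> n \<longleftrightarrow> x * t powi (- n) \<in> R" if "x \<in> F" "x ~= 0" for x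
  using order_ge_0_iff[OF D, of "x * t powi (- n)"] order_mult[OF D that, of "t powi (-n)"] tn[of "- n"]
   F_mult F_powi that t by auto
 show ?thesis using n vringD(6)[OF R] assms F_add by (simp add: * distrib_right)
qed

text \<open>A discrete valuation ring is maximal among proper subrings: an element of negative
  order, multiplied by a power of \<open>t\<close> and a unit, gives \<open>inverse t\<close>, and
  then all of \<open>F\<close>. A place of the curve is thus identified as soon as it contains a
  known local ring.\<close>

lemma vring_subset_eq:
 assumes D: "dvr R t" and R': "vring R'" and "R <= R'" shows "R' = R"
proof (rule ccontr)
 have R: "vring R" and t: "t \<in> R" "t ~= 0" using D by (auto simp: dvr_def)
 note d = vringD[OF R] and d' = vringD[OF R']
 assume "R' ~= R"
 then obtain z where z: "z \<in> R'" "z \<notin> R" using assms by blast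
 then have zF: "z \<in> F" "z ~= 0" using d' d by auto
 obtain u where u: "u \<in> R" "u ~= 0" "inverse u \<in> R" "z = t powi place_order FR R z * u" using dvr_decomp[OF D zF] by blast
 define n where "n = place_order FR R z"
 have n: "n < 0" using order_ge_0_iff[OF D zF] z by (simp add: n_def)
 have "t powi (- n - 1) \<in> R'" using power_in_vring[OF R t(1), of "- n - 1"] n assms by auto
 moreover have "t powi (- n - 1) * z * inverse u = inverse t"
  using u t by (subst u(4), simp add: n_def[symmetric] power_int_diff power_int_minus field_simps)
 ultimately have ti: "inverse t \<in> R'" using d'(4) z u assms(3) by (metis subsetD)
 have "F <= R'"
 proof
  fix y assume y: "y \<in> F"
  show "y \<in> R'"
  proof (cases "y = 0")
   case False
   obtain v where v: "v \<in> R" "v ~= 0" "y = t powi place_order FR R y * v" using dvr_decomp[OF D y False] by blast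
   have "t powi i \<in> R'" for i :: int using power_in_vring[OF R', of t i] power_in_vring[OF R' ti, of "- i"] t assms(3)
    by (cases "i \<ge> 0") (auto simp: power_int_minus power_int_inverse)
   then show ?thesis using v d'(4) assms(3) by (metis subsetD)
  qed (use d' in auto)
 qed
 then show False using R' by (auto simp: vring_def)
qed

end

section \<open>Divisors and Riemann-Roch spaces\<close>

context field_extension
begin

abbreviation "ordp R z \<equiv> place_order FR R z"
abbreviation "ddeg D \<equiv> divisor_degree FR k D"
abbreviation "RR D \<equiv> riemann_roch_space FR k D"

lemma k0: "0 \<in> k" using k_diff[OF k1 k1] by simp

lemma mem_RR: "x \<in> RR D \<longleftrightarrow> x \<in> F & (x = 0 \<or> (\<forall>R. vring R --> - D R \<le> ordp R x))"
 by (auto simp: riemann_roch_space_def places_iff)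

lemma RR_cong: "(!!R. vring R ==> D R = E R) ==> RR D = RR E" by (auto simp: mem_RR)

lemma line_extension_FR:
 "ring.line_extension FR K v E = {c * v + u | c u. c \<in> K & u \<in> E}"
 using ring.line_extension_mem_iff[OF ring_FR, of _ K v E] by (simp add: set_eq_iff) blast

lemma dimension_scale:
 assumes "ring.dimension FR n k V" "c \<in> F" "c ~= 0" shows "ring.dimension FR n k ((*) c ` V)" using assms(1)
proof (induction n k V rule: ring.dimension.induct[OF ring_FR, consumes 1])
 case (1 k)
 then show ?case using ring.zero_dim[OF ring_FR, of k] by simp
next
 case (2 v E n k)
 have "c * v \<notin> (*) c ` E" using 2 assms by auto
 moreover have "(*) c ` ring.line_extension FR k v E = ring.line_extension FR k (c * v) ((*) c ` E)"
 proof -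
  have "c * (d * v + u) = d * (c * v) + c * u" for d u by (simp add: algebra_simps)
  note * = this
  show ?thesis unfolding line_extension_FR
  proof (intro equalityI subsetI)
   fix z assume "z \<in> (*) c ` {d * v + u |d u. d \<in> k & u \<in> E}"
   then obtain d u where "d \<in> k" "u \<in> E" "z = d * (c * v) + c * u" using * by blast
   then show "z \<in> {d * (c * v) + u |d u. d \<in> k & u \<in> (*) c ` E}" by blast
  next
   fix z assume "z \<in> {d * (c * v) + u |d u. d \<in> k & u \<in> (*) c ` E}"
   then obtain d u where "d \<in> k" "u \<in> E" "z = c * (d * v + u)" using * by auto
   then show "z \<in> (*) c ` {d * v + u |d u. d \<in> k & u \<in> E}" by blast
  qed
 qed
 ultimately show ?case using 2 assms F_mult ring.Suc_dim[OF ring_FR, of "c * v"] by auto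
qed

text \<open>The hypothesis \<open>codim\<close> replaces a linear functional on \<open>E\<close>
  with kernel \<open>E'\<close>: any one vector of \<open>E\<close> outside \<open>E'\<close> spans
  \<open>E\<close> together with \<open>E'\<close>.\<close>

lemma dimension_codim_le_1:
 assumes E: "ring.dimension FR n k E" and E': "E' <= E" "0 \<in> E'" and add: "!!x y. x \<in> E' ==> y \<in> E' ==> x + y \<in> E'"
  and smult: "!!c x. c \<in> k ==> x \<in> E' ==> c * x \<in> E'"
  and codim: "!!x y. x \<in> E ==> y \<in> E ==> y \<notin> E' ==> \<exists>c\<in>k. x - c * y \<in> E'"
 shows "\<exists>n'. ring.dimension FR n' k E' & n \<le> n' + 1"
proof -
 interpret FR: field FR by (rule field_FR)
 note Ep = FR.space_subgroup_props[OF subfield_k E]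
 have "-1 \<in> k" using k_diff[OF k0 k1] by simp
 then have um: "- x \<in> E'" if "x \<in> E'" for x using smult[of "-1" x] that by simp
 have "subalgebra k E' FR"
 proof (intro subalgebra.intro subalgebra_axioms.intro)
  show "subgroup E' (add_monoid FR)"
  proof (rule FR.add.subgroupI)
   show "\<ominus>\<^bsub>FR\<^esub> a \<in> E'" if "a \<in> E'" for a using um[OF that] Ep(1) E' that by (subst uminus_FR) auto
  qed (use E' Ep(1) add in auto)
 qed (use smult in auto)
 then obtain n' where n': "FR.dimension n' k E'" using FR.subalbegra_incl_imp_finite_dimension[OF subfield_k _ _ E'(1)] FR.finite_dimensionI[OF E]
  by (meson FR.finite_dimensionE')
 show ?thesis
 proof (cases "E' = E")
  case True
  then show ?thesis using E by auto
 next
  case False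
  then obtain y where y: "y \<in> E" "y \<notin> E'" using E' by auto
  have "FR.line_extension k y E' = E"
  proof (intro equalityI subsetI)
   fix x assume "x \<in> FR.line_extension k y E'"
   then show "x \<in> E" using Ep(3,5) E' y by (auto simp: line_extension_FR)
  next
   fix x assume "x \<in> E"
   then obtain c where "c \<in> k" "x - c * y \<in> E'" using codim y by blast
   then show "x \<in> FR.line_extension k y E'" unfolding line_extension_FR by (intro CollectI exI[of _ c] exI[of _ "x - c * y"]) auto
  qed
  then have "FR.dimension (Suc n') k E" using FR.Suc_dim[of y E' n' k] n' y Ep(1) by auto
  then have "n = Suc n'" using FR.dimension_is_inj[OF subfield_k E] by blast
  then show ?thesis using n' by auto
 qed
qed

lemma deg_superset:
 assumes "finite S" "!!R. R \<in> S ==> vring R" "!!R. vring R ==> D R ~= 0 ==> R \<in> S" shows "ddeg D = sum D S"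
 unfolding divisor_degree_def using assms by (intro sum.mono_neutral_left) (auto simp: places_iff)

lemma is_divisor_iff: "is_divisor FR k D \<longleftrightarrow> finite {R. vring R & D R ~= 0}" by (simp add: is_divisor_def places_iff)

lemma is_divisor_add:
 assumes "is_divisor FR k D" "is_divisor FR k E" shows "is_divisor FR k (%R. D R + E R)" "ddeg (%R. D R + E R) = ddeg D + ddeg E"
proof -
 define S where "S = {R. vring R & D R ~= 0} \<union> {R. vring R & E R ~= 0}"
 have S: "finite S" using assms by (auto simp: S_def is_divisor_iff)
 show "is_divisor FR k (%R. D R + E R)" unfolding is_divisor_iff by (rule finite_subset[OF _ S]) (auto simp: S_def)
 show "ddeg (%R. D R + E R) = ddeg D + ddeg E" using S by (subst (1 2 3) deg_superset[of S]) (auto simp: S_def sum.distrib)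
qed

end

text \<open>\<open>residue\<close> says that the residue field of every place is \<open>k\<close>,
  so that one point of a divisor costs at most one linear condition.\<close>

locale function_field_ext = field_extension +
 assumes ex_dvr: "vring R ==> \<exists>t. dvr R t" and residue: "vring R ==> x \<in> R ==> \<exists>c\<in>k. x = c \<or> inverse (x - c) \<notin> R"
begin

lemma ord_mult:
 "vring R ==> z \<in> F ==> z ~= 0 ==> w \<in> F ==> w ~= 0 ==> ordp R (z * w) = ordp R z + ordp R w" using ex_dvr order_mult by metis

lemma ord_inverse: "vring R ==> z \<in> F ==> z ~= 0 ==> ordp R (inverse z) = - ordp R z" using ex_dvr order_inverse by metis

lemma ord_nonneg_iff: "vring R ==> z \<in> F ==> z ~= 0 ==> ordp R z \<ge> 0 \<longleftrightarrow> z \<in> R" using ex_dvr order_ge_0_iff by metis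

lemma ord_add:
 "vring R ==> z \<in> F ==> z ~= 0 ==> w \<in> F ==> w ~= 0 ==> z + w ~= 0 ==> n \<le> ordp R z ==> n \<le> ordp R w ==> n \<le> ordp R (z + w)"
 using ex_dvr order_add by metis

lemma ord_const: "vring R ==> c \<in> k ==> c ~= 0 ==> ordp R c = 0"
 using ord_nonneg_iff[of R c] ord_nonneg_iff[of R "inverse c"] ord_inverse[of R c] vringD(7)[of R] k_inv kF by force

lemma RR_0: "0 \<in> RR D" by (simp add: mem_RR F0)

lemma RR_add:
 assumes "x \<in> RR D" "y \<in> RR D" shows "x + y \<in> RR D"
proof (cases "x = 0 \<or> y = 0 \<or> x + y = 0")
 case False
 then show ?thesis using assms ord_add F_add by (auto simp: mem_RR)
qed (use assms RR_0 in auto)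

lemma RR_smult:
 assumes "c \<in> k" "x \<in> RR D" shows "c * x \<in> RR D"
proof (cases "x = 0 \<or> c = 0")
 case False
 then show ?thesis using assms ord_mult ord_const F_mult kF by (auto simp: mem_RR)
qed (use assms RR_0 in auto)

text \<open>A \<open>y\<close> in the larger space but not in the smaller one has order exactly
  \<open>- D R0\<close> at \<open>R0\<close>. Subtracting \<open>c * y\<close>, with
  \<open>c\<close> the residue of \<open>x / y\<close>, raises the order of \<open>x\<close>
  there.\<close>

lemma RR_step:
 assumes R0: "vring R0" and n: "ring.dimension FR n k (RR D)" shows "\<exists>n'. ring.dimension FR n' k (RR (D(R0 := D R0 - 1))) & n \<le> n' + 1"
proof (rule dimension_codim_le_1[OF n])
 let ?D = "D(R0 := D R0 - 1)"
 show "RR ?D <= RR D"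
 proof
  fix x assume "x \<in> RR ?D"
  moreover have "- D R \<le> - ?D R" for R by simp
  ultimately show "x \<in> RR D" unfolding mem_RR by (meson order_trans)
 qed
 fix x y assume x: "x \<in> RR D" and y: "y \<in> RR D" "y \<notin> RR ?D"
 have y0: "y ~= 0" "y \<in> F" "x \<in> F" using y RR_0 x by (auto simp: mem_RR)
 have oy: "ordp R0 y = - D R0" using y R0 by (auto simp: mem_RR split: if_splits)
 show "\<exists>c\<in>k. x - c * y \<in> RR ?D"
 proof (cases "x = 0")
  case True
  then show ?thesis using RR_0 k0 by (intro bexI[of _ 0]) auto
 next
  case False
  have "ordp R0 (x * inverse y) \<ge> 0" using x y0 False oy R0 ord_mult[OF R0, of x "inverse y"] ord_inverse[OF R0, of y] F_inv
   by (auto simp: mem_RR)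
  then have "x / y \<in> R0" using ord_nonneg_iff[OF R0, of "x / y"] False y0 F_div by (simp add: divide_inverse)
  then obtain c where c: "c \<in> k" "x / y = c \<or> inverse (x / y - c) \<notin> R0" using residue[OF R0] by blast
  show ?thesis
  proof (intro bexI[OF _ c(1)])
   show "x - c * y \<in> RR ?D"
   proof (cases "x - c * y = 0")
    case nz: False
    have D: "x - c * y \<in> RR D" using RR_add[OF x RR_smult[OF _ y(1), of "- c"]] c k_diff[OF k0 c(1)] by simp
    define w where "w = x / y - c"
    have w: "w ~= 0" "w \<in> F" "x - c * y = w * y" "inverse w \<notin> R0"
     using nz y0 c kF by (auto simp: w_def field_simps intro!: F_diff F_div F_mult)
    have "ordp R0 w \<ge> 1" using ord_nonneg_iff[OF R0 F_inv[OF w(2)]] ord_inverse[OF R0 w(2,1)] w by simp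
    then have "ordp R0 (x - c * y) \<ge> 1 - D R0" using ord_mult[OF R0 w(2,1) y0(2,1)] w(3) oy by simp
    then show ?thesis using D by (auto simp: mem_RR)
   qed (use RR_0 in simp)
  qed
 qed
qed (use RR_0 RR_add RR_smult in auto)

lemma RR_descend:
 assumes "is_divisor FR k E" "is_divisor FR k D" "!!R. vring R ==> D R \<le> E R"
  "ring.dimension FR n k (RR E)" shows "\<exists>n'. ring.dimension FR n' k (RR D) & int n - (ddeg E - ddeg D) \<le> int n'" using assms
proof (induction "nat (ddeg E - ddeg D)" arbitrary: E n rule: less_induct)
 case less
 define S where "S = {R. vring R & D R ~= 0} \<union> {R. vring R & E R ~= 0}"
 have S: "finite S" using less.prems by (auto simp: S_def is_divisor_iff)
 have dE: "ddeg E = sum E S" and dD: "ddeg D = sum D S" using S by (auto intro!: deg_superset simp: S_def)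
 show ?case
 proof (cases "\<forall>R. vring R --> D R = E R")
  case True
  then have "RR D = RR E" by (intro RR_cong) auto
  moreover have "ddeg E = ddeg D" unfolding dE dD using True by (auto simp: S_def intro!: sum.cong)
  ultimately show ?thesis using less.prems by auto
 next
  case False
  then obtain R0 where R0: "vring R0" "D R0 < E R0" using less.prems(3) by fastforce
  define E' where "E' = E(R0 := E R0 - 1)"
  have R0S: "R0 \<in> S" using R0 by (auto simp: S_def)
  have divE': "is_divisor FR k E'" unfolding is_divisor_iff by (rule finite_subset[OF _ S]) (use R0S R0 in \<open>auto simp: S_def E'_def\<close>)
  have "ddeg E' = sum E' S" using S R0S R0 by (intro deg_superset) (auto simp: S_def E'_def split: if_splits)
  also have "\<dots> = ddeg E - 1" unfolding dE E'_def using S R0S by (simp add: sum.remove)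
  finally have degE': "ddeg E' = ddeg E - 1" .
  have le: "D R \<le> E' R" if "vring R" for R using less.prems(3)[OF that] R0 by (auto simp: E'_def)
  have "ddeg D < ddeg E" unfolding dE dD using less.prems(3) R0 R0S S by (intro sum_strict_mono_ex1) (auto simp: S_def)
  then have lt: "nat (ddeg E' - ddeg D) < nat (ddeg E - ddeg D)" using degE' by auto
  obtain m where m: "ring.dimension FR m k (RR E')" "n \<le> m + 1" using RR_step[OF R0(1) less.prems(4)] unfolding E'_def by blast
  obtain n' where "ring.dimension FR n' k (RR D)" "int m - (ddeg E' - ddeg D) \<le> int n'"
   using less.hyps[OF lt divE' less.prems(2) le m(1)] by blast
  then show ?thesis using m(2) degE' by (intro exI[of _ n']) auto
 qed
qed

text \<open>By \<open>RR_descend\<close> the number \<open>deg D - dim L(D)\<close> does not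
  decrease when \<open>D\<close> grows, so the upper bound need only be known on a cofinal family of
  divisors.\<close>

lemma has_genusI:
 assumes "is_divisor FR k D0" "ring.dimension FR n0 k (RR D0)" "ddeg D0 - int n0 + 1 = int g"
  and "!!D. is_divisor FR k D ==> \<exists>E n. is_divisor FR k E & (\<forall>R. vring R --> D R \<le> E R) &
      ring.dimension FR n k (RR E) & ddeg E - int n + 1 \<le> int g" shows "has_genus FR k g" unfolding has_genus_def
proof (intro conjI allI impI)
 show "\<exists>D n. is_divisor FR k D & ring.dimension FR n k (RR D) & ddeg D - int n + 1 = int g" using assms by blast
 fix D n assume D: "is_divisor FR k D & ring.dimension FR n k (RR D)"
 then obtain E m where E: "is_divisor FR k E" "!!R. vring R ==> D R \<le> E R"
  "ring.dimension FR m k (RR E)" "ddeg E - int m + 1 \<le> int g" using assms(4) by blast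
 then obtain n' where n': "ring.dimension FR n' k (RR D)" "int m - (ddeg E - ddeg D) \<le> int n'" using RR_descend[OF E(1) _ E(2,3)] D by blast
 then have "n' = n" using ring.dimension_is_inj[OF ring_FR subfield_k] D by blast
 then show "ddeg D - int n + 1 \<le> int g" using n' E by auto
qed

end

lemma has_genus_unique: "has_genus F k g ==> has_genus F k g' ==> g = g'" unfolding has_genus_def by (metis nle_le of_nat_le_iff)

section \<open>Double covers of the line: coordinate ring and local rings at smooth points\<close>

text \<open>\<open>kp\<close> embeds the constants and \<open>xi\<close> is the coordinate of the
  line. It is a parameter, so that \<open>1 / xi\<close> can take its place at infinity.\<close>

locale field_embedding =
 fixes kp :: "'a::field => 'l::field" and xi :: 'l
 assumes kp_add: "kp (a + b) = kp a + kp b" and kp_mult: "kp (a * b) = kp a * kp b" and kp_1: "kp 1 = 1"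
begin

lemma kp_0: "kp 0 = 0" using kp_add[of 0 0] by (metis add_cancel_right_right add_0)

lemma kp_uminus: "kp (- a) = - kp a" using kp_add[of a "- a"] kp_0 by (simp add: minus_unique)

lemma kp_diff: "kp (a - b) = kp a - kp b" using kp_add[of a "- b"] kp_uminus by simp

lemma kp_eq_0_iff: "kp a = 0 \<longleftrightarrow> a = 0" using kp_mult[of a "inverse a"] kp_1 kp_0 by (cases "a = 0") auto

lemma kp_inverse: "kp (inverse a) = inverse (kp a)" using kp_mult[of a "inverse a"] kp_1 kp_0
 by (cases "a = 0") (auto intro!: inverse_unique[symmetric])

lemma kp_power: "kp (a ^ n) = kp a ^ n" by (induction n) (auto simp: kp_1 kp_mult)

lemma kp_eq_iff: "kp a = kp b \<longleftrightarrow> a = b" using kp_diff[of a b] kp_eq_0_iff[of "a - b"] by auto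

lemmas kp_simps = kp_add kp_mult kp_1 kp_0 kp_uminus kp_diff kp_eq_0_iff kp_inverse kp_power kp_eq_iff

definition ev :: "'a poly => 'l" where
 "ev p = poly (map_poly kp p) xi"

lemma ev_0 [simp]: "ev 0 = 0" by (simp add: ev_def)

lemma ev_pCons [simp]: "ev (pCons c p) = kp c + xi * ev p" by (simp add: ev_def map_poly_pCons kp_0)

lemma ev_1 [simp]: "ev 1 = 1" by (simp add: one_pCons kp_1)

lemma ev_add [simp]: "ev (p + q) = ev p + ev q" by (induction p q rule: poly_induct2) (auto simp: kp_add algebra_simps)

lemma ev_smult [simp]: "ev (smult c p) = kp c * ev p" by (induction p) (auto simp: kp_mult algebra_simps)

lemma ev_uminus [simp]: "ev (- p) = - ev p" using ev_smult[of "-1" p] by (simp add: kp_uminus kp_1)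

lemma ev_diff [simp]: "ev (p - q) = ev p - ev q" using ev_add[of p "- q"] by simp

lemma ev_mult [simp]: "ev (p * q) = ev p * ev q" by (induction p) (auto simp: algebra_simps kp_0)

lemma ev_power [simp]: "ev (p ^ n) = ev p ^ n" by (induction n) auto

lemma ev_monom [simp]: "ev (monom c n) = kp c * xi ^ n" by (induction n) (auto simp: monom_0 monom_Suc kp_0 algebra_simps)

lemma ev_sum [simp]: "ev (sum f A) = (\<Sum>i\<in>A. ev (f i))" by (induction A rule: infinite_finite_induct) auto

lemma ev_altdef:
 assumes "degree p \<le> n" shows "ev p = (\<Sum>i\<le>n. kp (coeff p i) * xi ^ i)"
proof -
 have "p = (\<Sum>i\<le>n. monom (coeff p i) i)" using poly_as_sum_of_monoms'[OF assms] by simp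
 then have "ev p = ev (\<Sum>i\<le>n. monom (coeff p i) i)" by simp
 then show ?thesis by simp
qed

end

text \<open>The reciprocal polynomial of formal degree \<open>n\<close>, used for the change of
  coordinate to infinity.\<close>

definition rev_poly :: "nat => 'a::comm_monoid_add poly => 'a poly" where
 "rev_poly n p = (\<Sum>i\<le>n. monom (coeff p (n - i)) i)"

lemma coeff_rev_poly: "coeff (rev_poly n p) i = (if i \<le> n then coeff p (n - i) else 0)" by (auto simp: rev_poly_def coeff_sum)

lemma degree_rev_poly: "degree (rev_poly n p) \<le> n" by (intro degree_le) (auto simp: coeff_rev_poly)

lemma rev_poly_eq_0D: "rev_poly n p = 0 ==> degree p \<le> n ==> p = 0"
proof -
 assume a: "rev_poly n p = 0" "degree p \<le> n"
 have "coeff p i = 0" for i using arg_cong[OF a(1), of "%q. coeff q (n - i)"] a(2) by (cases "i \<le> n") (auto simp: coeff_rev_poly coeff_eq_0)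
 then show "p = 0" by (simp add: poly_eq_iff)
qed

lemma (in field_embedding) ev_rev_poly:
 assumes "degree p \<le> n" "xi ~= 0" shows "field_embedding.ev kp (1 / xi) (rev_poly n p) = ev p / xi ^ n"
proof -
 interpret I: field_embedding kp "1 / xi" by standard (simp_all add: kp_simps)
 have "I.ev (rev_poly n p) = (\<Sum>i\<le>n. kp (coeff p (n - i)) * (1 / xi) ^ i)"
  by (subst I.ev_altdef[OF degree_rev_poly]) (simp add: coeff_rev_poly)
 also have "\<dots> = (\<Sum>i\<le>n. kp (coeff p i) * (1 / xi) ^ (n - i))" by (rule sum.reindex_bij_witness[of _ "%i. n - i" "%i. n - i"]) auto
 also have "\<dots> = (\<Sum>i\<le>n. kp (coeff p i) * xi ^ i) / xi ^ n" unfolding sum_divide_distrib using assms(2)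
  by (intro sum.cong) (auto simp: power_diff field_simps)
 finally show ?thesis using ev_altdef[OF assms(1)] by simp
qed

text \<open>\<open>indep\<close> says at once that \<open>xi\<close> is transcendental over the
  constants and that \<open>W\<close> has degree two over the rational functions in
  \<open>xi\<close>.\<close>

locale quadratic_curve = field_embedding kp xi for kp :: "'a::alg_closed_field => 'l::field" and xi +
 fixes W :: 'l and h g :: "'a poly"
 assumes W_eq: "W * W = - ev h * W - ev g" and indep: "ev af + ev bt * W = 0 ==> af = 0 & bt = 0"
begin

definition E :: "'a poly => 'a poly => 'l" where
 "E af bt = ev af + ev bt * W"

text \<open>The coordinate ring of the affine curve. Its fraction field is \<open>ff\<close> below,
  where multiplication by the conjugate brings every denominator into the polynomials in
  \<open>xi\<close>.\<close>

definition PE :: "'l set" where "PE = {E af bt | af bt. True}"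

definition ff :: "'l set" where
 "ff = {E af bt / ev ga | af bt ga. ga ~= 0}"

lemma E_inj: "E af bt = E af' bt' \<longleftrightarrow> af = af' & bt = bt'"
proof
 assume "E af bt = E af' bt'"
 then have "ev (af - af') + ev (bt - bt') * W = 0" by (simp add: E_def algebra_simps)
 from indep[OF this] show "af = af' & bt = bt'" by simp
qed simp

lemma E_eq_0_iff: "E af bt = 0 \<longleftrightarrow> af = 0 & bt = 0" using E_inj[of af bt 0 0] by (simp add: E_def)

lemma ev_eq_0_iff [simp]: "ev p = 0 \<longleftrightarrow> p = 0" using E_eq_0_iff[of p 0] by (simp add: E_def)

lemma E_mult: "E af bt * E af' bt' = E (af * af' - bt * bt' * g) (af * bt' + bt * af' - bt * bt' * h)"
proof -
 have "E af bt * E af' bt' = ev af * ev af' + (ev af * ev bt' + ev bt * ev af') * W + ev bt * ev bt' * (W * W)" by (simp add: E_def algebra_simps)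
 then show ?thesis unfolding W_eq by (simp add: E_def algebra_simps)
qed

text \<open>The second factor is the conjugate of the first: \<open>W\<close> is replaced by the
  other root \<open>- ev h - W\<close>.\<close>

lemma E_norm: "E af bt * E (af - bt * h) (- bt) = ev (af * af - af * bt * h + bt * bt * g)" unfolding E_mult by (simp add: E_def algebra_simps)

lemma E_add: "E af bt + E af' bt' = E (af + af') (bt + bt')" by (simp add: E_def algebra_simps)

lemma E_diff: "E af bt - E af' bt' = E (af - af') (bt - bt')" by (simp add: E_def algebra_simps)

lemma E_ev: "E p 0 = ev p" by (simp add: E_def)

lemma PE_intros: "E af bt \<in> PE" "ev p \<in> PE" "kp c \<in> PE" "1 \<in> PE" "0 \<in> PE" "W \<in> PE"
proof -
 show "E af bt \<in> PE" for af bt by (auto simp: PE_def)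
 from this[of p 0] this[of "[:c:]" 0] this[of 1 0] this[of 0 0] this[of 0 1]
 show "ev p \<in> PE" "kp c \<in> PE" "1 \<in> PE" "0 \<in> PE" "W \<in> PE" by (simp_all add: E_def)
qed

lemma PE_mult: "a \<in> PE ==> b \<in> PE ==> a * b \<in> PE" by (auto simp: PE_def E_mult) blast

lemma PE_add: "a \<in> PE ==> b \<in> PE ==> a + b \<in> PE" by (auto simp: PE_def E_add) blast

lemma PE_diff: "a \<in> PE ==> b \<in> PE ==> a - b \<in> PE" by (auto simp: PE_def E_diff) blast

lemma PE_uminus: "a \<in> PE ==> - a \<in> PE" using PE_diff[OF PE_intros(5), of a] by simp

lemma PE_power: "a \<in> PE ==> a ^ n \<in> PE" by (induction n) (auto intro: PE_mult PE_intros)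

lemma ffI: "a \<in> PE ==> ga ~= 0 ==> a / ev ga \<in> ff" by (auto simp: PE_def ff_def)

lemma ffE:
 assumes "z \<in> ff" obtains a ga where "a \<in> PE" "ga ~= 0" "z = a / ev ga" using assms by (auto simp: ff_def PE_def)

lemma PE_ff: "a \<in> PE ==> a \<in> ff" using ffI[of a 1] by simp

lemma ff_mult: "x \<in> ff ==> y \<in> ff ==> x * y \<in> ff"
proof -
 assume "x \<in> ff" "y \<in> ff"
 then obtain a ga b \<delta> where ab: "a \<in> PE" "ga ~= 0" "x = a / ev ga" "b \<in> PE" "\<delta> ~= 0" "y = b / ev \<delta>" by (metis ffE)
 then have "x * y = a * b / ev (ga * \<delta>)" by simp
 then show ?thesis using ffI[OF PE_mult, of a b "ga * \<delta>"] ab by simp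
qed

lemma ff_diff: "x \<in> ff ==> y \<in> ff ==> x - y \<in> ff"
proof -
 assume "x \<in> ff" "y \<in> ff"
 then obtain a ga b \<delta> where ab: "a \<in> PE" "ga ~= 0" "x = a / ev ga" "b \<in> PE" "\<delta> ~= 0" "y = b / ev \<delta>" by (metis ffE)
 then have "x - y = (a * ev \<delta> - b * ev ga) / ev (ga * \<delta>)" by (simp add: diff_frac_eq)
 moreover have "a * ev \<delta> - b * ev ga \<in> PE" using ab by (intro PE_diff PE_mult PE_intros)
 ultimately show ?thesis using ffI[of _ "ga * \<delta>"] ab by simp
qed

lemma PE_conj: "a \<in> PE ==> a ~= 0 ==> \<exists>b N. b \<in> PE & N ~= 0 & a * b = ev N"
proof -
 assume "a \<in> PE" "a ~= 0"
 then obtain af bt where a: "a = E af bt" by (auto simp: PE_def)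
 let ?b = "E (af - bt * h) (- bt)" and ?N = "af * af - af * bt * h + bt * bt * g"
 have "?b ~= 0" using \<open>a ~= 0\<close> a by (auto simp: E_eq_0_iff)
 then have "a * ?b ~= 0" using \<open>a ~= 0\<close> by simp
 moreover have eq: "a * ?b = ev ?N" unfolding a by (rule E_norm)
 ultimately have "?N ~= 0" using ev_0 by metis
 then show ?thesis using PE_intros(1) eq by blast
qed

lemma ff_inverse: "x \<in> ff ==> inverse x \<in> ff"
proof (cases "x = 0")
 case False
 assume "x \<in> ff"
 then obtain a ga where a: "a \<in> PE" "ga ~= 0" "x = a / ev ga" by (metis ffE)
 then have "a ~= 0" using False by auto
 then obtain b N where b: "b \<in> PE" "N ~= 0" "a * b = ev N" using PE_conj[OF a(1)] by blast
 have "b ~= 0" using b ev_eq_0_iff[of N] by auto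
 then have "inverse x = (ev ga * b) / (a * b)" using a by simp
 then have "inverse x = (ev ga * b) / ev N" unfolding b(3) .
 then show ?thesis using ffI[OF PE_mult[OF PE_intros(2) b(1)] b(2)] by simp
qed simp

sublocale field_extension ff "range kp"
proof unfold_locales
 show "range kp <= ff" using PE_ff PE_intros(3) by auto
 show "1 \<in> range kp" using kp_1 by (metis rangeI)
 show "x - y \<in> range kp" "x * y \<in> range kp" if xy: "x \<in> range kp" "y \<in> range kp" for x y
 proof -
  obtain a b where "x = kp a" "y = kp b" using xy by blast
  then have "x - y = kp (a - b)" "x * y = kp (a * b)" by (simp_all only: kp_diff kp_mult)
  then show "x - y \<in> range kp" "x * y \<in> range kp" by (simp_all only: rangeI)
 qed
 show "inverse x \<in> range kp" if x: "x \<in> range kp" for x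
 proof -
  obtain a where "x = kp a" using x by blast
  then have "inverse x = kp (inverse a)" by (simp only: kp_inverse)
  then show ?thesis by (simp only: rangeI)
 qed
 show "1 \<in> ff" by (rule PE_ff[OF PE_intros(4)])
qed (fact ff_mult ff_diff ff_inverse)+

lemma X_ff: "xi \<in> ff" and W_ff: "W \<in> ff" using PE_ff[OF PE_intros(2), of "[:0, 1:]"] PE_ff[OF PE_intros(6)] by (simp_all add: kp_simps)

lemma X_neq: "xi ~= kp c" using ev_eq_0_iff[of "[:-c, 1:]"] by (auto simp: kp_simps)

lemma ff_subset:
 assumes "1 \<in> G" "!!x y. x \<in> G ==> y \<in> G ==> x - y \<in> G" "!!x y. x \<in> G ==> y \<in> G ==> x * y \<in> G"
  "!!p. p ~= 0 ==> inverse (ev p) \<in> G" "range kp <= G" "xi \<in> G" "W \<in> G" shows "ff <= G"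
proof
 have "0 \<in> G" using assms(1) assms(2)[of 1 1] by simp
 then have add: "x + y \<in> G" if "x \<in> G" "y \<in> G" for x y using assms(2)[OF that(1) assms(2)[OF _ that(2), of 0]] by simp
 have ev: "ev p \<in> G" for p
 proof (induction p)
  case (pCons c p)
  have "kp c \<in> G" using assms(5) by blast
  from add[OF this assms(3)[OF assms(6) pCons.IH]] show ?case by simp
 qed (use \<open>0 \<in> G\<close> in simp)
 fix z assume "z \<in> ff"
 then obtain af bt ga where "ga ~= 0" "z = E af bt / ev ga" by (auto simp: ff_def)
 then show "z \<in> G" unfolding E_def divide_inverse using add[OF ev assms(3)[OF ev assms(7)]] assms(3,4) by metis
qed

definition on_curve :: "'a => 'a => bool" where
 "on_curve r om \<longleftrightarrow> om * om + poly h r * om + poly g r = 0"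

text \<open>For a point of the curve this is the Jacobian criterion: the second alternative says
  that \<open>W^2 + h W + g\<close>, restricted to \<open>W = om\<close>, has nonzero derivative in
  \<open>x\<close> at \<open>r\<close>.\<close>

definition smooth_at :: "'a => 'a => bool" where
 "smooth_at r om \<longleftrightarrow> 2 * om + poly h r ~= 0 \<or> \<not> [:-r, 1:] ^ 2 dvd [:om * om:] + smult om h + g"

text \<open>Evaluation of a regular function at the point \<open>(r, om)\<close>; \<open>THE\<close>
  is justified by \<open>E_inj\<close>.\<close>

definition val :: "'a => 'a => 'l => 'a" where
 "val r om z = (THE y. \<exists>af bt. z = E af bt & y = poly af r + poly bt r * om)"

definition loc :: "'a => 'a => 'l set" where
 "loc r om = {a / b | a b. a \<in> PE & b \<in> PE & val r om b ~= 0}"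

definition unif :: "'a => 'a => 'l" where
 "unif r om = (if 2 * om + poly h r ~= 0 then xi - kp r else W - kp om)"

lemma val_E: "val r om (E af bt) = poly af r + poly bt r * om" unfolding val_def by (rule the_equality) (auto simp: E_inj)

lemma val_ev: "val r om (ev p) = poly p r" using val_E[of r om p 0] by (simp add: E_ev)

lemma val_kp: "val r om (kp c) = c" using val_ev[of r om "[:c:]"] by simp

lemma val_0: "val r om 0 = 0" and val_1: "val r om 1 = 1" using val_ev[of r om 0] val_ev[of r om 1] by simp_all

lemma val_W: "val r om W = om" using val_E[of r om 0 1] by (simp add: E_def)

lemma val_add: "a \<in> PE ==> b \<in> PE ==> val r om (a + b) = val r om a + val r om b" by (auto simp: PE_def E_add val_E algebra_simps)

lemma val_diff: "a \<in> PE ==> b \<in> PE ==> val r om (a - b) = val r om a - val r om b" by (auto simp: PE_def E_diff val_E algebra_simps)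

lemma val_mult:
 assumes "on_curve r om" "a \<in> PE" "b \<in> PE" shows "val r om (a * b) = val r om a * val r om b"
proof -
 obtain af bt af' bt' where ab: "a = E af bt" "b = E af' bt'" using assms by (auto simp: PE_def)
 have o: "poly g r = - (om * om) - poly h r * om" using assms(1) by (simp add: on_curve_def algebra_simps eq_neg_iff_add_eq_0)
 show ?thesis unfolding ab E_mult val_E by (simp add: o algebra_simps)
qed

lemma val_power: "on_curve r om ==> a \<in> PE ==> val r om (a ^ n) = val r om a ^ n" by (induction n) (auto simp: val_1 val_mult PE_power)

end

lemma root_factor: "poly p r = 0 ==> \<exists>q. p = [:-r, 1:] * q" for r :: "'a::comm_ring_1" by (simp only: poly_eq_0_iff_dvd dvd_def)

locale curve_point = quadratic_curve +
 fixes r om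
 assumes on: "on_curve r om" and smooth: "smooth_at r om"
begin

abbreviation "v \<equiv> val r om"
abbreviation "Oc \<equiv> loc r om"
abbreviation "t \<equiv> unif r om"

lemmas v_simps = val_mult[OF on] val_power[OF on] val_add val_diff val_kp val_ev val_W val_1 val_0
lemmas PE_in = PE_intros PE_mult PE_add PE_diff PE_power PE_uminus

lemma v_nz: "v a ~= 0 ==> a ~= 0" using val_0 by auto

lemma ev_lin: "ev [:-r, 1:] = xi - kp r" by (simp add: kp_simps)

lemma t_PE: "t \<in> PE" using PE_intros(2)[of "[:-r, 1:]"] PE_diff[OF PE_intros(6,3)] by (auto simp: unif_def ev_lin kp_simps)

lemma v_t: "v t = 0" using val_ev[of r om "[:-r, 1:]"] unfolding ev_lin by (auto simp: unif_def v_simps PE_in)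

lemma t_nz: "t ~= 0"
proof
 assume "t = 0"
 moreover have "E [:-om:] 1 = W - kp om" by (simp add: E_def kp_simps)
 ultimately show False using X_neq[of r] E_eq_0_iff[of "[:-om:]" 1] by (auto simp: unif_def split: if_splits)
qed

lemma local_equation:
 obtains G U where "U = W + kp om + ev h" "(W - kp om) * U = - (xi - kp r) * ev G" "v U = 2 * om + poly h r"
  "[:om * om:] + smult om h + g = [:-r, 1:] * G"
proof -
 have "poly ([:om * om:] + smult om h + g) r = 0" using on by (simp add: on_curve_def algebra_simps)
 then obtain G where G: "[:om * om:] + smult om h + g = [:-r, 1:] * G" using root_factor by blast
 have *: "(W - kp om) * (W + kp om + ev h) = - ev ([:om * om:] + smult om h + g)"
 proof -
  have "(W - kp om) * (W + kp om + ev h) = W * W + ev h * W - kp om * kp om - kp om * ev h" by (simp add: algebra_simps)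
  then show ?thesis by (simp add: W_eq kp_simps)
 qed
 have "v (W + kp om + ev h) = 2 * om + poly h r" by (simp add: v_simps PE_in)
 moreover have "(W - kp om) * (W + kp om + ev h) = - (xi - kp r) * ev G" unfolding * G by (simp add: kp_simps left_diff_distrib)
 ultimately show ?thesis using G that by blast
qed

text \<open>The exponent \<open>e\<close> is the ramification index. At a ramified point the local
  equation reads \<open>(xi - kp r) * (ev G + t * ev h1) = - t^2\<close>, and smoothness makes the
  second factor on the left nonzero at the point.\<close>

lemma x_minus_r:
 obtains e a b where "a \<in> PE" "b \<in> PE" "v a ~= 0" "v b ~= 0" "(xi - kp r) * a = t ^ e * b"
  "e = (if 2 * om + poly h r ~= 0 then 1 else 2)"
proof (cases "2 * om + poly h r = 0")
 case False
 then show ?thesis using that[of 1 1 1] by (simp add: PE_in v_simps unif_def)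
next
 case True
 obtain G U where GU: "U = W + kp om + ev h" "(W - kp om) * U = - (xi - kp r) * ev G"
  "[:om * om:] + smult om h + g = [:-r, 1:] * G" by (rule local_equation)
 have t: "t = W - kp om" using True by (simp add: unif_def)
 have "\<not> [:-r, 1:] dvd G" using smooth True mult_dvd_mono[OF dvd_refl, of "[:-r, 1:]" G "[:-r, 1:]"]
  unfolding smooth_at_def power2_eq_square GU(3) by blast
 then have vG: "v (ev G) ~= 0" by (simp add: v_simps poly_eq_0_iff_dvd)
 have "poly (h + [:2 * om:]) r = 0" using True by (simp add: add.commute)
 then obtain h1 where h1: "h + [:2 * om:] = [:-r, 1:] * h1" using root_factor by blast
 have "ev h + kp (2 * om) = (xi - kp r) * ev h1" using arg_cong[OF h1, of ev] by (simp add: kp_simps left_diff_distrib)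
 then have U: "U = t + (xi - kp r) * ev h1" unfolding GU(1) t mult_2 kp_add by (simp add: algebra_simps)
 have "(xi - kp r) * (ev G + t * ev h1) = t ^ 2 * (- 1)"
  using GU(2) unfolding t[symmetric] U by (simp add: algebra_simps power2_eq_square add_eq_0_iff)
 moreover have "v (ev G + t * ev h1) ~= 0" using vG by (simp add: v_simps v_t PE_in t_PE)
 moreover have "v (- 1) ~= 0" using val_kp[of r om "-1"] by (simp add: kp_simps)
 ultimately show ?thesis using that[of "ev G + t * ev h1" "-1" 2] True PE_in t_PE by auto
qed

text \<open>The multiplier \<open>u\<close>, nonzero at the point, stands for a denominator in the
  local ring, so that the division by \<open>t\<close> takes place inside \<open>PE\<close>.\<close>

lemma local_step:
 assumes "a \<in> PE" "v a = 0" shows "\<exists>b\<in>PE. \<exists>u\<in>PE. v u ~= 0 & a * u = t * b"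
proof -
 obtain af bt where a: "a = E af bt" using assms by (auto simp: PE_def)
 have "poly (af + smult om bt) r = 0" using assms by (simp add: a val_E algebra_simps)
 then obtain af' where af': "af + smult om bt = [:-r, 1:] * af'" using root_factor by blast
 have "ev af + kp om * ev bt = (xi - kp r) * ev af'" using arg_cong[OF af', of ev] by (simp add: kp_simps left_diff_distrib)
 then have a': "a = (xi - kp r) * ev af' + ev bt * (W - kp om)" by (simp add: a E_def algebra_simps)
 obtain G U where GU: "U = W + kp om + ev h" "(W - kp om) * U = - (xi - kp r) * ev G"
  "v U = 2 * om + poly h r" "[:om * om:] + smult om h + g = [:-r, 1:] * G" by (rule local_equation)
 have UP: "U \<in> PE" unfolding GU by (intro PE_in)
 show ?thesis
 proof (cases "2 * om + poly h r = 0")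
  case False
  have "a * U = (xi - kp r) * ev af' * U + ev bt * ((W - kp om) * U)" unfolding a' by (simp add: algebra_simps)
  also have "\<dots> = t * (ev af' * U - ev bt * ev G)" unfolding GU(2) using False by (simp add: unif_def algebra_simps)
  finally show ?thesis using UP False GU by (intro bexI[of _ "ev af' * U - ev bt * ev G"] bexI[of _ U]) (auto intro: PE_in)
 next
  case True
  obtain e c b where e: "c \<in> PE" "b \<in> PE" "v c ~= 0" "v b ~= 0" "(xi - kp r) * c = t ^ e * b"
   "e = (if 2 * om + poly h r ~= 0 then 1 else 2)" by (rule x_minus_r)
  have "a * c = ev af' * ((xi - kp r) * c) + ev bt * t * c" unfolding a' using True by (simp add: unif_def algebra_simps)
  also have "\<dots> = t * (ev af' * t * b + ev bt * c)" unfolding e(5) using e(6) True by (simp add: algebra_simps power2_eq_square)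
  finally show ?thesis using e by (intro bexI[of _ "ev af' * t * b + ev bt * c"] bexI[of _ c]) (auto intro: PE_in t_PE)
 qed
qed

text \<open>If \<open>a\<close> were divisible by every power of \<open>t\<close>, so would be its
  norm. But the norm is a power \<open>(xi - kp r)^j\<close> times a function that is nonzero at the
  point, hence of order exactly \<open>e * j\<close>.\<close>

lemma local_decomp:
 assumes a: "a \<in> PE" "a ~= 0" shows "\<exists>n. \<exists>b\<in>PE. \<exists>u\<in>PE. v b ~= 0 & v u ~= 0 & a * u = t ^ n * b"
proof (rule ccontr)
 assume neg: "\<not> ?thesis"
 have all: "\<exists>b\<in>PE. \<exists>u\<in>PE. v u ~= 0 & a * u = t ^ n * b" for n
 proof (induction n)
  case 0
  show ?case using a PE_intros by (intro bexI[of _ a] bexI[of _ 1]) (auto simp: val_1)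
 next
  case (Suc n)
  then obtain b u where bu: "b \<in> PE" "u \<in> PE" "v u ~= 0" "a * u = t ^ n * b" by blast
  have "v b = 0" using neg bu by blast
  then obtain b' u' where bu': "b' \<in> PE" "u' \<in> PE" "v u' ~= 0" "b * u' = t * b'" using local_step bu by blast
  have "a * (u * u') = (a * u) * u'" by simp
  also have "\<dots> = t ^ n * (b * u')" unfolding bu(4) by simp
  also have "\<dots> = t ^ Suc n * b'" unfolding bu'(4) by simp
  finally show ?case using bu bu' by (intro bexI[of _ b'] bexI[of _ "u * u'"]) (auto simp: v_simps intro: PE_in)
 qed
 obtain a' N where N: "a' \<in> PE" "N ~= 0" "a * a' = ev N" using PE_conj[OF a] by blast
 define j where "j = order r N"
 obtain N' where N': "N = [:-r, 1:] ^ j * N'" "\<not> [:-r, 1:] dvd N'" using order_decomp[OF N(2), of r] by (auto simp: j_def)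
 obtain e c d where e: "c \<in> PE" "d \<in> PE" "v c ~= 0" "v d ~= 0" "(xi - kp r) * c = t ^ e * d" by (rule x_minus_r)
 \<comment> \<open>The exponent exceeds the order of the norm by one.\<close>
 obtain b u where bu: "b \<in> PE" "u \<in> PE" "v u ~= 0" "a * u = t ^ (Suc (e * j)) * b" using all by blast
 have evN: "ev N = (xi - kp r) ^ j * ev N'" unfolding N'(1) by (simp add: kp_simps)
 have "t ^ (e * j) * (d ^ j * ev N' * u) = ((xi - kp r) * c) ^ j * ev N' * u" unfolding e(5) by (simp add: power_mult_distrib power_mult)
 also have "\<dots> = c ^ j * (a * a') * u" unfolding N(3) evN by (simp add: power_mult_distrib)
 also have "\<dots> = c ^ j * a' * (a * u)" by simp
 also have "\<dots> = t ^ (e * j) * (t * (c ^ j * a' * b))" unfolding bu(4) by simp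
 finally have *: "d ^ j * ev N' * u = t * (c ^ j * a' * b)" using t_nz by simp
 have "v (d ^ j * ev N' * u) ~= 0" using e bu N'(2) by (simp add: v_simps PE_in poly_eq_0_iff_dvd)
 moreover have "v (t * (c ^ j * a' * b)) = 0" using e bu N by (simp add: v_simps PE_in v_t t_PE)
 ultimately show False using * by simp
qed

lemma Oc_I: "a \<in> PE ==> b \<in> PE ==> v b ~= 0 ==> a / b \<in> Oc" by (auto simp: loc_def)

lemma Oc_PE: "a \<in> PE ==> a \<in> Oc" using Oc_I[of a 1] PE_intros by (simp add: val_1)

lemma Oc_nonunit:
 assumes "a \<in> PE" "v a = 0" "b \<in> PE" "v b ~= 0" "a ~= 0" shows "inverse (a / b) \<notin> Oc"
proof
 assume "inverse (a / b) \<in> Oc"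
 then obtain c d where cd: "c \<in> PE" "d \<in> PE" "v d ~= 0" "b / a = c / d" by (auto simp: loc_def)
 then have "b * d = a * c" using assms v_nz by (auto simp: field_simps)
 then have "v b * v d = v a * v c" using assms cd val_mult[OF on] by metis
 then show False using assms cd by auto
qed

lemma Oc_dvr: "dvr Oc t"
proof -
 have Oc_ff: "Oc <= ff" using PE_ff F_div by (auto simp: loc_def)
 have decomp: "\<exists>n::int. \<exists>u\<in>Oc - {0}. inverse u \<in> Oc & z = t powi n * u" if z: "z \<in> ff - {0}" for z
 proof -
  obtain a ga where a: "a \<in> PE" "ga ~= 0" "z = a / ev ga" using z ffE by blast
  then have "a ~= 0" "ev ga ~= 0" using z by auto
  then obtain n b u m b' u' where 1: "b \<in> PE" "u \<in> PE" "v b ~= 0" "v u ~= 0" "a * u = t ^ n * b"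
   and 2: "b' \<in> PE" "u' \<in> PE" "v b' ~= 0" "v u' ~= 0" "ev ga * u' = t ^ m * b'"
   using local_decomp[OF a(1)] local_decomp[OF PE_intros(2), of ga] by blast
  define w where "w = (b * u') / (u * b')"
  have nz: "b ~= 0" "u ~= 0" "b' ~= 0" "u' ~= 0" "ev ga ~= 0" using 1 2 v_nz a by auto
  have "w \<in> Oc" "inverse w \<in> Oc" "w ~= 0" unfolding w_def inverse_divide using 1 2 nz by (auto intro!: Oc_I PE_in simp: v_simps)
  moreover have "z = t powi (int n - int m) * w"
  proof -
   have "a = t ^ n * b / u" "ev ga = t ^ m * b' / u'" using 1 2 nz by (simp_all add: field_simps)
   then show ?thesis using a nz t_nz by (simp add: w_def power_int_diff mult_ac)
  qed
  ultimately show ?thesis by blast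
 qed
 have inv_t: "inverse t \<notin> Oc" using Oc_nonunit[OF t_PE v_t PE_intros(4)] t_nz by (simp add: val_1)
 have mult: "x * y \<in> Oc" if xy: "x \<in> Oc" "y \<in> Oc" for x y
 proof -
  obtain a b c d where "x = a / b" "y = c / d" "a \<in> PE" "b \<in> PE" "c \<in> PE" "d \<in> PE" "v b ~= 0" "v d ~= 0"
   using xy unfolding loc_def by blast
  then show ?thesis using Oc_I[of "a * c" "b * d"] by (simp add: v_simps PE_in)
 qed
 have diff: "x - y \<in> Oc" if xy: "x \<in> Oc" "y \<in> Oc" for x y
 proof -
  obtain a b c d where *: "x = a / b" "y = c / d" "a \<in> PE" "b \<in> PE" "c \<in> PE" "d \<in> PE" "v b ~= 0" "v d ~= 0"
   using xy unfolding loc_def by blast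
  then have "x - y = (a * d - c * b) / (b * d)" using v_nz[of b] v_nz[of d] by (simp add: field_simps)
  then show ?thesis using * Oc_I[of "a * d - c * b" "b * d"] by (simp add: v_simps PE_in)
 qed
 have t_nk: "t \<notin> range kp" using v_t val_kp[of r om] t_nz kp_0 by auto
 have pow: "t ^ n \<in> Oc" for n by (intro Oc_PE PE_in t_PE)
 have "x \<in> Oc \<or> inverse x \<in> Oc" if x: "x \<in> ff" for x
 proof (cases "x = 0")
  case True
  then show ?thesis using Oc_PE PE_intros by auto
 next
  case False
  then obtain n u where n: "u \<in> Oc" "inverse u \<in> Oc" "x = t powi n * u" using decomp x by blast
  show ?thesis
  proof (cases "n \<ge> 0")
   case True
   then show ?thesis using n pow mult by (auto simp: power_int_def)
  next
   case False
   then have "inverse x = t ^ nat (- n) * inverse u" using n by (simp add: power_int_def power_inverse)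
   then show ?thesis using n pow mult by auto
  qed
 qed
 then have "vring Oc" unfolding vring_def using Oc_PE PE_intros mult diff Oc_ff t_nk t_PE inv_t F_inv[OF PE_ff[OF t_PE]] by blast
 then show ?thesis unfolding dvr_def using Oc_PE t_PE t_nz inv_t decomp by blast
qed

lemma Oc_residue:
 assumes "x \<in> Oc" shows "\<exists>c\<in>range kp. x = c \<or> inverse (x - c) \<notin> Oc"
proof -
 obtain a b where ab: "x = a / b" "a \<in> PE" "b \<in> PE" "v b ~= 0" using assms by (auto simp: loc_def)
 define c where "c = v a / v b"
 have *: "x - kp c = (a - kp c * b) / b" using ab v_nz[of b] by (simp add: field_simps)
 have "v (a - kp c * b) = 0" using ab by (simp add: v_simps PE_in c_def)
 then have "x = kp c \<or> inverse (x - kp c) \<notin> Oc" using Oc_nonunit[of "a - kp c * b" b] ab PE_in * by (cases "a - kp c * b = 0") auto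
 then show ?thesis by blast
qed

end

lemma rev_rev_poly: "degree p \<le> n ==> rev_poly n (rev_poly n p) = p" by (rule poly_eqI) (auto simp: coeff_rev_poly coeff_eq_0)

section \<open>Centers of places on the affine curve\<close>

context quadratic_curve
begin

lemma ev_in_vring:
 assumes R: "vring R" and "xi \<in> R" shows "ev p \<in> R"
proof (induction p)
 case (pCons c p)
 then show ?case using vringD(4,6,7)[OF R] assms by (metis ev_pCons rangeI)
qed (use vringD(2)[OF R] in simp)

text \<open>\<open>W\<close> is integral over the polynomials in \<open>xi\<close>: if it were not
  in \<open>R\<close>, its equation divided by \<open>W\<close> would express it through elements of
  \<open>R\<close>.\<close>

lemma W_in_vring:
 assumes R: "vring R" and "xi \<in> R" shows "W \<in> R"
proof (rule ccontr)
 note d = vringD[OF R] and e = ev_in_vring[OF assms]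
 assume W: "W \<notin> R"
 then have "inverse W \<in> R" "W ~= 0" using d W_ff by auto
 moreover have "W = - ev h - ev g * inverse W"
 proof -
  have "W = W * W * inverse W" using \<open>W ~= 0\<close> by simp
  also have "\<dots> = (- ev h * W - ev g) * inverse W" by (simp only: W_eq)
  also have "\<dots> = - ev h - ev g * inverse W" using \<open>W ~= 0\<close> by (simp add: left_diff_distrib)
  finally show ?thesis .
 qed
 ultimately show False using W d(3)[OF d(5)[OF e] d(4)[OF e]] by metis
qed

text \<open>Polynomials over the constants split into linear factors. If all
  \<open>xi - kp r\<close> were units of \<open>R\<close>, so would be all nonzero polynomials in
  \<open>xi\<close>, and \<open>R\<close> would be the whole field.\<close>

lemma ex_center:
 assumes R: "vring R" and X: "xi \<in> R" shows "\<exists>r. inverse (xi - kp r) \<notin> R"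
proof (rule ccontr)
 note d = vringD[OF R]
 assume "\<not> ?thesis"
 then have *: "inverse (xi - kp r) \<in> R" for r by blast
 have "inverse (ev p) \<in> R" if "p ~= 0" for p using that
 proof (induction "degree p" arbitrary: p rule: less_induct)
  case less
  show ?case
  proof (cases "degree p = 0")
   case True
   then obtain c where "p = [:c:]" by (rule degree_eq_zeroE)
   then show ?thesis using d(7) k_inv[of "kp c"] by simp
  next
   case False
   then obtain r q where p: "p = [:-r, 1:] * q" using alg_closed_imp_poly_has_root[of p] root_factor by blast
   with less have q: "q ~= 0" by auto
   have "degree p = Suc (degree q)" unfolding p using q by (subst degree_mult_eq) auto
   then have "inverse (ev q) \<in> R" using less q by simp
   moreover have "inverse (ev p) = inverse (xi - kp r) * inverse (ev q)" unfolding p ev_mult by (simp add: kp_simps)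
   ultimately show ?thesis using d(4)[OF *] by simp
  qed
 qed
 then have "ff <= R" by (intro ff_subset) (use d X W_in_vring[OF R X] in auto)
 then show False using R by (auto simp: vring_def)
qed

lemma ex_on_curve: "\<exists>om. on_curve r om" using alg_closed_imp_poly_has_root[of "[:poly g r, poly h r, 1:]"]
 by (auto simp: on_curve_def algebra_simps)

lemma on_curve_conj: "on_curve r om ==> on_curve r (- poly h r - om)" by (simp add: on_curve_def algebra_simps)

lemma on_curve_unique:
 assumes "on_curve r om" "on_curve r om'" shows "om' = om \<or> om' = - poly h r - om"
proof -
 have "(om' - om) * (om' + poly h r + om) = (om' * om' + poly h r * om' + poly g r) - (om * om + poly h r * om + poly g r)"
  by (simp add: algebra_simps)
 also have "\<dots> = 0" using assms by (simp only: on_curve_def diff_self)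
 finally have "om' - om = 0 \<or> om' + poly h r + om = 0" by simp
 then show ?thesis by (auto simp: algebra_simps eq_neg_iff_add_eq_0)
qed

text \<open>The product of \<open>W - kp om0\<close> and the corresponding factor for the conjugate
  value lies in the maximal ideal of \<open>R\<close>, hence so does one of the factors. With that
  \<open>om\<close>, each function agrees with its value at \<open>(r, om)\<close> up to the maximal
  ideal, so functions with nonzero value are units.\<close>

lemma center:
 assumes R: "vring R" and X: "xi \<in> R" and r: "inverse (xi - kp r) \<notin> R" shows "\<exists>om. on_curve r om & loc r om <= R"
proof -
 note d = vringD[OF R] and e = ev_in_vring[OF R X] and W = W_in_vring[OF R X]
 have kR: "kp c \<in> R" for c using d(7) by blast
 define NU where "NU z \<longleftrightarrow> z \<in> R & (z = 0 \<or> inverse z \<notin> R)" for z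
 have NU_add: "NU (x + y)" if "NU x" "NU y" for x y using that nonunit_add[OF R, of x y] d(6) by (auto simp: NU_def)
 have NU_mult: "NU (x * y)" if "NU x" "y \<in> R" for x y using that nonunit_mult[OF R, of x y] d(2,4) by (cases "y = 0") (auto simp: NU_def)
 have NUx: "NU (xi - kp r)" using r d(3)[OF X kR] by (simp add: NU_def)
 have NUe: "NU (ev p - kp (poly p r))" for p
 proof -
  have "poly (p - [:poly p r:]) r = 0" by simp
  then obtain q where "p - [:poly p r:] = [:-r, 1:] * q" using root_factor by blast
  from arg_cong[OF this, of ev] have "ev p - kp (poly p r) = (xi - kp r) * ev q"
   by (simp only: ev_diff ev_mult ev_pCons ev_0 kp_simps) (simp add: kp_simps)
  then show ?thesis using NU_mult[OF NUx e] by simp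
 qed
 obtain om0 where o0: "on_curve r om0" using ex_on_curve by blast
 let ?om1 = "- poly h r - om0"
 have gr: "poly g r = - (om0 * om0) - poly h r * om0" using o0 by (simp add: on_curve_def algebra_simps eq_neg_iff_add_eq_0)
 have "(W - kp om0) * (W - kp ?om1) = W * W + kp (poly h r) * W + kp (poly g r)" unfolding gr by (simp add: kp_simps algebra_simps)
 also have "\<dots> = (ev h - kp (poly h r)) * (- W) + (ev g - kp (poly g r)) * (-1)" unfolding W_eq by (simp add: algebra_simps)
 finally have "NU ((W - kp om0) * (W - kp ?om1))" using NU_add[OF NU_mult[OF NUe d(5)[OF W]] NU_mult[OF NUe d(5)[OF d(1)]]] by simp
 moreover have "W - kp c ~= 0" for c using E_eq_0_iff[of "[:-c:]" 1] by (simp add: E_def kp_simps)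
 ultimately have "inverse (W - kp om0) \<notin> R \<or> inverse (W - kp ?om1) \<notin> R"
  using d(4)[of "inverse (W - kp om0)" "inverse (W - kp ?om1)"] by (auto simp: NU_def)
 then obtain om where o: "on_curve r om" "inverse (W - kp om) \<notin> R" using o0 on_curve_conj by blast
 then have NUw: "NU (W - kp om)" using d(3)[OF W kR] by (simp add: NU_def)
 have NUv: "NU (a - kp (val r om a))" "a \<in> R" if aPE: "a \<in> PE" for a
 proof -
  obtain af bt where a: "a = E af bt" using aPE by (auto simp: PE_def)
  have "a - kp (val r om a) = (ev af - kp (poly af r)) + ((ev bt - kp (poly bt r)) * W + (W - kp om) * kp (poly bt r))"
   unfolding a val_E by (simp add: E_def kp_simps algebra_simps)
  then show "NU (a - kp (val r om a))" using NU_add[OF NUe NU_add[OF NU_mult[OF NUe W] NU_mult[OF NUw kR]]] by simp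
  show "a \<in> R" unfolding a E_def by (intro d e W)
 qed
 have "inverse b \<in> R" if b: "b \<in> PE" "val r om b ~= 0" for b
 proof (rule ccontr)
  assume "inverse b \<notin> R"
  then have "NU b" using NUv(2)[OF b(1)] by (simp add: NU_def)
  then have "NU (b + (b - kp (val r om b)) * (-1))" using NU_add NU_mult[OF NUv(1)[OF b(1)] d(5)[OF d(1)]] by blast
  then have "NU (kp (val r om b))" by simp
  then show False using b kR[of "inverse (val r om b)"] by (auto simp: NU_def kp_simps)
 qed
 then have "loc r om <= R" using NUv(2) d(4) by (auto simp: loc_def divide_inverse)
 then show ?thesis using o by blast
qed

end

section \<open>The genus of a smooth double cover that is unramified at infinity\<close>

text \<open>The degree conditions produce two distinct unramified points at infinity, where
  \<open>W / xi^m\<close> takes the values \<open>0\<close> and \<open>- coeff h m\<close>.\<close>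

locale complete_curve = quadratic_curve +
 fixes m :: nat
 assumes smooth_all: "on_curve r om ==> smooth_at r om" and m1: "m \<ge> 1" and deg_h: "degree h = m" and deg_g: "degree g < 2 * m"
begin

lemma X_nz: "xi ~= 0" using X_neq[of 0] by (simp add: kp_simps)

sublocale inf0: field_embedding kp "1 / xi" by standard (simp_all add: kp_simps)

lemma inf0_ev: "degree p \<le> n ==> inf0.ev p = ev (rev_poly n p) / xi ^ n"
 using ev_rev_poly[OF degree_rev_poly X_nz, of n p] by (simp add: rev_rev_poly)

text \<open>The chart at infinity is again a quadratic curve, so the local theory applies to it
  unchanged.\<close>

sublocale inf: quadratic_curve kp "1 / xi" "W / xi ^ m" "rev_poly m h" "rev_poly (2 * m) g"
proof
 have 1: "inf0.ev (rev_poly m h) = ev h / xi ^ m" "inf0.ev (rev_poly (2 * m) g) = ev g / xi ^ (2 * m)"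
  using deg_h deg_g by (auto intro!: ev_rev_poly X_nz)
 have "W / xi ^ m * (W / xi ^ m) = W * W / xi ^ (2 * m)" by (simp add: power_add mult_2)
 also have "\<dots> = - (ev h / xi ^ m) * (W / xi ^ m) - ev g / xi ^ (2 * m)" unfolding W_eq by (simp add: power_add mult_2 diff_divide_distrib)
 finally show "W / xi ^ m * (W / xi ^ m) = - inf0.ev (rev_poly m h) * (W / xi ^ m) - inf0.ev (rev_poly (2 * m) g)" unfolding 1 .
 fix af bt assume a: "inf0.ev af + inf0.ev bt * (W / xi ^ m) = 0"
 define N where "N = max (degree af) (degree bt) + m"
 have N: "degree af \<le> N" "degree bt \<le> N - m" "m \<le> N" by (auto simp: N_def)
 have "ev (rev_poly N af) / xi ^ N + ev (rev_poly (N - m) bt) * W / (xi ^ (N - m) * xi ^ m) = 0" using a inf0_ev[OF N(1)] inf0_ev[OF N(2)] by simp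
 moreover have "xi ^ (N - m) * xi ^ m = xi ^ N" using N(3) by (simp flip: power_add)
 ultimately have "(ev (rev_poly N af) + ev (rev_poly (N - m) bt) * W) / xi ^ N = 0" by (simp add: add_divide_distrib)
 then have "ev (rev_poly N af) + ev (rev_poly (N - m) bt) * W = 0" using X_nz by simp
 then have "rev_poly N af = 0" "rev_poly (N - m) bt = 0" using indep by blast+
 then show "af = 0 & bt = 0" using N rev_poly_eq_0D by blast
qed

lemma inf_ff: "inf.ff = ff"
proof
 have i: "1 / xi \<in> ff" using F_inv[OF X_ff] by (simp add: divide_inverse)
 have "inf0.ev p \<in> ff" for p
 proof (induction p)
  case (pCons c p)
  have "kp c \<in> ff" using kF by blast
  then show ?case using F_add[OF _ F_mult[OF i pCons.IH]] by (simp only: inf0.ev_pCons)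
 qed (simp add: F0)
 then show "inf.ff <= ff" using i F_div[OF W_ff F_power[OF X_ff]] kF by (intro inf.ff_subset F1 F_diff F_mult F_inv)
 have X: "xi \<in> inf.ff" using inf.F_inv[OF inf.X_ff] by simp
 have "ev p \<in> inf.ff" for p
 proof (induction p)
  case (pCons c p)
  have "kp c \<in> inf.ff" using inf.kF by blast
  then show ?case using inf.F_add inf.F_mult[OF X pCons.IH] by simp
 qed (simp add: inf.F0)
 moreover have "W \<in> inf.ff" using inf.F_mult[OF inf.W_ff inf.F_power[OF X, of m]] X_nz by simp
 ultimately show "ff <= inf.ff" using X inf.kF by (intro ff_subset inf.F1 inf.F_diff inf.F_mult inf.F_inv) auto
qed

definition infpt :: "'a set" where "infpt = {0, - coeff h m}"

lemma lc_nz: "coeff h m ~= 0" using deg_h m1 leading_coeff_0_iff[of h] by auto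

lemma fin_point: "on_curve r om ==> curve_point kp xi W h g r om" by unfold_locales (auto intro: smooth_all)

lemma inf_on: "om \<in> infpt ==> inf.on_curve 0 om" and inf_unram: "om \<in> infpt ==> 2 * om + poly (rev_poly m h) 0 ~= 0"
 using deg_g lc_nz by (auto simp: inf.on_curve_def infpt_def poly_0_coeff_0 coeff_rev_poly coeff_eq_0)

lemma inf_point: "om \<in> infpt ==> curve_point kp (1 / xi) (W / xi ^ m) (rev_poly m h) (rev_poly (2 * m) g) 0 om"
 using inf_on inf_unram by unfold_locales (auto simp: inf.smooth_at_def)

lemma inf_on_iff: "inf.on_curve 0 om \<longleftrightarrow> om \<in> infpt"
proof
 assume "inf.on_curve 0 om"
 then show "om \<in> infpt" using inf.on_curve_unique[OF inf_on[of 0]] by (auto simp: infpt_def poly_0_coeff_0 coeff_rev_poly)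
qed (rule inf_on)

lemma fin_dvr: "on_curve r om ==> dvr (loc r om) (unif r om)" by (rule curve_point.Oc_dvr[OF fin_point])

lemma inf_dvr: "om \<in> infpt ==> dvr (inf.loc 0 om) (1 / xi)" using curve_point.Oc_dvr[OF inf_point, of om] inf_unram
 unfolding inf_ff by (simp add: inf.unif_def kp_simps)

lemma vring_fin:
 assumes R: "vring R" "xi \<in> R" "inverse (xi - kp r) \<notin> R"
 obtains om where "on_curve r om" "R = loc r om" using center[OF R] fin_dvr vring_subset_eq R(1) that by blast

lemma vring_inf:
 assumes R: "vring R" "xi \<notin> R"
 obtains om where "om \<in> infpt" "R = inf.loc 0 om"
proof -
 have "1 / xi \<in> R" using vringD(9)[OF R(1) X_ff R(2)] by (simp add: divide_inverse)
 moreover have "inf.vring R" using R(1) by (simp add: inf_ff)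
 ultimately obtain om where o: "inf.on_curve 0 om" "inf.loc 0 om <= R" using inf.center[of R 0] R(2) by (auto simp: kp_simps)
 then have "om \<in> infpt" by (simp add: inf_on_iff)
 then show ?thesis using that o vring_subset_eq[OF inf_dvr R(1)] by blast
qed

lemma X_loc: "xi \<in> loc r om" if "on_curve r om" using curve_point.Oc_PE[OF fin_point[OF that] PE_intros(2), of "[:0, 1:]"] by (simp add: kp_simps)

lemma loc_center: assumes "on_curve r om" shows "inverse (xi - kp r) \<notin> loc r om"
proof -
 interpret P: curve_point kp xi W h g r om by (rule fin_point) fact
 have "inverse (ev [:-r, 1:] / 1) \<notin> loc r om" by (rule P.Oc_nonunit) (auto simp only: ev_eq_0_iff val_ev val_1 PE_intros, auto)
 then show ?thesis by (simp only: P.ev_lin div_by_1) simp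
qed

lemma X_inf: "om \<in> infpt ==> xi \<notin> inf.loc 0 om" using inf_dvr by (auto simp: dvr_def)

text \<open>Every place is the local ring of a point of one of the two charts, according to whether
  it contains \<open>xi\<close>; discreteness and residues come from there.\<close>

sublocale function_field_ext ff "range kp"
proof
 fix R assume R: "vring R"
 show "\<exists>t. dvr R t"
 proof (cases "xi \<in> R")
  case True
  then show ?thesis using ex_center[OF R True] vring_fin[OF R True] fin_dvr by metis
 next
  case False
  then show ?thesis using vring_inf[OF R False] inf_dvr by metis
 qed
 fix x assume x: "x \<in> R"
 show "\<exists>c\<in>range kp. x = c \<or> inverse (x - c) \<notin> R"
 proof (cases "xi \<in> R")
  case True
  then obtain r om where "on_curve r om" "R = loc r om" using ex_center[OF R True] vring_fin[OF R True] by metis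
  then show ?thesis using curve_point.Oc_residue[OF fin_point] x by metis
 next
  case False
  then obtain om where "om \<in> infpt" "R = inf.loc 0 om" using vring_inf[OF R False] by metis
  then show ?thesis using curve_point.Oc_residue[OF inf_point] x by metis
 qed
qed

lemma loc_inj:
 assumes "on_curve r om" "on_curve r om'" "loc r om = loc r om'" shows "om = om'"
proof (rule ccontr)
 assume "om ~= om'"
 interpret P: curve_point kp xi W h g r om by (rule fin_point) fact
 interpret P': curve_point kp xi W h g r om' by (rule fin_point) fact
 have PE: "W - kp om \<in> PE" by (intro PE_diff PE_intros)
 have nz: "W - kp om ~= 0" using E_eq_0_iff[of "[:-om:]" 1] by (simp add: E_def kp_simps)
 have "inverse ((W - kp om) / 1) \<notin> loc r om" by (rule P.Oc_nonunit) (use PE nz in \<open>auto simp: P.v_simps PE_intros\<close>)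
 moreover have "1 / (W - kp om) \<in> loc r om'"
  by (rule P'.Oc_I) (use PE \<open>om ~= om'\<close> in \<open>auto simp: P'.v_simps PE_intros\<close>)
 ultimately show False using assms by (simp add: divide_inverse)
qed

lemma inf_loc_inj:
 assumes "om \<in> infpt" "om' \<in> infpt" "inf.loc 0 om = inf.loc 0 om'" shows "om = om'"
proof (rule ccontr)
 assume "om ~= om'"
 interpret P: curve_point kp "1 / xi" "W / xi ^ m" "rev_poly m h" "rev_poly (2 * m) g" 0 om by (rule inf_point) fact
 interpret P': curve_point kp "1 / xi" "W / xi ^ m" "rev_poly m h" "rev_poly (2 * m) g" 0 om' by (rule inf_point) fact
 let ?W = "W / xi ^ m"
 have PE: "?W - kp om \<in> inf.PE" by (intro inf.PE_diff inf.PE_intros)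
 have nz: "?W - kp om ~= 0" using inf.E_eq_0_iff[of "[:-om:]" 1] by (simp add: inf.E_def kp_simps)
 have "inverse ((?W - kp om) / 1) \<notin> inf.loc 0 om" by (rule P.Oc_nonunit) (use PE nz in \<open>auto simp: P.v_simps inf.PE_intros\<close>)
 moreover have "1 / (?W - kp om) \<in> inf.loc 0 om'"
  by (rule P'.Oc_I) (use PE \<open>om ~= om'\<close> in \<open>auto simp: P'.v_simps inf.PE_intros\<close>)
 ultimately show False using assms by (simp add: divide_inverse)
qed

lemma lin_ff: "xi - kp r \<in> ff" "xi - kp r ~= 0" using F_diff[OF X_ff, of "kp r"] kF X_neq[of r] by auto

lemma ord_unit:
 assumes R: "vring R" "xi \<in> R" "inverse (xi - kp r) \<in> R" shows "ordp R (xi - kp r) = 0"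
proof -
 have "xi - kp r \<in> R" using vringD(3,7)[OF R(1)] R(2) by blast
 then have "ordp R (xi - kp r) \<ge> 0" "ordp R (inverse (xi - kp r)) \<ge> 0" using ord_nonneg_iff[OF R(1)] lin_ff F_inv R by auto
 then show ?thesis using ord_inverse[OF R(1) lin_ff] by simp
qed

lemma ord_inf_X: "om \<in> infpt ==> ordp (inf.loc 0 om) xi = - 1"
 using place_orderI[OF inf_dvr, of om 1 "-1"] vringD(1)[of "inf.loc 0 om"] inf_dvr[of om] by (auto simp: dvr_def power_int_minus)

lemma ord_inf:
 assumes R: "vring R" "xi \<notin> R" shows "ordp R (xi - kp r) = - 1"
proof -
 obtain om where o: "om \<in> infpt" "R = inf.loc 0 om" using vring_inf[OF R] by blast
 interpret P: curve_point kp "1 / xi" "W / xi ^ m" "rev_poly m h" "rev_poly (2 * m) g" 0 om by (rule inf_point) fact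
 let ?a = "inf0.ev [:1, -r:]"
 have a: "?a = 1 - kp r / xi" by (simp add: kp_simps)
 have v: "inf.val 0 om ?a = 1" by (simp only: P.v_simps) simp
 have *: "xi - kp r = (1 / xi) powi (-1) * ?a" unfolding a using X_nz by (simp add: power_int_minus field_simps)
 show ?thesis unfolding o(2) *
 proof (rule place_orderI[OF inf_dvr[OF o(1)]])
  show "?a \<in> inf.loc 0 om" by (intro P.Oc_PE inf.PE_intros)
  show "inverse ?a \<in> inf.loc 0 om" using P.Oc_I[OF inf.PE_intros(4) inf.PE_intros(2), of "[:1, -r:]"] v by (simp add: divide_inverse)
  show "?a ~= 0" using v inf.val_0 by (metis zero_neq_one)
 qed
qed

definition fiber :: "'a => 'b set set" where
 "fiber r = loc r ` {om. on_curve r om}"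

definition Inf_places :: "'b set set" where
 "Inf_places = inf.loc 0 ` infpt"

lemma fiber_iff: "R \<in> fiber r \<longleftrightarrow> vring R & xi \<in> R & inverse (xi - kp r) \<notin> R"
proof
 assume "R \<in> fiber r"
 then obtain om where "on_curve r om" "R = loc r om" by (auto simp: fiber_def)
 then show "vring R & xi \<in> R & inverse (xi - kp r) \<notin> R" using fin_dvr X_loc loc_center by (auto simp: dvr_def)
next
 assume "vring R & xi \<in> R & inverse (xi - kp r) \<notin> R"
 then show "R \<in> fiber r" using vring_fin unfolding fiber_def by blast
qed

lemma Inf_places_iff: "R \<in> Inf_places \<longleftrightarrow> vring R & xi \<notin> R"
proof
 assume "R \<in> Inf_places"
 then show "vring R & xi \<notin> R" using inf_dvr X_inf by (auto simp: Inf_places_def dvr_def)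
next
 assume "vring R & xi \<notin> R"
 then show "R \<in> Inf_places" using vring_inf unfolding Inf_places_def by blast
qed

lemma card_Inf_places: "finite Inf_places" "card Inf_places = 2"
proof -
 have "inj_on (inf.loc 0) infpt" using inf_loc_inj by (auto simp: inj_on_def)
 then have "card Inf_places = card infpt" unfolding Inf_places_def by (rule card_image)
 then show "card Inf_places = 2" using lc_nz by (simp add: infpt_def)
 show "finite Inf_places" by (simp add: Inf_places_def infpt_def)
qed

text \<open>Over \<open>r\<close> there are either two conjugate points, with
  \<open>xi - kp r\<close> of order one at each, or a single ramified point, where the order is
  two.\<close>

lemma fiber_degree: "finite (fiber r)" "(\<Sum>R\<in>fiber r. ordp R (xi - kp r)) = 2"
proof -
 obtain om where o: "on_curve r om" using ex_on_curve by blast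
 let ?om' = "- poly h r - om"
 have e: "{om. on_curve r om} = {om, ?om'}" using o on_curve_conj[OF o] on_curve_unique[OF o] by blast
 then show "finite (fiber r)" by (simp add: fiber_def)
 have fib: "fiber r = {loc r om, loc r ?om'}" by (simp add: fiber_def e)
 have one: "1 \<in> loc r om" if "on_curve r om" for om using curve_point.Oc_PE[OF fin_point[OF that] PE_intros(4)] .
 show "(\<Sum>R\<in>fiber r. ordp R (xi - kp r)) = 2"
 proof (cases "2 * om + poly h r = 0")
  case False
  have u: "ordp (loc r om) (xi - kp r) = 1" if "on_curve r om" "2 * om + poly h r ~= 0" for om
   using place_orderI[OF fin_dvr[OF that(1)] one[OF that(1)], of 1] one[OF that(1)] that(2) by (simp add: unif_def)
  have ne: "om ~= ?om'" using False by (auto simp: algebra_simps)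
  have "2 * ?om' + poly h r = - (2 * om + poly h r)" by (simp add: algebra_simps)
  then have F': "2 * ?om' + poly h r ~= 0" using False by (metis neg_equal_0_iff_equal)
  have "loc r om ~= loc r ?om'" using loc_inj o on_curve_conj[OF o] ne by blast
  then show ?thesis using u[OF o False] u[OF on_curve_conj[OF o] F'] by (simp add: fib)
 next
  case True
  then have "?om' = om" by (simp add: algebra_simps add_eq_0_iff)
  then have fib': "fiber r = {loc r om}" by (simp add: fib)
  interpret P: curve_point kp xi W h g r om by (rule fin_point) fact
  obtain e a b where eab: "a \<in> PE" "b \<in> PE" "val r om a ~= 0" "val r om b ~= 0"
   "(xi - kp r) * a = unif r om ^ e * b" "e = (if 2 * om + poly h r ~= 0 then 1 else 2)" by (rule P.x_minus_r)
  have nz: "a ~= 0" "b ~= 0" using eab P.v_nz by auto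
  have "xi - kp r = unif r om powi 2 * (b / a)" using eab(5,6) True nz by (simp add: field_simps)
  moreover have "b / a \<in> loc r om" "inverse (b / a) \<in> loc r om" "b / a ~= 0" using eab nz P.Oc_I by auto
  ultimately have "ordp (loc r om) (xi - kp r) = 2" using place_orderI[OF fin_dvr[OF o]] by metis
  then show ?thesis by (simp add: fib')
 qed
qed

definition div_lin :: "'a => 'b set => int" where
 "div_lin r R = ordp R (xi - kp r)"

text \<open>The two zeros over \<open>r\<close>, counted with multiplicity, balance the two simple
  poles at infinity.\<close>

lemma div_lin: "is_divisor FR (range kp) (div_lin r)" "ddeg (div_lin r) = 0"
proof -
 have disj: "fiber r \<inter> Inf_places = {}" by (auto simp: fiber_iff Inf_places_iff)
 have supp: "R \<in> fiber r \<union> Inf_places" if "vring R" "div_lin r R ~= 0" for R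
  using that ord_unit[of R r] by (auto simp: fiber_iff Inf_places_iff div_lin_def)
 have fin: "finite (fiber r \<union> Inf_places)" using fiber_degree card_Inf_places by auto
 show "is_divisor FR (range kp) (div_lin r)" unfolding is_divisor_iff by (rule finite_subset[OF _ fin]) (use supp in blast)
 have "ddeg (div_lin r) = sum (div_lin r) (fiber r \<union> Inf_places)"
  by (rule deg_superset[OF fin]) (use supp in \<open>auto simp: fiber_iff Inf_places_iff\<close>)
 also have "\<dots> = sum (div_lin r) (fiber r) + sum (div_lin r) Inf_places"
  using fiber_degree card_Inf_places disj by (intro sum.union_disjoint) auto
 also have "sum (div_lin r) (fiber r) = 2" unfolding div_lin_def by (rule fiber_degree)
 also have "sum (div_lin r) Inf_places = (\<Sum>R\<in>Inf_places. - 1)" by (intro sum.cong) (auto simp: div_lin_def ord_inf Inf_places_iff)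
 also have "\<dots> = - 2" using card_Inf_places by simp
 finally show "ddeg (div_lin r) = 0" by simp
qed


text \<open>A smooth affine curve is normal. A linear factor \<open>xi - kp r\<close> of the
  denominator cancels because both components of the numerator vanish at \<open>r\<close>: in the
  unramified case by comparing the two points over \<open>r\<close>, in the ramified case because
  the numerator vanishes to order two at the single point.\<close>

lemma regular_imp_PE:
 assumes z: "z \<in> ff" and reg: "!!r om. on_curve r om ==> z \<in> loc r om" shows "z \<in> PE"
proof -
 have "ga ~= 0 ==> a \<in> PE ==> z = a / ev ga ==> z \<in> PE" for ga a
 proof (induction "degree ga" arbitrary: ga a rule: less_induct)
  case less
  show ?case
  proof (cases "degree ga = 0")
   case True
   then obtain c where "ga = [:c:]" by (rule degree_eq_zeroE)
   then have "z = a * kp (inverse c)" using less by (simp add: kp_simps divide_inverse)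
   then show ?thesis using PE_mult less PE_intros by simp
  next
   case False
   then obtain r ga' where g: "ga = [:-r, 1:] * ga'" using alg_closed_imp_poly_has_root[of ga] root_factor by blast
   with less have g0: "ga' ~= 0" by auto
   have deg: "degree ga = Suc (degree ga')" unfolding g using g0 by (subst degree_mult_eq) auto
   obtain af bt where a: "a = E af bt" using less.prems by (auto simp: PE_def)
   have evg: "ev ga = (xi - kp r) * ev ga'" unfolding g ev_mult by (simp add: kp_simps)
   have loc: "\<exists>c\<in>PE. \<exists>d\<in>PE. val r om d ~= 0 & a * d = ev ga * c & val r om a = 0" if o: "on_curve r om" for om
   proof -
    interpret P: curve_point kp xi W h g r om by (rule fin_point) fact
    obtain c d where cd: "z = c / d" "c \<in> PE" "d \<in> PE" "val r om d ~= 0" using reg[OF o] unfolding loc_def by blast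
    have eq: "a * d = ev ga * c" using cd less.prems P.v_nz[OF cd(4)] by (auto simp: divide_eq_eq)
    have "val r om (a * d) = 0" unfolding eq using cd by (simp only: P.v_simps PE_intros) (simp add: g)
    then have "val r om a = 0" using cd less.prems by (simp add: P.v_simps)
    then show ?thesis using cd eq by blast
   qed
   obtain om where o: "on_curve r om" using ex_on_curve by blast
   have va: "poly af r + poly bt r * om = 0" if "on_curve r om" for om using loc[OF that] by (auto simp: a val_E)
   have "poly bt r = 0"
   proof (cases "2 * om + poly h r = 0")
    case False
    have "poly bt r * (2 * om + poly h r) = (poly af r + poly bt r * om) - (poly af r + poly bt r * (- poly h r - om))"
     by (simp add: algebra_simps)
    then have "poly bt r * (2 * om + poly h r) = 0" using va[OF o] va[OF on_curve_conj[OF o]] by simp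
    then show ?thesis using False by simp
   next
    case True
    interpret P: curve_point kp xi W h g r om by (rule fin_point) fact
    obtain e A B where eab: "A \<in> PE" "B \<in> PE" "val r om A ~= 0" "val r om B ~= 0"
     "(xi - kp r) * A = unif r om ^ e * B" "e = (if 2 * om + poly h r ~= 0 then 1 else 2)" by (rule P.x_minus_r)
    define t where "t = W - kp om"
    have t: "unif r om = t" using True by (simp add: unif_def t_def)
    have eab': "(xi - kp r) * A = t * t * B" using eab(5,6) True by (simp add: t power2_eq_square)
    obtain c d where cd: "c \<in> PE" "d \<in> PE" "val r om d ~= 0" "a * d = ev ga * c" using loc[OF o] by blast
    have "poly (af + smult om bt) r = 0" using va[OF o] by (simp add: mult.commute)
    then obtain af' where "af + smult om bt = [:-r, 1:] * af'" using root_factor by blast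
    from arg_cong[OF this, of ev] have "ev af + kp om * ev bt = (xi - kp r) * ev af'" by (simp only: ev_add ev_smult ev_mult) (simp add: kp_simps)
    then have a': "a = (xi - kp r) * ev af' + ev bt * t" by (simp add: a E_def t_def algebra_simps)
    \<comment> \<open>Up to factors that are nonzero at the point, \<open>a\<close> and the first
      summand of \<open>a'\<close> are divisible by \<open>t^2\<close>. Hence so is
      \<open>ev bt * t\<close>, and \<open>bt\<close> vanishes at \<open>r\<close>.\<close>
    have "t * (ev bt * A * d) = a * d * A - (xi - kp r) * A * ev af' * d" unfolding a' by (simp add: algebra_simps)
    also have "a * d * A = ((xi - kp r) * A) * ev ga' * c" unfolding cd(4) evg by simp
    also have "\<dots> - (xi - kp r) * A * ev af' * d = t * (t * (B * ev ga' * c - B * ev af' * d))" unfolding eab' by (simp add: algebra_simps)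
    finally have "ev bt * A * d = t * (B * ev ga' * c - B * ev af' * d)" using P.t_nz t by simp
    then have "val r om (ev bt * A * d) = 0" using P.v_t P.t_PE eab cd unfolding t by (simp add: P.v_simps P.PE_in)
    then show ?thesis using eab cd by (simp add: P.v_simps P.PE_in)
   qed
   moreover from this have "poly af r = 0" using va[OF o] by simp
   ultimately obtain af' bt' where "af = [:-r, 1:] * af'" "bt = [:-r, 1:] * bt'" using root_factor by metis
   then have "ev af = (xi - kp r) * ev af'" "ev bt = (xi - kp r) * ev bt'" by (simp_all only: ev_mult) (simp_all add: kp_simps)
   then have "a = (xi - kp r) * E af' bt'" unfolding a E_def by (simp only: distrib_left mult.assoc)
   then have "z = E af' bt' / ev ga'" using less.prems(3) lin_ff(2)[of r] by (simp add: evg)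
   then show ?thesis using less.hyps[of ga' "E af' bt'"] deg g0 PE_intros(1) by simp
  qed
 qed
 then show ?thesis using z ffE by metis
qed

text \<open>\<open>l\<close> times the fiber over infinity, which consists of two simple
  points.\<close>

definition Dinf :: "nat => 'b set => int" where
 "Dinf l R = (if xi \<in> R then 0 else int l)"

lemma E_div_power:
 assumes "degree af \<le> N" "bt = 0 \<or> degree bt + m \<le> N"
 shows "E af bt / xi ^ N = inf.E (rev_poly N af) (if bt = 0 then 0 else rev_poly (N - m) bt)"
proof -
 have 1: "inf0.ev (rev_poly N af) = ev af / xi ^ N" using assms by (intro ev_rev_poly X_nz) auto
 show ?thesis
 proof (cases "bt = 0")
  case True
  then show ?thesis using 1 by (simp add: E_def inf.E_def)
 next
  case False
  then have "inf0.ev (rev_poly (N - m) bt) = ev bt / xi ^ (N - m)" using assms by (intro ev_rev_poly X_nz) auto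
  moreover have "xi ^ (N - m) * xi ^ m = xi ^ N" using False assms by (simp flip: power_add)
  ultimately show ?thesis using False 1 by (simp add: E_def inf.E_def add_divide_distrib)
 qed
qed

text \<open>The poles of the two summands cannot cancel at both points at infinity: their
  coefficients \<open>A\<close> and \<open>B\<close> of the top order \<open>N\<close> would satisfy
  \<open>A + B * om = 0\<close> for the two distinct values \<open>om\<close> in
  \<open>infpt\<close>.\<close>

lemma RR_Dinf: "RR (Dinf l) = {E af bt | af bt. degree af \<le> l & (bt = 0 \<or> degree bt + m \<le> l)}" (is "_ = ?V")
proof (intro equalityI subsetI)
 fix z assume "z \<in> ?V"
 then obtain af bt where z: "z = E af bt" "degree af \<le> l" "bt = 0 \<or> degree bt + m \<le> l" by blast
 have zff: "z \<in> ff" using PE_ff PE_intros z by blast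
 have "- Dinf l R \<le> ordp R z" if nz: "z ~= 0" and R: "vring R" for R
 proof (cases "xi \<in> R")
  case True
  then have "z \<in> R" using vringD(4,6)[OF R] ev_in_vring[OF R] W_in_vring[OF R] by (simp add: z E_def)
  then show ?thesis using ord_nonneg_iff[OF R zff nz] True by (simp add: Dinf_def)
 next
  case False
  then obtain om where o: "om \<in> infpt" "R = inf.loc 0 om" using vring_inf[OF R] by blast
  interpret P: curve_point kp "1 / xi" "W / xi ^ m" "rev_poly m h" "rev_poly (2 * m) g" 0 om by (rule inf_point) fact
  define y where "y = z / xi ^ l"
  have y: "y ~= 0" "y \<in> ff" "z = y * xi ^ l" using nz X_nz F_div[OF zff F_power[OF X_ff]] by (auto simp: y_def)
  have yR: "y \<in> R" unfolding y_def z(1) E_div_power[OF z(2,3)] o(2) by (intro P.Oc_PE inf.PE_intros)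
  have "ordp R z = ordp R y + int l * ordp R xi"
   using ord_mult[OF R y(2,1), of "xi ^ l"] order_power[of R _ xi l] ex_dvr[OF R] X_ff X_nz F_power[OF X_ff] y(3) by auto
  then show ?thesis using ord_nonneg_iff[OF R y(2,1)] yR ord_inf_X[OF o(1)] o(2) False by (simp add: Dinf_def)
 qed
 then show "z \<in> RR (Dinf l)" using zff by (auto simp: mem_RR)
next
 fix z assume z: "z \<in> RR (Dinf l)"
 then have zff: "z \<in> ff" by (simp add: mem_RR)
 show "z \<in> ?V"
 proof (cases "z = 0")
  case True
  then show ?thesis using E_eq_0_iff[of 0 0] by (intro CollectI exI[of _ 0]) auto
 next
  case nz: False
  have "z \<in> loc r om" if "on_curve r om" for r om
  proof -
   have R: "vring (loc r om)" using fin_dvr[OF that] by (simp add: dvr_def)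
   then have "ordp (loc r om) z \<ge> 0" using z nz X_loc[OF that] by (auto simp: mem_RR Dinf_def)
   then show ?thesis using ord_nonneg_iff[OF R zff nz] by simp
  qed
  then have "z \<in> PE" using regular_imp_PE zff by blast
  then obtain af bt where zE: "z = E af bt" by (auto simp: PE_def)
  define N where "N = max (degree af) (if bt = 0 then 0 else degree bt + m)"
  have N: "degree af \<le> N" "bt = 0 \<or> degree bt + m \<le> N" by (auto simp: N_def)
  have "N \<le> l"
  proof (rule ccontr)
   assume "\<not> N \<le> l"
   define y where "y = z / xi ^ N"
   have yE: "y = inf.E (rev_poly N af) (if bt = 0 then 0 else rev_poly (N - m) bt)" unfolding y_def zE by (rule E_div_power[OF N])
   have y: "y ~= 0" "y \<in> ff" "z = y * xi ^ N" using nz X_nz F_div[OF zff F_power[OF X_ff]] by (auto simp: y_def)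
   have v0: "coeff af N + (if bt = 0 then 0 else coeff bt (N - m)) * om = 0" if o: "om \<in> infpt" for om
   proof -
    interpret P: curve_point kp "1 / xi" "W / xi ^ m" "rev_poly m h" "rev_poly (2 * m) g" 0 om by (rule inf_point) fact
    define R where "R = inf.loc 0 om"
    have R: "vring R" using inf_dvr[OF o] by (simp add: dvr_def R_def)
    have "ordp R z = ordp R y + int N * ordp R xi"
     using ord_mult[OF R y(2,1), of "xi ^ N"] order_power[of R _ xi N] ex_dvr[OF R] X_ff X_nz F_power[OF X_ff] y(3) by auto
    moreover have "ordp R z \<ge> - int l" using z nz R X_inf[OF o] by (auto simp: mem_RR Dinf_def R_def)
    ultimately have "ordp R y > 0" using ord_inf_X[OF o] \<open>\<not> N \<le> l\<close> by (simp add: R_def)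
    then have "inverse y \<notin> R" using ord_nonneg_iff[OF R F_inv[OF y(2)]] ord_inverse[OF R y(2,1)] y(1) by simp
    then have "inf.val 0 om y = 0" using P.Oc_I[OF inf.PE_intros(4), of y] inf.PE_intros(1) yE unfolding R_def by (metis inverse_eq_divide)
    then show ?thesis unfolding yE inf.val_E by (auto simp: poly_0_coeff_0 coeff_rev_poly split: if_splits)
   qed
   have "coeff af N = 0" using v0[of 0] by (simp add: infpt_def)
   moreover from this have "bt = 0 \<or> coeff bt (N - m) = 0" using v0[of "- coeff h m"] lc_nz by (auto simp: infpt_def split: if_splits)
   ultimately show False using \<open>\<not> N \<le> l\<close> leading_coeff_0_iff[of af] leading_coeff_0_iff[of bt]
    by (auto simp: N_def max_def split: if_splits)
  qed
  then show ?thesis using zE N by (intro CollectI exI[of _ af] exI[of _ bt]) auto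
 qed
qed

lemma dim_bounded_degrees:
 "ring.dimension FR (p + q) (range kp) {E af bt | af bt. (\<forall>i\<ge>p. coeff af i = 0) & (\<forall>i\<ge>q. coeff bt i = 0)}"
proof -
 interpret FR: field FR by (rule field_FR)
 define V where "V p q = {E af bt | af bt. (\<forall>i\<ge>p. coeff af i = 0) & (\<forall>i\<ge>q. coeff bt i = 0)}" for p q
 have ext: "ring.line_extension FR (range kp) v U = {kp c * v + u | c u. u \<in> U}" for v U unfolding line_extension_FR by auto
 have cut: "\<exists>c af'. af = monom c p + af' & (\<forall>i\<ge>p. coeff af' i = 0)" if "\<forall>i\<ge>Suc p. coeff af i = 0" for af :: "'a poly" and p
  using that by (intro exI[of _ "coeff af p"] exI[of _ "af - monom (coeff af p) p"]) (auto simp: Suc_le_eq)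
 have E_monom: "kp c * xi ^ p + E af bt = E (monom c p + af) bt" "kp c * (xi ^ p * W) + E af bt = E af (monom c p + bt)" for c p af bt
  by (simp_all add: E_def algebra_simps)
 have inV: "E af bt \<in> V p q \<longleftrightarrow> (\<forall>i\<ge>p. coeff af i = 0) & (\<forall>i\<ge>q. coeff bt i = 0)" for af bt p q
  by (auto simp: V_def E_inj)
 have q: "FR.dimension q (range kp) (V 0 q)" for q
 proof (induction q)
  case 0
  have "V 0 0 = {0}"
  proof -
   have "(\<forall>i\<ge>0. coeff af i = 0) \<longleftrightarrow> af = 0" for af :: "'a poly" by (simp add: poly_eq_iff)
   then have "V 0 0 = {E 0 0}" unfolding V_def by simp
   then show ?thesis by (simp add: E_def)
  qed
  then show ?case using FR.zero_dim by simp
 next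
  case (Suc q)
  have "V 0 (Suc q) = FR.line_extension (range kp) (xi ^ q * W) (V 0 q)"
  proof (intro equalityI subsetI)
   fix z assume "z \<in> V 0 (Suc q)"
   then obtain af bt where z: "z = E af bt" "\<forall>i\<ge>0. coeff af i = 0" "\<forall>i\<ge>Suc q. coeff bt i = 0" by (auto simp: V_def)
   obtain c bt' where "bt = monom c q + bt'" "\<forall>i\<ge>q. coeff bt' i = 0" using cut[OF z(3)] by blast
   then show "z \<in> FR.line_extension (range kp) (xi ^ q * W) (V 0 q)" unfolding ext using z(2)
    by (intro CollectI exI[of _ c] exI[of _ "E af bt'"]) (auto simp: z(1) E_monom inV)
  next
   fix z assume "z \<in> FR.line_extension (range kp) (xi ^ q * W) (V 0 q)"
   then obtain c u where z: "z = kp c * (xi ^ q * W) + u" "u \<in> V 0 q" unfolding ext by blast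
   moreover from z(2) obtain af bt where "u = E af bt" unfolding V_def by blast
   ultimately have "z = kp c * (xi ^ q * W) + E af bt" "E af bt \<in> V 0 q" by simp_all
   then show "z \<in> V 0 (Suc q)" unfolding E_monom by (auto simp: inV)
  qed
  moreover have "xi ^ q * W \<notin> V 0 q" using E_monom(2)[of 1 q 0 0] inV[of 0 "monom 1 q" 0 q] by (auto simp: kp_simps E_eq_0_iff E_def)
  moreover have "xi ^ q * W \<in> ff" by (intro F_mult F_power X_ff W_ff)
  ultimately show ?case using FR.Suc_dim Suc by simp
 qed
 have "FR.dimension (p + q) (range kp) (V p q)"
 proof (induction p)
  case 0
  then show ?case using q by simp
 next
  case (Suc p)
  have "V (Suc p) q = FR.line_extension (range kp) (xi ^ p) (V p q)"
  proof (intro equalityI subsetI)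
   fix z assume "z \<in> V (Suc p) q"
   then obtain af bt where z: "z = E af bt" "\<forall>i\<ge>Suc p. coeff af i = 0" "\<forall>i\<ge>q. coeff bt i = 0" by (auto simp: V_def)
   obtain c af' where "af = monom c p + af'" "\<forall>i\<ge>p. coeff af' i = 0" using cut[OF z(2)] by blast
   then show "z \<in> FR.line_extension (range kp) (xi ^ p) (V p q)" unfolding ext using z(3)
    by (intro CollectI exI[of _ c] exI[of _ "E af' bt"]) (auto simp: z(1) E_monom inV)
  next
   fix z assume "z \<in> FR.line_extension (range kp) (xi ^ p) (V p q)"
   then obtain c u where z: "z = kp c * xi ^ p + u" "u \<in> V p q" unfolding ext by blast
   moreover from z(2) obtain af bt where "u = E af bt" unfolding V_def by blast
   ultimately have "z = kp c * xi ^ p + E af bt" "E af bt \<in> V p q" by simp_all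
   then show "z \<in> V (Suc p) q" unfolding E_monom by (auto simp: inV)
  qed
  moreover have "xi ^ p \<notin> V p q" using E_monom(1)[of 1 p 0 0] inV[of "monom 1 p" 0 p q] by (auto simp: kp_simps E_eq_0_iff E_def)
  ultimately show ?case using FR.Suc_dim[of "xi ^ p" "V p q"] Suc F_power[OF X_ff] by simp
 qed
 then show ?thesis by (simp add: V_def)
qed

text \<open>There are \<open>l + 1\<close> coefficients for \<open>af\<close> and
  \<open>l + 1 - m\<close> for \<open>bt\<close>. Together with the degree \<open>2 * l\<close> of
  the divisor this yields the genus \<open>m - 1\<close>.\<close>

lemma dim_RR_Dinf:
 assumes "m \<le> l + 1" shows "ring.dimension FR (2 * l + 2 - m) (range kp) (RR (Dinf l))"
proof -
 have "degree af \<le> l \<longleftrightarrow> (\<forall>i\<ge>l + 1. coeff af i = 0)" for af :: "'a poly"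
  using degree_le[of l af] coeff_eq_0[of af] by (auto simp: Suc_le_eq)
 moreover have "bt = 0 \<or> degree bt + m \<le> l \<longleftrightarrow> (\<forall>i\<ge>l + 1 - m. coeff bt i = 0)" for bt :: "'a poly"
 proof
  assume "bt = 0 \<or> degree bt + m \<le> l"
  then show "\<forall>i\<ge>l + 1 - m. coeff bt i = 0" by (auto simp: coeff_eq_0)
 next
  assume a: "\<forall>i\<ge>l + 1 - m. coeff bt i = 0"
  show "bt = 0 \<or> degree bt + m \<le> l"
  proof (cases "bt = 0")
   case False
   then have "\<not> l + 1 - m \<le> degree bt" using a leading_coeff_0_iff[of bt] by blast
   then show ?thesis using assms by linarith
  qed simp
 qed
 ultimately have *: "RR (Dinf l) = {E af bt | af bt. (\<forall>i\<ge>l + 1. coeff af i = 0) & (\<forall>i\<ge>l + 1 - m. coeff bt i = 0)}"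
  unfolding RR_Dinf by simp
 have eq: "2 * l + 2 - m = l + 1 + (l + 1 - m)" using assms by simp
 show ?thesis unfolding * eq by (rule dim_bounded_degrees)
qed

lemma Dinf_divisor: "is_divisor FR (range kp) (Dinf l)" "ddeg (Dinf l) = 2 * int l"
proof -
 show "is_divisor FR (range kp) (Dinf l)" unfolding is_divisor_iff
  by (rule finite_subset[OF _ card_Inf_places(1)]) (auto simp: Inf_places_iff Dinf_def split: if_splits)
 have "ddeg (Dinf l) = sum (Dinf l) Inf_places" by (rule deg_superset[OF card_Inf_places(1)]) (auto simp: Inf_places_iff Dinf_def split: if_splits)
 also have "\<dots> = (\<Sum>R\<in>Inf_places. int l)" by (intro sum.cong) (auto simp: Inf_places_iff Dinf_def)
 finally show "ddeg (Dinf l) = 2 * int l" using card_Inf_places by simp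
qed

text \<open>Divisors linearly equivalent to \<open>Dinf l\<close>; repeating an entry of
  \<open>rs\<close> raises the multiplicity of the fiber over it.\<close>

definition Dl :: "nat => 'a list => 'b set => int" where
 "Dl l rs R = Dinf l R + (\<Sum>r\<leftarrow>rs. div_lin r R)"

lemma Dl:
 assumes "m \<le> l + 1" shows "is_divisor FR (range kp) (Dl l rs) & ddeg (Dl l rs) = 2 * int l &
  ring.dimension FR (2 * l + 2 - m) (range kp) (RR (Dl l rs))" proof (induction rs) case Nil have "Dl l [] = Dinf l" by (auto simp: Dl_def)
 then show ?case using Dinf_divisor dim_RR_Dinf[OF assms] by simp
next
 case (Cons r rs)
 have D: "Dl l (r # rs) = (%R. div_lin r R + Dl l rs R)" by (auto simp: Dl_def)
 have "RR (Dl l (r # rs)) = (*) (inverse (xi - kp r)) ` RR (Dl l rs)"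
 proof -
  have *: "z \<in> RR (Dl l (r # rs)) \<longleftrightarrow> z * (xi - kp r) \<in> RR (Dl l rs)" if z: "z \<in> ff" "z ~= 0" for z
   using z lin_ff[of r] F_mult[OF z(1) lin_ff(1)] ord_mult[OF _ z lin_ff[of r]] by (auto simp: mem_RR D div_lin_def algebra_simps)
  show ?thesis
  proof (intro equalityI subsetI)
   fix z assume z: "z \<in> RR (Dl l (r # rs))"
   then have "z * (xi - kp r) \<in> RR (Dl l rs)" using *[of z] RR_0 by (cases "z = 0") (auto simp: mem_RR)
   moreover have "z = inverse (xi - kp r) * (z * (xi - kp r))" using lin_ff by simp
   ultimately show "z \<in> (*) (inverse (xi - kp r)) ` RR (Dl l rs)" by blast
  next
   fix z assume "z \<in> (*) (inverse (xi - kp r)) ` RR (Dl l rs)"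
   then obtain y where y: "y \<in> RR (Dl l rs)" "z = inverse (xi - kp r) * y" by blast
   then have zy: "z * (xi - kp r) = y" and zf: "z \<in> ff" using lin_ff F_mult[OF F_inv[OF lin_ff(1)], of y] by (auto simp: mem_RR)
   show "z \<in> RR (Dl l (r # rs))"
   proof (cases "z = 0")
    case False
    then show ?thesis using *[OF zf False] y(1) unfolding zy by blast
   qed (simp add: RR_0)
  qed
 qed
 then have "ring.dimension FR (2 * l + 2 - m) (range kp) (RR (Dl l (r # rs)))"
  using dimension_scale[of _ _ "inverse (xi - kp r)"] Cons lin_ff F_inv by simp
 then show ?case using Cons is_divisor_add[OF div_lin(1) conjunct1[OF Cons]] div_lin(2)[of r] unfolding D by simp
qed

theorem genus_complete_curve: "has_genus FR (range kp) (m - 1)"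
proof (rule has_genusI)
 show "is_divisor FR (range kp) (Dinf m)" by (rule Dinf_divisor)
 show "ring.dimension FR (2 * m + 2 - m) (range kp) (RR (Dinf m))" by (rule dim_RR_Dinf) simp
 show "ddeg (Dinf m) - int (2 * m + 2 - m) + 1 = int (m - 1)" using Dinf_divisor m1 by simp
 fix D assume D: "is_divisor FR (range kp) D"
 define S where "S = {R. vring R & D R ~= 0}"
 have S: "finite S" using D by (simp add: S_def is_divisor_iff)
 define N where "N = nat (Max (insert 0 (D ` S)))"
 have N: "D R \<le> int N" if "vring R" for R
 proof (cases "R \<in> S")
  case True
  then have "D R \<le> Max (insert 0 (D ` S))" using S by (intro Max_ge) auto
  then show ?thesis by (simp add: N_def)
 qed (use that in \<open>simp add: S_def\<close>)
 have "\<forall>R\<in>{R\<in>S. xi \<in> R}. \<exists>r. inverse (xi - kp r) \<notin> R" using ex_center by (auto simp: S_def)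
 then obtain cen where "\<forall>R\<in>{R\<in>S. xi \<in> R}. inverse (xi - kp (cen R)) \<notin> R" unfolding bchoice_iff by blast
 then have cen: "!!R. R \<in> S ==> xi \<in> R ==> inverse (xi - kp (cen R)) \<notin> R" by simp
 obtain cs where cs: "set cs = cen ` S" using S finite_list[of "cen ` S"] by auto
 \<comment> \<open>Each center occurs \<open>N\<close> times, which dominates \<open>D\<close> at
   the finite places. The summand \<open>length rs\<close> in \<open>l\<close> makes up for the
   poles at infinity of these principal divisors.\<close>
 define rs where "rs = concat (replicate N cs)"
 define l where "l = N + length rs + m"
 have sum_rs: "(\<Sum>r\<leftarrow>rs. f r) = int N * (\<Sum>r\<leftarrow>cs. f r)" for f :: "'a => int"
  unfolding rs_def by (induction N) (auto simp: algebra_simps)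
 have "D R \<le> Dl l rs R" if R: "vring R" for R
 proof (cases "xi \<in> R")
  case True
  have "xi - kp r \<in> R" for r using vringD(3,7)[OF R] True by blast
  then have nonneg: "0 \<le> div_lin r R" for r using ord_nonneg_iff[OF R lin_ff] by (simp add: div_lin_def)
  then have nn: "0 \<le> (\<Sum>r\<leftarrow>rs'. div_lin r R)" for rs' by (intro sum_list_nonneg) auto
  show ?thesis
  proof (cases "R \<in> S")
   case RS: True
   have "inverse (xi - kp (cen R)) \<notin> R" using cen RS True by blast
   then have "\<not> ordp R (inverse (xi - kp (cen R))) \<ge> 0" using ord_nonneg_iff[OF R F_inv[OF lin_ff(1)], of "cen R"] lin_ff by simp
   then have "1 \<le> div_lin (cen R) R" using ord_inverse[OF R lin_ff] by (simp add: div_lin_def)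
   moreover have "div_lin (cen R) R \<le> (\<Sum>r\<leftarrow>cs. div_lin r R)"
   proof (rule member_le_sum_list)
    show "div_lin (cen R) R \<in> set (map (%r. div_lin r R) cs)" using RS cs by auto
   qed (use nonneg in auto)
   ultimately have "int N * 1 \<le> (\<Sum>r\<leftarrow>rs. div_lin r R)" unfolding sum_rs by (intro mult_left_mono) auto
   then show ?thesis using N[OF R] True by (simp add: Dl_def Dinf_def)
  next
   case False
   then show ?thesis using nn[of rs] R True by (simp add: S_def Dl_def Dinf_def)
  qed
 next
  case False
  then have "(\<Sum>r\<leftarrow>rs. div_lin r R) = - int (length rs)" using ord_inf[OF R False] by (induction rs) (auto simp: div_lin_def)
  then show ?thesis using N[OF R] False by (simp add: Dl_def Dinf_def l_def)
 qed
 moreover have "m \<le> l + 1" by (simp add: l_def)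
 ultimately show "\<exists>E n. is_divisor FR (range kp) E & (\<forall>R. vring R --> D R \<le> E R) &
   ring.dimension FR n (range kp) (RR E) & ddeg E - int n + 1 \<le> int (m - 1)"
  using Dl[of l rs] m1 by (intro exI[of _ "Dl l rs"] exI[of _ "2 * l + 2 - m"]) auto
qed

end

section \<open>Invariance of the genus under isomorphism\<close>

locale field_iso =
 F: field F + F': field F' for F :: "'f ring" and F' :: "'g ring" +
 fixes fi :: "'f => 'g" and k :: "'f set"
 assumes iso: "fi \<in> ring_iso F F'" and sub: "subfield k F"
begin

lemma bij: "bij_betw fi (carrier F) (carrier F')" using iso by (auto simp: ring_iso_def)

lemma hom:
 "x \<in> carrier F ==> fi x \<in> carrier F'"
 "x \<in> carrier F ==> y \<in> carrier F ==> fi (x \<otimes>\<^bsub>F\<^esub> y) = fi x \<otimes>\<^bsub>F'\<^esub> fi y"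
 "x \<in> carrier F ==> y \<in> carrier F ==> fi (x \<oplus>\<^bsub>F\<^esub> y) = fi x \<oplus>\<^bsub>F'\<^esub> fi y"
 "fi \<one>\<^bsub>F\<^esub> = \<one>\<^bsub>F'\<^esub>" using iso by (auto simp: ring_iso_def ring_hom_def)

sublocale H: ring_hom_ring F F' fi using hom by unfold_locales (auto simp: ring_hom_def)

lemma inj: "x \<in> carrier F ==> y \<in> carrier F ==> fi x = fi y \<longleftrightarrow> x = y" using bij by (auto simp: bij_betw_def inj_on_def)

lemma eq0: "x \<in> carrier F ==> fi x = \<zero>\<^bsub>F'\<^esub> \<longleftrightarrow> x = \<zero>\<^bsub>F\<^esub>"
 using inj[of x "\<zero>\<^bsub>F\<^esub>"] by simp

lemma mem_image: "R <= carrier F ==> x \<in> carrier F ==> fi x \<in> fi ` R \<longleftrightarrow> x \<in> R"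
 using bij by (auto simp: bij_betw_def inj_on_def)

lemma surj: "y \<in> carrier F' ==> \<exists>x\<in>carrier F. y = fi x" using bij by (auto simp: bij_betw_def)

lemma inv: "x \<in> carrier F ==> x ~= \<zero>\<^bsub>F\<^esub> ==> fi (inv\<^bsub>F\<^esub> x) = inv\<^bsub>F'\<^esub> fi x"
proof -
 assume x: "x \<in> carrier F" "x ~= \<zero>\<^bsub>F\<^esub>"
 then have u: "x \<in> Units F" by (simp add: F.field_Units)
 then have "fi x \<otimes>\<^bsub>F'\<^esub> fi (inv\<^bsub>F\<^esub> x) = \<one>\<^bsub>F'\<^esub>"
  using x hom(2)[OF x(1) F.Units_inv_closed[OF u]] hom(4) F.Units_r_inv[OF u] by simp
 then show ?thesis using F'.comm_inv_char[of "fi x" "fi (inv\<^bsub>F\<^esub> x)"] x u hom(1) F.Units_inv_closed by auto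
qed

lemma inv_nz: "x \<in> carrier F ==> x ~= \<zero>\<^bsub>F\<^esub> ==> inv\<^bsub>F\<^esub> x \<in> carrier F & inv\<^bsub>F\<^esub> x ~= \<zero>\<^bsub>F\<^esub>"
 using F.field_Units F.Units_inv_Units[of x] F.Units_inv_closed[of x] by auto

lemma nat_pow: "x \<in> carrier F ==> fi (x [^]\<^bsub>F\<^esub> (n::nat)) = fi x [^]\<^bsub>F'\<^esub> n" by (induction n) (auto simp: hom)

lemma nat_pow_nz: "x \<in> carrier F ==> x ~= \<zero>\<^bsub>F\<^esub> ==> x [^]\<^bsub>F\<^esub> (n::nat) ~= \<zero>\<^bsub>F\<^esub>"
proof (induction n)
 case (Suc n)
 then show ?case using F.integral[of "x [^]\<^bsub>F\<^esub> n" x] by auto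
qed simp

lemma int_pow:
 assumes x: "x \<in> carrier F" "x ~= \<zero>\<^bsub>F\<^esub>"
 shows "fi (x [^]\<^bsub>F\<^esub> (n::int)) = fi x [^]\<^bsub>F'\<^esub> n" "x [^]\<^bsub>F\<^esub> n \<in> carrier F"
proof -
 have p: "x [^]\<^bsub>F\<^esub> nat i \<in> carrier F" "x [^]\<^bsub>F\<^esub> nat i ~= \<zero>\<^bsub>F\<^esub>" for i
  using x nat_pow_nz F.nat_pow_closed by blast+
 show "fi (x [^]\<^bsub>F\<^esub> n) = fi x [^]\<^bsub>F'\<^esub> n" unfolding int_pow_def2 if_distrib[of fi] inv[OF p] nat_pow[OF x(1)] ..
 show "x [^]\<^bsub>F\<^esub> n \<in> carrier F" unfolding int_pow_def2 using inv_nz[OF p] p by (simp only: split: if_split) blast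
qed

lemmas int_pow_closed = int_pow(2)

lemma subring_image: "R <= carrier F ==> subring (fi ` R) F' \<longleftrightarrow> subring R F"
proof
 assume R: "R <= carrier F" and s: "subring (fi ` R) F'"
 note d = subringE[OF s]
 show "subring R F"
 proof (rule F.subringI[OF R])
  show "\<one>\<^bsub>F\<^esub> \<in> R" using d(3) hom(4) mem_image[OF R F.one_closed] by simp
  fix h assume h: "h \<in> R"
  then show "\<ominus>\<^bsub>F\<^esub> h \<in> R"
   using d(5)[of "fi h"] R mem_image[OF R, of "\<ominus>\<^bsub>F\<^esub> h"] by (auto simp: subset_iff)
  fix h' assume h': "h' \<in> R"
  show "h \<otimes>\<^bsub>F\<^esub> h' \<in> R" "h \<oplus>\<^bsub>F\<^esub> h' \<in> R"
   using d(6,7)[of "fi h" "fi h'"] R h h' mem_image[OF R, of "h \<otimes>\<^bsub>F\<^esub> h'"] mem_image[OF R, of "h \<oplus>\<^bsub>F\<^esub> h'"] hom(2,3)[of h h']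
   by (auto simp: subset_iff)
 qed
next
 assume "subring R F"
 then show "subring (fi ` R) F'" by (rule H.img_is_subring)
qed

lemma k_carrier: "k <= carrier F" using subfieldE(3)[OF sub] .

lemma places_image: "R <= carrier F ==> fi ` R \<in> places F' (fi ` k) \<longleftrightarrow> R \<in> places F k"
proof -
 assume R: "R <= carrier F"
 have im: "fi ` A \<subset> fi ` B \<longleftrightarrow> A \<subset> B" if "A <= carrier F" "B <= carrier F" for A B
  using that bij inj_on_image_eq_iff[of fi "carrier F" A B] inj_on_image_subset_iff[of fi "carrier F" A B] by (auto simp: psubset_eq bij_betw_def)
 have c: "carrier F' = fi ` carrier F" using bij by (auto simp: bij_betw_def)
 have v: "(\<forall>x\<in>carrier F' - {\<zero>\<^bsub>F'\<^esub>}. x \<in> fi ` R \<or> inv\<^bsub>F'\<^esub> x \<in> fi ` R) \<longleftrightarrow>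
   (\<forall>x\<in>carrier F - {\<zero>\<^bsub>F\<^esub>}. x \<in> R \<or> inv\<^bsub>F\<^esub> x \<in> R)" (is "?L \<longleftrightarrow> ?R")
 proof -
  have "?L \<longleftrightarrow> (\<forall>x\<in>carrier F. x ~= \<zero>\<^bsub>F\<^esub> --> fi x \<in> fi ` R \<or> inv\<^bsub>F'\<^esub> (fi x) \<in> fi ` R)"
   unfolding c using eq0 by auto
  also have "\<dots> \<longleftrightarrow> ?R" using mem_image[OF R] inv inv_nz by (metis DiffE DiffI insertE insertI1 singletonD)
  finally show ?thesis .
 qed
 show ?thesis unfolding places_def using subring_image[OF R] im[OF k_carrier R] im[OF R] v c by auto
qed

lemma places_F': "R' \<in> places F' (fi ` k) ==> \<exists>R. R \<in> places F k & R' = fi ` R"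
proof -
 assume R': "R' \<in> places F' (fi ` k)"
 then have "R' <= carrier F'" by (auto simp: places_def)
 moreover have "carrier F' = fi ` carrier F" using bij by (auto simp: bij_betw_def)
 ultimately obtain R where "R <= carrier F" "R' = fi ` R" by (metis subset_imageE)
 then show ?thesis using places_image R' by blast
qed

lemma places_carrier: "R \<in> places F k ==> R <= carrier F" by (auto simp: places_def)

lemma image_inj: "R \<in> places F k ==> R' \<in> places F k ==> fi ` R = fi ` R' \<longleftrightarrow> R = R'"
 using bij inj_on_image_eq_iff[of fi "carrier F" R R'] places_carrier by (auto simp: bij_betw_def)

lemma uniformizer_image:
 assumes R: "R <= carrier F" and t: "t \<in> carrier F" shows "uniformizer F' (fi ` R) (fi t) \<longleftrightarrow> uniformizer F R t"
proof -
 define M where "M = {x \<in> R. x = \<zero>\<^bsub>F\<^esub> \<or> inv\<^bsub>F\<^esub> x \<notin> R}"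
 define N where "N = {t \<otimes>\<^bsub>F\<^esub> y | y. y \<in> R}"
 have "{x \<in> fi ` R. x = \<zero>\<^bsub>F'\<^esub> \<or> inv\<^bsub>F'\<^esub> x \<notin> fi ` R} = fi ` M"
 proof -
  have "(fi x = \<zero>\<^bsub>F'\<^esub> \<or> inv\<^bsub>F'\<^esub> (fi x) \<notin> fi ` R) \<longleftrightarrow> (x = \<zero>\<^bsub>F\<^esub> \<or> inv\<^bsub>F\<^esub> x \<notin> R)" if "x \<in> R" for x
   using that R eq0[of x] inv[of x] inv_nz[of x] mem_image[OF R, of "inv\<^bsub>F\<^esub> x"] by (metis subsetD)
  then show ?thesis unfolding M_def by blast
 qed
 moreover have "{fi t \<otimes>\<^bsub>F'\<^esub> y | y. y \<in> fi ` R} = fi ` N"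
 proof -
  have "fi t \<otimes>\<^bsub>F'\<^esub> fi y = fi (t \<otimes>\<^bsub>F\<^esub> y)" if "y \<in> R" for y using that R t hom(2) by auto
  then show ?thesis unfolding N_def by (auto simp: image_iff) metis+
 qed
 moreover have "M <= carrier F" "N <= carrier F" using R t by (auto simp: M_def N_def)
 then have "fi ` M = fi ` N \<longleftrightarrow> M = N" using bij inj_on_image_eq_iff[of fi "carrier F" M N] by (auto simp: bij_betw_def)
 ultimately show ?thesis unfolding uniformizer_def using mem_image[OF R t] by (simp add: M_def N_def)
qed

text \<open>If \<open>t\<close> were zero, the maximal ideal would be zero; but it contains the
  inverse of any element outside \<open>R\<close>, and such an element exists.\<close>

lemma uniformizer_nz:
 assumes R: "R \<in> places F k" and t: "uniformizer F R t" shows "t ~= \<zero>\<^bsub>F\<^esub>"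
proof
 assume "t = \<zero>\<^bsub>F\<^esub>"
 have Rc: "R \<subset> carrier F" and v: "!!x. x \<in> carrier F - {\<zero>\<^bsub>F\<^esub>} ==> x \<in> R \<or> inv\<^bsub>F\<^esub> x \<in> R" and s: "subring R F"
  using R by (auto simp: places_def)
 obtain x where x: "x \<in> carrier F" "x \<notin> R" using Rc by blast
 moreover have "\<zero>\<^bsub>F\<^esub> \<in> R" using subringE(2)[OF s] .
 ultimately have "x ~= \<zero>\<^bsub>F\<^esub>" "inv\<^bsub>F\<^esub> x \<in> R" using v by auto
 moreover have "inv\<^bsub>F\<^esub> (inv\<^bsub>F\<^esub> x) = x" using x calculation F.Units_inv_inv[of x] F.field_Units by auto
 ultimately have "inv\<^bsub>F\<^esub> x \<in> {x \<in> R. x = \<zero>\<^bsub>F\<^esub> \<or> inv\<^bsub>F\<^esub> x \<notin> R}" using x by simp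
 moreover have "{x \<in> R. x = \<zero>\<^bsub>F\<^esub> \<or> inv\<^bsub>F\<^esub> x \<notin> R} = {t \<otimes>\<^bsub>F\<^esub> y | y. y \<in> R}"
  using t by (simp add: uniformizer_def)
 ultimately have "inv\<^bsub>F\<^esub> x \<in> {t \<otimes>\<^bsub>F\<^esub> y | y. y \<in> R}" by blast
 then have "inv\<^bsub>F\<^esub> x = \<zero>\<^bsub>F\<^esub>" using \<open>t = \<zero>\<^bsub>F\<^esub>\<close> Rc by auto
 then show False using inv_nz x \<open>x ~= \<zero>\<^bsub>F\<^esub>\<close> by blast
qed

lemma place_order_image:
 assumes R: "R \<in> places F k" and x: "x \<in> carrier F" shows "place_order F' (fi ` R) (fi x) = place_order F R x"
proof -
 note Rc = places_carrier[OF R]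
 have "(\<exists>t u. uniformizer F' (fi ` R) t & u \<in> fi ` R - {\<zero>\<^bsub>F'\<^esub>} & inv\<^bsub>F'\<^esub> u \<in> fi ` R &
     fi x = (t [^]\<^bsub>F'\<^esub> (n::int)) \<otimes>\<^bsub>F'\<^esub> u) \<longleftrightarrow>
    (\<exists>t u. uniformizer F R t & u \<in> R - {\<zero>\<^bsub>F\<^esub>} & inv\<^bsub>F\<^esub> u \<in> R &
     x = (t [^]\<^bsub>F\<^esub> n) \<otimes>\<^bsub>F\<^esub> u)" (is "?L \<longleftrightarrow> ?R") for n proof assume ?L
  then obtain t' u' where tu: "uniformizer F' (fi ` R) t'" "u' \<in> fi ` R - {\<zero>\<^bsub>F'\<^esub>}" "inv\<^bsub>F'\<^esub> u' \<in> fi ` R"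
   "fi x = (t' [^]\<^bsub>F'\<^esub> n) \<otimes>\<^bsub>F'\<^esub> u'" by blast
  obtain t u where t: "t \<in> R" "t' = fi t" and u: "u \<in> R" "u' = fi u" using tu(1,2) by (auto simp: uniformizer_def)
  have tc: "t \<in> carrier F" and uc: "u \<in> carrier F" using t u Rc by auto
  have un: "uniformizer F R t" using tu(1) uniformizer_image[OF Rc tc] t by simp
  note tnz = uniformizer_nz[OF R un]
  have u0: "u ~= \<zero>\<^bsub>F\<^esub>" using tu(2) u eq0[OF uc] by auto
  have "inv\<^bsub>F\<^esub> u \<in> R" using tu(3) u inv[OF uc u0] inv_nz[OF uc u0] mem_image[OF Rc] by metis
  moreover have "fi x = fi ((t [^]\<^bsub>F\<^esub> n) \<otimes>\<^bsub>F\<^esub> u)"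
   using tu(4) t u int_pow(1)[OF tc tnz] hom(2)[OF int_pow_closed[OF tc tnz] uc] by simp
  then have "x = (t [^]\<^bsub>F\<^esub> n) \<otimes>\<^bsub>F\<^esub> u" using inj[OF x F.m_closed[OF int_pow_closed[OF tc tnz] uc]] by blast
  ultimately show ?R using un u u0 by blast
 next
  assume ?R
  then obtain t u where tu: "uniformizer F R t" "u \<in> R - {\<zero>\<^bsub>F\<^esub>}" "inv\<^bsub>F\<^esub> u \<in> R" "x = (t [^]\<^bsub>F\<^esub> n) \<otimes>\<^bsub>F\<^esub> u"
   by blast
  have tc: "t \<in> carrier F" and uc: "u \<in> carrier F" using tu Rc by (auto simp: uniformizer_def)
  note tnz = uniformizer_nz[OF R tu(1)]
  have "uniformizer F' (fi ` R) (fi t)" using tu(1) uniformizer_image[OF Rc tc] by simp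
  moreover have "fi u \<in> fi ` R - {\<zero>\<^bsub>F'\<^esub>}" using tu(2) eq0[OF uc] by auto
  moreover have "inv\<^bsub>F'\<^esub> (fi u) \<in> fi ` R" using tu inv[OF uc] by (metis DiffE image_eqI insertI1)
  moreover have "fi x = (fi t [^]\<^bsub>F'\<^esub> n) \<otimes>\<^bsub>F'\<^esub> fi u"
   using tu(4) int_pow(1)[OF tc tnz] hom(2)[OF int_pow_closed[OF tc tnz] uc] by simp
  ultimately show ?L by blast
 qed
 then show ?thesis unfolding place_order_def by simp
qed

text \<open>Divisors are total functions on sets, of which only the values at places matter; hence
  \<open>push\<close> may be defined through preimages of arbitrary sets.\<close>

lemma has_genus_image:
 assumes "has_genus F k g" shows "has_genus F' (fi ` k) g"
proof -
 have k': "subfield (fi ` k) F'" by (rule H.img_is_subfield(2)[OF sub]) simp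
 define pull where "pull D' = (%R. D' (fi ` R))" for D' :: "'g set => int"
 define push where "push D = (%R'. D {x \<in> carrier F. fi x \<in> R'})" for D :: "'f set => int"
 have pre: "{x \<in> carrier F. fi x \<in> fi ` R} = R" if "R \<in> places F k" for R
  using mem_image[OF places_carrier[OF that]] places_carrier[OF that] by auto
 have im: "places F' (fi ` k) = (`) fi ` places F k" using places_F' places_image places_carrier by blast
 have agree: "D' (fi ` R) = D R" if "D = pull D' \<or> D' = push D" "R \<in> places F k" for D D' R using that pre by (auto simp: pull_def push_def)
 have inj_places: "inj_on ((`) fi) A" if "A <= places F k" for A using image_inj that by (auto simp: inj_on_def)
 have supp: "{R' \<in> places F' (fi ` k). D' R' ~= 0} = (`) fi ` {R \<in> places F k. D R ~= 0}" if "D = pull D' \<or> D' = push D" for D D'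
  unfolding im using agree[OF that] by auto
 have div: "is_divisor F' (fi ` k) D' \<longleftrightarrow> is_divisor F k D"
  and deg: "divisor_degree F' (fi ` k) D' = divisor_degree F k D" if "D = pull D' \<or> D' = push D" for D D'
 proof -
  have i: "inj_on ((`) fi) {R \<in> places F k. D R ~= 0}" by (rule inj_places) auto
  show "is_divisor F' (fi ` k) D' \<longleftrightarrow> is_divisor F k D" unfolding is_divisor_def supp[OF that] by (rule finite_image_iff[OF i])
  show "divisor_degree F' (fi ` k) D' = divisor_degree F k D" unfolding divisor_degree_def supp[OF that] sum.reindex[OF i]
   by (intro sum.cong) (auto simp: agree[OF that])
 qed
 have RRim: "riemann_roch_space F' (fi ` k) D' = fi ` riemann_roch_space F k D" if "D = pull D' \<or> D' = push D" for D D'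
 proof -
  have c: "carrier F' = fi ` carrier F" using bij by (auto simp: bij_betw_def)
  have "(fi x = \<zero>\<^bsub>F'\<^esub> \<or> (\<forall>R'\<in>places F' (fi ` k). - D' R' \<le> place_order F' R' (fi x))) \<longleftrightarrow>
    (x = \<zero>\<^bsub>F\<^esub> \<or> (\<forall>R\<in>places F k. - D R \<le> place_order F R x))" if x: "x \<in> carrier F" for x
   unfolding im using place_order_image[OF _ x] agree[OF \<open>D = pull D' \<or> D' = push D\<close>] eq0[OF x] by simp
  then show ?thesis unfolding riemann_roch_space_def c by blast
 qed
 have dim: "ring.dimension F' n (fi ` k) (fi ` U) \<longleftrightarrow> ring.dimension F n k U" if U: "U <= carrier F" for n U
 proof
  assume "ring.dimension F n k U"
  then show "ring.dimension F' n (fi ` k) (fi ` U)" using H.inj_hom_dimension[OF sub] bij U by (metis F'.zero_not_one bij_betw_def inj_on_subset)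
 next
  assume d: "ring.dimension F' n (fi ` k) (fi ` U)"
  define ps where "ps = inv_into (carrier F) fi"
  have psi: "ps (fi x) = x" if "x \<in> carrier F" for x using that bij by (auto simp: ps_def bij_betw_def)
  have "ps \<in> ring_iso F' F" unfolding ps_def using ring_iso_set_sym[OF F.ring_axioms iso] .
  then interpret H': ring_hom_ring F' F ps by unfold_locales (auto simp: ring_iso_def)
  have "fi ` U <= carrier F'" using U hom(1) by auto
  then have "inj_on ps (fi ` U)" using psi U by (auto simp: inj_on_def) (metis subsetD)
  then have "ring.dimension F n (ps ` fi ` k) (ps ` fi ` U)" using H'.inj_hom_dimension[OF k' _ _ d] by simp
  moreover have "ps ` fi ` A = A" if "A <= carrier F" for A using psi that by (auto simp: image_iff) (metis subsetD)
  ultimately show "ring.dimension F n k U" using U k_carrier by simp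
 qed
 have RRc: "riemann_roch_space F k D <= carrier F" for D by (auto simp: riemann_roch_space_def)
 show ?thesis unfolding has_genus_def
 proof (intro conjI allI impI)
  obtain D n where "is_divisor F k D" "ring.dimension F n k (riemann_roch_space F k D)"
   "divisor_degree F k D - int n + 1 = int g" using assms unfolding has_genus_def by blast
  then show "\<exists>D n. is_divisor F' (fi ` k) D & ring.dimension F' n (fi ` k) (riemann_roch_space F' (fi ` k) D) &
    divisor_degree F' (fi ` k) D - int n + 1 = int g" using div[of D "push D"] deg[of D "push D"] RRim[of D "push D"] dim[OF RRc]
   by (intro exI[of _ "push D"] exI[of _ n]) auto
  fix D' n assume "is_divisor F' (fi ` k) D' & ring.dimension F' n (fi ` k) (riemann_roch_space F' (fi ` k) D')"
  then show "divisor_degree F' (fi ` k) D' - int n + 1 \<le> int g"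
   using div[of "pull D'" D'] deg[of "pull D'" D'] RRim[of "pull D'" D'] dim[OF RRc] assms unfolding has_genus_def by auto
 qed
qed

end

section \<open>Conductors and the normalization of a double cover\<close>

text \<open>For \<open>W^2 + P W + Q = 0\<close> the element \<open>w = (W - s) / S\<close>
  satisfies \<open>w^2 + ((P + 2 s) / S) w + (s^2 + P s + Q) / S^2 = 0\<close>; the two
  divisibilities make this equation integral. No square root of the discriminant occurs, so
  characteristic two is covered.\<close>

definition conductor :: "'a::field poly => 'a poly => 'a poly => 'a poly => bool" where
 "conductor P Q S s \<longleftrightarrow> S ~= 0 & S dvd P + 2 * s & S ^ 2 dvd s ^ 2 + P * s + Q"

text \<open>Passing from \<open>W\<close> to \<open>(W - s) / S\<close> divides the discriminant by
  \<open>S^2\<close>.\<close>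

lemma conductor_disc: "conductor P Q S s ==> S ^ 2 dvd P ^ 2 - 4 * Q"
proof -
 assume c: "conductor P Q S s"
 have "P ^ 2 - 4 * Q = (P + 2 * s) ^ 2 - 4 * (s ^ 2 + P * s + Q)" by (simp add: algebra_simps power2_eq_square)
 moreover have "S ^ 2 dvd (P + 2 * s) ^ 2" using c by (auto simp: conductor_def intro: dvd_power_same)
 moreover have "S ^ 2 dvd 4 * (s ^ 2 + P * s + Q)" using c unfolding conductor_def by (intro dvd_mult) blast
 ultimately show ?thesis by (metis dvd_diff)
qed

lemma degree_dvd_square:
 fixes S D :: "'a::field poly"
 assumes "S ^ 2 dvd D" "D ~= 0" shows "2 * degree S \<le> degree D"
 using dvd_imp_degree_le[OF assms] assms by (simp add: degree_power_eq power2_eq_square degree_mult_eq)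
  (metis add_eq_self_zero degree_0 degree_mult_eq dvd_0_left_iff mult_2 mult_zero_left)

text \<open>Replacing \<open>s\<close> by \<open>s - S * t\<close> only adds the polynomial
  \<open>t\<close> to \<open>(W - s) / S\<close>. The reduced \<open>s\<close> has smaller degree
  than \<open>S\<close>, which keeps the degrees at infinity under control.\<close>

lemma conductor_mod:
 assumes "conductor P Q S s" shows "conductor P Q S (s mod S)"
proof -
 define t where "t = s div S"
 have s: "s mod S = s - S * t" by (simp add: t_def minus_mult_div_eq_mod)
 have "P + 2 * (s mod S) = (P + 2 * s) - S * (2 * t)" by (simp add: s algebra_simps)
 moreover have "(s mod S) ^ 2 + P * (s mod S) + Q = (s ^ 2 + P * s + Q) - S * (P + 2 * s) * t + S ^ 2 * t ^ 2"
  by (simp add: s algebra_simps power2_eq_square)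
 moreover have "S ^ 2 dvd S * (P + 2 * s) * t" using assms by (auto simp: conductor_def power2_eq_square intro!: dvd_mult2 mult_dvd_mono)
 ultimately show ?thesis using assms unfolding conductor_def by (metis dvd_add dvd_diff dvd_triv_left)
qed

context quadratic_curve
begin

text \<open>For a conductor of greatest degree the curve of \<open>w = (W - s) / S\<close> is
  smooth, because a singular point over \<open>r\<close> would make \<open>S * [:- r, 1:]\<close> a
  conductor. Its linear coefficient has degree \<open>n - degree S\<close>, and the genus is one
  less.\<close>

theorem genus_conductor:
 assumes n: "degree h = n" "n \<ge> 1" "degree g \<le> n" and D: "h ^ 2 - 4 * g ~= 0"
 shows "\<exists>S s. conductor h g S s & (\<forall>S' s'. conductor h g S' s' --> degree S' \<le> degree S) &
  degree S < n & has_genus (subfield_record ff) (range kp) (n - 1 - degree S)" proof - have "conductor h g 1 0" by (simp add: conductor_def)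
 moreover have bound: "degree S \<le> n" if "conductor h g S s" for S s
 proof -
  have "degree (h ^ 2 - 4 * g) \<le> 2 * n"
   using n by (intro degree_diff_le) (auto simp: numeral_poly degree_power_le[THEN order_trans] power2_eq_square intro!: degree_mult_le[THEN order_trans])
  then show ?thesis using degree_dvd_square[OF conductor_disc[OF that] D] by linarith
 qed
 ultimately have "\<exists>S. (\<exists>s. conductor h g S s) & (\<forall>S'. (\<exists>s. conductor h g S' s) --> degree S' \<le> degree S)"
  by (intro ex_has_greatest_nat[of _ 1 _ "Suc n"]) (auto simp: less_Suc_eq_le)
 then obtain S s0 where S0: "conductor h g S s0" and max: "!!S' s'. conductor h g S' s' ==> degree S' \<le> degree S" by blast
 define s where "s = s0 mod S"
 have c: "conductor h g S s" unfolding s_def by (rule conductor_mod[OF S0])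
 then have S: "S ~= 0" by (simp add: conductor_def)
 have deg_s: "s = 0 \<or> degree s < degree S" unfolding s_def using degree_mod_less[OF S] by blast
 obtain h1 g1 where h1: "h + 2 * s = S * h1" and g1: "s ^ 2 + h * s + g = S ^ 2 * g1" using c by (auto simp: conductor_def elim!: dvdE)
 define w where "w = (W - ev s) / ev S"
 have evS: "ev S ~= 0" using S by simp
 have W: "W = ev s + ev S * w" using evS by (simp add: w_def)
 interpret w: quadratic_curve kp xi w h1 g1
 proof
  have "ev S * ev S * (w * w) = (W - ev s) * (W - ev s)" unfolding W by (simp add: algebra_simps)
  also have "\<dots> = W * W - (ev s + ev s) * W + ev s * ev s" by (simp add: algebra_simps)
  also have "\<dots> = (- ev h * W - ev g) - (ev s + ev s) * W + ev s * ev s" by (simp only: W_eq)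
  also have "\<dots> = - ev (h + 2 * s) * (W - ev s) - ev (s ^ 2 + h * s + g)"
  proof -
   have "ev (h + 2 * s) = ev h + (ev s + ev s)" "ev (s ^ 2 + h * s + g) = ev s * ev s + ev h * ev s + ev g"
    by (simp_all only: mult_2 ev_add ev_mult power2_eq_square)
   then show ?thesis by (simp only:) (simp add: algebra_simps)
  qed
  also have "\<dots> = ev S * ev S * (- ev h1 * w - ev g1)"
  proof -
   have "W - ev s = ev S * w" using W by simp
   then show ?thesis unfolding h1 g1 by (simp only: ev_mult ev_power power2_eq_square) (simp add: right_diff_distrib)
  qed
  finally show "w * w = - ev h1 * w - ev g1" using evS by simp
  fix af bt assume "ev af + ev bt * w = 0"
  moreover have "ev (af * S - bt * s) + ev bt * W = ev S * (ev af + ev bt * w)" unfolding W by (simp add: algebra_simps)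
  ultimately have "ev (af * S - bt * s) + ev bt * W = 0" by simp
  from indep[OF this] show "af = 0 & bt = 0" using S by auto
 qed
 have ff_eq: "w.ff = ff"
 proof
  show "w.ff <= ff" unfolding w_def[symmetric] by (intro w.ff_subset F1 F_diff F_mult F_inv X_ff PE_ff[OF PE_intros(2)] kF)
    (auto simp: w_def intro!: F_div F_diff W_ff PE_ff[OF PE_intros(2)])
  show "ff <= w.ff" by (intro ff_subset w.F1 w.F_diff w.F_mult w.F_inv w.X_ff w.PE_ff[OF w.PE_intros(2)] w.kF)
    (auto simp: W intro!: w.F_add w.F_mult w.W_ff w.PE_ff[OF w.PE_intros(2)])
 qed
 define m where "m = n - degree S"
 have degS: "degree S \<le> n" by (rule bound[OF c])
 have "degree (2 * s) < n" using deg_s degS n(2) degree_mult_le[of 2 s] by (auto simp: numeral_poly degree_smult_eq split: if_splits)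
 then have "degree (h + 2 * s) = n" using n by (simp add: degree_add_eq_left)
 then have "degree (S * h1) = n" unfolding h1 .
 moreover from this have h1_nz: "h1 ~= 0" using n(2) by auto
 ultimately have deg_h1: "degree h1 + degree S = n" "h1 ~= 0" by (simp_all add: degree_mult_eq S)
 have deg_num: "s = 0 \<or> degree (s ^ 2 + h * s + g) + 1 \<le> n + degree S"
 proof (cases "s = 0")
  case False
  then have ds: "degree s < degree S" using deg_s by simp
  have "degree (s ^ 2 + h * s + g) \<le> n + degree S - 1" using ds degS n degree_mult_le[of s s] degree_mult_le[of h s]
   by (intro degree_add_le) (auto simp: power2_eq_square)
  then show ?thesis using ds by linarith
 qed simp
 have deg_g1: "g1 = 0 \<or> degree g1 + 2 * degree S = degree (s ^ 2 + h * s + g)"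
  unfolding g1 by (cases "g1 = 0") (simp_all add: degree_mult_eq S power2_eq_square)
 \<comment> \<open>If \<open>S\<close> used up the whole degree \<open>n\<close>, then
   \<open>g1\<close> would vanish and \<open>w * (w + ev h1) = 0\<close> would contradict
   \<open>indep\<close>.\<close>
 have m1: "m \<ge> 1"
 proof (rule ccontr)
  assume "\<not> m \<ge> 1"
  then have "degree S = n" using degS by (simp add: m_def)
  then have "g1 = 0" using deg_g1 deg_num n(3) S \<open>degree S = n\<close> n(2) g1 by (cases "s = 0") auto
  have "w * (w + ev h1) = w * w + ev h1 * w" by (simp add: algebra_simps)
  also have "\<dots> = 0" unfolding w.W_eq \<open>g1 = 0\<close> by simp
  finally have "ev 0 + ev 1 * w = 0 \<or> ev h1 + ev 1 * w = 0" by (simp add: add.commute)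
  then show False using w.indep one_neq_zero by blast
 qed
 have "degree g1 < 2 * m" using deg_g1 deg_num m1 degS n(3) deg_h1 by (auto simp: m_def)
 moreover have "degree h1 = m" using deg_h1 by (simp add: m_def)
 moreover have "w.smooth_at r om" if o: "w.on_curve r om" for r om
 proof (rule ccontr)
  assume neg: "\<not> w.smooth_at r om"
  let ?l = "[:-r, 1:]"
  have 1: "2 * om + poly h1 r = 0" and 2: "?l ^ 2 dvd [:om * om:] + smult om h1 + g1" using neg by (auto simp: w.smooth_at_def)
  have "poly (h1 + [:2 * om:]) r = 0" using 1 by (simp add: add.commute)
  then have l1: "?l dvd h1 + [:2 * om:]" by (simp only: poly_eq_0_iff_dvd)
  \<comment> \<open>Translating the singular point to \<open>w = 0\<close> means replacing
    \<open>s\<close> by \<open>s + smult om S\<close>.\<close>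
  have e1: "h + 2 * (s + smult om S) = S * (h1 + [:2 * om:])" by (simp add: distrib_left flip: h1) (simp add: algebra_simps numeral_poly)
  have e2: "(s + smult om S) ^ 2 + h * (s + smult om S) + g = S ^ 2 * ([:om * om:] + smult om h1 + g1)"
  proof -
   have "(s + smult om S) ^ 2 + h * (s + smult om S) + g = (s ^ 2 + h * s + g) + smult om (S * (h + 2 * s)) + smult (om * om) (S ^ 2)"
    by (simp add: algebra_simps power2_eq_square numeral_poly smult_add_right mult_2 flip: smult_add_left)
   then show ?thesis unfolding h1 g1 by (simp add: algebra_simps power2_eq_square)
  qed
  have nz: "S * ?l ~= 0" using S by (metis mult_eq_0_iff pCons_eq_0_iff one_neq_zero)
  have "conductor h g (S * ?l) (s + smult om S)" unfolding conductor_def power_mult_distrib e1 e2 by (intro conjI nz mult_dvd_mono dvd_refl l1 2)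
  then have "degree (S * ?l) \<le> degree S" by (rule max)
  moreover have "degree (S * ?l) = degree S + degree ?l" by (rule degree_mult_eq) (use S in auto)
  ultimately show False by simp
 qed
 ultimately interpret w: complete_curve kp xi w h1 g1 m using m1 by unfold_locales auto
 have "has_genus (subfield_record ff) (range kp) (m - 1)" using w.genus_complete_curve by (simp add: ff_eq)
 then show ?thesis using c max m1 by (intro exI[of _ S] exI[of _ s]) (auto simp: m_def)
qed

end

section \<open>Evaluation of forms, projective space and its Zariski topology\<close>

text \<open>One linear extension serves both forms, whose exponents are finitely supported
  functions, and Laurent polynomials, whose exponents are pairs of integers, as well as the maps
  between them.\<close>

definition plin :: "('a => 'r::comm_ring_1) => ('m => 'r) => ('m \<Rightarrow>\<^sub>0 'a::comm_ring_1) => 'r" where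
 "plin kp fi F = (\<Sum>u\<in>pkeys F. kp (plookup F u) * fi u)"

definition mval :: "('v => 'r::comm_ring_1) => ('v \<Rightarrow>\<^sub>0 nat) => 'r" where
 "mval z u = (\<Prod>v\<in>pkeys u. z v ^ plookup u v)"

definition crhom :: "('a::comm_ring_1 => 'r::comm_ring_1) => bool" where
 "crhom kp \<longleftrightarrow> (\<forall>a b. kp (a + b) = kp a + kp b & kp (a * b) = kp a * kp b) & kp 1 = 1"

lemma crhomD:
 assumes "crhom kp" shows "kp (a + b) = kp a + kp b" "kp (a * b) = kp a * kp b" "kp 1 = 1" "kp 0 = 0"
proof -
 show a: "kp (a + b) = kp a + kp b" for a b using assms by (auto simp: crhom_def)
 show "kp 0 = 0" using a[of 0 0] by (metis add_cancel_right_right add_0)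
qed (use assms in \<open>auto simp: crhom_def\<close>)

lemma crhom_id: "crhom id" by (simp add: crhom_def)

lemma crhom_sum: "crhom ps ==> ps (sum f I) = (\<Sum>i\<in>I. ps (f i))" by (induction I rule: infinite_finite_induct) (auto simp: crhomD)

lemma crhom_prod: "crhom ps ==> ps (prod f I) = (\<Prod>i\<in>I. ps (f i))" by (induction I rule: infinite_finite_induct) (auto simp: crhomD)

lemma crhom_power: "crhom ps ==> ps (x ^ n) = ps x ^ n" by (induction n) (auto simp: crhomD)

lemma plin_superset:
 assumes "crhom kp" "finite S" "pkeys F <= S" shows "plin kp fi F = (\<Sum>u\<in>S. kp (plookup F u) * fi u)" unfolding plin_def using assms
 by (intro sum.mono_neutral_left) (auto simp: not_in_keys_iff_lookup_eq_zero crhomD)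

lemma plin_add: "crhom kp ==> plin kp fi (F + G) = plin kp fi F + plin kp fi G"
proof -
 assume k: "crhom kp"
 define S where "S = pkeys F \<union> pkeys G"
 have S: "finite S" "pkeys F <= S" "pkeys G <= S" "pkeys (F + G) <= S" using Poly_Mapping.keys_add[of F G] by (auto simp: S_def)
 show ?thesis unfolding plin_superset[OF k S(1,2)] plin_superset[OF k S(1,3)] plin_superset[OF k S(1,4)]
  by (simp add: lookup_add crhomD[OF k] distrib_right sum.distrib)
qed

lemma plin_single: "crhom kp ==> plin kp fi (psingle u c) = kp c * fi u" by (cases "c = 0") (auto simp: plin_def crhomD)

lemma plin_0: "plin kp fi 0 = 0" by (simp add: plin_def)

lemma plin_sum: "crhom kp ==> plin kp fi (sum f I) = (\<Sum>i\<in>I. plin kp fi (f i))"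
 by (induction I rule: infinite_finite_induct) (auto simp: plin_add plin_0)

lemma poly_mapping_sum_single: "F = (\<Sum>u\<in>pkeys F. psingle u (plookup F u))"
 by (rule poly_mapping_eqI) (simp add: lookup_sum lookup_single when_def not_in_keys_iff_lookup_eq_zero)

lemma plin_mult:
 assumes k: "crhom kp" and m: "!!u v. fi (u + v) = fi u * fi v" shows "plin kp fi (F * G) = plin kp fi F * plin kp fi G"
proof -
 let ?s = "%F u. psingle u (plookup F u)"
 have "F * G = (\<Sum>u\<in>pkeys F. ?s F u) * (\<Sum>v\<in>pkeys G. ?s G v)"
  by (subst poly_mapping_sum_single[of F], subst poly_mapping_sum_single[of G]) (rule refl)
 also have "\<dots> = (\<Sum>u\<in>pkeys F. \<Sum>v\<in>pkeys G. ?s F u * ?s G v)" by (rule sum_product)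
 finally have "plin kp fi (F * G) = (\<Sum>u\<in>pkeys F. \<Sum>v\<in>pkeys G. (kp (plookup F u) * fi u) * (kp (plookup G v) * fi v))"
  by (simp add: plin_sum[OF k] mult_single plin_single[OF k] crhomD[OF k] m mult_ac)
 also have "\<dots> = plin kp fi F * plin kp fi G" unfolding plin_def by (rule sum_product[symmetric])
 finally show ?thesis .
qed

lemma plin_hom:
 assumes "crhom ps" shows "ps (plin kp fi F) = plin (ps \<circ> kp) (ps \<circ> fi) F" by (simp add: plin_def crhom_sum[OF assms] crhomD[OF assms])

lemma mval_superset:
 assumes "finite S" "pkeys u <= S" shows "mval z u = (\<Prod>v\<in>S. z v ^ plookup u v)" unfolding mval_def using assms
 by (intro prod.mono_neutral_left) (auto simp: not_in_keys_iff_lookup_eq_zero)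

lemma mval_add: "mval z (u + v) = mval z u * mval z v"
proof -
 define S where "S = pkeys u \<union> pkeys v"
 have S: "finite S" "pkeys u <= S" "pkeys v <= S" "pkeys (u + v) <= S" using Poly_Mapping.keys_add[of u v] by (auto simp: S_def)
 show ?thesis unfolding mval_superset[OF S(1,2)] mval_superset[OF S(1,3)] mval_superset[OF S(1,4)] by (simp add: lookup_add power_add prod.distrib)
qed

lemma mval_0: "mval z 0 = 1" by (simp add: mval_def)

lemma mval_single: "mval z (psingle v n) = z v ^ n" by (cases "n = 0") (auto simp: mval_def)

lemma mval_hom: "crhom ps ==> ps (mval z u) = mval (%v. ps (z v)) u" by (simp add: mval_def crhom_prod crhom_power)

lemma mpoly_eval_plin: "mpoly_eval F z = plin id (mval z) F" by (simp add: mpoly_eval_def plin_def mval_def)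

lemma mpoly_eval_add: "mpoly_eval (F + G) z = mpoly_eval F z + mpoly_eval G z"
 and mpoly_eval_mult: "mpoly_eval (F * G) z = mpoly_eval F z * mpoly_eval G z" and mpoly_eval_single: "mpoly_eval (psingle u c) z = c * mval z u"
 and mpoly_eval_sum: "mpoly_eval (sum f I) z = (\<Sum>i\<in>I. mpoly_eval (f i) z)"
 by (simp_all add: mpoly_eval_plin plin_add plin_mult plin_single plin_sum crhom_id mval_add)

definition wt :: "('v \<Rightarrow>\<^sub>0 nat) => nat" where
 "wt u = (\<Sum>v\<in>pkeys u. plookup u v)"

lemma wt_add: "wt (u + v) = wt u + wt v"
proof -
 define S where "S = pkeys u \<union> pkeys v"
 have S: "finite S" "pkeys (u + v) <= S" using Poly_Mapping.keys_add[of u v] by (auto simp: S_def)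
 have *: "wt w = (\<Sum>v\<in>S. plookup w v)" if "pkeys w <= S" for w unfolding wt_def using S(1) that
  by (intro sum.mono_neutral_left) (auto simp: not_in_keys_iff_lookup_eq_zero)
 show ?thesis using *[OF S(2)] *[of u] *[of v] by (auto simp: S_def lookup_add sum.distrib)
qed

lemma wt_single: "wt (psingle v n) = n" by (cases "n = 0") (auto simp: wt_def)

lemma homogeneous_iff: "homogeneous d F \<longleftrightarrow> (\<forall>u\<in>pkeys F. wt u = d)" by (simp add: homogeneous_def wt_def)

lemma homogeneous_add: "homogeneous d F ==> homogeneous d G ==> homogeneous d (F + G)"
 unfolding homogeneous_iff using Poly_Mapping.keys_add[of F G] by blast

lemma homogeneous_sum: "(!!i. i \<in> I ==> homogeneous d (f i)) ==> homogeneous d (sum f I)"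
 by (induction I rule: infinite_finite_induct) (auto simp: homogeneous_add, auto simp: homogeneous_iff)

lemma homogeneous_mult: "homogeneous d F ==> homogeneous e G ==> homogeneous (d + e) (F * G)"
 unfolding homogeneous_iff using Poly_Mapping.keys_mult[of F G] by (fastforce simp: wt_add)

lemma homogeneous_single: "wt u = d ==> homogeneous d (psingle u c)" by (auto simp: homogeneous_iff)

abbreviation mvar :: "'v => nat => ('v, 'a::field) mpoly" where
 "mvar v n \<equiv> psingle (psingle v n) 1"

lemma homogeneous_mvar: "homogeneous n (mvar v n)" by (rule homogeneous_single) (rule wt_single)

lemma mpoly_eval_mvar: "mpoly_eval (mvar v n) z = z v ^ n" by (simp add: mpoly_eval_single mval_single)

definition mconst :: "'a::field => ('v, 'a) mpoly" where "mconst c = psingle 0 c"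

lemma homogeneous_mconst: "homogeneous 0 (mconst c)" unfolding mconst_def by (rule homogeneous_single) (simp add: wt_def)

lemma mpoly_eval_mconst: "mpoly_eval (mconst c) z = c" by (simp add: mpoly_eval_single mval_0 mconst_def)

lemma homogeneous_smult: "homogeneous d F ==> homogeneous d (mconst c * F)" using homogeneous_mult[OF homogeneous_mconst] by force

lemma mval_scale: "mval (%v. c * z v) u = c ^ wt u * mval z u" by (simp add: mval_def wt_def power_mult_distrib prod.distrib power_sum)

lemma mpoly_eval_scale: "homogeneous d F ==> mpoly_eval F (%v. c * z v) = c ^ d * mpoly_eval F z" unfolding mpoly_eval_plin plin_def sum_distrib_left
proof (intro sum.cong refl)
 fix u assume "homogeneous d F" "u \<in> pkeys F"
 then have "wt u = d" by (simp add: homogeneous_iff)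
 then show "id (plookup F u) * mval (%v. c * z v) u = c ^ d * (id (plookup F u) * mval z u)" by (simp add: mval_scale)
qed

lemma vanishes_at_iff:
 assumes "homogeneous d F" shows "vanishes_at F (proj_point z) \<longleftrightarrow> mpoly_eval F z = 0"
proof
 assume "vanishes_at F (proj_point z)"
 moreover have "z \<in> proj_point z" unfolding proj_point_def by (intro CollectI exI[of _ 1]) auto
 ultimately show "mpoly_eval F z = 0" by (simp add: vanishes_at_def)
qed (auto simp: vanishes_at_def proj_point_def mpoly_eval_scale[OF assms])

lemma proj_point_self: "z \<in> proj_point z" unfolding proj_point_def by (intro CollectI exI[of _ 1]) auto

lemma proj_point_scale: "c ~= 0 ==> proj_point (%v. c * z v) = proj_point z"
proof -
 assume c: "c ~= 0"
 show ?thesis unfolding proj_point_def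
 proof (intro equalityI subsetI)
  fix w assume "w \<in> {(%v. ca * (c * z v)) |ca. ca ~= 0}"
  then obtain d where "d ~= 0" "w = (%v. d * (c * z v))" by blast
  then show "w \<in> {(%v. c * z v) |c. c ~= 0}" using c by (intro CollectI exI[of _ "d * c"]) auto
 next
  fix w assume "w \<in> {(%v. c * z v) |c. c ~= 0}"
  then obtain d where "d ~= 0" "w = (%v. d * z v)" by blast
  then show "w \<in> {(%v. ca * (c * z v)) |ca. ca ~= 0}" using c by (intro CollectI exI[of _ "d / c"]) auto
 qed
qed

lemma proj_point_mem: "w \<in> proj_point z ==> proj_point w = proj_point z"
proof -
 assume "w \<in> proj_point z"
 then obtain c where "c ~= 0" "w = (%v. c * z v)" by (auto simp: proj_point_def)
 then show ?thesis using proj_point_scale by simp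
qed

lemma proj_spaceE:
 assumes "q \<in> proj_space A"
 obtains z where "q = proj_point z" "!!v. v \<notin> A ==> z v = 0" "\<exists>v. z v ~= 0" using assms by (auto simp: proj_space_def)

lemma proj_point_in_space: "(!!v. v \<notin> A ==> z v = 0) ==> z v ~= 0 ==> proj_point z \<in> proj_space A" by (auto simp: proj_space_def)

lemma vanishes_at_mult:
 assumes "q \<in> proj_space A" "homogeneous d F" "homogeneous e G"
 shows "vanishes_at (F * G) q \<longleftrightarrow> vanishes_at F q \<or> vanishes_at G q"
proof -
 obtain z where "q = proj_point z" using assms(1) by (rule proj_spaceE)
 then show ?thesis using vanishes_at_iff[OF assms(2)] vanishes_at_iff[OF assms(3)] vanishes_at_iff[OF homogeneous_mult[OF assms(2,3)]]
  by (simp add: mpoly_eval_mult)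
qed

lemma not_vanishes_1: "q \<in> proj_space A ==> \<not> vanishes_at (mconst 1) q"
 using vanishes_at_iff[OF homogeneous_mconst] mpoly_eval_mconst by (metis proj_spaceE one_neq_zero)

text \<open>Products of forms make the nonvanishing sets stable under intersection, so the
  generating family is a basis.\<close>

lemma zariski_open_basis:
 assumes "openin (zariski A) U" "q \<in> U"
 shows "q \<in> proj_space A & (\<exists>F d. homogeneous d F & \<not> vanishes_at F q & {q \<in> proj_space A. \<not> vanishes_at F q} <= U)"
proof -
 have "generate_topology_on {{q \<in> proj_space A. \<not> vanishes_at F q} | F d. homogeneous d F} U"
  using assms(1) unfolding zariski_def openin_topology_generated_by_iff .
 then show ?thesis using assms(2)
 proof induction
  case (Int a b)
  then obtain F d G e where F: "homogeneous d F" "\<not> vanishes_at F q" "{q \<in> proj_space A. \<not> vanishes_at F q} <= a"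
   and G: "homogeneous e G" "\<not> vanishes_at G q" "{q \<in> proj_space A. \<not> vanishes_at G q} <= b" and q: "q \<in> proj_space A" by auto
  have "{q \<in> proj_space A. \<not> vanishes_at (F * G) q} <= a \<inter> b" using vanishes_at_mult[OF _ F(1) G(1)] F(3) G(3) by auto
  then show ?case using q vanishes_at_mult[OF q F(1) G(1)] F G homogeneous_mult[OF F(1) G(1)] by blast
 next
  case (UN K)
  then show ?case by blast
 next
  case (Basis s)
  then show ?case by blast
 qed simp
qed

lemma openin_zariski: "homogeneous d F ==> openin (zariski A) {q \<in> proj_space A. \<not> vanishes_at F q}"
 unfolding zariski_def by (intro topology_generated_by_Basis) blast

lemma topspace_zariski: "topspace (zariski A :: ('v, 'a::field) ppoint topology) = proj_space A"
proof
 show "topspace (zariski A :: ('v, 'a) ppoint topology) <= proj_space A" using zariski_open_basis[OF openin_topspace] by blast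
 have "{q \<in> proj_space A. \<not> vanishes_at (mconst 1 :: ('v, 'a) mpoly) q} = proj_space A" using not_vanishes_1 by blast
 then show "proj_space A <= topspace (zariski A :: ('v, 'a) ppoint topology)" using openin_subset[OF openin_zariski[OF homogeneous_mconst]] by metis
qed

lemma closedin_zariski: "homogeneous d F ==> closedin (zariski A) {q \<in> proj_space A. vanishes_at F q}" unfolding closedin_def topspace_zariski
proof
 assume "homogeneous d F"
 moreover have "proj_space A - {q \<in> proj_space A. vanishes_at F q} = {q \<in> proj_space A. \<not> vanishes_at F q}" by blast
 ultimately show "openin (zariski A) (proj_space A - {q \<in> proj_space A. vanishes_at F q})" using openin_zariski by metis
qed blast

lemma closedin_separating:
 assumes "closedin (zariski A) C" "q \<in> proj_space A" "q \<notin> C"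
 shows "\<exists>F d. homogeneous d F & \<not> vanishes_at F q & (\<forall>c\<in>C. vanishes_at F c)"
proof -
 have C: "C <= proj_space A" and "openin (zariski A) (proj_space A - C)" using assms(1) by (auto simp: closedin_def topspace_zariski)
 then obtain F d where "homogeneous d F" "\<not> vanishes_at F q" "{q \<in> proj_space A. \<not> vanishes_at F q} <= proj_space A - C"
  using zariski_open_basis[of A "proj_space A - C" q] assms by blast
 then show ?thesis using C by blast
qed

lemma zariski_closure_iff:
 assumes "W <= proj_space A" shows "q \<in> zariski A closure_of W \<longleftrightarrow> q \<in> proj_space A &
  (\<forall>F d. homogeneous d F --> (\<forall>w\<in>W. vanishes_at F w) --> vanishes_at F q)" proof (intro iffI conjI allI impI)
 assume q: "q \<in> zariski A closure_of W"
 then show "q \<in> proj_space A" using closure_of_subset_topspace[of "zariski A" W] topspace_zariski by blast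
 fix F d assume F: "homogeneous d F" "\<forall>w\<in>W. vanishes_at F w"
 then have "zariski A closure_of W <= {q \<in> proj_space A. vanishes_at F q}" using assms by (intro closure_of_minimal closedin_zariski) auto
 then show "vanishes_at F q" using q by blast
next
 assume q: "q \<in> proj_space A & (\<forall>F d. homogeneous d F --> (\<forall>w\<in>W. vanishes_at F w) --> vanishes_at F q)"
 show "q \<in> zariski A closure_of W"
 proof (rule ccontr)
  assume "q \<notin> zariski A closure_of W"
  then obtain F d where "homogeneous d F" "\<not> vanishes_at F q" "\<forall>c\<in>zariski A closure_of W. vanishes_at F c"
   using closedin_separating[OF closedin_closure_of, of q A W] q by blast
  then show False using q closure_of_subset[of W "zariski A"] assms topspace_zariski by blast
 qed
qed

text \<open>Zorn's lemma. The union of a chain of irreducible sets is irreducible: one member not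
  contained in \<open>C2\<close> forces all members, smaller or larger, into
  \<open>C1\<close>.\<close>

lemma ex_irreducible_component:
 assumes "irreducible_in \<X> S" "S <= Z" shows "\<exists>V. S <= V & irreducible_component \<X> Z V"
proof -
 define \<A> where "\<A> = {T. S <= T & T <= Z & irreducible_in \<X> T}"
 have "\<exists>M\<in>\<A>. \<forall>T\<in>\<A>. M <= T --> T = M"
 proof (rule subset_Zorn_nonempty)
  show "\<A> ~= {}" using assms by (auto simp: \<A>_def)
  fix \<C> assume C: "\<C> ~= {}" "subset.chain \<A> \<C>"
  then have CA: "\<C> <= \<A>" and lin: "!!T U. T \<in> \<C> ==> U \<in> \<C> ==> T <= U \<or> U <= T" by (auto simp: subset.chain_def)
  have "irreducible_in \<X> (\<Union>\<C>)" unfolding irreducible_in_def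
  proof (intro conjI allI impI)
   obtain T where "T \<in> \<C>" using C by blast
   moreover from this have "T ~= {}" using CA by (auto simp: \<A>_def irreducible_in_def)
   ultimately show "\<Union>\<C> ~= {}" by blast
   have "T <= topspace \<X>" if "T \<in> \<C>" for T using CA that by (auto simp: \<A>_def irreducible_in_def)
   then show "\<Union>\<C> <= topspace \<X>" by blast
   fix C1 C2 assume cl: "closedin \<X> C1 & closedin \<X> C2 & \<Union>\<C> <= C1 \<union> C2"
   have each: "T <= C1 \<or> T <= C2" if "T \<in> \<C>" for T using that CA cl unfolding \<A>_def irreducible_in_def by blast
   show "\<Union>\<C> <= C1 \<or> \<Union>\<C> <= C2"
   proof (rule disjCI)
    assume "\<not> \<Union>\<C> <= C2"
    then obtain T0 where T0: "T0 \<in> \<C>" "\<not> T0 <= C2" by blast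
    have "T <= C1" if "T \<in> \<C>" for T using lin[OF that T0(1)] each[OF that] each[OF T0(1)] T0(2) by blast
    then show "\<Union>\<C> <= C1" by blast
   qed
  qed
  moreover have "T <= Z" "S <= T" if "T \<in> \<C>" for T using CA that by (auto simp: \<A>_def)
  ultimately show "\<Union>\<C> \<in> \<A>" unfolding \<A>_def using C(1) by blast
 qed
 then obtain M where M: "M \<in> \<A>" "!!T. T \<in> \<A> ==> M <= T ==> T = M" by blast
 then have "irreducible_component \<X> Z M" unfolding irreducible_component_def \<A>_def by auto
 then show ?thesis using M by (auto simp: \<A>_def)
qed

text \<open>A component through \<open>c\<close> is irreducible, hence contained in
  \<open>C1\<close> or in \<open>C2\<close>, and \<open>c\<close> rules out
  \<open>C1\<close>.\<close>

lemma component_avoiding: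
 assumes S: "S <= topspace \<X>" "S <= C1 \<union> C2" and cl: "closedin \<X> C1" "closedin \<X> C2"
  and c: "c \<in> S" "c \<notin> C1" and "C2 \<inter> T = {}"
 shows "\<exists>V. irreducible_component \<X> (\<X> closure_of S) V & V \<inter> T = {}"
proof -
 have "irreducible_in \<X> {c}" using c S by (auto simp: irreducible_in_def)
 moreover have "{c} <= \<X> closure_of S" using c closure_of_subset[OF S(1)] by auto
 ultimately obtain V where V: "c \<in> V" "irreducible_component \<X> (\<X> closure_of S) V" using ex_irreducible_component[of \<X> "{c}"] by blast
 have "\<X> closure_of S <= C1 \<union> C2" by (intro closure_of_minimal S closedin_Un cl)
 then have "V <= C1 \<or> V <= C2" using V cl unfolding irreducible_component_def irreducible_in_def by (metis order_trans)
 then have "V <= C2" using V c by blast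
 then show ?thesis using V assms by blast
qed

section \<open>Extension of homomorphisms along integral elements\<close>

locale algebra_hom =
 fixes kp :: "'a::alg_closed_field => 'r::comm_ring_1"
 assumes kp_add: "kp (a + b) = kp a + kp b" and kp_mult: "kp (a * b) = kp a * kp b" and kp_1: "kp 1 = 1"
begin

lemma kp_0: "kp 0 = 0" using kp_add[of 0 0] by (metis add_cancel_right_right add_0)

lemma kp_uminus: "kp (- a) = - kp a" using kp_add[of a "- a"] kp_0 by (simp add: minus_unique)

definition subalg :: "'r set => bool" where
 "subalg A \<longleftrightarrow> range kp <= A & (\<forall>x\<in>A. \<forall>y\<in>A. x + y \<in> A & x * y \<in> A)"

text \<open>A homomorphism to the constants on a subset only, so that domain and map can grow
  together inside one ambient ring.\<close>

definition hom_on :: "'r set => ('r => 'a) => bool" where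
 "hom_on A e \<longleftrightarrow> (\<forall>c. e (kp c) = c) & (\<forall>x\<in>A. \<forall>y\<in>A. e (x + y) = e x + e y & e (x * y) = e x * e y)"

definition integral_over :: "'r set => 'r => bool" where
 "integral_over A t \<longleftrightarrow> (\<exists>p. lead_coeff p = 1 & (\<forall>i. coeff p i \<in> A) & poly p t = 0)"

lemma subalgD:
 assumes "subalg A"
 shows "kp c \<in> A" "0 \<in> A" "1 \<in> A" "x \<in> A ==> y \<in> A ==> x + y \<in> A" "x \<in> A ==> y \<in> A ==> x * y \<in> A"
  "x \<in> A ==> - x \<in> A" "x \<in> A ==> y \<in> A ==> x - y \<in> A"
proof -
 show k: "kp c \<in> A" for c using assms by (auto simp: subalg_def)
 show "0 \<in> A" "1 \<in> A" using k[of 0] k[of 1] by (simp_all add: kp_0 kp_1)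
 show a: "x \<in> A ==> y \<in> A ==> x + y \<in> A" and m: "x \<in> A ==> y \<in> A ==> x * y \<in> A" for x y
  using assms by (auto simp: subalg_def)
 show u: "x \<in> A ==> - x \<in> A" for x using m[of "kp (-1)" x] k[of "-1"] by (simp add: kp_uminus kp_1)
 show "x \<in> A ==> y \<in> A ==> x - y \<in> A" for x y using a[OF _ u, of x y] by simp
qed

lemma subalg_sum: "subalg A ==> (!!i. i \<in> I ==> f i \<in> A) ==> sum f I \<in> A"
 by (induction I rule: infinite_finite_induct) (auto intro: subalgD)

lemma hom_onD:
 assumes "subalg A" "hom_on A e" shows "e (kp c) = c" "e 0 = 0" "e 1 = 1" "x \<in> A ==> y \<in> A ==> e (x + y) = e x + e y"
  "x \<in> A ==> y \<in> A ==> e (x * y) = e x * e y" "x \<in> A ==> e (- x) = - e x"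
  "x \<in> A ==> y \<in> A ==> e (x - y) = e x - e y"
proof -
 note d = subalgD[OF assms(1)]
 show k: "e (kp c) = c" for c using assms by (auto simp: hom_on_def)
 show "e 0 = 0" "e 1 = 1" using k[of 0] k[of 1] by (simp_all add: kp_0 kp_1)
 show a: "x \<in> A ==> y \<in> A ==> e (x + y) = e x + e y" and m: "x \<in> A ==> y \<in> A ==> e (x * y) = e x * e y" for x y
  using assms by (auto simp: hom_on_def)
 show u: "x \<in> A ==> e (- x) = - e x" for x using m[of "kp (-1)" x] k[of "-1"] d(1)[of "-1"] by (simp add: kp_uminus kp_1)
 show "x \<in> A ==> y \<in> A ==> e (x - y) = e x - e y" for x y using a[OF _ d(6), of x y] u by simp
qed

lemma hom_sum: "subalg A ==> hom_on A e ==> (!!i. i \<in> I ==> f i \<in> A) ==> e (sum f I) = (\<Sum>i\<in>I. e (f i))"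
 by (induction I rule: infinite_finite_induct) (auto simp: hom_onD subalg_sum)

text \<open>The determinant trick, carried out by eliminating the last generator repeatedly until
  only \<open>v 0\<close> is left; \<open>u\<close>, with \<open>e u = 1\<close>, collects the
  factors that would otherwise be inverted.\<close>

lemma nakayama:
 assumes A: "subalg A" and e: "hom_on A e" shows "u \<in> A ==> e u = 1 ==> (!!i j. c i j \<in> A & e (c i j) = 0) ==>
  (!!j. j < Suc n ==> u * v j = (\<Sum>i<Suc n. c j i * v i)) ==> \<exists>w\<in>A. e w = 1 & w * v 0 = 0" proof (induction n arbitrary: u c) case 0
 then have "(u - c 0 0) * v 0 = 0" by (simp add: left_diff_distrib)
 moreover have "u - c 0 0 \<in> A" "e (u - c 0 0) = 1" using 0 subalgD[OF A] hom_onD[OF A e] by auto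
 ultimately show ?case by blast
next
 case (Suc n)
 note d = subalgD[OF A] and h = hom_onD[OF A e]
 let ?m = "Suc n"
 define u' where "u' = u - c ?m ?m"
 define c' where "c' j i = u' * c j i + c j ?m * c ?m i" for j i
 have u': "u' \<in> A" "e u' = 1" using Suc.prems d h by (auto simp: u'_def)
 have vm: "u' * v ?m = (\<Sum>i<Suc n. c ?m i * v i)" using Suc.prems(4)[of ?m] by (simp add: u'_def algebra_simps)
 have "u' * u * v j = (\<Sum>i<Suc n. c' j i * v i)" if j: "j < Suc n" for j
 proof -
  have "u' * u * v j = u' * (\<Sum>i<Suc n. c j i * v i) + c j ?m * (u' * v ?m)"
   using Suc.prems(4)[of j] j by (simp add: mult.assoc distrib_left mult.left_commute)
  also have "\<dots> = (\<Sum>i<Suc n. c' j i * v i)" unfolding vm sum_distrib_left sum.distrib[symmetric] c'_def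
   by (intro sum.cong refl) (simp add: algebra_simps)
  finally show ?thesis .
 qed
 moreover have "c' i j \<in> A & e (c' i j) = 0" for i j using Suc.prems(3) u' d h by (simp add: c'_def)
 moreover have "u' * u \<in> A" "e (u' * u) = 1" using u' Suc.prems d h by auto
 ultimately show ?case using Suc.IH[of "u' * u" c'] by blast
qed

lemma span_powers:
 assumes A: "subalg A" and f: "lead_coeff f = 1" "!!i. coeff f i \<in> A" "poly f t = 0" "degree f = Suc n"
 shows "\<exists>a. (\<forall>i. a i \<in> A) & t ^ N = (\<Sum>i<Suc n. a i * t ^ i)"
proof (induction N)
 note d = subalgD[OF A]
 case 0
 show ?case
 proof -
  have "(\<Sum>i<Suc n. (if i = 0 then 1 else 0) * t ^ i) = (\<Sum>i\<in>{0::nat}. 1)" by (rule sum.mono_neutral_cong_right) auto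
  then show ?thesis using d by (intro exI[of _ "%i. if i = 0 then 1 else 0"]) auto
 qed
next
 note d = subalgD[OF A]
 case (Suc N)
 then obtain a where a: "!!i. a i \<in> A" "t ^ N = (\<Sum>i<Suc n. a i * t ^ i)" by blast
 have pf: "poly f t = (\<Sum>i<Suc n. coeff f i * t ^ i) + t ^ Suc n"
  unfolding poly_altdef f(4) using f(1,4) by (simp add: lessThan_Suc_atMost[symmetric])
 have "t ^ Suc n = - (\<Sum>i<Suc n. coeff f i * t ^ i)" using f(3) pf by (metis add_eq_0_iff)
 then have tn: "t ^ Suc n = (\<Sum>i<Suc n. - coeff f i * t ^ i)" by (simp only: mult_minus_left sum_negf)
 define b where "b i = (if i = 0 then 0 else a (i - 1)) - a n * coeff f i" for i
 have "t ^ Suc N = (\<Sum>i<Suc n. a i * t ^ Suc i)" using a(2) by (simp add: sum_distrib_left algebra_simps)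
 also have "\<dots> = (\<Sum>i<n. a i * t ^ Suc i) + a n * t ^ Suc n" by simp
 also have "(\<Sum>i<n. a i * t ^ Suc i) = (\<Sum>i<Suc n. (if i = 0 then 0 else a (i - 1)) * t ^ i)" by (subst sum.lessThan_Suc_shift) simp
 also have "\<dots> + a n * t ^ Suc n = (\<Sum>i<Suc n. b i * t ^ i)" unfolding tn sum_distrib_left sum.distrib[symmetric] b_def
  by (intro sum.cong refl) (simp add: algebra_simps)
 finally show ?case using a f(2) d by (intro exI[of _ b]) (auto simp: b_def)
qed

text \<open>Lying over: the kernel of \<open>e\<close> does not generate the unit ideal of
  \<open>A[t]\<close>. A relation \<open>q\<close> as in the hypotheses would express each power of
  \<open>t\<close> through finitely many powers with coefficients in this kernel, and
  \<open>nakayama\<close> would give \<open>w = 0\<close> with \<open>e w = 1\<close>.\<close>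

lemma no_unit_relation:
 assumes A: "subalg A" and e: "hom_on A e" and f: "lead_coeff f = 1" "!!i. coeff f i \<in> A" "poly f t = 0"
  and q: "!!i. coeff q i \<in> A" "poly q t = 0" "e (coeff q 0) = 1" "!!i. i > 0 ==> e (coeff q i) = 0" shows False
proof -
 note d = subalgD[OF A] and h = hom_onD[OF A e]
 obtain n where n: "degree f = Suc n"
 proof (cases "degree f")
  case 0
  then have "f = [:1:]" using f(1) by (metis degree_eq_zeroE lead_coeff_pCons(2) coeff_pCons_0)
  then have "(1::'r) = 0" using f(3) by simp
  then show ?thesis using h by (metis zero_neq_one)
 qed blast
 define q' where "q' i = coeff q i - (if i = 0 then 1 else 0)" for i
 have q': "q' i \<in> A" "e (q' i) = 0" for i using q d h by (auto simp: q'_def)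
 have "poly q t = (\<Sum>k\<le>degree q. q' k * t ^ k + (if k = 0 then 1 else 0) * t ^ k)"
  unfolding poly_altdef by (intro sum.cong refl) (simp add: q'_def algebra_simps)
 also have "\<dots> = (\<Sum>k\<le>degree q. q' k * t ^ k) + 1" by (simp add: sum.distrib if_distrib[of "%x. x * _"] sum.delta cong: if_cong)
 finally have one: "1 = (\<Sum>k\<le>degree q. - q' k * t ^ k)" using q(2) by (simp add: sum_negf eq_neg_iff_add_eq_0 add.commute)
 obtain a where a: "!!N i. a N i \<in> A" "!!N. t ^ N = (\<Sum>i<Suc n. a N i * t ^ i)" using span_powers[OF A f n] by metis
 define c where "c j i = (\<Sum>k\<le>degree q. - q' k * a (j + k) i)" for j i
 have c: "c j i \<in> A & e (c j i) = 0" for j i unfolding c_def using q' a(1) d h by (auto intro!: subalg_sum[OF A] simp: hom_sum[OF A e])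
 have rel: "1 * t ^ j = (\<Sum>i<Suc n. c j i * t ^ i)" for j
 proof -
  have "1 * t ^ j = (\<Sum>k\<le>degree q. - q' k * t ^ k) * t ^ j" by (simp only: one[symmetric])
  also have "\<dots> = (\<Sum>k\<le>degree q. - q' k * t ^ (j + k))"
   unfolding sum_distrib_right by (intro sum.cong refl) (simp add: power_add algebra_simps)
  also have "\<dots> = (\<Sum>k\<le>degree q. \<Sum>i<Suc n. - q' k * a (j + k) i * t ^ i)" by (subst a(2)) (simp only: sum_distrib_left mult.assoc)
  also have "\<dots> = (\<Sum>i<Suc n. c j i * t ^ i)" unfolding c_def sum_distrib_right by (rule sum.swap)
  finally show ?thesis .
 qed
 obtain w where "w \<in> A" "e w = 1" "w * t ^ 0 = 0" using nakayama[OF A e d(3) h(3) c rel] by blast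
 then show False using h by simp
qed

text \<open>The relations satisfied by \<open>t\<close> reduce under \<open>e\<close> to an ideal of
  polynomials over the constants. It is principal and, by \<open>no_unit_relation\<close>, proper,
  so its generator has a root, and this root is an admissible value for \<open>t\<close>.\<close>

lemma extend_hom:
 assumes A: "subalg A" and e: "hom_on A e" and t: "integral_over A t"
 shows "\<exists>A' e'. subalg A' & hom_on A' e' & A <= A' & t \<in> A' & (\<forall>a\<in>A. e' a = e a)"
proof -
 note d = subalgD[OF A] and h = hom_onD[OF A e]
 obtain f where f: "lead_coeff f = 1" "!!i. coeff f i \<in> A" "poly f t = 0" using t by (auto simp: integral_over_def)
 define AX where "AX = {p. \<forall>i. coeff p i \<in> A}"
 define E where "E p = map_poly e p" for p
 have coeff_E: "coeff (E p) i = e (coeff p i)" for p i unfolding E_def by (rule coeff_map_poly) (rule h(2))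
 have AX_add: "p + q \<in> AX" and E_add: "E (p + q) = E p + E q" if "p \<in> AX" "q \<in> AX" for p q
  using that d h by (auto simp: AX_def poly_eq_iff coeff_E)
 have AX_mult: "p * q \<in> AX" and E_mult: "E (p * q) = E p * E q" if "p \<in> AX" "q \<in> AX" for p q
 proof -
  have c: "coeff p i \<in> A" "coeff q i \<in> A" for i using that by (auto simp: AX_def)
  show "p * q \<in> AX" using c d by (auto simp: AX_def coeff_mult intro!: subalg_sum[OF A])
  show "E (p * q) = E p * E q" using c d by (simp add: poly_eq_iff coeff_E coeff_mult hom_sum[OF A e] h)
 qed
 define lift where "lift p = map_poly kp p" for p :: "'a poly"
 have coeff_lift: "coeff (lift p) i = kp (coeff p i)" for p i unfolding lift_def by (rule coeff_map_poly) (rule kp_0)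
 have lift: "lift p \<in> AX" "E (lift p) = p" for p using d h by (auto simp: AX_def poly_eq_iff coeff_E coeff_lift)
 define J where "J = {p \<in> AX. poly p t = 0}"
 have J_add: "p + q \<in> J" if "p \<in> J" "q \<in> J" for p q using that AX_add by (auto simp: J_def)
 have J_mult: "p * q \<in> J" if "p \<in> AX" "q \<in> J" for p q using that AX_mult by (auto simp: J_def)
 have fJ: "f \<in> J" using f by (auto simp: J_def AX_def)
 have "coeff (E f) (degree f) = 1" using f h by (simp add: coeff_E)
 then have Ef: "E f ~= 0" by auto
 obtain p0 where p0: "p0 \<in> J" "E p0 ~= 0" and min: "!!p. p \<in> J ==> E p ~= 0 ==> degree (E p0) \<le> degree (E p)"
  using ex_has_least_nat[of "%p. p \<in> J & E p ~= 0" f "%p. degree (E p)"] fJ Ef by blast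
 have div: "E p0 dvd E p" if "p \<in> J" for p
 proof -
  define r where "r = p + lift (- (E p div E p0)) * p0"
  have r: "r \<in> J" unfolding r_def using that p0 lift J_add J_mult by auto
  have "E r = E p + (- (E p div E p0)) * E p0" unfolding r_def using that p0 lift J_mult E_add E_mult AX_mult by (auto simp: J_def)
  also have "\<dots> = E p mod E p0" by (simp add: minus_div_mult_eq_mod[symmetric])
  finally have Er: "E r = E p mod E p0" .
  have "E r = 0"
  proof (rule ccontr)
   assume nz: "E r ~= 0"
   then have "degree (E r) < degree (E p0)" unfolding Er using p0(2) degree_mod_less' by metis
   then show False using min[OF r nz] by simp
  qed
  then show ?thesis using Er by (simp add: mod_eq_0_iff_dvd)
 qed
 have "degree (E p0) > 0"
 proof (rule ccontr)
  assume "\<not> degree (E p0) > 0"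
  then obtain c where c: "E p0 = [:c:]" "c ~= 0" using p0 by (metis degree_eq_zeroE neq0_conv pCons_0_0)
  define q where "q = lift [:inverse c:] * p0"
  have q: "q \<in> J" "E q = 1" using p0 lift J_mult c E_mult by (auto simp: q_def J_def one_pCons)
  then have "e (coeff q i) = (if i = 0 then 1 else 0)" for i by (auto simp: q(2) coeff_1 simp flip: coeff_E)
  then show False using no_unit_relation[OF A e f, of q] q by (auto simp: J_def AX_def)
 qed
 then obtain \<tau> where "poly (E p0) \<tau> = 0" using alg_closed_imp_poly_has_root by blast
 then have tau: "poly (E p) \<tau> = 0" if "p \<in> J" for p using div[OF that] by (auto elim!: dvdE)
 define A' where "A' = (%p. poly p t) ` AX"
 \<comment> \<open>Independent of the chosen polynomial: the difference of two choices lies in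
   \<open>J\<close>, and its reduction vanishes at the root.\<close>
 define e' where "e' x = poly (E (SOME p. p \<in> AX & poly p t = x)) \<tau>" for x
 have e': "e' (poly p t) = poly (E p) \<tau>" if p: "p \<in> AX" for p
 proof -
  define p' where "p' = (SOME p'. p' \<in> AX & poly p' t = poly p t)"
  have p': "p' \<in> AX & poly p' t = poly p t" unfolding p'_def by (rule someI[of _ p]) (use p in simp)
  have m: "lift [:-1:] * p \<in> AX" "poly (lift [:-1:] * p) t = - poly p t"
   using AX_mult[OF lift(1) p, of "[:-1:]"] by (simp_all add: lift_def map_poly_pCons kp_0 kp_uminus kp_1)
  have "p' + lift [:-1:] * p \<in> J" using p' m AX_add by (auto simp: J_def)
  then have "poly (E (p' + lift [:-1:] * p)) \<tau> = 0" by (rule tau)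
  then have "poly (E p') \<tau> - poly (E p) \<tau> = 0" using E_add[of p' "lift [:-1:] * p"] p' m E_mult[OF lift(1) p] lift by simp
  then show ?thesis unfolding e'_def p'_def by simp
 qed
 have const: "[:a:] \<in> AX" "E [:a:] = [:e a:]" if "a \<in> A" for a
  using that d h by (auto simp: AX_def coeff_pCons E_def map_poly_pCons split: nat.splits)
 have inA': "poly p t \<in> A'" if "p \<in> AX" for p using that by (auto simp: A'_def)
 have "subalg A'" unfolding subalg_def
 proof (intro conjI ballI)
  show "range kp <= A'" using inA'[OF const(1)] d(1) by force
  fix x y assume "x \<in> A'" "y \<in> A'"
  then obtain p q where "p \<in> AX" "q \<in> AX" "x = poly p t" "y = poly q t" by (auto simp: A'_def)
  then show "x + y \<in> A'" "x * y \<in> A'" using inA'[OF AX_add, of p q] inA'[OF AX_mult, of p q] by auto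
 qed
 moreover have AA': "e' a = e a" "a \<in> A'" if "a \<in> A" for a
  using e'[OF const(1)[OF that]] inA'[OF const(1)[OF that]] const(2)[OF that] by auto
 moreover have "hom_on A' e'" unfolding hom_on_def
 proof (intro conjI ballI allI)
  show "e' (kp c) = c" for c using AA'(1)[OF d(1)] h by simp
  fix x y assume "x \<in> A'" "y \<in> A'"
  then obtain p q where pq: "p \<in> AX" "q \<in> AX" "x = poly p t" "y = poly q t" by (auto simp: A'_def)
  then show "e' (x + y) = e' x + e' y" "e' (x * y) = e' x * e' y" using e'[OF AX_add, of p q] e'[OF AX_mult, of p q] e' E_add E_mult by auto
 qed
 moreover have "t \<in> A'" using inA'[of "[:0, 1:]"] d by (auto simp: AX_def coeff_pCons split: nat.splits)
 ultimately show ?thesis by (intro exI[of _ A'] exI[of _ e']) auto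
qed

lemma integral_over_mono: "integral_over A t ==> A <= B ==> integral_over B t" unfolding integral_over_def by blast

lemma extend_hom_list:
 assumes "subalg A" "hom_on A e" "!!t. t \<in> set ts ==> integral_over A t"
 shows "\<exists>A' e'. subalg A' & hom_on A' e' & A <= A' & set ts <= A' & (\<forall>a\<in>A. e' a = e a)" using assms
proof (induction ts arbitrary: A e)
 case Nil
 then show ?case by auto
next
 case (Cons t ts)
 obtain A1 e1 where 1: "subalg A1" "hom_on A1 e1" "A <= A1" "t \<in> A1" "!!a. a \<in> A ==> e1 a = e a"
  using extend_hom[OF Cons.prems(1,2), of t] Cons.prems(3) by auto
 have "integral_over A1 s" if "s \<in> set ts" for s using integral_over_mono[OF Cons.prems(3) 1(3)] that by auto
 then obtain A2 e2 where "subalg A2" "hom_on A2 e2" "A1 <= A2" "set ts <= A2" "\<forall>a\<in>A1. e2 a = e1 a" using Cons.IH[OF 1(1,2)] by blast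
 then show ?case using 1 by (intro exI[of _ A2] exI[of _ e2]) auto
qed

lemma hom_prod_linear:
 assumes A: "subalg A" and e: "hom_on A e" and ts: "set ts <= A"
 shows "coeff (\<Prod>t\<leftarrow>ts. [:- t, 1:]) i \<in> A & e (coeff (\<Prod>t\<leftarrow>ts. [:- t, 1:]) i) = coeff (\<Prod>t\<leftarrow>ts. [:- e t, 1:]) i"
 using ts
proof (induction ts arbitrary: i)
 case Nil
 then show ?case using subalgD[OF A] hom_onD[OF A e] by (auto simp: coeff_1)
next
 case (Cons t ts)
 then show ?case using subalgD[OF A] hom_onD[OF A e] by (auto simp: coeff_pCons split: nat.splits)
qed

end

type_synonym 'a lau = "(int \<times> int) \<Rightarrow>\<^sub>0 'a"

lemma infinite_alg_closed: "infinite (UNIV :: 'a::alg_closed_field set)"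
proof
 assume fin: "finite (UNIV :: 'a set)"
 define p where "p = (\<Prod>a\<in>(UNIV :: 'a set). [:-a, 1:]) + 1"
 have "poly p x = 1" for x using fin by (simp add: p_def poly_prod)
 moreover have "degree p > 0"
 proof -
  have "degree (\<Prod>a\<in>(UNIV :: 'a set). [:-a, 1:]) = card (UNIV :: 'a set)" by (subst degree_prod_eq_sum_degree) auto
  moreover have "card (UNIV :: 'a set) > 0" using fin by (simp add: card_gt_0_iff)
  ultimately show ?thesis unfolding p_def by (subst degree_add_eq_left) auto
 qed
 ultimately show False using alg_closed_imp_poly_has_root[of p] by auto
qed

lemma poly_eq_0_cofinite:
 fixes p :: "'a::alg_closed_field poly"
 assumes "finite S" "!!x. x \<notin> S ==> poly p x = 0" shows "p = 0"
proof (rule ccontr)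
 assume "p ~= 0"
 then have "finite ({x. poly p x = 0} \<union> S)" using assms(1) poly_roots_finite by blast
 moreover have "{x. poly p x = 0} \<union> S = UNIV" using assms(2) by blast
 ultimately have "finite (UNIV :: 'a set)" by metis
 then show False using infinite_alg_closed[where 'a = 'a] by blast
qed

section \<open>The kite\<close>

text \<open>The four half-planes cut out by the sides of the kite; they reappear in
  \<open>bnd\<close> for its multiples.\<close>

lemma kite_bounds:
 assumes "(x, y) \<in> kite k k"
 shows "real k * y \<le> x" "- (real k * y) \<le> x" "x + real k * y \<le> 2 * real k" "x - real k * y \<le> 2 * real k"
proof -
 define S :: "(real \<times> real) set" where "S = {p. inner (-1, real k) p \<le> 0} \<inter> {p. inner (-1, - real k) p \<le> 0} \<inter>
   {p. inner (1, real k) p \<le> 2 * real k} \<inter> {p. inner (1, - real k) p \<le> 2 * real k}" have "convex S"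
  unfolding S_def by (intro convex_Int convex_halfspace_le)
 moreover have "{(0, 0), (real k, 1), (real k, -1), (real k + real k, 0)} <= S" by (auto simp: S_def)
 ultimately have "kite k k <= S" unfolding kite_def by (rule hull_minimal[rotated])
 then show "real k * y \<le> x" "- (real k * y) \<le> x" "x + real k * y \<le> 2 * real k" "x - real k * y \<le> 2 * real k"
  using assms by (auto simp: S_def)
qed

lemma lattice_points_kite:
 assumes "k \<ge> 1" shows "lattice_points (kite k k) = (%i. (int i, 0)) ` {..2 * k} \<union> {(int k, 1), (int k, -1)}"
proof (intro equalityI subsetI)
 fix m :: "int \<times> int" assume "m \<in> lattice_points (kite k k)"
 moreover obtain i j where m: "m = (i, j)" by force
 ultimately have "(real_of_int i, real_of_int j) \<in> kite k k" by (simp add: lattice_points_def)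
 note b = kite_bounds[OF this]
 have b': "int k * j \<le> i" "- (int k * j) \<le> i" "i + int k * j \<le> 2 * int k" "i - int k * j \<le> 2 * int k"
 proof -
  have "real_of_int (int k * j) \<le> real_of_int i" "real_of_int (- (int k * j)) \<le> real_of_int i"
   "real_of_int (i + int k * j) \<le> real_of_int (2 * int k)" "real_of_int (i - int k * j) \<le> real_of_int (2 * int k)" using b by simp_all
  then show "int k * j \<le> i" "- (int k * j) \<le> i" "i + int k * j \<le> 2 * int k" "i - int k * j \<le> 2 * int k"
   by (simp_all only: of_int_le_iff)
 qed
 have "int k * j \<le> int k * 1" "int k * (- 1) \<le> int k * j" using b' by linarith+
 then have j: "j \<le> 1" "-1 \<le> j" using assms by (simp_all only: mult_le_cancel_left_pos of_nat_0_less_iff Suc_le_eq One_nat_def)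
 then consider "j = 0" | "j = 1" | "j = -1" by linarith
 then show "m \<in> (%i. (int i, 0)) ` {..2 * k} \<union> {(int k, 1), (int k, -1)}"
 proof cases
  case 1
  then have "m = (int (nat i), 0)" "nat i \<le> 2 * k" using b' m by auto
  then show ?thesis by blast
 qed (use b' m in auto)
next
 fix m :: "int \<times> int" assume "m \<in> (%i. (int i, 0)) ` {..2 * k} \<union> {(int k, 1), (int k, -1)}"
 then consider i where "i \<le> 2 * k" "m = (int i, 0)" | "m = (int k, 1)" | "m = (int k, -1)" by auto
 then show "m \<in> lattice_points (kite k k)"
 proof cases
  case 1
  define t where "t = real i / (2 * real k)"
  have t: "0 \<le> t" "t \<le> 1" "t * (2 * real k) = real i" using 1 assms by (auto simp: t_def)
  have "(1 - t) *\<^sub>R (0, 0) + t *\<^sub>R (real k + real k, 0) \<in> kite k k"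
   unfolding kite_def by (rule convexD[OF convex_convex_hull]) (use t in \<open>auto intro: hull_inc\<close>)
  then show ?thesis using t(3) 1 by (simp add: lattice_points_def algebra_simps)
 qed (auto simp: lattice_points_def kite_def intro: hull_inc)
qed

section \<open>Laurent polynomials\<close>

definition leval :: "('a::comm_ring_1 => 'l::field) => 'l => 'l => 'a lau => 'l" where
 "leval kp x y F = plin kp (%m. x powi fst m * y powi snd m) F"

lemma leval_simps:
 assumes "crhom kp" shows "leval kp x y (F + G) = leval kp x y F + leval kp x y G"
  "leval kp x y (psingle m c) = kp c * (x powi fst m * y powi snd m)"
  "leval kp x y (sum f I) = (\<Sum>i\<in>I. leval kp x y (f i))"
  "leval kp x y 0 = 0" using assms by (simp_all add: leval_def plin_add plin_single plin_sum plin_0)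

lemma leval_mult:
 assumes "crhom kp" "x ~= 0" "y ~= 0" shows "leval kp x y (F * G) = leval kp x y F * leval kp x y G"
 unfolding leval_def using assms by (intro plin_mult) (auto simp: power_int_add mult_ac)

lemma crhom_leval: "crhom kp ==> x ~= 0 ==> y ~= 0 ==> crhom (leval kp x y)" unfolding crhom_def[of "leval kp x y"]
 by (simp add: leval_simps leval_mult single_one[symmetric] crhomD del: single_one)

lemma crhom_single: "crhom (psingle (0::'m::comm_monoid_add) :: 'a::comm_ring_1 => _)" by (simp add: crhom_def single_add mult_single)

lemma lookup_single_mult:
 fixes G :: "'a::comm_ring_1 lau" shows "plookup (psingle m c * G) w = c * plookup G (w - m)"
proof -
 have "psingle m c * G = (\<Sum>u\<in>pkeys G. psingle (m + u) (c * plookup G u))"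
  by (subst (1) poly_mapping_sum_single[of G]) (simp add: sum_distrib_left mult_single)
 moreover have "m + u = w \<longleftrightarrow> u = w - m" for u by (auto simp: algebra_simps)
 ultimately have "plookup (psingle m c * G) w = (\<Sum>u\<in>pkeys G. if u = w - m then c * plookup G u else 0)"
  by (simp add: lookup_sum lookup_single when_def)
 also have "\<dots> = c * plookup G (w - m)" by (simp add: not_in_keys_iff_lookup_eq_zero)
 finally show ?thesis .
qed

locale kite_surface =
 fixes k :: nat and A :: "(int \<times> int) set"
 assumes k1: "k \<ge> 1" and A_def: "A = lattice_points (kite k k)"
begin

abbreviation "\<Delta> \<equiv> kite k k"

lemma A_eq: "A = (%i. (int i, 0)) ` {..2 * k} \<union> {(int k, 1), (int k, -1)}" unfolding A_def by (rule lattice_points_kite[OF k1])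

lemma finite_A: "finite A" by (simp add: A_eq)

lemma A_mem: "i \<le> 2 * k ==> (int i, 0) \<in> A" "(int k, 1) \<in> A" "(int k, -1) \<in> A" "(0, 0) \<in> A" "(2 * int k, 0) \<in> A"
 unfolding A_eq by (auto simp: image_iff intro: bexI[of _ 0] bexI[of _ "2 * k"])

lemma A_cases:
 assumes "m \<in> A" obtains i where "i \<le> 2 * k" "m = (int i, 0)" | "m = (int k, 1)" | "m = (int k, -1)" using assms by (auto simp: A_eq)

lemma sum_A: "(\<Sum>m\<in>A. f m) = f (int k, 1) + f (int k, -1) + (\<Sum>i\<le>2 * k. f (int i, 0))"
proof -
 have "(\<Sum>m\<in>A. f m) = (\<Sum>m\<in>(%i. (int i, 0)) ` {..2 * k}. f m) + (\<Sum>m\<in>{(int k, 1), (int k, -1)}. f m)"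
  unfolding A_eq by (rule sum.union_disjoint) auto
 also have "(\<Sum>m\<in>(%i. (int i, 0)) ` {..2 * k}. f m) = (\<Sum>i\<le>2 * k. f (int i, 0))" by (subst sum.reindex) (auto simp: inj_on_def)
 finally show ?thesis by (simp add: algebra_simps)
qed

text \<open>The value is \<open>0\<close> off \<open>A\<close>, because a form may involve variables
  indexed by any pair of integers, while coordinate vectors vanish off \<open>A\<close>.\<close>

definition mono :: "int \<times> int => 'a::comm_ring_1 lau" where
 "mono v = (if v \<in> A then psingle v 1 else 0)"

text \<open>The restriction of a form to the torus as a Laurent polynomial, see
  \<open>mpoly_eval_tz\<close>.\<close>

definition tol :: "(int \<times> int, 'a::field) mpoly => 'a lau" where
 "tol H = plin (psingle 0) (mval mono) H"

lemma tol_add: "tol (F + G) = tol F + tol G" and tol_mult: "tol (F * G) = tol F * tol G"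
 and tol_single: "tol (psingle u c) = psingle 0 c * mval mono u" and tol_sum: "tol (sum f I) = (\<Sum>i\<in>I. tol (f i))" and tol_0: "tol 0 = 0"
 by (simp_all add: tol_def plin_add plin_mult plin_single plin_sum plin_0 crhom_single mval_add)

lemma tol_mconst: "tol (mconst c) = psingle 0 c" by (simp add: mconst_def tol_single mval_0)

definition tz :: "'a::field => 'a => int \<times> int => 'a" where
 "tz s t m = (if m \<in> A then s powi fst m * t powi snd m else 0)"

lemma leval_tol:
 assumes "crhom kp" "x ~= 0" "y ~= 0" shows "leval kp x y (tol H) = plin kp (mval (%v. if v \<in> A then x powi fst v * y powi snd v else 0)) H"
proof -
 have h: "crhom (leval kp x y)" using assms by (rule crhom_leval)
 have "leval kp x y \<circ> psingle 0 = kp" by (auto simp: leval_simps[OF assms(1)])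
 moreover have "leval kp x y \<circ> mval mono = mval (%v. if v \<in> A then x powi fst v * y powi snd v else 0)"
  using assms(1) by (auto simp: mval_hom[OF h] mono_def leval_simps crhomD[OF assms(1)] if_distrib cong: if_cong)
 ultimately show ?thesis unfolding tol_def plin_hom[OF h] by simp
qed

lemma mpoly_eval_tz: "s ~= 0 ==> t ~= 0 ==> mpoly_eval H (tz s t) = leval id s t (tol H)" unfolding leval_tol[OF crhom_id] mpoly_eval_plin tz_def ..

definition bnd :: "nat => 'a::zero lau => bool" where
 "bnd d F \<longleftrightarrow> (\<forall>m\<in>pkeys F. 0 \<le> fst m + int k * snd m & fst m + int k * snd m \<le> 2 * int k * int d &
   0 \<le> fst m - int k * snd m & fst m - int k * snd m \<le> 2 * int k * int d)"

lemma bnd_add: "bnd d F ==> bnd d G ==> bnd d (F + G)" unfolding bnd_def using Poly_Mapping.keys_add[of F G] by blast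

lemma bnd_sum: "(!!i. i \<in> I ==> bnd d (f i)) ==> bnd d (sum f I)"
 by (induction I rule: infinite_finite_induct) (auto simp: bnd_add, auto simp: bnd_def)

lemma bnd_mult: "bnd d F ==> bnd e G ==> bnd (d + e) (F * G)" unfolding bnd_def
proof
 fix m assume F: "\<forall>m\<in>pkeys F. 0 \<le> fst m + int k * snd m & fst m + int k * snd m \<le> 2 * int k * int d &
   0 \<le> fst m - int k * snd m & fst m - int k * snd m \<le> 2 * int k * int d"
  and G: "\<forall>m\<in>pkeys G. 0 \<le> fst m + int k * snd m & fst m + int k * snd m \<le> 2 * int k * int e &
   0 \<le> fst m - int k * snd m & fst m - int k * snd m \<le> 2 * int k * int e" and "m \<in> pkeys (F * G)"
 then obtain u v where uv: "u \<in> pkeys F" "v \<in> pkeys G" "m = u + v" using Poly_Mapping.keys_mult[of F G] by blast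
 show "0 \<le> fst m + int k * snd m & fst m + int k * snd m \<le> 2 * int k * int (d + e) &
   0 \<le> fst m - int k * snd m & fst m - int k * snd m \<le> 2 * int k * int (d + e)"
  using F[rule_format, OF uv(1)] G[rule_format, OF uv(2)] uv(3) by (simp add: algebra_simps)
qed

lemma bnd_const: "bnd 0 (psingle 0 c)" by (auto simp: bnd_def)

lemma bnd_one: "bnd 0 (1 :: 'a::comm_ring_1 lau)" using bnd_const[of "1::'a"] by simp

lemma bnd_mono: "bnd 1 (mono v :: 'a::comm_ring_1 lau)" by (auto simp: bnd_def mono_def elim!: A_cases)

lemma bnd_power: "bnd d F ==> bnd (n * d) (F ^ n)" for F :: "'a::comm_ring_1 lau"
proof (induction n)
 case 0
 then show ?case by (simp add: bnd_one)
next
 case (Suc n)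
 then show ?case using bnd_mult[of d F "n * d" "F ^ n"] by simp
qed

lemma bnd_mval: "bnd (wt u) (mval mono u :: 'a::comm_ring_1 lau)"
proof -
 have "bnd (\<Sum>v\<in>S. plookup u v) (\<Prod>v\<in>S. mono v ^ plookup u v :: 'a lau)" if "finite S" for S using that
 proof induction
  case empty
  then show ?case by (simp add: bnd_one)
 next
  case (insert v S)
  then show ?case using bnd_mult[OF bnd_power[OF bnd_mono]] by simp
 qed
 then show ?thesis by (simp add: wt_def mval_def)
qed

lemma bnd_tol:
 assumes "homogeneous d H" shows "bnd d (tol H)" unfolding tol_def plin_def
proof (rule bnd_sum)
 fix u assume "u \<in> pkeys H"
 then have "wt u = d" using assms by (simp add: homogeneous_iff)
 then show "bnd d (psingle 0 (plookup H u) * mval mono u)" using bnd_mult[OF bnd_const bnd_mval[of u]] by simp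
qed

text \<open>One lattice point of the kite is split off at a time: the upper or lower vertex if
  \<open>j\<close> is not zero, the right vertex if \<open>j = 0\<close> and \<open>i\<close> is at
  least \<open>2 * k\<close>, and otherwise the point itself.\<close>

lemma normality:
 assumes "bnd d (psingle (i, j) (1::'a::comm_ring_1))" shows "\<exists>u. wt u = d & mval mono u = psingle (i, j) (1::'a)" using assms
proof (induction d arbitrary: i j)
 case 0
 then have "i = 0" "int k * j = 0" by (auto simp: bnd_def)
 then have "(i, j) = 0" using k1 by (auto simp: zero_prod_def)
 then show ?case by (intro exI[of _ 0]) (auto simp: wt_def mval_0)
next
 case (Suc d)
 then have b: "0 \<le> i + int k * j" "i + int k * j \<le> 2 * int k * (int d + 1)"
   "0 \<le> i - int k * j" "i - int k * j \<le> 2 * int k * (int d + 1)" by (auto simp: bnd_def algebra_simps)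
 have "\<exists>v\<in>A. bnd d (psingle ((i, j) - v) (1::'a))"
 proof -
  consider "j \<ge> 1" | "j \<le> -1" | "j = 0" "i \<ge> 2 * int k" | "j = 0" "i < 2 * int k" by linarith
  then show ?thesis
  proof cases
   case 1
   then have "int k * j \<ge> int k * 1" by (intro mult_left_mono) auto
   then show ?thesis using b 1 by (intro bexI[of _ "(int k, 1)"] A_mem) (auto simp: bnd_def algebra_simps)
  next
   case 2
   then have "int k * j \<le> int k * (-1)" by (intro mult_left_mono) auto
   then show ?thesis using b 2 by (intro bexI[of _ "(int k, -1)"] A_mem) (auto simp: bnd_def algebra_simps)
  next
   case 3
   then show ?thesis using b by (intro bexI[of _ "(2 * int k, 0)"] A_mem) (auto simp: bnd_def algebra_simps)
  next
   case 4
   then have "(i, 0) = (int (nat i), 0)" "nat i \<le> 2 * k" using b by auto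
   then have "(i, 0) \<in> A" using A_mem(1) by metis
   then show ?thesis using b 4 by (intro bexI[of _ "(i, 0)"]) (auto simp: bnd_def)
  qed
 qed
 then obtain v where v: "v \<in> A" "bnd d (psingle ((i, j) - v) (1::'a))" by blast
 obtain u where u: "wt u = d" "mval mono u = psingle ((i, j) - v) (1::'a)"
 proof -
  have e: "(i, j) - v = (i - fst v, j - snd v)" by (simp add: prod_eq_iff)
  show ?thesis using Suc.IH[OF v(2)[unfolded e]] that unfolding e by blast
 qed
 have "mono v = psingle v (1::'a)" using v(1) by (simp add: mono_def)
 then show ?case using u by (intro exI[of _ "u + psingle v 1"])
   (simp add: wt_add wt_single mval_add mval_single mult_single)
qed

lemma bnd_imp_tol:
 fixes F :: "'a::field lau"
 assumes "bnd d F" shows "\<exists>H. homogeneous d H & tol H = F"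
proof -
 have "\<exists>u. wt u = d & mval mono u = psingle m (1::'a)" if "m \<in> pkeys F" for m
  using normality[of d "fst m" "snd m"] assms that by (auto simp: bnd_def)
 then obtain u where u: "!!m. m \<in> pkeys F ==> wt (u m) = d & mval mono (u m) = psingle m (1::'a)" by metis
 define H where "H = (\<Sum>m\<in>pkeys F. psingle (u m) (plookup F m))"
 have "homogeneous d H" unfolding H_def by (intro homogeneous_sum homogeneous_single) (use u in blast)
 moreover have "tol H = (\<Sum>m\<in>pkeys F. psingle m (plookup F m))"
  unfolding H_def tol_sum by (intro sum.cong refl) (use u in \<open>simp add: tol_single mult_single\<close>)
 then have "tol H = F" using poly_mapping_sum_single[of F] by simp
 ultimately show ?thesis by blast
qed

text \<open>\<open>(k, 0)\<close> is an interior point of the kite, so multiplication by the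
  \<open>d\<close>-th power of its monomial moves any finite support into the \<open>d\<close>-th
  multiple when \<open>d\<close> is large.\<close>

lemma bnd_large:
 fixes F :: "'a::field lau" shows "\<exists>d0. \<forall>d\<ge>d0. bnd d (psingle (int k * int d, 0) 1 * F)"
proof -
 define M where "M = nat (Max (insert 0 ((%m. \<bar>fst m\<bar> + int k * \<bar>snd m\<bar>) ` pkeys F)))"
 have M: "\<bar>fst m\<bar> + int k * \<bar>snd m\<bar> \<le> int M" if "m \<in> pkeys F" for m
 proof -
  have "\<bar>fst m\<bar> + int k * \<bar>snd m\<bar> \<le> Max (insert 0 ((%m. \<bar>fst m\<bar> + int k * \<bar>snd m\<bar>) ` pkeys F))"
   using that by (intro Max_ge) auto
  then show ?thesis by (simp add: M_def)
 qed
 have "bnd d (psingle (int k * int d, 0) 1 * F)" if "d \<ge> M" for d unfolding bnd_def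
 proof
  fix m assume "m \<in> pkeys (psingle (int k * int d, 0) 1 * F)"
  then have "m \<in> {a + b |a b. a \<in> pkeys (psingle (int k * int d, 0) (1::'a)) & b \<in> pkeys F}" using Poly_Mapping.keys_mult by blast
  then obtain u where u: "u \<in> pkeys F" "m = (int k * int d, 0) + u" by auto
  have "int M \<le> int d" using that by simp
  also have "\<dots> \<le> int k * int d" using k1 mult_right_mono[of 1 "int k" "int d"] by simp
  finally have "\<bar>fst u\<bar> + int k * \<bar>snd u\<bar> \<le> int k * int d" using M[OF u(1)] by linarith
  moreover have "\<bar>int k * snd u\<bar> = int k * \<bar>snd u\<bar>" by (simp add: abs_mult)
  ultimately have "\<bar>fst u + int k * snd u\<bar> \<le> int k * int d" "\<bar>fst u - int k * snd u\<bar> \<le> int k * int d" by linarith+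
  then show "0 \<le> fst m + int k * snd m & fst m + int k * snd m \<le> 2 * int k * int d &
   0 \<le> fst m - int k * snd m & fst m - int k * snd m \<le> 2 * int k * int d" unfolding u(2) by (simp add: abs_le_iff algebra_simps) qed
 then show ?thesis by blast
qed

section \<open>The toric surface of the kite\<close>

definition TS :: "(int \<times> int, 'a::alg_closed_field) ppoint set" where "TS = toric_surface \<Delta>"

lemma tz_nz: "s ~= 0 ==> t ~= 0 ==> m \<in> A ==> tz s t m ~= 0" by (auto simp: tz_def power_int_eq_0_iff)

lemma tz_in_space: "s ~= 0 ==> t ~= 0 ==> proj_point (tz s t) \<in> proj_space A"
 by (rule proj_point_in_space[of A _ "(0, 0)"]) (auto simp: tz_nz A_mem, simp add: tz_def)

lemma torus_act_proj_point: "torus_act s t ` proj_point z = proj_point (torus_act s t z)"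
proof -
 have "torus_act s t (%v. c * z v) = (%v. c * torus_act s t z v)" for c by (auto simp: torus_act_def)
 moreover have "torus_act s t ` {(%v. c * z v) | c. c ~= 0} = {torus_act s t (%v. c * z v) | c. c ~= 0}" by blast
 ultimately show ?thesis unfolding proj_point_def by simp
qed

lemma torus_orbit_one: "torus_orbit (proj_point (%m. if m \<in> A then 1 else 0)) = {proj_point (tz s t) | s t. s ~= 0 & t ~= 0}"
proof -
 have "torus_act s t (%m. if m \<in> A then 1 else 0) = tz s t" for s t :: 'a by (auto simp: torus_act_def tz_def)
 then show ?thesis unfolding torus_orbit_def torus_act_proj_point by simp
qed

lemma TS_iff:
 "q \<in> TS \<longleftrightarrow> q \<in> proj_space A & (\<forall>F d. homogeneous d F --> (\<forall>s t. s ~= 0 --> t ~= 0 --> mpoly_eval F (tz s t) = 0) --> vanishes_at F q)"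
proof -
 have "{proj_point (tz s t) | s t. s ~= 0 & t ~= 0} <= proj_space A" using tz_in_space by blast
 then show ?thesis unfolding TS_def toric_surface_def A_def[symmetric] torus_orbit_one zariski_closure_iff[OF \<open>_ <= proj_space A\<close>]
  using vanishes_at_iff by blast
qed

lemma tz_in_TS: "s ~= 0 ==> t ~= 0 ==> proj_point (tz s t) \<in> TS" unfolding TS_iff using tz_in_space vanishes_at_iff by blast

lemma TS_space: "q \<in> TS ==> q \<in> proj_space A" by (simp add: TS_iff)

text \<open>The difference of the two forms vanishes on the torus, which is dense in the
  surface.\<close>

lemma TS_eq:
 assumes "q \<in> TS" "homogeneous d F" "homogeneous d G" "tol F = tol G" "z \<in> q" shows "mpoly_eval F z = mpoly_eval G z"
proof -
 define D where "D = F + mconst (-1) * G"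
 have D: "homogeneous d D" unfolding D_def by (intro homogeneous_add homogeneous_smult assms)
 have e: "mpoly_eval D z = mpoly_eval F z - mpoly_eval G z" for z by (simp add: D_def mpoly_eval_add mpoly_eval_mult mpoly_eval_mconst)
 have "mpoly_eval D (tz s t) = 0" if "s ~= 0" "t ~= 0" for s t using that assms(4) by (simp add: e mpoly_eval_tz)
 then have "vanishes_at D q" using assms(1) D by (auto simp: TS_iff)
 then show ?thesis using assms(5) e by (simp add: vanishes_at_def)
qed

lemma TS_binomials:
 assumes "q \<in> TS" "z \<in> q" shows "0 < i ==> i < 2 * k ==> z (int i, 0) ^ 2 = z (int i - 1, 0) * z (int i + 1, 0)"
  "z (int k, 1) * z (int k, -1) = z (int k, 0) ^ 2"
proof -
 have tm: "tol (mvar v n :: (int \<times> int, 'a) mpoly) = mono v ^ n" for v n by (simp add: tol_single mval_single)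
 show "z (int i, 0) ^ 2 = z (int i - 1, 0) * z (int i + 1, 0)" if i: "0 < i" "i < 2 * k"
 proof -
  have A: "(int i - 1, 0) \<in> A" "(int i + 1, 0) \<in> A" "(int i, 0) \<in> A"
   using A_mem(1)[of "i - 1"] A_mem(1)[of "i + 1"] A_mem(1)[of i] i by (auto simp: of_nat_diff algebra_simps)
  have "mpoly_eval (mvar (int i, 0) 2) z = mpoly_eval (mvar (int i - 1, 0) 1 * mvar (int i + 1, 0) 1) z"
  proof (rule TS_eq[OF assms(1) _ _ _ assms(2)])
   show "homogeneous 2 (mvar (int i, 0) 2 :: (int \<times> int, 'a) mpoly)" by (rule homogeneous_mvar)
   show "homogeneous 2 (mvar (int i - 1, 0) 1 * mvar (int i + 1, 0) 1 :: (int \<times> int, 'a) mpoly)"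
    using homogeneous_mult[OF homogeneous_mvar homogeneous_mvar] by (metis one_add_one)
   show "tol (mvar (int i, 0) 2) = tol (mvar (int i - 1, 0) 1 * mvar (int i + 1, 0) 1 :: (int \<times> int, 'a) mpoly)"
    unfolding tol_mult tm using A by (simp add: mono_def power2_eq_square mult_single)
  qed
  then show ?thesis by (simp only: mpoly_eval_mult mpoly_eval_mvar power_one_right)
 qed
 have A: "(int k, 0) \<in> A" using A_mem(1)[of k] by simp
 have "mpoly_eval (mvar (int k, 1) 1 * mvar (int k, -1) 1) z = mpoly_eval (mvar (int k, 0) 2) z"
 proof (rule TS_eq[OF assms(1) _ _ _ assms(2)])
  show "homogeneous 2 (mvar (int k, 0) 2 :: (int \<times> int, 'a) mpoly)" by (rule homogeneous_mvar)
  show "homogeneous 2 (mvar (int k, 1) 1 * mvar (int k, -1) 1 :: (int \<times> int, 'a) mpoly)"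
   using homogeneous_mult[OF homogeneous_mvar homogeneous_mvar] by (metis one_add_one)
  show "tol (mvar (int k, 1) 1 * mvar (int k, -1) 1 :: (int \<times> int, 'a) mpoly) = tol (mvar (int k, 0) 2)"
   unfolding tol_mult tm using A A_mem(2,3) by (simp add: mono_def power2_eq_square mult_single)
 qed
 then show "z (int k, 1) * z (int k, -1) = z (int k, 0) ^ 2" by (simp only: mpoly_eval_mult mpoly_eval_mvar power_one_right)
qed

definition pt :: "int \<times> int => int \<times> int => 'a::field" where
 "pt v = (%m. if m = v then 1 else 0)"

definition vertices :: "(int \<times> int) set" where
 "vertices = {(0, 0), (2 * int k, 0), (int k, 1), (int k, -1)}"

lemma vertices_A: "vertices <= A" using A_mem by (auto simp: vertices_def)

lemma pt_in_space: "v \<in> A ==> proj_point (pt v) \<in> proj_space A" by (rule proj_point_in_space[of A _ v]) (auto simp: pt_def)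

text \<open>The vertex points are limits of points of the torus along one-parameter subgroups.\<close>

lemma vertex_in_TS:
 assumes "v \<in> vertices" shows "proj_point (pt v :: _ => 'a::alg_closed_field) \<in> TS"
proof -
 \<comment> \<open>An affine integral function that is nonnegative on \<open>A\<close> and zero only
   at \<open>v\<close>; its linear part is the one-parameter subgroup.\<close>
 have "\<exists>(e :: int \<times> int => nat) a b c. (\<forall>m\<in>A. (e m = 0 \<longleftrightarrow> m = v) & int (e m) = a * fst m + b * snd m + c)"
 proof -
  consider "v = (0, 0)" | "v = (2 * int k, 0)" | "v = (int k, 1)" | "v = (int k, -1)" using assms by (auto simp: vertices_def)
  then show ?thesis
  proof cases
   case 1
   then show ?thesis using k1 by (intro exI[of _ "%m. nat (fst m)"] exI[of _ 1] exI[of _ 0]) (auto elim!: A_cases)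
  next
   case 2
   then show ?thesis
    using k1 by (intro exI[of _ "%m. nat (2 * int k - fst m)"] exI[of _ "-1"] exI[of _ 0] exI[of _ "2 * int k"]) (auto elim!: A_cases)
  next
   case 3
   then show ?thesis using k1 by (intro exI[of _ "%m. nat (1 - snd m)"] exI[of _ 0] exI[of _ "-1"] exI[of _ 1]) (auto elim!: A_cases)
  next
   case 4
   then show ?thesis using k1 by (intro exI[of _ "%m. nat (1 + snd m)"] exI[of _ 0] exI[of _ 1] exI[of _ 1]) (auto elim!: A_cases)
  qed
 qed
 then obtain e :: "int \<times> int => nat" and a b c where e: "!!m. m \<in> A ==> (e m = 0 \<longleftrightarrow> m = v) & int (e m) = a * fst m + b * snd m + c"
  by blast
 have vA: "v \<in> A" using assms vertices_A by blast
 define p where "p s m = (if m \<in> A then s ^ e m else 0)" for s :: 'a and m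
 show ?thesis unfolding TS_iff
 proof (intro conjI allI impI pt_in_space vA)
  fix F :: "(int \<times> int, 'a) mpoly" and d assume F: "homogeneous d F" and van: "\<forall>s t. s ~= 0 --> t ~= 0 --> mpoly_eval F (tz s t) = 0"
  define R where "R = plin (%c. [:c:]) (mval (%m. if m \<in> A then monom 1 (e m) else 0)) F"
  have R: "poly R s = mpoly_eval F (p s)" for s
  proof -
   have h: "crhom (%q. poly q s)" by (simp add: crhom_def)
   have "(%q. poly q s) \<circ> (%c. [:c:]) = id" by auto
   moreover have "(%q. poly q s) \<circ> mval (%m. if m \<in> A then monom 1 (e m) else 0) = mval (p s)"
   proof -
    have "(%v. poly (if v \<in> A then monom 1 (e v) else 0) s) = p s" by (auto simp: p_def poly_monom)
    then show ?thesis unfolding o_def mval_hom[OF h] by simp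
   qed
   ultimately show ?thesis unfolding R_def plin_hom[OF h] mpoly_eval_plin by simp
  qed
  have "poly R s = 0" if s: "s ~= 0" for s
  proof -
   have "p s = (%m. s powi c * tz (s powi a) (s powi b) m)"
   proof
    fix m
    show "p s m = s powi c * tz (s powi a) (s powi b) m"
    proof (cases "m \<in> A")
     case True
     have "s ^ e m = s powi (a * fst m + b * snd m + c)" using e[OF True] by (metis power_int_of_nat)
     then show ?thesis using s True by (simp add: p_def tz_def power_int_add power_int_mult)
    qed (simp add: p_def tz_def)
   qed
   then show ?thesis unfolding R using van s mpoly_eval_scale[OF F] by simp
  qed
  then have "R = 0" by (intro poly_eq_0_cofinite[of "{0}"]) auto
  then have "mpoly_eval F (p 0) = 0" using R[of 0] by simp
  moreover have "p 0 = pt v"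
  proof
   fix m show "p 0 m = pt v m" using e[of m] vA by (cases "m \<in> A") (auto simp: p_def pt_def power_0_left)
  qed
  ultimately show "vanishes_at F (proj_point (pt v))" using vanishes_at_iff[OF F] by simp
 qed
qed

text \<open>Two nonzero coordinates would yield a nontrivial character of the torus, whose values
  exhaust all nonzero constants, so the orbit would be infinite. A single nonzero coordinate at an
  inner point of the axis contradicts the relation between three consecutive axis coordinates in
  \<open>TS_binomials\<close>.\<close>

lemma finite_orbit_vertex:
 assumes q: "q \<in> (TS :: (int \<times> int, 'a::alg_closed_field) ppoint set)" and fin: "finite (torus_orbit q)"
 shows "\<exists>v\<in>vertices. q = proj_point (pt v)"
proof -
 obtain z where z: "q = proj_point z" "!!v. v \<notin> A ==> z v = 0" "\<exists>v. z v ~= 0" using proj_spaceE[OF TS_space[OF q]] by blast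
 have zq: "z \<in> q" unfolding z(1) by (rule proj_point_self)
 obtain m where m: "z m ~= 0" using z by blast
 have single: "z m' = 0" if "m' ~= m" for m'
 proof (rule ccontr)
  assume m': "z m' ~= 0"
  define a b where "a = fst m - fst m'" and "b = snd m - snd m'"
  have ab: "a ~= 0 \<or> b ~= 0" using that by (auto simp: a_def b_def prod_eq_iff)
  have root: "\<exists>s. s ~= 0 & s powi n = x" if "n ~= 0" "x ~= 0" for n :: int and x :: 'a
  proof -
   obtain y where y: "y ^ nat \<bar>n\<bar> = (if n > 0 then x else inverse x)"
    using nth_root_exists[of "nat \<bar>n\<bar>"] \<open>n ~= 0\<close> by auto
   have "y ~= 0" using y that by (auto simp: power_0_left split: if_splits)
   moreover have "y powi n = x"
   proof (cases "n > 0")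
    case True
    then show ?thesis using y by (simp add: power_int_def)
   next
    case False
    then have "y powi n = inverse (y ^ nat \<bar>n\<bar>)" by (simp add: power_int_def power_inverse)
    then show ?thesis using y False by simp
   qed
   ultimately show ?thesis by blast
  qed
  have st: "\<exists>s t. s ~= 0 & t ~= 0 & s powi a * t powi b = x" if x0: "x ~= 0" for x :: 'a
  proof (cases "a = 0")
   case True
   then obtain t where "t ~= 0" "t powi b = x" using root[OF _ x0, of b] True ab by blast
   then show ?thesis using True by (intro exI[of _ 1] exI[of _ t]) auto
  next
   case False
   then obtain s where "s ~= 0" "s powi a = x" using root[OF False x0] by blast
   then show ?thesis by (intro exI[of _ s] exI[of _ 1]) auto
  qed
  define r where "r Q = (let w = (SOME w. w \<in> Q) in w m / w m' :: 'a)" for Q :: "(int \<times> int, 'a) ppoint"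
  have r: "r (proj_point w) = w m / w m'" for w :: "int \<times> int => 'a"
  proof -
   have "(SOME w'. w' \<in> proj_point w) \<in> proj_point w" by (rule someI[of _ w]) (rule proj_point_self)
   then obtain c where "c ~= 0" "(SOME w'. w' \<in> proj_point w) = (%v. c * w v)" by (auto simp: proj_point_def)
   then show ?thesis by (simp add: r_def)
  qed
  have "UNIV - {0} <= (%Q. r Q * z m' / z m) ` torus_orbit q"
  proof
   fix x :: 'a assume "x \<in> UNIV - {0}"
   then obtain s t where s: "s ~= 0" "t ~= 0" "s powi a * t powi b = x" using st[of x] by auto
   have "r (proj_point (torus_act s t z)) = x * z m / z m'"
    unfolding r s(3)[symmetric] torus_act_def a_def b_def power_int_diff[OF s(1)[THEN disjI1]] power_int_diff[OF s(2)[THEN disjI1]] by simp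
   then have "x = r (proj_point (torus_act s t z)) * z m' / z m" using m m' by simp
   moreover have "proj_point (torus_act s t z) \<in> torus_orbit q" unfolding torus_orbit_def z(1) torus_act_proj_point using s by blast
   ultimately show "x \<in> (%Q. r Q * z m' / z m) ` torus_orbit q" by blast
  qed
  then have "finite (UNIV - {0 :: 'a})" using fin finite_surj by blast
  then show False using infinite_alg_closed[where 'a = 'a] by simp
 qed
 have mA: "m \<in> A" using m z by blast
 have "z = (%v. z m * pt m v)" using single by (auto simp: pt_def)
 then have qe: "q = proj_point (pt m)" using proj_point_scale[OF m, of "pt m"] z(1) by simp
 have "m \<in> vertices"
 proof (rule ccontr)
  assume nv: "m \<notin> vertices"
  then obtain i where i: "0 < i" "i < 2 * k" "m = (int i, 0)" using mA by (auto simp: vertices_def elim!: A_cases)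
  then show False using TS_binomials(1)[OF q zq i(1,2)] m single[of "(int i - 1, 0)"] by auto
 qed
 then show ?thesis using qe by blast
qed

end

section \<open>The curve of a section: its ideal, reducedness and transversality\<close>

text \<open>The ambient field is an algebraic closure of the rational functions, where the quadratic
  equation of the curve has a root.\<close>

definition cst :: "'a::field => 'a poly fract alg_closure" where "cst c = to_ac (Fract [:c:] 1)"

definition gen :: "'a::field poly fract alg_closure" where "gen = to_ac (Fract [:0, 1:] 1)"

interpretation CG: field_embedding "cst :: 'a::field => _" gen
 by standard (simp_all add: cst_def One_fract_def one_pCons mult.commute flip: to_ac_add to_ac_mult)

lemma CG_ev: "CG.ev p = to_ac (Fract p 1)"
proof (induction p)
 case 0
 then show ?case by (simp add: Zero_fract_def[symmetric])
next
 case (pCons c p)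
 have "cst c + gen * to_ac (Fract p 1) = to_ac (Fract [:c:] 1 + Fract [:0, 1:] 1 * Fract p 1)" by (simp only: cst_def gen_def to_ac_add to_ac_mult)
 also have "Fract [:c:] 1 + Fract [:0, 1:] 1 * Fract p 1 = Fract (pCons c p) 1" by simp
 finally show ?case using pCons by simp
qed

lemma CG_ev_eq_0: "CG.ev p = 0 \<longleftrightarrow> p = 0" by (simp add: CG_ev Zero_fract_def eq_fract)

lemma crhom_cst: "crhom cst" by (simp add: crhom_def CG.kp_simps)

text \<open>The coefficient of \<open>y^j\<close>, multiplied by \<open>x^N\<close> so that it
  becomes an ordinary polynomial.\<close>

definition lau_part :: "nat => nat => int => 'a::comm_ring_1 lau => 'a poly" where
 "lau_part N M j R = (\<Sum>n\<le>M. monom (plookup R (int n - int N, j)) n)"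

definition lau_box :: "nat => nat => 'a::comm_ring_1 lau => bool" where
 "lau_box N M R \<longleftrightarrow> (\<forall>m\<in>pkeys R. snd m \<in> {0, 1} & 0 \<le> fst m + int N & fst m + int N \<le> int M)"

lemma coeff_lau_part: "coeff (lau_part N M j R) n = (if n \<le> M then plookup R (int n - int N, j) else 0)" by (auto simp: lau_part_def coeff_sum)

lemma lau_box_zero:
 assumes "lau_box N M R" "lau_part N M 0 R = 0" "lau_part N M 1 R = 0" shows "R = 0"
proof (rule ccontr)
 assume "R ~= 0"
 then obtain m where m: "m \<in> pkeys R" by (metis keys_eq_empty equals0I)
 define n where "n = nat (fst m + int N)"
 have "n \<le> M" "m = (int n - int N, snd m)" "snd m = 0 \<or> snd m = 1" using assms(1) m by (auto simp: lau_box_def n_def prod_eq_iff)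
 then have "plookup R m = 0" using assms(2,3) coeff_lau_part[of N M "snd m" R n] by auto
 then show False using m by (simp add: in_keys_iff)
qed

lemma ex_lau_box:
 assumes "!!m. m \<in> pkeys R ==> snd m \<in> {0, 1}" shows "\<exists>N M. lau_box N M R"
proof -
 define B where "B = Max (insert 0 ((%m. \<bar>fst m\<bar>) ` pkeys R))"
 have B: "\<bar>fst m\<bar> \<le> B" if "m \<in> pkeys R" for m unfolding B_def using that by (intro Max_ge) auto
 have "B \<ge> 0" unfolding B_def by (intro Max_ge) auto
 then have "lau_box (nat B) (2 * nat B) R" unfolding lau_box_def using assms B by fastforce
 then show ?thesis by blast
qed

lemma poly_sum_upto:
 fixes p :: "'a::comm_semiring_1 poly"
 assumes "degree p \<le> n" shows "poly p x = (\<Sum>i\<le>n. coeff p i * x ^ i)"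
 unfolding poly_altdef using assms by (intro sum.mono_neutral_left) (auto simp: coeff_eq_0)

lemma leval_lau_box:
 assumes k: "crhom kp" and xy: "x ~= 0" and R: "lau_box N M R"
 shows "leval kp x y R * x ^ N = poly (map_poly kp (lau_part N M 0 R)) x + poly (map_poly kp (lau_part N M 1 R)) x * y"
proof -
 have pm: "poly (map_poly kp (lau_part N M j R)) x = (\<Sum>n\<le>M. kp (plookup R (int n - int N, j)) * x ^ n)" for j
 proof -
  have "degree (map_poly kp (lau_part N M j R)) \<le> M" by (rule degree_le) (auto simp: coeff_map_poly crhomD[OF k] coeff_lau_part)
  then have "poly (map_poly kp (lau_part N M j R)) x = (\<Sum>n\<le>M. coeff (map_poly kp (lau_part N M j R)) n * x ^ n)" by (rule poly_sum_upto)
  then show ?thesis by (simp add: coeff_map_poly crhomD[OF k] coeff_lau_part)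
 qed
 define S where "S = (%(n, j). (int n - int N, j)) ` ({..M} \<times> {0, 1::int})"
 have "pkeys R <= S"
 proof
  fix m assume "m \<in> pkeys R"
  then have "m = (%(n, j). (int n - int N, j)) (nat (fst m + int N), snd m)" "(nat (fst m + int N), snd m) \<in> {..M} \<times> {0, 1}"
   using R by (auto simp: lau_box_def prod_eq_iff)
  then show "m \<in> S" unfolding S_def by (rule image_eqI)
 qed
 then have "leval kp x y R = (\<Sum>m\<in>S. kp (plookup R m) * (x powi fst m * y powi snd m))"
  unfolding leval_def by (intro plin_superset k) (auto simp: S_def)
 also have "\<dots> = (\<Sum>(n, j)\<in>{..M} \<times> {0, 1}. kp (plookup R (int n - int N, j)) * (x powi (int n - int N) * y powi j))"
  unfolding S_def by (subst sum.reindex) (auto simp: inj_on_def case_prod_beta)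
 also have "\<dots> = (\<Sum>n\<le>M. \<Sum>j\<in>{0, 1}. kp (plookup R (int n - int N, j)) * (x powi (int n - int N) * y powi j))"
  by (rule sum.cartesian_product[symmetric])
 finally have "leval kp x y R * x ^ N =
   (\<Sum>n\<le>M. (\<Sum>j\<in>{0, 1}. kp (plookup R (int n - int N, j)) * (x powi (int n - int N) * y powi j)) * x ^ N)"
  by (simp only: sum_distrib_right)
 also have "\<dots> = (\<Sum>n\<le>M. kp (plookup R (int n - int N, 0)) * x ^ n + kp (plookup R (int n - int N, 1)) * x ^ n * y)"
  using xy by (intro sum.cong refl) (simp add: power_int_diff field_simps)
 finally have "leval kp x y R * x ^ N = (\<Sum>n\<le>M. kp (plookup R (int n - int N, 0)) * x ^ n) +
   (\<Sum>n\<le>M. kp (plookup R (int n - int N, 1)) * x ^ n) * y" by (simp only: sum.distrib sum_distrib_right) then show ?thesis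
  by (simp add: pm)
qed

text \<open>Nonzero coefficients at the four vertices characterize the torically transverse members
  of the linear system, see \<open>torically_transverse\<close> and
  \<open>transverse_imp_good\<close>.\<close>

locale good_curve = kite_surface k A for k A +
 fixes z :: "int \<times> int => 'a::alg_closed_field"
 assumes supp: "v \<notin> A ==> z v = 0" and good: "v \<in> vertices ==> z v ~= 0"
begin

definition PP :: "'a poly" where "PP = (\<Sum>i\<le>2 * k. monom (z (int i, 0)) i)"

abbreviation "ca \<equiv> z (int k, 1)"
abbreviation "cb \<equiv> z (int k, -1)"

definition QQ :: "'a poly" where "QQ = monom (ca * cb) (2 * k)"

lemma ab_nz: "ca ~= 0" "cb ~= 0" using good by (auto simp: vertices_def)

lemma coeff_PP: "coeff PP i = (if i \<le> 2 * k then z (int i, 0) else 0)" by (auto simp: PP_def coeff_sum)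

lemma degree_PP: "degree PP = 2 * k"
proof (rule antisym)
 show "degree PP \<le> 2 * k" by (rule degree_le) (auto simp: coeff_PP)
 have "coeff PP (2 * k) ~= 0" using good[of "(2 * int k, 0)"] by (simp add: coeff_PP vertices_def)
 then show "2 * k \<le> degree PP" by (rule le_degree)
qed

lemma PP_0: "poly PP 0 ~= 0" using good[of "(0, 0)"] by (simp add: poly_0_coeff_0 coeff_PP vertices_def)

text \<open>At \<open>0\<close> the discriminant is the square of \<open>poly PP 0\<close>, in every
  characteristic.\<close>

lemma disc_nz: "PP ^ 2 - 4 * QQ ~= 0"
proof
 assume "PP ^ 2 - 4 * QQ = 0"
 then have "poly (PP ^ 2 - 4 * QQ) 0 = 0" by simp
 then show False using PP_0 k1 by (simp add: QQ_def poly_monom power_0_left)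
qed

definition fz :: "'a lau" where "fz = (\<Sum>m\<in>A. psingle m (z m))"

definition sec :: "(int \<times> int, 'a) mpoly" where "sec = section_form \<Delta> z"

lemma leval_fz:
 assumes "crhom kp" shows "leval kp x y fz = kp ca * (x ^ k * y) + kp cb * (x ^ k * inverse y) + poly (map_poly kp PP) x"
proof -
 have "poly (map_poly kp PP) x = (\<Sum>i\<le>2 * k. coeff (map_poly kp PP) i * x ^ i)" by (rule poly_sum_upto) (metis degree_PP map_poly_degree_leq)
 also have "\<dots> = (\<Sum>i\<le>2 * k. kp (z (int i, 0)) * x ^ i)" by (simp add: coeff_map_poly crhomD[OF assms] coeff_PP)
 finally show ?thesis unfolding fz_def leval_simps[OF assms] sum_A by (simp add: power_int_minus)
qed

lemma homogeneous_sec: "homogeneous 1 sec" unfolding sec_def section_form_def by (intro homogeneous_sum homogeneous_single wt_single)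

lemma tol_sec: "tol sec = fz" unfolding sec_def section_form_def fz_def tol_sum A_def[symmetric]
 by (intro sum.cong refl) (simp add: tol_single mval_single mono_def mult_single)

lemma mpoly_eval_sec: "mpoly_eval sec w = (\<Sum>m\<in>A. z m * w m)" unfolding sec_def section_form_def A_def[symmetric] mpoly_eval_sum
 by (simp add: mpoly_eval_single mval_single)

definition tc :: "'a => 'a => bool" where
 "tc s t \<longleftrightarrow> s ~= 0 & t ~= 0 & leval id s t fz = 0"

lemma leval_fz_mult:
 assumes "s ~= 0" "t ~= 0" shows "leval id s t fz * t = ca * s ^ k * (t * t) + poly PP s * t + cb * s ^ k"
 using assms unfolding leval_fz[OF crhom_id] by (simp add: algebra_simps)

text \<open>The two roots of the quadratic equation for \<open>y\<close>. If they coincided, the sum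
  and product of the roots would make the discriminant zero; the computation is valid in
  characteristic two as well.\<close>

lemma two_points:
 assumes "s ~= 0" "poly (PP ^ 2 - 4 * QQ) s ~= 0" shows "\<exists>t1 t2. tc s t1 & tc s t2 & t1 ~= t2"
proof -
 define q where "q t = ca * s ^ k * (t * t) + poly PP s * t + cb * s ^ k" for t
 have sk: "ca * s ^ k ~= 0" "cb * s ^ k ~= 0" using assms ab_nz by auto
 have tc: "tc s t" if "q t = 0" for t
 proof -
  have "t ~= 0" using that sk by (auto simp: q_def)
  then show ?thesis using that leval_fz_mult[OF assms(1), of t] assms(1) by (simp add: tc_def q_def)
 qed
 have "degree [:cb * s ^ k, poly PP s, ca * s ^ k:] > 0" using sk by simp
 then obtain t1 where "poly [:cb * s ^ k, poly PP s, ca * s ^ k:] t1 = 0" using alg_closed_imp_poly_has_root by blast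
 then have t1: "q t1 = 0" by (simp add: q_def algebra_simps)
 define t2 where "t2 = - (poly PP s / (ca * s ^ k)) - t1"
 have e: "ca * s ^ k * (t1 + t2) = - poly PP s" using sk by (simp add: t2_def)
 have "q t2 - q t1 = (t2 - t1) * (ca * s ^ k * (t1 + t2) + poly PP s)" by (simp add: q_def algebra_simps)
 then have t2: "q t2 = 0" using t1 e by simp
 have "t1 ~= t2"
 proof
  assume "t1 = t2"
  then have "poly PP s = - (2 * (ca * s ^ k * t1))" using e by (simp add: algebra_simps)
  moreover have "cb * s ^ k = ca * s ^ k * (t1 * t1)" using t1 calculation by (simp add: q_def algebra_simps)
  moreover have "poly QQ s = (ca * s ^ k) * (cb * s ^ k)" by (simp add: QQ_def poly_monom power_add mult_2 del: mult_2_right)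
  ultimately have "poly (PP ^ 2 - 4 * QQ) s = (- (2 * (ca * s ^ k * t1))) ^ 2 - 4 * ((ca * s ^ k) * (ca * s ^ k * (t1 * t1)))"
   by (simp only: poly_diff poly_power poly_mult poly_numeral)
  also have "\<dots> = 0" by (simp add: power2_eq_square algebra_simps)
  finally have "poly (PP ^ 2 - 4 * QQ) s = 0" .
  then show False using assms by simp
 qed
 then show ?thesis using tc t1 t2 by blast
qed

lemma ex_good_s: "finite S ==> \<exists>s. s \<notin> S & s ~= 0 & poly (PP ^ 2 - 4 * QQ) s ~= 0"
proof -
 assume "finite S"
 then have "finite (S \<union> {0} \<union> {s. poly (PP ^ 2 - 4 * QQ) s = 0})" using poly_roots_finite[OF disc_nz] by blast
 then show ?thesis using infinite_alg_closed by (metis (mono_tags, lifting) UnI1 UnI2 ex_new_if_finite insertI1 mem_Collect_eq)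
qed

lemma ex_tc: "\<exists>s t. tc s t" using ex_good_s[of "{}"] two_points by blast

text \<open>Over all but finitely many \<open>x\<close> the curve has two points with distinct
  \<open>y\<close>, and there \<open>r0 + r1 * y\<close> has to vanish.\<close>

lemma reduced_zero:
 assumes R: "!!m. m \<in> pkeys R ==> snd m \<in> {0, 1}" and van: "!!s t. tc s t ==> leval id s t R = 0" shows "R = 0"
proof -
 obtain N M where box: "lau_box N M R" using ex_lau_box[OF R] by blast
 define r0 r1 where "r0 = lau_part N M 0 R" and "r1 = lau_part N M 1 R"
 have pt: "poly r0 s = 0 & poly r1 s = 0" if s: "s \<notin> {0} \<union> {s. poly (PP ^ 2 - 4 * QQ) s = 0}" for s
 proof -
  obtain t1 t2 where t: "tc s t1" "tc s t2" "t1 ~= t2" using two_points s by blast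
  have "poly r0 s + poly r1 s * t = 0" if "tc s t" for t
   using leval_lau_box[OF crhom_id, of s N M R t] van[OF that] box s by (simp add: r0_def r1_def)
  then have e: "poly r0 s + poly r1 s * t1 = 0" "poly r0 s + poly r1 s * t2 = 0" using t by auto
  have "poly r1 s * (t1 - t2) = (poly r0 s + poly r1 s * t1) - (poly r0 s + poly r1 s * t2)" by (simp add: algebra_simps)
  then have "poly r1 s = 0" using e t(3) by simp
  then show ?thesis using e by simp
 qed
 have fin: "finite ({0} \<union> {s. poly (PP ^ 2 - 4 * QQ) s = 0})" using poly_roots_finite[OF disc_nz] by simp
 have "r0 = 0" by (rule poly_eq_0_cofinite[OF fin]) (use pt in blast)
 moreover have "r1 = 0" by (rule poly_eq_0_cofinite[OF fin]) (use pt in blast)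
 ultimately show ?thesis using lau_box_zero[OF box] by (simp add: r0_def r1_def)
qed

lemma fz_mult_single: "fz * psingle w c = psingle ((int k, 1) + w) (ca * c) +
  psingle ((int k, -1) + w) (cb * c) + (\<Sum>i\<le>2 * k. psingle ((int i, 0) + w) (z (int i, 0) * c))"
 unfolding fz_def sum_distrib_right mult_single by (rule sum_A)

text \<open>Laurent polynomials that admit division by \<open>fz\<close> with a remainder of
  \<open>y\<close>-degree \<open>0\<close> or \<open>1\<close>. The extreme coefficients
  \<open>ca x^k\<close> and \<open>cb x^k\<close> of \<open>fz\<close> in \<open>y\<close> are
  units, so the degree can be lowered from above and raised from below.\<close>

definition LM :: "'a lau set" where
 "LM = {F. \<exists>G R. F = fz * G + R & (\<forall>m\<in>pkeys R. snd m \<in> {0, 1})}"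

lemma LM_add: "F \<in> LM ==> F' \<in> LM ==> F + F' \<in> LM"
proof -
 assume "F \<in> LM" "F' \<in> LM"
 then obtain G R G' R' where *: "F = fz * G + R" "F' = fz * G' + R'"
  "\<forall>m\<in>pkeys R. snd m \<in> {0, 1}" "\<forall>m\<in>pkeys R'. snd m \<in> {0, 1}" by (auto simp: LM_def)
 then have "F + F' = fz * (G + G') + (R + R')" "\<forall>m\<in>pkeys (R + R'). snd m \<in> {0, 1}"
  using Poly_Mapping.keys_add[of R R'] by (auto simp: algebra_simps)
 then show ?thesis unfolding LM_def by blast
qed

lemma LM_fz: "fz * G \<in> LM" unfolding LM_def by (intro CollectI exI[of _ G] exI[of _ 0]) auto

lemma LM_sum: "(!!i. i \<in> I ==> f i \<in> LM) ==> sum f I \<in> LM"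
 using LM_fz[of 0] by (induction I rule: infinite_finite_induct) (auto intro: LM_add)

lemma LM_low: "j \<in> {0, 1} ==> psingle (i, j) c \<in> LM" unfolding LM_def by (intro CollectI exI[of _ 0] exI[of _ "psingle (i, j) c"]) auto

lemma LM_up: "psingle (i, int n) c \<in> LM"
proof (induction n arbitrary: i c rule: less_induct)
 case (less n)
 show ?case
 proof (cases "n \<le> 1")
  case True
  then show ?thesis by (intro LM_low) auto
 next
  case False
  define w where "w = (i - int k, int n - 1)"
  have 1: "(int k, 1) + w = (i, int n)" "(int k, -1) + w = (i, int (n - 2))" "(int l, 0) + w = (int l + i - int k, int (n - 1))" for l
   using False by (auto simp: w_def of_nat_diff)
  have e: "psingle (i, int n) c = fz * psingle w (c / ca) +
   (psingle (i, int (n - 2)) (- (cb * (c / ca))) + (\<Sum>l\<le>2 * k. psingle (int l + i - int k, int (n - 1)) (- (z (int l, 0) * (c / ca)))))"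
   unfolding fz_mult_single 1 using ab_nz by (simp add: single_uminus sum_negf)
  show ?thesis unfolding e using False by (intro LM_add LM_fz LM_sum less.IH) auto
 qed
qed

lemma LM_down: "psingle (i, - int n) c \<in> LM"
proof (induction n arbitrary: i c rule: less_induct)
 case (less n)
 show ?case
 proof (cases "n = 0")
  case True
  then show ?thesis by (intro LM_low) auto
 next
  case False
  define w where "w = (i - int k, 1 - int n)"
  have 1: "(int k, 1) + w = (i, 2 - int n)" "(int k, -1) + w = (i, - int n)" "(int l, 0) + w = (int l + i - int k, - int (n - 1))" for l
   using False by (auto simp: w_def of_nat_diff)
  have 2: "psingle (i, 2 - int n) d \<in> LM" for d
  proof (cases "n = 1")
   case True
   then show ?thesis by (intro LM_low) auto
  next
   case False
   then have *: "2 - int n = - int (n - 2)" using \<open>n ~= 0\<close> by (auto simp: of_nat_diff)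
   show ?thesis unfolding * by (rule less.IH) (use \<open>n ~= 0\<close> in simp)
  qed
  have e: "psingle (i, - int n) c = fz * psingle w (c / cb) +
   (psingle (i, 2 - int n) (- (ca * (c / cb))) + (\<Sum>l\<le>2 * k. psingle (int l + i - int k, - int (n - 1)) (- (z (int l, 0) * (c / cb)))))"
   unfolding fz_mult_single 1 using ab_nz by (simp add: single_uminus sum_negf)
  show ?thesis unfolding e using False by (intro LM_add LM_fz LM_sum less.IH 2) auto
 qed
qed

lemma division: "\<exists>G R. F = fz * G + R & (\<forall>m\<in>pkeys R. snd m \<in> {0, 1})"
proof -
 have "psingle m c \<in> LM" for m c using LM_up[of "fst m" "nat (snd m)" c] LM_down[of "fst m" "nat (- snd m)" c] by (cases "snd m \<ge> 0") auto
 then have "(\<Sum>u\<in>pkeys F. psingle u (plookup F u)) \<in> LM" by (intro LM_sum)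
 then show ?thesis using poly_mapping_sum_single[of F] by (simp add: LM_def)
qed

text \<open>The remainder of the division by \<open>fz\<close> still vanishes on the curve, so it is
  zero by \<open>reduced_zero\<close>.\<close>

lemma vanishing_imp_multiple:
 assumes "!!s t. tc s t ==> leval id s t F = 0" shows "\<exists>G. F = fz * G"
proof -
 obtain G R where GR: "F = fz * G + R" "\<forall>m\<in>pkeys R. snd m \<in> {0, 1}" using division by blast
 have "leval id s t R = 0" if "tc s t" for s t using assms[OF that] that leval_mult[OF crhom_id, of s t fz G]
  by (simp add: GR(1) leval_simps[OF crhom_id] tc_def)
 then have "R = 0" using reduced_zero GR(2) by blast
 then show ?thesis using GR(1) by auto
qed

text \<open>Among the exponents of \<open>G\<close> minimizing \<open>la\<close>, the one minimizing \<open>\<tau>\<close> contributes to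
 the product with \<open>fz\<close> through the vertex \<open>v1\<close> only.\<close>

lemma support_quotient:
 fixes la \<tau> :: "int \<times> int => int"
 assumes l: "!!u v. la (u + v) = la u + la v" and t: "!!u v. \<tau> (u + v) = \<tau> u + \<tau> v"
  and v: "v1 \<in> vertices" "v2 \<in> A" "la v2 = la v1" "\<tau> v1 < \<tau> v2" and min: "!!m. m \<in> A ==> m ~= v1 ==> m ~= v2 ==> la v1 < la m"
  and bd: "!!m. m \<in> pkeys (fz * G) ==> bt \<le> la m" and u: "u \<in> pkeys G" shows "bt - la v1 \<le> la u"
proof -
 have lm: "la (u - v) = la u - la v" and tm: "\<tau> (u - v) = \<tau> u - \<tau> v" for u v using l[of "u - v" v] t[of "u - v" v] by simp_all
 define L where "L = Min (la ` pkeys G)"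
 define K where "K = {u \<in> pkeys G. la u = L}"
 have Lmin: "L \<le> la u" if "u \<in> pkeys G" for u unfolding L_def using that by (intro Min_le) auto
 have "L \<in> la ` pkeys G" unfolding L_def using u by (intro Min_in) auto
 then have K: "K ~= {}" "finite K" by (auto simp: K_def)
 then have "Min (\<tau> ` K) \<in> \<tau> ` K" by (intro Min_in) auto
 then obtain u0 where u0: "u0 \<in> K" "\<tau> u0 = Min (\<tau> ` K)" by auto
 have tmin: "\<tau> u0 \<le> \<tau> u" if "u \<in> K" for u unfolding u0(2) using that K by (intro Min_le) auto
 have "plookup (fz * G) (u0 + v1) = (\<Sum>m\<in>A. z m * plookup G (u0 + v1 - m))"
  unfolding fz_def sum_distrib_right lookup_sum lookup_single_mult ..
 also have "\<dots> = (\<Sum>m\<in>{v1}. z m * plookup G (u0 + v1 - m))"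
 proof (rule sum.mono_neutral_right[OF finite_A])
  show "{v1} <= A" using v vertices_A by auto
  show "\<forall>m\<in>A - {v1}. z m * plookup G (u0 + v1 - m) = 0"
  proof
   fix m assume m: "m \<in> A - {v1}"
   have "u0 + v1 - m \<notin> pkeys G"
   proof
    assume k: "u0 + v1 - m \<in> pkeys G"
    have l0: "la (u0 + v1 - m) = L + la v1 - la m" using u0 by (simp add: lm l K_def)
    show False
    proof (cases "m = v2")
     case True
     then have "u0 + v1 - m \<in> K" using k l0 v by (simp add: K_def)
     from tmin[OF this] show False using v(4) by (simp add: tm t True)
    next
     case False
     then show False using min[of m] m Lmin[OF k] l0 by auto
    qed
   qed
   then show "z m * plookup G (u0 + v1 - m) = 0" by (simp add: not_in_keys_iff_lookup_eq_zero)
  qed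
 qed
 also have "\<dots> = z v1 * plookup G u0" by simp
 also have "\<dots> ~= 0" using good[OF v(1)] u0 by (auto simp: K_def in_keys_iff)
 finally have "u0 + v1 \<in> pkeys (fz * G)" by (simp add: in_keys_iff)
 from bd[OF this] have "bt \<le> L + la v1" using u0 by (simp add: l K_def)
 then show ?thesis using Lmin[OF u] by linarith
qed

text \<open>Each side of the kite has integral length one, so its two ends are the only lattice
  points of the kite where the functional of that side is minimal. They serve as \<open>v1\<close>
  and \<open>v2\<close> in \<open>support_quotient\<close>, once for each side.\<close>

lemma bnd_quotient:
 assumes "bnd d (fz * G)" shows "G = 0 \<or> d \<ge> 1 & bnd (d - 1) G"
proof (cases "G = 0")
 case False
 have b: "0 \<le> fst u + int k * snd u" "0 \<le> fst u - int k * snd u"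
  "fst u + int k * snd u \<le> 2 * int k * int d - 2 * int k" "fst u - int k * snd u \<le> 2 * int k * int d - 2 * int k"
  if u: "u \<in> pkeys G" for u
 proof -
  show "0 \<le> fst u + int k * snd u"
  proof -
   have "0 - (fst (int k, - 1 :: int) + int k * snd (int k, - 1 :: int)) \<le> fst u + int k * snd u"
   proof (rule support_quotient[of "%m. fst m + int k * snd m" snd "(int k, - 1 :: int)" "(0 :: int, 0 :: int)" G "0" u])
    show "fst (int k, - 1 :: int) + int k * snd (int k, - 1 :: int) < fst m + int k * snd m" if "m \<in> A" "m ~= (int k, - 1 :: int)" "m ~= (0 :: int, 0 :: int)" for m
     using that k1 by (elim A_cases) auto
    show "0 \<le> fst m + int k * snd m" if "m \<in> pkeys (fz * G)" for m using assms that by (auto simp: bnd_def)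
   qed (use u k1 A_mem in \<open>auto simp: vertices_def ring_distribs\<close>)
   then show ?thesis by (simp add: algebra_simps)
  qed
  show "0 \<le> fst u - int k * snd u"
  proof -
   have "0 - (fst (0 :: int, 0 :: int) - int k * snd (0 :: int, 0 :: int)) \<le> fst u - int k * snd u"
   proof (rule support_quotient[of "%m. fst m - int k * snd m" snd "(0 :: int, 0 :: int)" "(int k, 1 :: int)" G "0" u])
    show "fst (0 :: int, 0 :: int) - int k * snd (0 :: int, 0 :: int) < fst m - int k * snd m" if "m \<in> A" "m ~= (0 :: int, 0 :: int)" "m ~= (int k, 1 :: int)" for m
     using that k1 by (elim A_cases) auto
    show "0 \<le> fst m - int k * snd m" if "m \<in> pkeys (fz * G)" for m using assms that by (auto simp: bnd_def)
   qed (use u k1 A_mem in \<open>auto simp: vertices_def ring_distribs\<close>)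
   then show ?thesis by (simp add: algebra_simps)
  qed
  show "fst u + int k * snd u \<le> 2 * int k * int d - 2 * int k"
  proof -
   have "- (2 * int k * int d) - (- fst (2 * int k, 0 :: int) - int k * snd (2 * int k, 0 :: int)) \<le> - fst u - int k * snd u"
   proof (rule support_quotient[of "%m. - fst m - int k * snd m" snd "(2 * int k, 0 :: int)" "(int k, 1 :: int)" G "- (2 * int k * int d)" u])
    show "- fst (2 * int k, 0 :: int) - int k * snd (2 * int k, 0 :: int) < - fst m - int k * snd m" if "m \<in> A" "m ~= (2 * int k, 0 :: int)" "m ~= (int k, 1 :: int)" for m
     using that k1 by (elim A_cases) auto
    show "- (2 * int k * int d) \<le> - fst m - int k * snd m" if "m \<in> pkeys (fz * G)" for m using assms that by (auto simp: bnd_def)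
   qed (use u k1 A_mem in \<open>auto simp: vertices_def ring_distribs\<close>)
   then show ?thesis by (simp add: algebra_simps)
  qed
  show "fst u - int k * snd u \<le> 2 * int k * int d - 2 * int k"
  proof -
   have "- (2 * int k * int d) - (- fst (int k, - 1 :: int) + int k * snd (int k, - 1 :: int)) \<le> - fst u + int k * snd u"
   proof (rule support_quotient[of "%m. - fst m + int k * snd m" snd "(int k, - 1 :: int)" "(2 * int k, 0 :: int)" G "- (2 * int k * int d)" u])
    show "- fst (int k, - 1 :: int) + int k * snd (int k, - 1 :: int) < - fst m + int k * snd m" if "m \<in> A" "m ~= (int k, - 1 :: int)" "m ~= (2 * int k, 0 :: int)" for m
     using that k1 by (elim A_cases) auto
    show "- (2 * int k * int d) \<le> - fst m + int k * snd m" if "m \<in> pkeys (fz * G)" for m using assms that by (auto simp: bnd_def)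
   qed (use u k1 A_mem in \<open>auto simp: vertices_def ring_distribs\<close>)
   then show ?thesis by (simp add: algebra_simps)
  qed
 qed
 obtain u where "u \<in> pkeys G" using False by (metis keys_eq_empty equals0I)
 then have "0 \<le> 2 * int k * int d - 2 * int k" using b(1,3) by fastforce
 then have "d \<ge> 1" using k1 by (cases d) auto
 moreover have "2 * int k * int d - 2 * int k = 2 * int k * int (d - 1)" using calculation by (simp add: of_nat_diff algebra_simps)
 ultimately show ?thesis using b by (auto simp: bnd_def)
qed simp

definition Y :: "(int \<times> int, 'a) ppoint set" where "Y = curve_support \<Delta> (proj_point z)"

lemma section_scale: "mpoly_eval (section_form \<Delta> (%v. c * z v)) w = c * mpoly_eval sec w" unfolding sec_def section_form_def mpoly_eval_sum
 by (simp add: mpoly_eval_single mval_single sum_distrib_left mult.assoc)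

lemma Y_iff: "q \<in> Y \<longleftrightarrow> q \<in> TS & vanishes_at sec q"
proof -
 have "(\<forall>a\<in>proj_point z. vanishes_at (section_form \<Delta> a) q) \<longleftrightarrow> vanishes_at sec q"
  using proj_point_self[of z] by (auto simp: proj_point_def vanishes_at_def section_scale) (auto simp: sec_def)
 then show ?thesis unfolding Y_def curve_support_def TS_def by auto
qed

lemma Y_TS: "q \<in> Y ==> q \<in> TS" and Y_space: "q \<in> Y ==> q \<in> proj_space A" using TS_space by (auto simp: Y_iff)

lemma tz_in_Y: "s ~= 0 ==> t ~= 0 ==> proj_point (tz s t) \<in> Y \<longleftrightarrow> tc s t"
 unfolding Y_iff tc_def using tz_in_TS[of s t] vanishes_at_iff[OF homogeneous_sec, of "tz s t"] by (simp add: mpoly_eval_tz tol_sec)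

text \<open>The quotient by \<open>fz\<close> is supported in the multiple \<open>d - 1\<close> of
  the kite and hence comes from a form, by normality of the kite. For \<open>d = 0\<close> the
  quotient is zero, so the truncated subtraction does no harm.\<close>

lemma form_vanishing_on_curve:
 assumes H: "homogeneous d H" and van: "!!s t. tc s t ==> mpoly_eval H (tz s t) = 0"
 shows "\<exists>G. homogeneous (d - 1) G & (\<forall>q\<in>TS. \<forall>w\<in>q. mpoly_eval H w = mpoly_eval G w * mpoly_eval sec w)"
proof -
 have "\<exists>G. tol H = fz * G" by (rule vanishing_imp_multiple) (use van in \<open>auto simp: tc_def mpoly_eval_tz\<close>)
 then obtain G where G: "tol H = fz * G" by blast
 have "bnd d (fz * G)" using bnd_tol[OF H] by (simp add: G)
 then consider "G = 0" | "d \<ge> 1" "bnd (d - 1) G" using bnd_quotient by blast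
 then show ?thesis
 proof cases
  case 1
  have 0: "homogeneous d (0 :: (int \<times> int, 'a) mpoly)" "homogeneous (d - 1) (0 :: (int \<times> int, 'a) mpoly)" "mpoly_eval (0 :: (int \<times> int, 'a) mpoly) w = 0" for w
   by (simp_all add: homogeneous_def mpoly_eval_def)
  show ?thesis using TS_eq[OF _ H 0(1)] 0 1 G by (intro exI[of _ 0]) (auto simp: tol_0)
 next
  case 2
  then obtain G' where G': "homogeneous (d - 1) G'" "tol G' = G" using bnd_imp_tol by blast
  have h: "homogeneous d (G' * sec)" using homogeneous_mult[OF G'(1) homogeneous_sec] 2 by simp
  have "tol H = tol (G' * sec)" by (simp add: tol_mult G' tol_sec G mult.commute)
  then show ?thesis using TS_eq[OF _ H h] G'(1) by (intro exI[of _ G']) (auto simp: mpoly_eval_mult)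
 qed
qed

lemma vanishes_on_Y:
 assumes H: "homogeneous d H" and van: "!!s t. tc s t ==> mpoly_eval H (tz s t) = 0" and q: "q \<in> Y" shows "vanishes_at H q"
 using form_vanishing_on_curve[OF H van] q by (fastforce simp: vanishes_at_def Y_iff)

text \<open>If a power of \<open>h\<close> lies in the local ideal, then the numerator of
  \<open>h\<close> vanishes at the torus points of the curve and is therefore a multiple of the
  section on the surface.\<close>

lemma curve_reduced: "curve_reduced \<Delta> (proj_point z)"
proof -
 have main: "in_local_ideal \<Delta> z m h" if m: "m \<in> A" and h: "h \<in> chart_functions m" and
  n: "in_local_ideal \<Delta> z m (%q. h q ^ n)" for m h n
 proof -
  obtain F d where F: "h = ratio F (mvar m d)" "homogeneous d F" using h by (auto simp: chart_functions_def)
  obtain g where g: "!!q. q \<in> chart \<Delta> m ==> h q ^ n = g q * local_equation \<Delta> z m q" using n by (auto simp: in_local_ideal_def)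
  have rep: "\<exists>w. w \<in> q & w m ~= 0 & (\<forall>F G. ratio F G q = mpoly_eval F w / mpoly_eval G w)"
   if q: "q \<in> chart \<Delta> m" for q :: "(int \<times> int, 'a) ppoint"
  proof -
   have nv: "\<not> vanishes_at (mvar m 1) q" and qT: "q \<in> TS" using q by (auto simp: chart_def TS_def)
   obtain w0 where w0: "q = proj_point w0" using proj_spaceE[OF TS_space[OF qT]] by blast
   define w where "w = (SOME w. w \<in> q)"
   have w: "w \<in> q" unfolding w_def by (rule someI[of _ w0]) (simp add: w0 proj_point_self)
   have "q = proj_point w" using proj_point_mem[of w w0] w w0 by simp
   then have "w m ~= 0" using nv vanishes_at_iff[OF homogeneous_mvar] by (metis mpoly_eval_mvar power_one_right)
   then show ?thesis using w by (intro exI[of _ w]) (auto simp: ratio_def w_def[symmetric] Let_def)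
  qed
  have "mpoly_eval F (tz s t) = 0" if tc: "tc s t" for s t
  proof -
   have st: "s ~= 0" "t ~= 0" using tc by (auto simp: tc_def)
   define q where "q = proj_point (tz s t)"
   have "\<not> vanishes_at (mvar m 1) q" unfolding q_def vanishes_at_iff[OF homogeneous_mvar] mpoly_eval_mvar using tz_nz[OF st m] by simp
   then have q: "q \<in> chart \<Delta> m" using tz_in_TS[OF st] by (simp add: chart_def TS_def q_def)
   obtain w where w: "w \<in> q" "w m ~= 0" "!!F G. ratio F G q = mpoly_eval F w / mpoly_eval G w" using rep[OF q] by blast
   have "q \<in> Y" unfolding q_def tz_in_Y[OF st] by (rule tc)
   then have "mpoly_eval sec w = 0" using w(1) by (simp add: Y_iff vanishes_at_def)
   then have "h q ^ n = 0" using g[OF q] w(3) by (simp add: local_equation_def sec_def)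
   then have "mpoly_eval F w = 0" using w by (cases "n = 0") (auto simp: F(1) mpoly_eval_mvar)
   then have "vanishes_at F q" using vanishes_at_iff[OF F(2), of w] proj_point_mem[of w "tz s t"] w(1) by (simp add: q_def)
   then show ?thesis unfolding q_def vanishes_at_iff[OF F(2)] .
  qed
  then obtain G where G: "homogeneous (d - 1) G" "!!q w. q \<in> TS ==> w \<in> q ==> mpoly_eval F w = mpoly_eval G w * mpoly_eval sec w"
   using form_vanishing_on_curve[OF F(2)] by blast
  show ?thesis
  proof (cases "d = 0")
   case False
   have "h q = ratio G (mvar m (d - 1)) q * local_equation \<Delta> z m q" if q: "q \<in> chart \<Delta> m" for q
   proof -
    obtain w where w: "w \<in> q" "w m ~= 0" "!!F G. ratio F G q = mpoly_eval F w / mpoly_eval G w" using rep[OF q] by blast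
    have "q \<in> TS" using q by (simp add: chart_def TS_def)
    moreover have "w m ^ d = w m ^ (d - 1) * w m" using False by (simp add: power_eq_if)
    ultimately show ?thesis using G(2)[OF _ w(1)] w(3) by (simp add: F(1) local_equation_def sec_def[symmetric] mpoly_eval_mvar)
   qed
   moreover have "ratio G (mvar m (d - 1)) \<in> chart_functions m" using G(1) by (auto simp: chart_functions_def)
   ultimately show ?thesis unfolding in_local_ideal_def by blast
  next
   case True
   \<comment> \<open>A form of degree \<open>0\<close> is constant, so vanishing at one point of the
     curve makes it zero.\<close>
   obtain s t where st: "tc s t" using ex_tc by blast
   have const: "mpoly_eval F w = mpoly_eval F w'" for w w'
    using F(2) True unfolding mpoly_eval_def homogeneous_def by (intro sum.cong refl) (auto intro!: prod.cong)
   have "mpoly_eval F w = 0" for w using const[of w "tz s t"] st \<open>!!s t. tc s t ==> mpoly_eval F (tz s t) = 0\<close> by simp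
   then have "h q = ratio 0 (mvar m 0) q * local_equation \<Delta> z m q" for q by (simp add: F(1) ratio_def Let_def mpoly_eval_def[of 0])
   moreover have "ratio 0 (mvar m 0) \<in> chart_functions m"
    unfolding chart_functions_def by (intro CollectI exI[of _ 0] exI[of _ "0::nat"]) (auto simp: homogeneous_def)
   ultimately show ?thesis unfolding in_local_ideal_def by blast
  qed
 qed
 show ?thesis unfolding curve_reduced_def
 proof (intro ballI allI impI)
  fix a m h n assume a: "a \<in> proj_point z" and m: "m \<in> lattice_points \<Delta>" and h: "h \<in> chart_functions m"
   and n: "in_local_ideal \<Delta> a m (%q. h q ^ n)"
  obtain c where c: "c ~= 0" "a = (%v. c * z v)" using a by (auto simp: proj_point_def)
  have le: "local_equation \<Delta> a m q = c * local_equation \<Delta> z m q" for q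
   unfolding c(2) local_equation_def ratio_def Let_def section_scale by (simp add: sec_def)
  have sc: "(%q. b * g q) \<in> chart_functions m" if g: "g \<in> chart_functions m" for g :: "(int \<times> int, 'a) ppoint => 'a" and b
  proof -
   obtain F d where F: "g = ratio F (mvar m d)" "homogeneous d F" using g by (auto simp: chart_functions_def)
   have "(%q. b * g q) = ratio (mconst b * F) (mvar m d)" by (auto simp: F ratio_def Let_def mpoly_eval_mult mpoly_eval_mconst)
   then show ?thesis unfolding chart_functions_def using homogeneous_smult[OF F(2)] by blast
  qed
  have "in_local_ideal \<Delta> z m (%q. h q ^ n)"
   using n unfolding in_local_ideal_def le by (metis (no_types, lifting) sc mult.assoc mult.left_commute)
  then have "in_local_ideal \<Delta> z m h" using main m h by (simp add: A_def)
  then obtain g where g: "g \<in> chart_functions m" "!!q. q \<in> chart \<Delta> m ==> h q = g q * local_equation \<Delta> z m q"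
   by (auto simp: in_local_ideal_def)
  then have "\<forall>q\<in>chart \<Delta> m. h q = (inverse c * g q) * local_equation \<Delta> a m q" using g(2) c(1) by (simp add: le)
  then show "in_local_ideal \<Delta> a m h" unfolding in_local_ideal_def by (intro bexI[OF _ sc[OF g(1), of "inverse c"]])
 qed
qed

lemma torically_transverse: "torically_transverse \<Delta> (proj_point z)" unfolding torically_transverse_def
proof (intro ballI impI notI)
 fix q assume q: "q \<in> toric_surface \<Delta>" and fin: "finite (torus_orbit q)" and sub: "torus_orbit q <= curve_support \<Delta> (proj_point z)"
 obtain v where v: "v \<in> vertices" "q = proj_point (pt v)" using finite_orbit_vertex[OF _ fin] q unfolding TS_def by blast
 have "torus_act (1::'a) 1 = id" by (auto simp: torus_act_def)
 then have "q \<in> torus_orbit q" unfolding torus_orbit_def by (intro CollectI exI[of _ 1]) auto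
 then have "q \<in> Y" using sub by (auto simp: Y_def)
 then have "mpoly_eval sec (pt v) = 0" unfolding Y_iff v(2) vanishes_at_iff[OF homogeneous_sec] by blast
 moreover have "mpoly_eval sec (pt v) = z v"
  unfolding mpoly_eval_sec pt_def using subsetD[OF vertices_A v(1)] finite_A by (simp add: sum.delta if_distrib cong: if_cong)
 ultimately show False using good[OF v(1)] by simp
qed

end

text \<open>A vertex gives a fixed point of the torus; if the coefficient there vanishes, this
  zero-dimensional orbit lies on the curve.\<close>

lemma (in kite_surface) transverse_imp_good:
 assumes c: "c \<in> linear_system \<Delta>" and tr: "torically_transverse \<Delta> c" shows "\<exists>z. c = proj_point z & good_curve k A z"
proof -
 obtain z where z: "c = proj_point z" "!!v. v \<notin> A ==> z v = 0" using proj_spaceE[OF c] by (metis A_def)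
 have "z v ~= 0" if v: "v \<in> vertices" for v
 proof
  assume zv: "z v = 0"
  let ?q = "proj_point (pt v) :: (int \<times> int, 'a) ppoint"
  have "torus_orbit ?q <= {?q}"
  proof -
   have "torus_act s t (pt v) = (%m. (s powi fst v * t powi snd v) * pt v m)" for s t :: 'a by (rule ext) (simp add: torus_act_def pt_def)
   then have "proj_point (torus_act s t (pt v)) = ?q" if "s ~= 0" "t ~= 0" for s t :: 'a
    using proj_point_scale[of "s powi fst v * t powi snd v" "pt v"] that by (simp add: power_int_eq_0_iff)
   then show ?thesis unfolding torus_orbit_def torus_act_proj_point by auto
  qed
  moreover have "?q \<in> curve_support \<Delta> c"
  proof -
   have "mpoly_eval (section_form \<Delta> a) (pt v) = 0" if a: "a \<in> c" for a
   proof -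
    obtain d where "a = (%v. d * z v)" using a unfolding z(1) proj_point_def by blast
    moreover have "mpoly_eval (section_form \<Delta> a) (pt v) = (\<Sum>m\<in>A. if m = v then a m else 0)"
     unfolding section_form_def A_def[symmetric] mpoly_eval_sum by (intro sum.cong refl) (auto simp: mpoly_eval_single mval_single pt_def)
    ultimately show ?thesis using finite_A zv by simp
   qed
   moreover have "homogeneous 1 (section_form \<Delta> a)" for a :: "int \<times> int => 'a"
    unfolding section_form_def by (intro homogeneous_sum homogeneous_single wt_single)
   ultimately show ?thesis unfolding curve_support_def using vertex_in_TS[OF v] vanishes_at_iff by (auto simp: TS_def) blast
  qed
  ultimately show False using tr vertex_in_TS[OF v] unfolding torically_transverse_def TS_def
   by (meson empty_subsetI finite.emptyI finite_insert finite_subset insert_subset order_trans)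
 qed
 then have "good_curve k A z" using z by unfold_locales auto
 then show ?thesis using z by blast
qed

section \<open>The generic point, irreducibility and the function field of the curve\<close>

lemma field_ring_iso:
 assumes "field F" and h: "h \<in> ring_iso F S" and zero: "h \<zero>\<^bsub>F\<^esub> = \<zero>\<^bsub>S\<^esub>" shows "field S"
 using field.ring_iso_imp_img_field[OF assms(1) h] unfolding zero by simp

lemma power_double: "x ^ (2 * n) = x ^ n * x ^ n" "x ^ (n * 2) = x ^ n * x ^ n" for x :: "'b::comm_monoid_mult"
 by (simp_all add: mult_2 mult_2_right power_add)

context good_curve
begin

lemma gen_nz: "gen ~= (0 :: 'a poly fract alg_closure)" using CG_ev_eq_0[of "[:0, 1:] :: 'a poly"] by (simp add: CG.kp_simps)

definition ww :: "'a poly fract alg_closure" where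
 "ww = (SOME w. w * w = - CG.ev PP * w - CG.ev QQ)"

lemma ww_eq: "ww * ww = - CG.ev PP * ww - CG.ev QQ"
proof -
 have "degree [:CG.ev QQ, CG.ev PP, 1:] > 0" by simp
 then obtain w where "poly [:CG.ev QQ, CG.ev PP, 1:] w = 0" using alg_closed_imp_poly_has_root by blast
 then have "CG.ev QQ + (w * CG.ev PP + w * w) = 0" by (simp add: distrib_left)
 then have "w * w = - CG.ev PP * w - CG.ev QQ"
  by (metis (no_types, opaque_lifting) add.commute add_diff_cancel_left' diff_minus_eq_add eq_neg_iff_add_eq_0 minus_diff_commute mult.commute mult_minus_left diff_0 add.assoc)
 then show ?thesis unfolding ww_def by (rule someI)
qed

lemma QQ_nz: "QQ ~= 0" using ab_nz by (simp add: QQ_def monom_eq_0_iff)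

lemma ww_nz: "ww ~= 0" using ww_eq QQ_nz CG_ev_eq_0[of QQ] by auto

text \<open>Solves \<open>ww = ca x^k y\<close>, the first term of the section, so that
  \<open>(gen, yy)\<close> is a point of the curve over the ambient field; for an irreducible curve
  it is a generic point.\<close>

definition yy :: "'a poly fract alg_closure" where "yy = ww / (cst ca * gen ^ k)"

lemma xk_nz: "cst ca * gen ^ k ~= 0" using ab_nz gen_nz by (simp add: CG.kp_simps)

lemma yy_nz: "yy ~= 0" using ww_nz xk_nz by (simp add: yy_def)

lemma ww_yy: "ww = cst ca * gen ^ k * yy" using xk_nz by (simp add: yy_def)

lemma leval_fz_yy: "leval cst gen yy fz = 0"
proof -
 define b where "b = cst cb * gen ^ k * inverse yy"
 have "ww * b = cst ca * gen ^ k * (cst cb * gen ^ k) * (yy * inverse yy)" by (simp only: ww_yy b_def mult_ac)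
 also have "\<dots> = CG.ev QQ" using yy_nz by (simp add: QQ_def CG.kp_simps power_double mult_ac)
 finally have wb: "ww * b = CG.ev QQ" .
 have "ww * (ww + b + CG.ev PP) = ww * ww + ww * b + CG.ev PP * ww" by (simp add: algebra_simps)
 also have "\<dots> = 0" unfolding wb ww_eq by simp
 finally have "ww * (ww + b + CG.ev PP) = 0" .
 moreover have "leval cst gen yy fz = ww + b + CG.ev PP" by (simp add: leval_fz[OF crhom_cst] ww_yy b_def CG.ev_def mult_ac)
 ultimately show ?thesis using ww_nz by simp
qed

definition lp :: "'a poly => int => 'a lau" where
 "lp p j = (\<Sum>i\<le>degree p. psingle (int i, j) (coeff p i))"

lemma leval_lp: "crhom kp ==> leval kp x y (lp p j) = poly (map_poly kp p) x * y powi j"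
proof -
 assume k: "crhom kp"
 have "poly (map_poly kp p) x = (\<Sum>i\<le>degree p. coeff (map_poly kp p) i * x ^ i)" by (rule poly_sum_upto) (rule map_poly_degree_leq)
 then show ?thesis unfolding lp_def leval_simps[OF k] by (simp add: coeff_map_poly crhomD[OF k] sum_distrib_right mult.assoc)
qed

lemma keys_lp: "m \<in> pkeys (lp p j) ==> snd m = j"
 unfolding lp_def using Poly_Mapping.keys_sum[of "%i. psingle (int i, j) (coeff p i)" "{..degree p}"] by (fastforce split: if_splits)

text \<open>The common monomial factor does not change the quotient, so every quotient of Laurent
  polynomials is one of forms of equal degree.\<close>

lemma ex_forms:
 fixes F1 F2 :: "'a lau"
 obtains d H1 H2 where "homogeneous d H1" "homogeneous d H2"
  "tol H1 = psingle (int k * int d, 0) 1 * F1" "tol H2 = psingle (int k * int d, 0) 1 * F2"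
proof -
 obtain d1 d2 where d: "\<forall>d\<ge>d1. bnd d (psingle (int k * int d, 0) 1 * F1)"
  "\<forall>d\<ge>d2. bnd d (psingle (int k * int d, 0) 1 * F2)" using bnd_large by metis
 define d where "d = max d1 d2"
 have "bnd d (psingle (int k * int d, 0) 1 * F1)" "bnd d (psingle (int k * int d, 0) 1 * F2)" using d by (simp_all add: d_def)
 then show thesis using bnd_imp_tol that by metis
qed

definition phi :: "(int \<times> int, 'a) mpoly => 'a poly fract alg_closure" where
 "phi H = leval cst gen yy (tol H)"

lemma phi_mult: "phi (F * G) = phi F * phi G" and phi_add: "phi (F + G) = phi F + phi G" and phi_mconst: "phi (mconst c) = cst c"
 by (simp_all add: phi_def tol_mult tol_add tol_mconst leval_mult[OF crhom_cst gen_nz yy_nz] leval_simps[OF crhom_cst])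

lemma vanishes_on_Y_iff:
 assumes "homogeneous d H" shows "(\<forall>q\<in>Y. vanishes_at H q) \<longleftrightarrow> (\<forall>s t. tc s t --> leval id s t (tol H) = 0)"
proof -
 have "leval id s t (tol H) = mpoly_eval H (tz s t)" if "tc s t" for s t using that by (simp add: mpoly_eval_tz tc_def)
 moreover have "vanishes_at H (proj_point (tz s t)) \<longleftrightarrow> mpoly_eval H (tz s t) = 0" for s t by (rule vanishes_at_iff[OF assms])
 ultimately show ?thesis using vanishes_on_Y[OF assms] tz_in_Y by (metis tc_def)
qed

lemma phi_vanishing:
 assumes "homogeneous d H" "\<forall>q\<in>Y. vanishes_at H q" shows "phi H = 0"
proof -
 have "\<exists>G. tol H = fz * G" by (rule vanishing_imp_multiple) (use vanishes_on_Y_iff[OF assms(1)] assms(2) in blast)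
 then show ?thesis by (auto simp: phi_def leval_mult[OF crhom_cst gen_nz yy_nz] leval_fz_yy)
qed

lemma Y_nonempty: "Y ~= {}" and Y_topspace: "Y <= topspace (zariski A)" using ex_tc tz_in_Y Y_space by (auto simp: topspace_zariski tc_def)

text \<open>A relation makes the norm of \<open>af + bt * ww\<close> zero, so the Laurent polynomial
  \<open>F1\<close> times its conjugate \<open>F2\<close> vanishes on the curve. By irreducibility
  one of them vanishes there, and being of degree at most one in \<open>y\<close> it is zero by
  \<open>reduced_zero\<close>.\<close>

lemma irreducible_imp_indep:
 assumes irr: "irreducible_in (zariski A) Y" and rel: "CG.ev af + CG.ev bt * ww = 0" shows "af = 0 & bt = 0"
proof (rule ccontr)
 assume nz: "\<not> (af = 0 & bt = 0)"
 have "CG.ev (af * af - af * bt * PP + bt * bt * QQ) = (CG.ev af + CG.ev bt * ww) * (CG.ev af - CG.ev bt * CG.ev PP - CG.ev bt * ww) + CG.ev bt * CG.ev bt * (ww * ww + CG.ev PP * ww + CG.ev QQ)"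
  by (simp add: algebra_simps)
 also have "\<dots> = 0" unfolding rel ww_eq by simp
 finally have N: "af * af - af * bt * PP + bt * bt * QQ = 0" using CG_ev_eq_0 by blast
 define F1 where "F1 = lp af 0 + lp (bt * monom ca k) 1"
 define F2 where "F2 = lp (af - bt * PP) 0 + lp (- (bt * monom ca k)) 1"
 have F: "leval id s t F1 = poly af s + poly bt s * (ca * s ^ k * t)"
  "leval id s t F2 = poly af s - poly bt s * poly PP s - poly bt s * (ca * s ^ k * t)" for s t
  by (simp_all add: F1_def F2_def leval_simps[OF crhom_id] leval_lp[OF crhom_id] poly_monom)
 have prod: "leval id s t F1 * leval id s t F2 = 0" if "tc s t" for s t
 proof -
  define w where "w = ca * s ^ k * t"
  have "w * w + poly PP s * w + poly QQ s = ca * s ^ k * (leval id s t fz * t)"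
   using that unfolding tc_def by (subst leval_fz_mult) (simp_all add: w_def QQ_def poly_monom power_double algebra_simps)
  then have w: "w * w = - poly PP s * w - poly QQ s" using that by (simp add: tc_def algebra_simps eq_neg_iff_add_eq_0)
  have "leval id s t F1 * leval id s t F2 = poly af s * poly af s - poly af s * poly bt s * poly PP s - poly bt s * poly bt s * (w * w + poly PP s * w)"
   unfolding F w_def[symmetric] by (simp add: algebra_simps)
  also have "\<dots> = poly (af * af - af * bt * PP + bt * bt * QQ) s" unfolding w by simp
  finally show ?thesis by (simp add: N)
 qed
 obtain d H1 H2 where H: "homogeneous d H1" "homogeneous d H2"
  "tol H1 = psingle (int k * int d, 0) 1 * F1" "tol H2 = psingle (int k * int d, 0) 1 * F2" by (rule ex_forms)
 have ev: "leval id s t (psingle (int k * int d, 0) 1 * F) = s powi (int k * int d) * leval id s t F" if "tc s t" for s t F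
  using that by (simp add: tc_def leval_mult[OF crhom_id] leval_simps[OF crhom_id])
 have "leval id s t (tol (H1 * H2)) = 0" if "tc s t" for s t
 proof -
  have "leval id s t (tol (H1 * H2)) = leval id s t (tol H1) * leval id s t (tol H2)"
   using that by (simp add: tol_mult leval_mult[OF crhom_id] tc_def)
  then show ?thesis using prod[OF that] by (auto simp: H ev[OF that])
 qed
 then have "\<forall>q\<in>Y. vanishes_at (H1 * H2) q" using vanishes_on_Y_iff[OF homogeneous_mult[OF H(1,2)]] by blast
 then have "Y <= {q \<in> proj_space A. vanishes_at H1 q} \<union> {q \<in> proj_space A. vanishes_at H2 q}"
  using vanishes_at_mult[OF Y_space H(1,2)] Y_space by blast
 then have "Y <= {q \<in> proj_space A. vanishes_at H1 q} \<or> Y <= {q \<in> proj_space A. vanishes_at H2 q}"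
  using irr closedin_zariski[OF H(1)] closedin_zariski[OF H(2)] unfolding irreducible_in_def by blast
 then have "(\<forall>q\<in>Y. vanishes_at H1 q) \<or> (\<forall>q\<in>Y. vanishes_at H2 q)" by blast
 then have "(\<forall>s t. tc s t --> leval id s t F1 = 0) \<or> (\<forall>s t. tc s t --> leval id s t F2 = 0)"
  unfolding vanishes_on_Y_iff[OF H(1)] vanishes_on_Y_iff[OF H(2)] by (auto simp: H ev) (auto simp: tc_def)
 moreover have "snd m \<in> {0, 1}" if "m \<in> pkeys F1 \<or> m \<in> pkeys F2" for m
  using that Poly_Mapping.keys_add[of "lp af 0" "lp (bt * monom ca k) 1"]
   Poly_Mapping.keys_add[of "lp (af - bt * PP) 0" "lp (- (bt * monom ca k)) 1"] keys_lp unfolding F1_def F2_def by blast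
 ultimately have "F1 = 0 \<or> F2 = 0" using reduced_zero[of F1] reduced_zero[of F2] by blast
 then have "leval cst gen yy F1 = 0 \<or> leval cst gen yy F2 = 0" using leval_simps(4)[OF crhom_cst] by metis
 moreover have "\<forall>s t. leval id s t F1 = 0 \<or> F1 ~= 0" "\<forall>s t. leval id s t F2 = 0 \<or> F2 ~= 0"
  using leval_simps(4)[OF crhom_id] by metis+
 ultimately consider "\<forall>s t. poly af s + poly bt s * (ca * s ^ k * t) = 0"
  | "\<forall>s t. poly af s - poly bt s * poly PP s - poly bt s * (ca * s ^ k * t) = 0"
  using \<open>F1 = 0 \<or> F2 = 0\<close> unfolding F by blast
 then have "bt = 0 & af = 0"
 proof cases
  case 1
  \<comment> \<open>No negative powers of \<open>y\<close> occur, so the evaluation at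
    \<open>t = 0\<close> is legitimate.\<close>
  have a: "poly af s = 0" for s using 1[rule_format, of s 0] by simp
  have "poly bt s = 0" if "s \<notin> {0}" for s using 1[rule_format, of s 1] a that ab_nz by simp
  then show ?thesis using a poly_eq_0_cofinite[of "{0}" bt] poly_eq_0_cofinite[of "{}" af] by blast
 next
  case 2
  have a: "poly af s - poly bt s * poly PP s = 0" for s using 2[rule_format, of s 0] by simp
  have "poly bt s = 0" if "s \<notin> {0}" for s using 2[rule_format, of s 1] a that ab_nz by simp
  then have "bt = 0" using poly_eq_0_cofinite[of "{0}" bt] by blast
  then show ?thesis using a poly_eq_0_cofinite[of "{}" af] by simp
 qed
 then show False using nz by blast
qed

end

locale irr_curve = good_curve +
 assumes indep: "CG.ev af + CG.ev bt * ww = 0 ==> af = 0 & bt = 0"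
begin

sublocale Q: quadratic_curve cst gen ww PP QQ by unfold_locales (rule ww_eq, rule indep)

text \<open>Vanishing at the generic point is vanishing on the curve: division by \<open>fz\<close>
  leaves a remainder of \<open>y\<close>-degree at most one, which \<open>indep\<close> makes
  zero.\<close>

lemma leval_eq_0_iff: "leval cst gen yy F = 0 \<longleftrightarrow> (\<forall>s t. tc s t --> leval id s t F = 0)"
proof
 assume 0: "leval cst gen yy F = 0"
 obtain G R where GR: "F = fz * G + R" "\<forall>m\<in>pkeys R. snd m \<in> {0, 1}" using division by blast
 obtain N M where box: "lau_box N M R" using ex_lau_box[of R] GR(2) by blast
 define r0 r1 where "r0 = lau_part N M 0 R" and "r1 = lau_part N M 1 R"
 have "leval cst gen yy R = 0" using 0 by (simp add: GR(1) leval_simps[OF crhom_cst] leval_mult[OF crhom_cst gen_nz yy_nz] leval_fz_yy)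
 then have "CG.ev r0 + CG.ev r1 * yy = 0" using leval_lau_box[OF crhom_cst gen_nz box, of yy] by (simp add: CG.ev_def r0_def r1_def)
 then have "(cst ca * gen ^ k) * (CG.ev r0 + CG.ev r1 * yy) = 0" by simp
 then have "CG.ev (monom ca k * r0) + CG.ev r1 * ww = 0" by (simp add: ww_yy algebra_simps)
 then have "monom ca k * r0 = 0 & r1 = 0" by (rule indep)
 then have "R = 0" using lau_box_zero[OF box] ab_nz by (simp add: r0_def r1_def monom_eq_0_iff)
 then show "\<forall>s t. tc s t --> leval id s t F = 0" by (auto simp: GR(1) tc_def leval_mult[OF crhom_id])
next
 assume "\<forall>s t. tc s t --> leval id s t F = 0"
 then obtain G where "F = fz * G" using vanishing_imp_multiple by blast
 then show "leval cst gen yy F = 0" by (simp add: leval_mult[OF crhom_cst gen_nz yy_nz] leval_fz_yy)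
qed

lemma phi_eq_0_iff: "homogeneous d H ==> phi H = 0 \<longleftrightarrow> (\<forall>q\<in>Y. vanishes_at H q)"
 by (simp add: phi_def leval_eq_0_iff vanishes_on_Y_iff)

lemma irreducible_Y: "irreducible_in (zariski A) Y" unfolding irreducible_in_def
proof (intro conjI allI impI Y_nonempty Y_topspace)
 fix C1 C2 assume C: "closedin (zariski A) C1 & closedin (zariski A) C2 & Y <= C1 \<union> C2"
 show "Y <= C1 \<or> Y <= C2"
 proof (rule ccontr)
  assume "\<not> (Y <= C1 \<or> Y <= C2)"
  then obtain q1 q2 where q: "q1 \<in> Y" "q1 \<notin> C1" "q2 \<in> Y" "q2 \<notin> C2" by blast
  obtain F1 d1 where F1: "homogeneous d1 F1" "\<not> vanishes_at F1 q1" "\<forall>c\<in>C1. vanishes_at F1 c"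
   using closedin_separating[of A C1 q1] C q Y_space by blast
  obtain F2 d2 where F2: "homogeneous d2 F2" "\<not> vanishes_at F2 q2" "\<forall>c\<in>C2. vanishes_at F2 c"
   using closedin_separating[of A C2 q2] C q Y_space by blast
  have "\<forall>q\<in>Y. vanishes_at (F1 * F2) q" using vanishes_at_mult[OF Y_space F1(1) F2(1)] F1(3) F2(3) C by blast
  then have "phi F1 * phi F2 = 0" using phi_vanishing[OF homogeneous_mult[OF F1(1) F2(1)]] by (simp add: phi_mult)
  then show False using phi_eq_0_iff[OF F1(1)] phi_eq_0_iff[OF F2(1)] q F1(2) F2(2) by auto
 qed
qed

lemma open_meet:
 assumes "openin (zariski A) U" "U \<inter> Y ~= {}" "openin (zariski A) V" "V \<inter> Y ~= {}" shows "U \<inter> V \<inter> Y ~= {}"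
proof
 assume "U \<inter> V \<inter> Y = {}"
 then have "Y <= (topspace (zariski A) - U) \<union> (topspace (zariski A) - V)" using Y_topspace by blast
 moreover have "closedin (zariski A) (topspace (zariski A) - U)" "closedin (zariski A) (topspace (zariski A) - V)" using assms by auto
 ultimately have "Y <= topspace (zariski A) - U \<or> Y <= topspace (zariski A) - V" using irreducible_Y unfolding irreducible_in_def by blast
 then show False using assms by blast
qed

abbreviation "gm \<equiv> germ A Y"

lemma germ_eqI:
 assumes "openin (zariski A) U" "U \<inter> Y ~= {}" "!!q. q \<in> U \<inter> Y ==> h q = h' q" shows "gm h = gm h'"
proof -
 have "gm f <= gm f'" if f: "!!q. q \<in> U \<inter> Y ==> f q = f' q" for f f'
 proof
  fix x assume "x \<in> gm f"
  then obtain V where "openin (zariski A) V" "V \<inter> Y ~= {}" "\<forall>q\<in>V \<inter> Y. x q = f q" by (auto simp: germ_def)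
  then show "x \<in> gm f'" unfolding germ_def using f assms(1,2) open_meet[of U V] by (intro CollectI exI[of _ "U \<inter> V"]) auto
 qed
 then show ?thesis using assms(3) by (metis subset_antisym)
qed

lemma germ_self: "h \<in> gm h" unfolding germ_def using Y_nonempty Y_topspace by (intro CollectI exI[of _ "topspace (zariski A)"]) auto

text \<open>\<open>function_field\<close> defines its operations as unions over representatives; all
  members of such a union agree, because nonempty open subsets of \<open>Y\<close> meet.\<close>

lemma germ_op: "(\<Union>x\<in>gm h. \<Union>z\<in>gm h'. gm (%q. f (x q) (z q))) = gm (%q. f (h q) (h' q))"
proof -
 have "gm (%q. f (x q) (z q)) = gm (%q. f (h q) (h' q))" if xz: "x \<in> gm h" "z \<in> gm h'" for x z
 proof -
  obtain U where U: "openin (zariski A) U" "U \<inter> Y ~= {}" "\<forall>q\<in>U \<inter> Y. x q = h q" using xz(1) by (auto simp: germ_def)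
  obtain V where V: "openin (zariski A) V" "V \<inter> Y ~= {}" "\<forall>q\<in>V \<inter> Y. z q = h' q" using xz(2) by (auto simp: germ_def)
  show ?thesis using U V open_meet[of U V] by (intro germ_eqI[of "U \<inter> V"]) auto
 qed
 then show ?thesis using germ_self[of h] germ_self[of h'] by blast
qed

definition adm :: "(int \<times> int, 'a) mpoly => (int \<times> int, 'a) mpoly => bool" where
 "adm F G \<longleftrightarrow> (\<exists>d. homogeneous d F & homogeneous d G) & phi G ~= 0"

lemma ratio_point:
 assumes "q \<in> Y"
 obtains w where "q = proj_point w" "!!F G. ratio F G q = mpoly_eval F w / mpoly_eval G w"
proof -
 obtain w0 where w0: "q = proj_point w0" using proj_spaceE[OF Y_space[OF assms]] by blast
 define w where "w = (SOME w. w \<in> q)"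
 have "w \<in> q" unfolding w_def by (rule someI[of _ w0]) (simp add: w0 proj_point_self)
 then have "q = proj_point w" using proj_point_mem[of w w0] w0 by simp
 moreover have "ratio F G q = mpoly_eval F w / mpoly_eval G w" for F G by (simp add: ratio_def w_def[symmetric] Let_def)
 ultimately show thesis by (rule that)
qed

lemma nonvanishing_open:
 assumes "homogeneous d G" "phi G ~= 0"
 shows "openin (zariski A) {q \<in> proj_space A. \<not> vanishes_at G q}" "{q \<in> proj_space A. \<not> vanishes_at G q} \<inter> Y ~= {}"
 using assms openin_zariski[OF assms(1)] phi_eq_0_iff[OF assms(1)] Y_space by auto

text \<open>Where both denominators are nonzero, equality of the two ratios is the vanishing of the
  single form \<open>H\<close>, which is decided at the generic point.\<close>

lemma germ_eq_iff:
 assumes "adm F G" "adm F' G'" shows "gm (ratio F G) = gm (ratio F' G') \<longleftrightarrow> phi F * phi G' = phi F' * phi G"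
proof -
 obtain d d' where d: "homogeneous d F" "homogeneous d G" "homogeneous d' F'" "homogeneous d' G'" and nz: "phi G ~= 0" "phi G' ~= 0"
  using assms by (auto simp: adm_def)
 define H where "H = F * G' + mconst (-1) * (F' * G)"
 have H: "homogeneous (d + d') H" unfolding H_def using homogeneous_mult[OF d(1,4)] homogeneous_smult[OF homogeneous_mult[OF d(3,2)], of "-1"]
  by (intro homogeneous_add) (simp_all add: add.commute)
 have phiH: "phi H = phi F * phi G' - phi F' * phi G" by (simp add: H_def phi_add phi_mult phi_mconst CG.kp_simps)
 define U where "U = {q \<in> proj_space A. \<not> vanishes_at (G * G') q}"
 have GG: "homogeneous (d + d') (G * G')" "phi (G * G') ~= 0" using homogeneous_mult[OF d(2,4)] nz by (auto simp: phi_mult)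
 note U = nonvanishing_open[OF GG, folded U_def]
 have eq: "ratio F G q = ratio F' G' q \<longleftrightarrow> vanishes_at H q" if q: "q \<in> U \<inter> Y" for q
 proof -
  obtain w where w: "q = proj_point w" "!!F G. ratio F G q = mpoly_eval F w / mpoly_eval G w" using ratio_point q by blast
  have "mpoly_eval G w * mpoly_eval G' w ~= 0" using q GG(1) vanishes_at_iff[OF GG(1)] by (simp add: U_def w(1) mpoly_eval_mult)
  then show ?thesis unfolding w(1) vanishes_at_iff[OF H] unfolding w(1)[symmetric] w(2)
   by (simp add: H_def mpoly_eval_add mpoly_eval_mult mpoly_eval_mconst frac_eq_eq)
 qed
 show ?thesis
 proof
  assume "gm (ratio F G) = gm (ratio F' G')"
  then have "ratio F G \<in> gm (ratio F' G')" using germ_self by blast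
  then obtain V where V: "openin (zariski A) V" "V \<inter> Y ~= {}" "\<forall>q\<in>V \<inter> Y. ratio F G q = ratio F' G' q"
   by (auto simp: germ_def)
  have "phi H = 0"
  proof (rule ccontr)
   assume "phi H ~= 0"
   note W = nonvanishing_open[OF H this]
   have "openin (zariski A) (U \<inter> V)" "(U \<inter> V) \<inter> Y ~= {}" using U V open_meet by blast+
   from open_meet[OF this W] show False using eq V(3) by blast
  qed
  then show "phi F * phi G' = phi F' * phi G" using phiH by simp
 next
  assume "phi F * phi G' = phi F' * phi G"
  then have "\<forall>q\<in>Y. vanishes_at H q" using phi_eq_0_iff[OF H] phiH by simp
  then show "gm (ratio F G) = gm (ratio F' G')" using eq by (intro germ_eqI[OF U]) auto
 qed
qed

lemma adm_mult: "adm F G ==> adm F' G' ==> adm (F * F') (G * G')" unfolding adm_def phi_mult by (metis homogeneous_mult mult_eq_0_iff)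

lemma adm_add: "adm F G ==> adm F' G' ==> adm (F * G' + F' * G) (G * G')"
 unfolding adm_def phi_mult by (metis add.commute homogeneous_add homogeneous_mult mult_eq_0_iff)

lemma adm_const: "adm (mconst c) (mconst 1)" unfolding adm_def phi_mconst using homogeneous_mconst by (auto simp: CG.kp_simps)

lemma germ_const: "gm (%q. c) = gm (ratio (mconst c) (mconst 1))"
proof -
 have "(%q. c) = ratio (mconst c) (mconst 1)" by (simp add: ratio_def Let_def mpoly_eval_mconst fun_eq_iff)
 then show ?thesis by (rule arg_cong[of _ _ gm])
qed

abbreviation "FF \<equiv> function_field A Y"

lemma carrier_FF: "carrier FF = {gm (ratio F G) | F G. adm F G}"
proof -
 have "(\<exists>q\<in>Y. \<not> vanishes_at G q) \<longleftrightarrow> phi G ~= 0" if "homogeneous d G" for d G using phi_eq_0_iff[OF that] by blast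
 then show ?thesis unfolding function_field_def adm_def by auto metis+
qed

lemma mult_FF: "gm h \<otimes>\<^bsub>FF\<^esub> gm h' = gm (%q. h q * h' q)"
 unfolding function_field_def monoid.simps ring.simps partial_object.simps by (rule germ_op)

lemma add_FF: "gm h \<oplus>\<^bsub>FF\<^esub> gm h' = gm (%q. h q + h' q)"
 unfolding function_field_def monoid.simps ring.simps partial_object.simps by (rule germ_op)

lemma ratio_mult: "(%q. ratio F G q * ratio F' G' q) = ratio (F * F') (G * G')" by (simp add: ratio_def Let_def mpoly_eval_mult fun_eq_iff)

lemma ratio_add:
 assumes "adm F G" "adm F' G'" shows "gm (%q. ratio F G q + ratio F' G' q) = gm (ratio (F * G' + F' * G) (G * G'))"
proof -
 obtain d d' where d: "homogeneous d G" "homogeneous d' G'" and nz: "phi G ~= 0" "phi G' ~= 0" using assms by (auto simp: adm_def)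
 have GG: "homogeneous (d + d') (G * G')" "phi (G * G') ~= 0" using homogeneous_mult[OF d] nz by (auto simp: phi_mult)
 show ?thesis
 proof (rule germ_eqI[OF nonvanishing_open[OF GG]])
  fix q assume q: "q \<in> {q \<in> proj_space A. \<not> vanishes_at (G * G') q} \<inter> Y"
  obtain w where w: "q = proj_point w" "!!F G. ratio F G q = mpoly_eval F w / mpoly_eval G w" using ratio_point q by blast
  have "mpoly_eval G w * mpoly_eval G' w ~= 0" using q vanishes_at_iff[OF GG(1)] by (simp add: w(1) mpoly_eval_mult)
  then show "ratio F G q + ratio F' G' q = ratio (F * G' + F' * G) (G * G') q" by (simp add: w(2) mpoly_eval_add mpoly_eval_mult add_frac_eq)
 qed
qed

text \<open>Sends the value of a ratio at the generic point to its germ; by \<open>iso_eq\<close>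
  the choice is immaterial.\<close>

definition iso :: "'a poly fract alg_closure => ((int \<times> int, 'a) ppoint => 'a) set" where
 "iso x = (SOME g. \<exists>F G. adm F G & x = phi F / phi G & g = gm (ratio F G))"

lemma iso_eq: "adm F G ==> iso (phi F / phi G) = gm (ratio F G)"
proof -
 assume a: "adm F G"
 have "\<exists>F' G'. adm F' G' & phi F / phi G = phi F' / phi G' & iso (phi F / phi G) = gm (ratio F' G')"
  unfolding iso_def by (rule someI[of _ "gm (ratio F G)"]) (use a in blast)
 then obtain F' G' where *: "adm F' G'" "phi F / phi G = phi F' / phi G'" "iso (phi F / phi G) = gm (ratio F' G')" by blast
 have "phi F * phi G' = phi F' * phi G" using *(1,2) a by (simp add: adm_def frac_eq_eq)
 then show ?thesis using germ_eq_iff[OF a *(1)] *(3) by simp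
qed

lemma yy_ff: "yy \<in> Q.ff"
proof -
 have "cst ca \<in> Q.ff" using Q.kF by blast
 then show ?thesis unfolding yy_def by (intro Q.F_div Q.F_mult Q.F_power Q.W_ff Q.X_ff)
qed

lemma phi_ff: "phi H \<in> Q.ff"
proof -
 have "(\<Sum>m\<in>S. cst (f m) * (gen powi fst m * yy powi snd m)) \<in> Q.ff" for S and f :: "int \<times> int => 'a"
 proof (induction S rule: infinite_finite_induct)
  case (insert m S)
  have "cst (f m) \<in> Q.ff" using Q.kF by blast
  then have "cst (f m) * (gen powi fst m * yy powi snd m) \<in> Q.ff" by (intro Q.F_mult Q.F_powi Q.X_ff yy_ff)
  then show ?case using insert Q.F_add by simp
 qed (simp_all add: Q.F0)
 then show ?thesis unfolding phi_def leval_def plin_def by blast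
qed

lemma ff_adm: "x \<in> Q.ff ==> \<exists>F G. adm F G & x = phi F / phi G"
proof -
 assume "x \<in> Q.ff"
 then obtain a ga where x: "a \<in> Q.PE" "ga ~= 0" "x = a / CG.ev ga" by (rule Q.ffE)
 then obtain af bt where a: "a = CG.ev af + CG.ev bt * ww" by (auto simp: Q.PE_def Q.E_def)
 obtain d H1 H2 where H: "homogeneous d H1" "homogeneous d H2"
  "tol H1 = psingle (int k * int d, 0) 1 * (lp af 0 + lp (bt * monom ca k) 1)"
  "tol H2 = psingle (int k * int d, 0) 1 * lp ga 0" by (rule ex_forms)
 define u :: "'a poly fract alg_closure" where "u = gen powi (int k * int d)"
 have "u ~= 0" using gen_nz by (auto simp: u_def)
 moreover have "phi H1 = u * a" "phi H2 = u * CG.ev ga" unfolding phi_def H(3,4)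
  by (simp_all add: leval_mult[OF crhom_cst gen_nz yy_nz] leval_simps[OF crhom_cst] leval_lp[OF crhom_cst] u_def CG.ev_def[symmetric] a ww_yy CG.kp_simps mult_ac)
 ultimately show ?thesis using H(1,2) x(2) CG_ev_eq_0[of ga] by (intro exI[of _ H1] exI[of _ H2]) (auto simp: adm_def x(3))
qed

abbreviation "FR \<equiv> subfield_record Q.ff"

lemma iso_const: "iso (cst c) = gm (%q. c)" using iso_eq[OF adm_const, of c] by (simp add: germ_const phi_mconst CG.kp_simps)

lemma iso_ring_iso: "iso \<in> ring_iso FR FF"
proof -
 have one: "\<one>\<^bsub>FF\<^esub> = gm (%q. 1)" by (simp add: function_field_def)
 have mem: "iso x \<in> carrier FF" if "x \<in> Q.ff" for x using ff_adm[OF that] iso_eq unfolding carrier_FF by blast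
 have "iso \<in> ring_hom FR FF"
 proof (rule ring_hom_memI)
  fix x assume "x \<in> carrier FR"
  then show "iso x \<in> carrier FF" using mem by simp
 next
  fix x y assume "x \<in> carrier FR" "y \<in> carrier FR"
  then have xy: "x \<in> Q.ff" "y \<in> Q.ff" by simp_all
  obtain F G where F: "adm F G" "x = phi F / phi G" using ff_adm[OF xy(1)] by blast
  obtain F' G' where F': "adm F' G'" "y = phi F' / phi G'" using ff_adm[OF xy(2)] by blast
  have nz: "phi G ~= 0" "phi G' ~= 0" using F(1) F'(1) by (auto simp: adm_def)
  show "iso (x \<otimes>\<^bsub>FR\<^esub> y) = iso x \<otimes>\<^bsub>FF\<^esub> iso y"
   using iso_eq[OF adm_mult[OF F(1) F'(1)]] iso_eq[OF F(1)] iso_eq[OF F'(1)] by (simp add: F(2) F'(2) mult_FF ratio_mult phi_mult)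
  show "iso (x \<oplus>\<^bsub>FR\<^esub> y) = iso x \<oplus>\<^bsub>FF\<^esub> iso y"
   using iso_eq[OF adm_add[OF F(1) F'(1)]] iso_eq[OF F(1)] iso_eq[OF F'(1)] nz
   by (simp add: F(2) F'(2) add_FF ratio_add[OF F(1) F'(1)] phi_mult phi_add add_frac_eq)
 next
  show "iso \<one>\<^bsub>FR\<^esub> = \<one>\<^bsub>FF\<^esub>" using iso_const[of 1] by (simp add: one CG.kp_simps)
 qed
 moreover have "bij_betw iso (carrier FR) (carrier FF)" unfolding bij_betw_def
 proof
  show "inj_on iso (carrier FR)"
  proof (rule inj_onI)
   fix x y assume "x \<in> carrier FR" "y \<in> carrier FR" and e: "iso x = iso y"
   then have xy: "x \<in> Q.ff" "y \<in> Q.ff" by simp_all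
   obtain F G where F: "adm F G" "x = phi F / phi G" using ff_adm[OF xy(1)] by blast
   obtain F' G' where F': "adm F' G'" "y = phi F' / phi G'" using ff_adm[OF xy(2)] by blast
   have nz: "phi G ~= 0" "phi G' ~= 0" using F(1) F'(1) by (auto simp: adm_def)
   have "phi F * phi G' = phi F' * phi G" using e germ_eq_iff[OF F(1) F'(1)] by (simp add: F(2) F'(2) iso_eq[OF F(1)] iso_eq[OF F'(1)])
   then show "x = y" using nz by (simp add: F(2) F'(2) frac_eq_eq)
  qed
  show "iso ` carrier FR = carrier FF"
  proof
   show "iso ` carrier FR <= carrier FF" using mem by auto
   show "carrier FF <= iso ` carrier FR"
   proof
    fix g assume "g \<in> carrier FF"
    then obtain F G where F: "adm F G" "g = gm (ratio F G)" by (auto simp: carrier_FF)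
    then have "g = iso (phi F / phi G)" by (simp add: iso_eq)
    moreover have "phi F / phi G \<in> carrier FR" using Q.F_div phi_ff by simp
    ultimately show "g \<in> iso ` carrier FR" by blast
   qed
  qed
 qed
 ultimately show ?thesis by (simp add: ring_iso_def)
qed

lemma field_FF: "field FF"
proof (rule field_ring_iso[OF Q.field_FR iso_ring_iso])
 show "iso \<zero>\<^bsub>FR\<^esub> = \<zero>\<^bsub>FF\<^esub>" using iso_const[of 0] by (simp add: function_field_def CG.kp_simps)
qed

lemma constants_image: "iso ` range cst = constant_functions A Y" by (auto simp: constant_functions_def iso_const image_iff)

theorem genus_conductor:
 "\<exists>S s. conductor PP QQ S s & (\<forall>S' s'. conductor PP QQ S' s' --> degree S' \<le> degree S) &
  degree S < 2 * k & (\<forall>g. geometric_genus \<Delta> (proj_point z) g \<longleftrightarrow> g = 2 * k - 1 - degree S)" proof -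
 have "degree QQ \<le> 2 * k" by (simp add: QQ_def degree_monom_le)
 then obtain S s where S: "conductor PP QQ S s" "\<forall>S' s'. conductor PP QQ S' s' --> degree S' \<le> degree S"
  "degree S < 2 * k" and g: "has_genus FR (range cst) (2 * k - 1 - degree S)" using Q.genus_conductor[OF degree_PP _ _ disc_nz] k1 by auto
 interpret field_iso FR FF iso "range cst" using Q.field_FR field_FF iso_ring_iso Q.subfield_k by (simp add: field_iso_def field_iso_axioms_def)
 have "has_genus FF (constant_functions A Y) (2 * k - 1 - degree S)" using has_genus_image[OF g] by (simp add: constants_image)
 then have "\<forall>g. geometric_genus \<Delta> (proj_point z) g \<longleftrightarrow> g = 2 * k - 1 - degree S"
  unfolding geometric_genus_def Y_def[symmetric] A_def[symmetric] using has_genus_unique by metis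
 then show ?thesis using S by blast
qed

end

context good_curve
begin

lemma curve_irreducible_iff: "curve_irreducible \<Delta> (proj_point z) \<longleftrightarrow> irr_curve k A z"
proof
 assume "curve_irreducible \<Delta> (proj_point z)"
 then have "irreducible_in (zariski A) Y" by (simp add: curve_irreducible_def Y_def A_def)
 then show "irr_curve k A z" using irreducible_imp_indep by unfold_locales blast
next
 assume "irr_curve k A z"
 then interpret irr_curve k A z .
 show "curve_irreducible \<Delta> (proj_point z)" using irreducible_Y by (simp add: curve_irreducible_def Y_def A_def)
qed

lemma z_in_system: "proj_point z \<in> linear_system \<Delta>"
 using proj_point_in_space[of A z "(0, 0)"] supp good[of "(0, 0)"] by (simp add: A_def vertices_def)

text \<open>The passage from geometry to polynomials: good curves are reduced and torically
  transverse, irreducibility is \<open>indep\<close>, and the genus is read off from the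
  conductors.\<close>

theorem severi_irr_iff: "proj_point z \<in> severi_irr g \<Delta> \<longleftrightarrow> irr_curve k A z &
  (\<exists>S s. conductor PP QQ S s & (\<forall>S' s'. conductor PP QQ S' s' --> degree S' \<le> degree S) &
   degree S < 2 * k & g = 2 * k - 1 - degree S)" proof (cases "irr_curve k A z") case True then interpret irr_curve k A z .
 obtain S s where S: "conductor PP QQ S s" "\<forall>S' s'. conductor PP QQ S' s' --> degree S' \<le> degree S"
  "degree S < 2 * k" "!!g. geometric_genus \<Delta> (proj_point z) g \<longleftrightarrow> g = 2 * k - 1 - degree S" using genus_conductor by blast
 have "degree S' = degree S" if "conductor PP QQ S' s'" "\<forall>S'' s''. conductor PP QQ S'' s'' --> degree S'' \<le> degree S'" for S' s'
  using that S(1,2) by (meson le_antisym)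
 then have "(\<exists>S s. conductor PP QQ S s & (\<forall>S' s'. conductor PP QQ S' s' --> degree S' \<le> degree S) &
   degree S < 2 * k & g = 2 * k - 1 - degree S) \<longleftrightarrow> g = 2 * k - 1 - degree S" using S by metis then show ?thesis
  using True S(4) curve_irreducible_iff curve_reduced torically_transverse z_in_system by (simp add: severi_irr_def)
qed (simp add: severi_irr_def curve_irreducible_iff)

end

section \<open>Limits of families of sections\<close>

text \<open>The ambient ring consists of all functions of a coefficient vector, with pointwise
  operations; roots of polynomials become elements of it by choosing them at each vector.\<close>

interpretation FA: algebra_hom "%(c::'a::alg_closed_field) (_::'w). c" by unfold_locales (simp_all add: fun_eq_iff)

lemma sum_fun_apply: "(sum f I) x = (\<Sum>i\<in>I. f i x)" for f :: "'i => 'w => 'a::comm_monoid_add"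
 by (induction I rule: infinite_finite_induct) auto

lemma power_fun_apply: "(f ^ n) x = f x ^ n" for f :: "'w => 'a::comm_ring_1" by (induction n) auto

text \<open>\<open>B\<close> consists of the functions that agree on \<open>W\<close> with a
  polynomial in the coordinates. Evaluating this polynomial at \<open>z0\<close> is well defined: a
  polynomial vanishing on \<open>W\<close>, homogenized by the coordinate \<open>v0\<close> that
  equals \<open>1\<close> there, vanishes at \<open>z0\<close>.\<close>

lemma closure_hom:
 fixes W :: "('v => 'a::alg_closed_field) set"
 assumes W: "!!ze. ze \<in> W ==> ze v0 = 1 & (\<forall>v. v \<notin> A --> ze v = 0)" and z0: "z0 v0 = 1"
  and cl: "proj_point z0 \<in> zariski A closure_of (proj_point ` W)"
 obtains B e where "FA.subalg B" "FA.hom_on B e"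
  "!!v. (%ze. ze v) \<in> B" "!!v. e (%ze. ze v) = z0 v"
  "!!f. (!!ze. ze \<in> W ==> f ze = 0) ==> f \<in> B & e f = 0"
proof -
 have "proj_point ` W <= proj_space A"
 proof
  fix q assume "q \<in> proj_point ` W"
  then obtain ze where "ze \<in> W" "q = proj_point ze" by blast
  then show "q \<in> proj_space A" using proj_point_in_space[of A ze v0] W[of ze] by simp
 qed
 note cl = cl[unfolded zariski_closure_iff[OF this]]
 have van: "mpoly_eval P z0 = 0" if P: "!!ze. ze \<in> W ==> mpoly_eval P ze = 0" for P :: "('v, 'a) mpoly"
 proof -
  define d where "d = Max (insert 0 (wt ` pkeys P))"
  have d: "wt u \<le> d" if "u \<in> pkeys P" for u unfolding d_def using that by (intro Max_ge) auto
  define H where "H = (\<Sum>u\<in>pkeys P. psingle (u + psingle v0 (d - wt u)) (plookup P u))"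
  have H: "homogeneous d H" unfolding H_def using d by (intro homogeneous_sum homogeneous_single) (simp add: wt_add wt_single)
  have ev: "mpoly_eval H ze = mpoly_eval P ze" if "ze v0 = 1" for ze unfolding H_def mpoly_eval_sum mpoly_eval_plin[of P] plin_def
   using that by (simp add: mpoly_eval_single mval_add mval_single)
  have "vanishes_at H q" if "q \<in> proj_point ` W" for q using that vanishes_at_iff[OF H] ev P W by auto
  then have "vanishes_at H (proj_point z0)" using cl H by blast
  then show ?thesis using vanishes_at_iff[OF H] ev[of z0] z0 by simp
 qed
 have eqv: "mpoly_eval P z0 = mpoly_eval Q z0" if "!!ze. ze \<in> W ==> mpoly_eval P ze = mpoly_eval Q ze" for P Q :: "('v, 'a) mpoly"
  using van[of "P + mconst (-1) * Q"] that by (simp add: mpoly_eval_add mpoly_eval_mult mpoly_eval_mconst)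
 define rep :: "('v, 'a) mpoly => (('v => 'a) => 'a) => bool"
  where "rep P f \<longleftrightarrow> (\<forall>ze\<in>W. f ze = mpoly_eval P ze)" for P f
 define B where "B = {f. \<exists>P. rep P f}"
 define e where "e f = mpoly_eval (SOME P. rep P f) z0" for f
 have e: "f \<in> B & e f = mpoly_eval P z0" if P: "rep P f" for P f
 proof -
  obtain Q where Q: "Q = (SOME P. rep P f)" by blast
  have "rep Q f" unfolding Q using P by (rule someI)
  then have "mpoly_eval Q z0 = mpoly_eval P z0" using P by (intro eqv) (simp add: rep_def)
  then show ?thesis using P by (auto simp: B_def e_def Q)
 qed
 have c: "rep (mconst c) (%_. c)" for c by (simp add: rep_def mpoly_eval_mconst)
 have am: "rep (P + Q) (f + g) & rep (P * Q) (f * g)" if "rep P f" "rep Q g" for P Q f g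
  using that by (simp add: rep_def mpoly_eval_add mpoly_eval_mult)
 have "FA.subalg B" unfolding FA.subalg_def using e[OF c] am by (fastforce simp: B_def)
 moreover have "FA.hom_on B e" unfolding FA.hom_on_def
 proof (intro conjI allI ballI)
  fix c show "e (%_. c) = c" using e[OF c, of c] by (simp add: mpoly_eval_mconst)
 next
  fix f g assume "f \<in> B" "g \<in> B"
  then obtain P Q where PQ: "rep P f" "rep Q g" by (auto simp: B_def)
  show "e (f + g) = e f + e g" "e (f * g) = e f * e g" using e[OF PQ(1)] e[OF PQ(2)] e[OF am[OF PQ, THEN conjunct1]] e[OF am[OF PQ, THEN conjunct2]]
   by (simp_all add: mpoly_eval_add mpoly_eval_mult)
 qed
 moreover have "rep (mvar v 1) (%ze. ze v)" for v by (simp add: rep_def mpoly_eval_mvar)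
 then have "(%ze. ze v) \<in> B" "e (%ze. ze v) = z0 v" for v using e[of "mvar v 1" "%ze. ze v"] by (simp_all add: mpoly_eval_mvar)
 moreover have "f \<in> B & e f = 0" if "!!ze. ze \<in> W ==> f ze = 0" for f using e[of "mconst 0" f] that by (simp add: rep_def mpoly_eval_mconst)
 ultimately show thesis by (rule that)
qed

text \<open>\<open>e\<close> plays the role of a limit of functions on \<open>W\<close> at the point
  \<open>z0\<close> of the closure; \<open>B\<close> may also contain functions that are only
  integral over the coordinates.\<close>

locale specialization =
 fixes W :: "('v => 'a::alg_closed_field) set" and z0 :: "'v => 'a" and B :: "(('v => 'a) => 'a) set" and e :: "(('v => 'a) => 'a) => 'a"
 assumes sub: "FA.subalg B" and hom: "FA.hom_on B e" and coord_mem: "(%ze. ze v) \<in> B" and e_coord: "e (%ze. ze v) = z0 v"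
  and null: "(!!ze. ze \<in> W ==> f ze = 0) ==> f \<in> B & e f = 0"
begin

lemma mem_const: "(%_. c) \<in> B" and e_const: "e (%_. c) = c" using FA.subalgD(1)[OF sub] FA.hom_onD(1)[OF sub hom] by auto

lemma mem_add: "f \<in> B ==> g \<in> B ==> (%ze. f ze + g ze) \<in> B" and mem_mult: "f \<in> B ==> g \<in> B ==> (%ze. f ze * g ze) \<in> B"
 and mem_diff: "f \<in> B ==> g \<in> B ==> (%ze. f ze - g ze) \<in> B" and e_add: "f \<in> B ==> g \<in> B ==> e (%ze. f ze + g ze) = e f + e g"
 and e_mult: "f \<in> B ==> g \<in> B ==> e (%ze. f ze * g ze) = e f * e g"
 and e_diff: "f \<in> B ==> g \<in> B ==> e (%ze. f ze - g ze) = e f - e g"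
 using FA.subalgD(4,5,7)[OF sub, of f g] FA.hom_onD(4,5,7)[OF sub hom, of f g] by (simp_all add: plus_fun_def times_fun_def fun_diff_def)

lemma mem_power: "f \<in> B ==> (%ze. f ze ^ n) \<in> B" and e_power: "f \<in> B ==> e (%ze. f ze ^ n) = e f ^ n"
proof -
 assume f: "f \<in> B"
 have "(%ze. f ze ^ n) \<in> B & e (%ze. f ze ^ n) = e f ^ n" using f by (induction n) (auto simp: mem_const e_const mem_mult e_mult)
 then show "(%ze. f ze ^ n) \<in> B" "e (%ze. f ze ^ n) = e f ^ n" by auto
qed

lemma e_sum:
 assumes "!!i. i \<in> I ==> f i \<in> B" shows "(%ze. \<Sum>i\<in>I. f i ze) \<in> B" "e (%ze. \<Sum>i\<in>I. f i ze) = (\<Sum>i\<in>I. e (f i))"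
proof -
 have "(%ze. \<Sum>i\<in>I. f i ze) = sum f I" by (simp add: fun_eq_iff sum_fun_apply)
 then show "(%ze. \<Sum>i\<in>I. f i ze) \<in> B" "e (%ze. \<Sum>i\<in>I. f i ze) = (\<Sum>i\<in>I. e (f i))"
  using FA.subalg_sum[OF sub] FA.hom_sum[OF sub hom] assms by auto
qed

lemma coeff_prod_linear:
 assumes "set ts <= B" shows "(%ze. coeff (\<Prod>t\<leftarrow>ts. [:- t ze, 1:]) i) \<in> B"
  "e (%ze. coeff (\<Prod>t\<leftarrow>ts. [:- t ze, 1:]) i) = coeff (\<Prod>t\<leftarrow>ts. [:- e t, 1:]) i"
proof -
 have "coeff (\<Prod>t\<leftarrow>ts. [:- t, 1:]) i ze = coeff (\<Prod>t\<leftarrow>ts. [:- t ze, 1:]) i" for ze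
  using FA.hom_prod_linear[of UNIV "%f. f ze" ts i] by (simp add: FA.subalg_def FA.hom_on_def)
 then have "(%ze. coeff (\<Prod>t\<leftarrow>ts. [:- t ze, 1:]) i) = coeff (\<Prod>t\<leftarrow>ts. [:- t, 1:]) i" by (simp add: fun_eq_iff)
 then show "(%ze. coeff (\<Prod>t\<leftarrow>ts. [:- t ze, 1:]) i) \<in> B"
  "e (%ze. coeff (\<Prod>t\<leftarrow>ts. [:- t ze, 1:]) i) = coeff (\<Prod>t\<leftarrow>ts. [:- e t, 1:]) i"
  using FA.hom_prod_linear[OF sub hom assms, of i] by auto
qed

lemma transfer:
 assumes "f \<in> B" "g \<in> B" "!!ze. ze \<in> W ==> f ze = g ze" shows "e f = e g" using null[of "%ze. f ze - g ze"] assms by (simp add: e_diff)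

lemmas mem_intros = mem_const mem_add mem_mult mem_diff mem_power coord_mem e_sum(1)
lemmas e_simps = e_const e_add e_mult e_diff e_power e_coord e_sum(2)

end

lemma lead_coeff_monom_add:
 fixes r :: "'a::comm_ring_1 poly"
 assumes "degree r < n" shows "lead_coeff (monom 1 n + r) = 1"
proof -
 have "degree (monom 1 n + r) = n" using degree_add_eq_left[of r "monom 1 n"] assms by (simp add: degree_monom_eq)
 then show ?thesis using assms by (simp add: coeff_eq_0)
qed

context kite_surface
begin

text \<open>The normalization at the vertex \<open>(2 k, 0)\<close> makes \<open>PP\<close> and the
  square of \<open>PP\<close> monic, which is what makes the roots in question integral over the
  coordinates.\<close>

definition chart_vectors :: "(int \<times> int => 'a::alg_closed_field) set" where
 "chart_vectors = {z. z (2 * int k, 0) = 1 & (\<forall>v. v \<notin> A --> z v = 0)}"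

definition profile :: "(int \<times> int => 'a::alg_closed_field) => 'a => 'a" where
 "profile z x = (\<Sum>i\<le>2 * k. z (int i, 0) * x ^ i)"

text \<open>The closure, inside the chart, of a set defined with auxiliary quantities: a quantity that is integral over
 the coordinates specializes along with them.\<close>

lemma ex_specialization:
 fixes W :: "(int \<times> int => 'a::alg_closed_field) set"
 assumes W: "W <= chart_vectors" and z0: "z0 \<in> chart_vectors" and cl: "proj_point z0 \<in> zariski A closure_of (proj_point ` W)"
  and ts: "!!t. t \<in> set ts ==> (\<forall>ze\<in>W. t ze ^ 2 = ze (int k, 1) * ze (int k, -1)) \<or>
   (\<forall>ze\<in>W. profile ze (t ze) ^ 2 = 4 * (ze (int k, 1) * ze (int k, -1)) * t ze ^ (2 * k))"
 obtains B e where "specialization W z0 B e" "set ts <= B"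
proof -
 obtain B e where B: "FA.subalg B" "FA.hom_on B e"
  "!!v. (%ze. ze v) \<in> B" "!!v. e (%ze. ze v) = z0 v"
  "!!f. (!!ze. ze \<in> W ==> f ze = 0) ==> f \<in> B & e f = 0"
 proof (rule closure_hom[where W = W and ?v0.0 = "(2 * int k, 0)" and A = A and ?z0.0 = z0])
  show "ze (2 * int k, 0) = 1 & (\<forall>v. v \<notin> A --> ze v = 0)" if "ze \<in> W" for ze using that W by (auto simp: chart_vectors_def)
  show "z0 (2 * int k, 0) = 1" using z0 by (auto simp: chart_vectors_def)
 qed (use cl that in blast)+
 interpret S: specialization W z0 B e by (rule specialization.intro) (fact B)+
 \<comment> \<open>Cutting off outside \<open>W\<close> makes the monic equations below hold at
   every vector, hence as identities of functions.\<close>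
 define cut where "cut f = (%ze. if ze \<in> W then f ze else 0)" for f :: "(int \<times> int => 'a) => 'a"
 have cut_B: "cut f \<in> B" if "f \<in> B" for f
 proof -
  have "(%ze. cut f ze - f ze) \<in> B" using B(5)[of "%ze. cut f ze - f ze"] by (simp add: cut_def)
  from S.mem_add[OF this that] show ?thesis by simp
 qed
 define crd where "crd v = cut (%ze. ze v)" for v
 have crd: "crd v \<in> B" for v unfolding crd_def by (intro cut_B B(3))
 have int: "FA.integral_over B (cut t)" if t: "t \<in> set ts" for t using ts[OF t]
 proof
  assume sq: "\<forall>ze\<in>W. t ze ^ 2 = ze (int k, 1) * ze (int k, -1)"
  have "poly [:- (crd (int k, 1) * crd (int k, -1)), 0, 1:] (cut t) = 0" using sq by (auto simp: fun_eq_iff crd_def cut_def power2_eq_square)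
  moreover have "coeff [:- (crd (int k, 1) * crd (int k, -1)), 0, 1:] i \<in> B" for i
   using FA.subalgD[OF B(1)] crd by (auto simp: coeff_pCons split: nat.splits)
  ultimately show ?thesis unfolding FA.integral_over_def by (intro exI[of _ "[:- (crd (int k, 1) * crd (int k, -1)), 0, 1:]"]) auto
 next
  assume root: "\<forall>ze\<in>W. profile ze (t ze) ^ 2 = 4 * (ze (int k, 1) * ze (int k, -1)) * t ze ^ (2 * k)"
  \<comment> \<open>\<open>p\<close> is the discriminant \<open>PP^2 - 4 * QQ\<close>, monic of
    degree \<open>4 * k\<close>, with coordinate functions as coefficients.\<close>
  define r1 where "r1 = (\<Sum>i<2 * k. monom (crd (int i, 0)) i)"
  define r2 where "r2 = monom (4 * (crd (int k, 1) * crd (int k, -1))) (2 * k)"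
  define p where "p = (monom 1 (2 * k) + r1) ^ 2 - r2"
  have c1: "coeff (monom 1 (2 * k) + r1) i \<in> B" for i using FA.subalgD[OF B(1)] crd by (auto simp: r1_def coeff_sum)
  have "(%_. 4) \<in> B" by (rule S.mem_const)
  moreover have "(4 :: (int \<times> int => 'a) => 'a) = (%_. 4)" by (metis numeral_fun)
  ultimately have four: "(4 :: (int \<times> int => 'a) => 'a) \<in> B" by metis
  have c2: "coeff r2 i \<in> B" for i using FA.subalgD(2)[OF B(1)] FA.subalgD(5)[OF B(1) four FA.subalgD(5)[OF B(1) crd crd]] by (simp add: r2_def)
  have "coeff p i \<in> B" for i unfolding p_def power2_eq_square coeff_diff coeff_mult
   by (intro FA.subalgD(7)[OF B(1)] FA.subalg_sum[OF B(1)] FA.subalgD(5)[OF B(1)] c1 c2)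
  moreover have "lead_coeff p = 1"
  proof -
   have "r1 = (\<Sum>i\<le>2 * k - 1. monom (crd (int i, 0)) i)" unfolding r1_def using k1 by (intro sum.cong) auto
   then have d1: "degree r1 \<le> 2 * k - 1" by (auto intro!: degree_sum_le degree_monom_le[THEN order_trans])
   have "p = monom 1 (4 * k) + (monom 2 (2 * k) * r1 + r1 * r1 - r2)"
    by (simp add: p_def power2_eq_square algebra_simps mult_monom) (metis add_monom mult_2 distrib_right one_add_one)
   moreover have "degree (monom 2 (2 * k) * r1 + r1 * r1 - r2) < 4 * k"
   proof -
    have "degree (monom 2 (2 * k) * r1) \<le> 4 * k - 1" "degree (r1 * r1) \<le> 4 * k - 1" "degree r2 \<le> 4 * k - 1"
     using d1 k1 degree_mult_le[of "monom 2 (2 * k)" r1] degree_mult_le[of r1 r1] degree_monom_le[of "2 :: (int \<times> int => 'a) => 'a" "2 * k"]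
      degree_monom_le[of "4 * (crd (int k, 1) * crd (int k, -1))" "2 * k"] by (auto simp: r2_def)
    then have "degree (monom 2 (2 * k) * r1 + r1 * r1 - r2) \<le> 4 * k - 1" by (intro degree_diff_le degree_add_le)
    then show ?thesis using k1 by linarith
   qed
   ultimately show ?thesis using lead_coeff_monom_add by metis
  qed
  moreover have "poly p (cut t) = 0"
  proof
   fix ze
   have "poly r1 (cut t) ze = (\<Sum>i<2 * k. crd (int i, 0) ze * cut t ze ^ i)"
    by (simp add: r1_def poly_sum poly_monom sum_fun_apply power_fun_apply)
   then have "poly p (cut t) ze = (cut t ze ^ (2 * k) + (\<Sum>i<2 * k. crd (int i, 0) ze * cut t ze ^ i)) ^ 2 - 4 * (crd (int k, 1) ze * crd (int k, -1) ze) * cut t ze ^ (2 * k)"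
    by (simp add: p_def r2_def poly_monom power_fun_apply numeral_fun)
   also have "\<dots> = 0"
   proof (cases "ze \<in> W")
    case True
    then have "profile ze (t ze) = t ze ^ (2 * k) + (\<Sum>i<2 * k. ze (int i, 0) * t ze ^ i)"
     using W by (auto simp: profile_def chart_vectors_def lessThan_Suc_atMost[symmetric])
    then show ?thesis using root[rule_format, OF True] True by (simp add: crd_def cut_def)
   qed (use k1 in \<open>simp add: crd_def cut_def\<close>)
   finally show "poly p (cut t) ze = 0 ze" by simp
  qed
  ultimately show ?thesis unfolding FA.integral_over_def by blast
 qed
 have int': "FA.integral_over B t" if "t \<in> set (map cut ts)" for t using that int by auto
 obtain B' e' where B': "FA.subalg B'" "FA.hom_on B' e'" "B <= B'" "set (map cut ts) <= B'" "\<forall>b\<in>B. e' b = e b"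
  using FA.extend_hom_list[OF B(1,2) int'] by blast
 have "specialization W z0 B' e'"
 proof (rule specialization.intro)
  show "FA.subalg B'" "FA.hom_on B' e'" by fact+
  show "(%ze. ze v) \<in> B'" "e' (%ze. ze v) = z0 v" for v using B(3,4)[of v] B'(3,5) by auto
  show "f \<in> B' & e' f = 0" if "!!ze. ze \<in> W ==> f ze = 0" for f using B(5)[OF that] B'(3,5) by auto
 qed
 then interpret S': specialization W z0 B' e' .
 have "t \<in> B'" if "t \<in> set ts" for t
 proof -
  have "(%ze. t ze - cut t ze) \<in> B'" using B(5)[of "%ze. t ze - cut t ze"] B'(3) by (auto simp: cut_def)
  moreover have "cut t \<in> B'" using B'(4) that by auto
  ultimately show ?thesis using S'.mem_add by force
 qed
 then show thesis using that \<open>specialization W z0 B' e'\<close> by blast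
qed

lemma severi_irr_chart:
 assumes "c \<in> severi_irr g \<Delta>"
 obtains z where "c = proj_point z" "good_curve k A z" "z \<in> chart_vectors"
proof -
 obtain z where z: "c = proj_point z" "good_curve k A z" using transverse_imp_good assms by (auto simp: severi_irr_def)
 interpret good_curve k A z by (rule z)
 define b where "b = inverse (z (2 * int k, 0))"
 have "z (2 * int k, 0) ~= 0" using good by (simp add: vertices_def)
 then have "b ~= 0" "b * z (2 * int k, 0) = 1" by (simp_all add: b_def)
 then have "proj_point (%v. b * z v) = c" "good_curve k A (%v. b * z v)" "(%v. b * z v) \<in> chart_vectors"
  using z proj_point_scale[of b z] supp good by (auto simp: chart_vectors_def good_curve_def good_curve_axioms_def)
 then show thesis using that by blast
qed

lemma chart_closed:
 "W <= chart_vectors ==> closedin (zariski A) (zariski A closure_of (proj_point ` W))"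
 "W <= chart_vectors ==> z \<in> W ==> proj_point z \<in> zariski A closure_of (proj_point ` W)"
proof -
 show "closedin (zariski A) (zariski A closure_of (proj_point ` W))" by simp
 assume "W <= chart_vectors" "z \<in> W"
 moreover have "proj_point ze \<in> proj_space A" if "ze \<in> chart_vectors" for ze
  using that proj_point_in_space[of A ze "(2 * int k, 0)"] by (auto simp: chart_vectors_def)
 ultimately have "proj_point ` W <= topspace (zariski A)" by (auto simp: topspace_zariski)
 then show "proj_point z \<in> zariski A closure_of (proj_point ` W)" using closure_of_subset \<open>z \<in> W\<close> by blast
qed

end

section \<open>A pair of polynomials with large square divisors in odd characteristic\<close>

text \<open>The coefficient of \<open>t\<close> in the recurrence never vanishes, so each step
  raises the degree in the parameter by exactly one. This provides parameters at which a term of the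
  sequence does or does not vanish.\<close>

lemma rec_poly:
 fixes b :: "'a::field => nat => 'a"
 assumes 0: "!!t. b t 0 = 1" and c: "!!i. i < m ==> c i ~= 0" and rec: "!!t i. i < m ==> b t (Suc i) = (c i * t + d i) * b t i + d' i * b t (i - 1)"
 shows "i \<le> m ==> \<exists>q. q ~= 0 & degree q = i & (\<forall>t. poly q t = b t i)"
proof (induction i rule: less_induct)
 case (less i)
 show ?case
 proof (cases i)
  case 0
  then show ?thesis using assms(1) by (intro exI[of _ 1]) auto
 next
  case (Suc j)
  obtain q1 where q1: "q1 ~= 0" "degree q1 = j" "!!t. poly q1 t = b t j" using less.IH[of j] less.prems Suc by auto
  have j: "j - 1 < i" "j - 1 \<le> m" using less.prems Suc by simp_all
  obtain q2 where q2: "degree q2 = j - 1" "!!t. poly q2 t = b t (j - 1)" using less.IH[OF j] by blast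
  have cj: "c j ~= 0" using c[of j] less.prems Suc by simp
  have d1: "degree ([:d j, c j:] * q1) = Suc j" using q1 cj by (subst degree_mult_eq) auto
  have "degree (smult (d' j) q2) < degree ([:d j, c j:] * q1)" unfolding d1 using q2(1) degree_smult_le[of "d' j" q2] by linarith
  then have d: "degree ([:d j, c j:] * q1 + smult (d' j) q2) = Suc j" using d1 by (simp add: degree_add_eq_left)
  moreover have "poly ([:d j, c j:] * q1 + smult (d' j) q2) t = b t (Suc j)" for t
   using rec[of j t] less.prems Suc by (simp add: q1 q2 algebra_simps)
  ultimately show ?thesis unfolding Suc by (metis degree_0 nat.distinct(1))
 qed
qed

text \<open>The coefficients of the power series \<open>b\<close> solving the system of
  \<open>ex_system\<close>, where \<open>a\<close> has been eliminated by
  \<open>(2 i + 1) a_i = ep b_i\<close> and \<open>\<mu> = ep^2\<close>.\<close>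

fun bseq :: "'a::field => 'a => nat => 'a" where
 "bseq h \<mu> 0 = 1"
| "bseq h \<mu> (Suc i) = ((\<mu> / of_nat (2 * i + 1) - of_nat (2 * i + 1) * h) * bseq h \<mu> i - of_nat (2 * i) * bseq h \<mu> (i - 1)) / of_nat (2 * i + 2)"

lemma bseq_step:
 fixes u D :: "'a::field"
 assumes "u ~= 0" "D ~= 0" shows "((x / u - u * y) * B - w * C) / D = (1 / (u * D) * x + (- (u * y / D))) * B + (- (w / D)) * C"
 using assms by (simp add: field_simps)

lemma power_root_exists: "n > 0 ==> \<exists>y. y ^ n = x" for x :: "'a::alg_closed_field"
proof -
 assume n: "n > 0"
 have "degree (monom 1 n + [:- x:]) = n" using n by (subst degree_add_eq_left) (auto simp: degree_monom_eq)
 then have "degree (monom 1 n + [:- x:]) > 0" using n by simp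
 then obtain y where "poly (monom 1 n + [:- x:]) y = 0" using alg_closed_imp_poly_has_root by blast
 then show ?thesis by (auto simp: poly_monom)
qed

lemma quadratic_simple_roots:
 fixes rh :: "'a::field"
 assumes "rh ~= 2" "rh ~= - 2" and r: "poly [:1, rh, 1:] r = 0" shows "poly (pderiv [:1, rh, 1:]) r ~= 0"
proof
 assume "poly (pderiv [:1, rh, 1:]) r = 0"
 then have rh: "rh = - (2 * r)" by (simp add: pderiv_pCons eq_neg_iff_add_eq_0 algebra_simps)
 have "1 = r * r" using r unfolding rh by (simp add: algebra_simps)
 then have "(r - 1) * (r + 1) = 0" by (simp add: algebra_simps)
 then have "r = 1 \<or> r = - 1" by (auto simp: eq_neg_iff_add_eq_0)
 then show False using rh assms by auto
qed

lemma ex_quadratic_root: "\<exists>r. poly [:1, rh, 1:] r = 0" for rh :: "'a::alg_closed_field"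
proof -
 have "degree [:1, rh, 1:] > 0" by simp
 then show ?thesis using alg_closed_imp_poly_has_root by blast
qed

locale odd_characteristic =
 fixes p m :: nat and ty :: "'a::alg_closed_field itself"
 assumes char: "CHAR('a) = p" and p: "p = 2 * m + 1" and m1: "m \<ge> 1"
begin

lemma prime_p: "prime p" using prime_CHAR_semidom[where 'a = 'a] char p by simp

lemma of_nat_nz: "0 < n ==> n < p ==> of_nat n ~= (0 :: 'a)" using of_nat_eq_0_iff_char_dvd[where 'a = 'a] char nat_dvd_not_less by auto

lemma of_nat_p: "of_nat p = (0 :: 'a)" using of_nat_CHAR[where 'a = 'a] char by simp

lemma two_nz: "(2 :: 'a) ~= 0" using of_nat_nz[of 2] p m1 by simp

lemma four_nz: "(4 :: 'a) ~= 0"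
proof -
 have "(4 :: 'a) = 2 * 2" by simp
 then show ?thesis using two_nz by (metis mult_eq_0_iff)
qed

lemma diff_power_p: "(x - y) ^ p = x ^ p - y ^ p" for x y :: 'a
proof -
 have "(x + (- y)) ^ p = x ^ p + (- y) ^ p" using freshmans_dream[where x = x and y = "- y"] prime_p char by simp
 then show ?thesis using p by simp
qed

lemma coeff_pderiv_0:
 fixes f :: "'a poly"
 assumes "pderiv f = 0" "coeff f i ~= 0" shows "p dvd i"
proof (cases i)
 case (Suc j)
 have "of_nat (Suc j) * coeff f (Suc j) = 0" unfolding coeff_pderiv[symmetric] assms(1) by simp
 then have "of_nat (Suc j) = (0 :: 'a)" using assms(2) Suc by (metis mult_eq_0_iff)
 then show ?thesis using of_nat_eq_0_iff_char_dvd[of "Suc j", where 'a = 'a] char Suc by metis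
qed simp

text \<open>The polynomials \<open>a\<close> and \<open>b\<close> below solve the first-order system for which
 \<open>a\<^sup>2 v\<close> and \<open>b\<^sup>2 (v\<^sup>2 + h v + 1)\<close> have the same derivative \<open>ep a b\<close>; their difference is then a
 \<open>p\<close>-th power.\<close>

lemma ex_system:
 obtains h ep :: 'a and a b :: "'a poly" where "h ~= 2" "h ~= - 2" "ep ~= 0" "degree a \<le> m" "degree b < m" "poly b 0 = 1" "poly a 0 = ep"
  "smult 2 (pCons 0 (pderiv a)) + a = smult ep b"
  "smult 2 (pderiv b * [:1, h, 1:]) + b * [:h, 2:] = smult ep a"
proof -
 have nz: "of_nat (2 * i + 1) ~= (0 :: 'a)" "of_nat (2 * i + 2) ~= (0 :: 'a)" if "i < m" for i using that p by (intro of_nat_nz; simp)+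
 \<comment> \<open>For \<open>\<mu> = 0\<close> the recurrence is that of the coefficients of
   \<open>(v^2 + h v + 1)^m\<close>. So \<open>q\<close> is the Hasse invariant of
   \<open>u^2 = v (v^2 + h v + 1)\<close> as a polynomial in \<open>h\<close>, and \<open>h\<close>
   is chosen to make this curve smooth and ordinary.\<close>
 have "\<exists>q. q ~= 0 & degree q = m & (\<forall>t. poly q t = bseq (t :: 'a) 0 m)"
 proof (rule rec_poly[where m = m])
  show "bseq t 0 (Suc i) = (- (of_nat (2 * i + 1) / of_nat (2 * i + 2)) * t + 0) * bseq t 0 i + (- (of_nat (2 * i) / of_nat (2 * i + 2))) * bseq t 0 (i - 1)" if "i < m" for t :: 'a and i
   unfolding bseq.simps bseq_step[OF nz[OF that]] by simp
  show "- (of_nat (2 * i + 1) / of_nat (2 * i + 2)) ~= (0 :: 'a)" if "i < m" for i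
   using nz[OF that] by (simp del: of_nat_add of_nat_mult of_nat_Suc)
 qed simp_all
 then obtain q where q': "q ~= 0 & degree q = m & (\<forall>t. poly q t = bseq (t :: 'a) 0 m)" ..
 then have q: "q ~= 0" "!!t. poly q t = bseq t 0 m" by simp_all
 have "finite ({2, - 2} \<union> {t. poly q t = 0})" using poly_roots_finite[OF q(1)] by simp
 then obtain h :: 'a where "h \<notin> {2, - 2} \<union> {t. poly q t = 0}" using ex_new_if_finite[OF infinite_alg_closed[where 'a = 'a]] by blast
 then have h: "h ~= 2" "h ~= - 2" "bseq h 0 m ~= 0" using q(2) by auto
 have "\<exists>q. q ~= 0 & degree q = m & (\<forall>t. poly q t = bseq h (t :: 'a) m)"
 proof (rule rec_poly[where m = m])
  show "bseq h t (Suc i) = (1 / (of_nat (2 * i + 1) * of_nat (2 * i + 2)) * t + (- (of_nat (2 * i + 1) * h / of_nat (2 * i + 2)))) * bseq h t i + (- (of_nat (2 * i) / of_nat (2 * i + 2))) * bseq h t (i - 1)" if "i < m" for t :: 'a and i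
   unfolding bseq.simps by (rule bseq_step[OF nz[OF that]])
  show "1 / (of_nat (2 * i + 1) * of_nat (2 * i + 2)) ~= (0 :: 'a)" if "i < m" for i
   using nz[OF that] by (simp del: of_nat_add of_nat_mult of_nat_Suc)
 qed simp_all
 then obtain r where r': "r ~= 0 & degree r = m & (\<forall>t. poly r t = bseq h (t :: 'a) m)" ..
 then have r: "degree r = m" "!!t. poly r t = bseq h t m" by simp_all
 \<comment> \<open>This choice makes the series break off before the term of degree
   \<open>m\<close>. As \<open>bseq h 0 m\<close> is not zero, neither \<open>\<mu>\<close> nor its
   square root \<open>ep\<close> is zero.\<close>
 then obtain \<mu> where \<mu>: "bseq h \<mu> m = 0" using alg_closed_imp_poly_has_root[of r] m1 by auto
 obtain ep where ep: "ep ^ 2 = \<mu>" using power_root_exists[of 2 \<mu>] by auto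
 have ep0: "ep ~= 0" using \<mu> h(3) ep by auto
 define bb where "bb i = (if i < m then bseq h \<mu> i else 0)" for i
 \<comment> \<open>At \<open>i = m\<close> the factor \<open>2 i + 1 = p\<close> is zero, so the
   first equation leaves this coefficient free and the second one determines it.\<close>
 define aa where "aa i = (if i < m then ep * bb i / of_nat (2 * i + 1) else if i = m then - (bb (m - 1) / ep) else 0)" for i
 define b where "b = (\<Sum>i<m. monom (bb i) i)"
 define a where "a = (\<Sum>i\<le>m. monom (aa i) i)"
 have cb: "coeff b i = bb i" for i by (auto simp: b_def coeff_sum bb_def)
 have ca: "coeff a i = aa i" for i by (auto simp: a_def coeff_sum aa_def)
 have R1: "of_nat (2 * i + 1) * aa i = ep * bb i" for i
 proof -
  have "of_nat (2 * i + 1) = (0 :: 'a)" if "i = m" using of_nat_p p that by simp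
  then show ?thesis using nz(1)[of i] by (cases "i < m"; cases "i = m") (simp_all add: aa_def bb_def del: of_nat_add of_nat_mult of_nat_Suc)
 qed
 have R2: "of_nat (2 * i) * bb (i - 1) + of_nat (2 * i + 1) * h * bb i + of_nat (2 * i + 2) * bb (Suc i) = ep * aa i" for i
 proof -
  consider "i < m" | "i = m" | "i > m" by linarith
  then show ?thesis
  proof cases
   case 1
   have "bb (Suc i) = bseq h \<mu> (Suc i)" using 1 \<mu> by (auto simp: bb_def less_Suc_eq not_less intro: Suc_lessI dest: le_antisym)
   then have "of_nat (2 * i + 2) * bb (Suc i) = (\<mu> / of_nat (2 * i + 1) - of_nat (2 * i + 1) * h) * bb i - of_nat (2 * i) * bb (i - 1)"
    using nz[OF 1] 1 by (simp add: bb_def del: of_nat_add of_nat_mult of_nat_Suc)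
   moreover have "ep * aa i = \<mu> / of_nat (2 * i + 1) * bb i"
    using 1 by (simp add: aa_def ep[symmetric] power2_eq_square del: of_nat_add of_nat_mult of_nat_Suc)
   ultimately show ?thesis by (simp add: left_diff_distrib)
  next
   case 2
   have "of_nat (2 * m) + 1 = (0 :: 'a)" using of_nat_p p by (metis of_nat_1 of_nat_add)
   then have "of_nat (2 * m) = (- 1 :: 'a)" by (simp add: eq_neg_iff_add_eq_0)
   then show ?thesis using 2 ep0 by (simp add: bb_def aa_def)
  next
   case 3
   then show ?thesis by (simp add: bb_def aa_def)
  qed
 qed
 show thesis
 proof (rule that[OF h(1,2) ep0, of a b])
  show "degree a \<le> m" by (rule degree_le) (auto simp: ca aa_def)
  show "degree b < m" using m1 by (intro le_less_trans[OF degree_le[of "m - 1" b]]) (auto simp: cb bb_def)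
  show "poly b 0 = 1" using m1 by (simp add: poly_0_coeff_0 cb bb_def)
  show "poly a 0 = ep" using m1 by (simp add: poly_0_coeff_0 ca aa_def bb_def)
  show "smult 2 (pCons 0 (pderiv a)) + a = smult ep b"
  proof (rule poly_eqI)
   fix i
   show "coeff (smult 2 (pCons 0 (pderiv a)) + a) i = coeff (smult ep b) i"
    using R1[of i] by (cases i) (simp_all add: coeff_pderiv ca cb algebra_simps)
  qed
  show "smult 2 (pderiv b * [:1, h, 1:]) + b * [:h, 2:] = smult ep a"
  proof (rule poly_eqI)
   fix i
   show "coeff (smult 2 (pderiv b * [:1, h, 1:]) + b * [:h, 2:]) i = coeff (smult ep a) i"
   proof (cases i)
    case 0
    then show ?thesis using R2[of 0] by (simp add: coeff_pderiv ca cb algebra_simps)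
   next
    case (Suc j)
    then show ?thesis using R2[of i] by (cases j) (simp_all add: coeff_pderiv ca cb algebra_simps)
   qed
  qed
 qed
qed

text \<open>The system propagates a common zero: if \<open>(v - v0)^n\<close> divides
  \<open>a\<close> and \<open>b\<close> and \<open>n < m\<close>, then so does the next power,
  because \<open>n\<close> and \<open>2 n + 1\<close> are invertible. At exponent \<open>m\<close>
  this contradicts the degree of \<open>b\<close>.\<close>

lemma no_common_zero:
 fixes a b :: "'a poly" and h ep v0 :: 'a
 assumes b: "degree b < m" "b ~= 0" and v0: "v0 ~= 0" and E1: "smult 2 (pCons 0 (pderiv a)) + a = smult ep b"
  and E2: "smult 2 (pderiv b * q) + b * pderiv q = smult ep a" and q: "poly q v0 ~= 0 \<or> poly (pderiv q) v0 ~= 0"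
 shows "poly a v0 ~= 0 \<or> poly b v0 ~= 0"
proof (rule ccontr)
 assume "\<not> (poly a v0 ~= 0 \<or> poly b v0 ~= 0)"
 then have 0: "poly a v0 = 0" "poly b v0 = 0" by auto
 define l where "l = [:- v0, 1:]"
 have pl: "pderiv l = 1" by (simp add: l_def pderiv_pCons one_pCons)
 have dl: "pderiv (l ^ n) = smult (of_nat n) (l ^ (n - 1))" for n
 proof (cases n)
  case (Suc j)
  show ?thesis unfolding Suc pderiv_power_Suc pl by simp
 qed simp
 have lz: "poly l v0 = 0" "l ~= 0" by (simp_all add: l_def)
 have "n \<ge> 1 ==> n \<le> m ==> l ^ n dvd a & l ^ n dvd b" for n
 proof (induction n rule: nat_induct_at_least)
  case base
  then show ?case using 0 by (simp add: l_def poly_eq_0_iff_dvd)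
 next
  case (Suc n)
  then obtain a1 b1 where ab: "a = l ^ n * a1" "b = l ^ n * b1" by (auto elim!: dvdE)
  have ln: "l ^ n = l ^ (n - 1) * l" using Suc(1) by (simp add: power_eq_if)
  have pa: "pderiv a = l ^ (n - 1) * (smult (of_nat n) a1 + l * pderiv a1)" unfolding ab pderiv_mult dl by (simp add: ln algebra_simps)
  have pb: "pderiv b = l ^ (n - 1) * (smult (of_nat n) b1 + l * pderiv b1)" unfolding ab pderiv_mult dl by (simp add: ln algebra_simps)
  have n: "of_nat n ~= (0 :: 'a)" "of_nat (2 * n + 1) ~= (0 :: 'a)" using Suc p by (intro of_nat_nz; simp)+
  have "l ^ (n - 1) * (smult 2 ([:0, 1:] * (smult (of_nat n) a1 + l * pderiv a1)) + l * a1) = l ^ (n - 1) * smult ep (l * b1)"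
   using E1 unfolding pa by (simp add: ab ln algebra_simps)
  then have "smult 2 ([:0, 1:] * (smult (of_nat n) a1 + l * pderiv a1)) + l * a1 = smult ep (l * b1)"
   by (rule mult_left_cancel[THEN iffD1, OF power_not_zero[OF lz(2)]])
  then have "poly (smult 2 ([:0, 1:] * (smult (of_nat n) a1 + l * pderiv a1)) + l * a1) v0 = poly (smult ep (l * b1)) v0" by simp
  then have a1: "poly a1 v0 = 0" using n(1) v0 two_nz lz by simp
  have e2: "l ^ (n - 1) * (smult 2 ((smult (of_nat n) b1 + l * pderiv b1) * q) + l * b1 * pderiv q) = l ^ (n - 1) * smult ep (l * a1)"
   using E2 unfolding pb by (simp add: ab ln algebra_simps)
  then have e2: "smult 2 ((smult (of_nat n) b1 + l * pderiv b1) * q) + l * b1 * pderiv q = smult ep (l * a1)"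
   by (rule mult_left_cancel[THEN iffD1, OF power_not_zero[OF lz(2)]])
  have b1: "poly b1 v0 = 0"
  proof (cases "poly q v0 = 0")
   case False
   have "poly (smult 2 ((smult (of_nat n) b1 + l * pderiv b1) * q) + l * b1 * pderiv q) v0 = poly (smult ep (l * a1)) v0" by (simp add: e2)
   then show ?thesis using n(1) two_nz lz False by simp
  next
   case True
   then obtain w where w: "q = l * w" by (auto simp: l_def poly_eq_0_iff_dvd elim!: dvdE)
   have pq: "pderiv q = w + l * pderiv w" unfolding w pderiv_mult by (simp add: l_def pderiv_pCons)
   have "l * (smult 2 ((smult (of_nat n) b1 + l * pderiv b1) * w) + b1 * (w + l * pderiv w)) = l * smult ep a1"
    using e2[unfolded pq, unfolded w] by (simp add: algebra_simps)
   then have "smult 2 ((smult (of_nat n) b1 + l * pderiv b1) * w) + b1 * (w + l * pderiv w) = smult ep a1"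
    by (rule mult_left_cancel[THEN iffD1, OF lz(2)])
   then have "poly (smult 2 ((smult (of_nat n) b1 + l * pderiv b1) * w) + b1 * (w + l * pderiv w)) v0 = poly (smult ep a1) v0" by simp
   then have "of_nat (2 * n + 1) * (poly b1 v0 * poly w v0) = 0" using a1 lz by (simp add: algebra_simps)
   moreover have "poly w v0 ~= 0" using q True lz by (simp add: pq)
   ultimately show ?thesis using n(2) by simp
  qed
  have "l dvd a1" "l dvd b1" using a1 b1 by (simp_all add: l_def poly_eq_0_iff_dvd)
  then show ?case unfolding ab by (simp add: mult.commute mult_dvd_mono)
 qed
 from this[of m] have "l ^ m dvd b" using m1 by simp
 then have "degree (l ^ m) \<le> degree b" using b(2) by (rule dvd_imp_degree_le)
 then show False using b(1) lz by (simp add: degree_power_eq l_def)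
qed

text \<open>The polynomials of \<open>ex_system\<close> satisfy
  \<open>a^2 v - b^2 q = kp (v - v0)^p\<close>. A rational function \<open>v = N / M\<close> of
  degree two with \<open>v - v0 = al x / M\<close> turns this, multiplied by \<open>M^p\<close>,
  into a multiple of \<open>x^p\<close>. If \<open>v\<close> is moreover ramified over both roots of
  \<open>q\<close>, then \<open>M^2 q(v)\<close> is a constant times a square, and the two terms on
  the left become multiples of \<open>S1^2 * T1\<close> and \<open>S2^2 * T2\<close>.\<close>

lemma ex_tangent_pair:
 obtains S1 S2 T1 T2 :: "'a poly" and c :: 'a
 where "degree S1 = 2 * m" "degree S2 = 2 * m" "degree (S1 ^ 2 * T1) = 2 * p" "lead_coeff (S1 ^ 2 * T1) = 1"
  "poly (S1 ^ 2 * T1) 0 ~= 0" "pderiv (S1 ^ 2 * T1) ~= 0" "c ~= 0" "S2 ^ 2 * T2 - S1 ^ 2 * T1 = monom (4 * c) p"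
  "\<exists>r. poly T1 r = 0 & poly (pderiv T1) r ~= 0" "\<exists>r. poly T2 r = 0 & poly (pderiv T2) r ~= 0"
proof -
 obtain h ep :: 'a and a b :: "'a poly" where h: "h ~= 2" "h ~= - 2" and ep: "ep ~= 0" and deg: "degree a \<le> m" "degree b < m"
  and b0: "poly b 0 = 1" and a0: "poly a 0 = ep"
  and E: "smult 2 (pCons 0 (pderiv a)) + a = smult ep b" "smult 2 (pderiv b * [:1, h, 1:]) + b * [:h, 2:] = smult ep a" by (rule ex_system)
 define q where "q = [:1, h, 1:]"
 have pq: "pderiv q = [:h, 2:]" by (simp add: q_def pderiv_pCons)
 note E2 = E(2)[folded q_def pq]
 have nz: "a ~= 0" "b ~= 0" using a0 b0 ep by auto
 define D where "D = a * a * [:0, 1:] - b * b * q"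
 have s2: "smult 2 f = f + f" for f :: "'a poly" by (metis one_add_one smult_1_left smult_add_left)
 define XX where "XX = ([:0, 1:] :: 'a poly)"
 have pX: "pCons 0 f = XX * f" "pderiv XX = 1" for f by (simp_all add: XX_def pderiv_pCons one_pCons)
 have "pderiv D = a * (smult 2 (pCons 0 (pderiv a)) + a) - b * (smult 2 (pderiv b * q) + b * pderiv q)"
  unfolding D_def XX_def[symmetric] pderiv_diff pderiv_mult pX s2 by (simp add: algebra_simps)
 then have D': "pderiv D = 0" unfolding E(1) E2 by (simp add: mult.commute)
 have degb: "2 * degree b + 2 \<le> p - 1" using deg(2) p by simp
 have dq: "degree q = 2" "q ~= 0" by (simp_all add: q_def)
 have dG: "degree (b * b * q) = 2 * degree b + 2" using nz dq by (simp add: degree_mult_eq)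
 have dF: "degree (a * a * [:0, 1:]) = 2 * degree a + 1" using nz by (subst degree_mult_eq) (simp_all add: degree_mult_eq)
 have degD: "degree D \<le> p" unfolding D_def using dF dG deg degb p by (intro degree_diff_le) auto
 define kp where "kp = coeff D p"
 have D0: "coeff D 0 = - 1" by (simp add: poly_0_coeff_0[symmetric] D_def b0 q_def)
 have D: "D = monom kp p + [:- 1:]"
 proof (rule poly_eqI)
  fix i
  consider "i = 0" | "i = p" | "i > p" | "\<not> p dvd i" using dvd_imp_le[of p i] by (meson linorder_neqE_nat not_le neq0_conv)
  then show "coeff D i = coeff (monom kp p + [:- 1:]) i"
  proof cases
   case 4
   then show ?thesis using coeff_pderiv_0[OF D', of i] by (cases i) (auto simp: coeff_pCons split: nat.splits)
  qed (use degD p D0 in \<open>auto simp: kp_def coeff_eq_0 coeff_pCons split: nat.splits\<close>)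
 qed
 \<comment> \<open>Otherwise \<open>a^2 v\<close>, of odd degree, would equal
   \<open>b^2 q - 1\<close>, of even degree.\<close>
 have kp: "kp ~= 0"
 proof
  assume "kp = 0"
  then have "a * a * [:0, 1:] = b * b * q + [:- 1:]" using D by (simp add: D_def algebra_simps)
  then have "2 * degree a + 1 = degree (b * b * q + [:- 1:])" using dF by simp
  also have "\<dots> = 2 * degree b + 2" using dG by (subst degree_add_eq_left) auto
  finally show False by presburger
 qed
 obtain v0 where v0: "v0 ^ p = 1 / kp" using power_root_exists[of p "1 / kp"] p by auto
 have v00: "v0 ~= 0" using v0 kp p by auto
 have polyD: "poly a x * poly a x * x - poly b x * poly b x * poly q x = kp * (x - v0) ^ p" for x
 proof -
  have "poly D x = kp * (x - v0) ^ p" unfolding D diff_power_p v0 using kp by (simp add: poly_monom algebra_simps)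
  then show ?thesis by (simp add: D_def mult_ac)
 qed
 have qs: "poly (pderiv q) x ~= 0" if "poly q x = 0" for x using quadratic_simple_roots[OF h] that by (simp add: q_def)
 have at_v0: "poly a v0 * poly a v0 * v0 = poly b v0 * poly b v0 * poly q v0" using polyD[of v0] p by simp
 \<comment> \<open>If \<open>a\<close> vanished at \<open>v0\<close>, then \<open>b\<close> would
   not, so \<open>q\<close> would vanish there, and the second equation of the system would make
   \<open>v0\<close> a double root of \<open>q\<close>.\<close>
 have av: "poly a v0 ~= 0"
 proof
  assume 0: "poly a v0 = 0"
  then have "poly b v0 ~= 0" using no_common_zero[OF deg(2) nz(2) v00 E(1) E2] qs by blast
  moreover have "poly q v0 = 0" using at_v0 0 calculation by simp
  moreover have "poly (smult 2 (pderiv b * q) + b * pderiv q) v0 = poly (smult ep a) v0" by (simp add: E2)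
  ultimately show False using qs 0 by simp
 qed
 have bv: "poly b v0 ~= 0" and qv: "poly q v0 ~= 0" using at_v0 av v00 by auto
 obtain v1 where v1: "poly q v1 = 0" using ex_quadratic_root[of h] by (auto simp: q_def)
 define v2 where "v2 = - h - v1"
 have qf: "poly q x = (x - v1) * (x - v2)" for x using v1 by (simp add: q_def v2_def algebra_simps)
 have v12: "v1 ~= v2" using qs[OF v1] by (auto simp: pq v2_def algebra_simps)
 define w1 w2 where "w1 = v0 - v1" and "w2 = v0 - v2"
 have w: "w1 ~= 0" "w2 ~= 0" "w2 - w1 ~= 0" "w1 ~= v0" "w2 ~= v0" using qv qf[of v0] v12 qf[of 0] by (auto simp: w1_def w2_def q_def)
 \<comment> \<open>Solved from \<open>N - v1 M = w1 (x + 1)^2\<close> and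
   \<open>N - v2 M = w2 (x - 1)^2\<close>: the ramification points are placed at
   \<open>x = -1\<close> and \<open>x = 1\<close>, while \<open>v\<close> takes the value
   \<open>v0\<close> at \<open>0\<close> and at infinity.\<close>
 define al be where "al = 4 * w1 * w2 / (w2 - w1)" and "be = al / w1 - 2"
 have al0: "al ~= 0" using w four_nz by (simp add: al_def)
 have al1: "al = w1 * (be + 2)" using w by (simp add: be_def)
 have "be - 2 = 4 * w2 / (w2 - w1) - 4" using w by (simp add: be_def al_def)
 also have "\<dots> = 4 * w1 / (w2 - w1)" using w by (simp add: field_simps)
 finally have al2: "al = w2 * (be - 2)" using w by (simp add: al_def)
 define M N where "M = [:1, - be, 1:]" and "N = [:v0, al - v0 * be, v0:]"
 have N: "poly N x = v0 * poly M x + al * x" for x by (simp add: N_def M_def algebra_simps)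
 have Nv1: "poly N x - v1 * poly M x = w1 * ((x + 1) * (x + 1))" for x
 proof -
  have "poly N x - v1 * poly M x = w1 * poly M x + al * x" by (simp add: N w1_def algebra_simps)
  then show ?thesis unfolding al1 by (simp add: M_def algebra_simps)
 qed
 have Nv2: "poly N x - v2 * poly M x = w2 * ((x - 1) * (x - 1))" for x
 proof -
  have "poly N x - v2 * poly M x = w2 * poly M x + al * x" by (simp add: N w2_def algebra_simps)
  then show ?thesis unfolding al2 by (simp add: M_def algebra_simps)
 qed
 have MN: "M ~= 0" "N ~= 0" "degree M = 2" "degree N = 2" "lead_coeff M = 1" "lead_coeff N = v0"
  using v00 by (simp_all add: M_def N_def numeral_2_eq_2)
 \<comment> \<open>\<open>M^n f(N / M)\<close>, the substitution cleared of denominators.\<close>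
 define H where "H n f = (\<Sum>i\<le>n. smult (coeff f i) (N ^ i * M ^ (n - i)))" for n f
 have trm: "degree (N ^ i * M ^ (n - i)) = 2 * n" "coeff (N ^ i * M ^ (n - i)) (2 * n) = v0 ^ i" if "i \<le> n" for i n
 proof -
  show d: "degree (N ^ i * M ^ (n - i)) = 2 * n" using that MN by (simp add: degree_mult_eq degree_power_eq algebra_simps)
  have "lead_coeff (N ^ i * M ^ (n - i)) = v0 ^ i" using MN by (simp add: lead_coeff_mult lead_coeff_power)
  then show "coeff (N ^ i * M ^ (n - i)) (2 * n) = v0 ^ i" by (simp add: d)
 qed
 have Hd: "degree (H n f) = 2 * n" and Hl: "coeff (H n f) (2 * n) = poly f v0" if "degree f \<le> n" "poly f v0 ~= 0" for n f
 proof -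
  show l: "coeff (H n f) (2 * n) = poly f v0" unfolding H_def poly_sum_upto[OF that(1)] by (simp add: coeff_sum trm)
  have "degree (H n f) \<le> 2 * n" unfolding H_def by (intro degree_sum_le) (auto intro!: degree_smult_le[THEN order_trans] simp: trm)
  moreover have "2 * n \<le> degree (H n f)" using l that(2) by (intro le_degree) simp
  ultimately show "degree (H n f) = 2 * n" by simp
 qed
 have H: "poly (H n f) x = poly M x ^ n * poly f (poly N x / poly M x)" if "degree f \<le> n" "poly M x ~= 0" for n f x
 proof -
  have "poly N x ^ i * poly M x ^ (n - i) = poly M x ^ n * (poly N x / poly M x) ^ i" if "i \<le> n" for i
   using that \<open>poly M x ~= 0\<close> by (simp add: power_divide power_diff)
  then show ?thesis unfolding H_def poly_sum_upto[OF that(1)] by (simp add: poly_sum sum_distrib_left mult_ac)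
 qed
 \<comment> \<open>The leading coefficient of \<open>(H m a)^2 * N\<close>, divided out to make
   \<open>S1^2 * T1\<close> monic.\<close>
 define L where "L = poly a v0 * poly a v0 * v0"
 have L: "L ~= 0" using av v00 by (simp add: L_def)
 define S1 S2 T1 T2 where "S1 = H m a" and "S2 = H (m - 1) b * [:- 1, 0, 1:]" and "T1 = smult (1 / L) N" and "T2 = smult (w1 * w2 / L) M"
 define c where "c = - (kp * al ^ p / (4 * L))"
 have degb': "degree b \<le> m - 1" using deg(2) by simp
 note HM = H[OF deg(1)] H[OF degb']
 have S1: "degree S1 = 2 * m" "coeff S1 (2 * m) = poly a v0" "S1 ~= 0" using Hd[OF deg(1) av] Hl[OF deg(1) av] av by (auto simp: S1_def)
 have T1: "degree T1 = 2" "lead_coeff T1 = v0 / L" "T1 ~= 0" using MN L by (simp_all add: T1_def)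
 have S1T1: "degree (S1 ^ 2 * T1) = 2 * p" "lead_coeff (S1 ^ 2 * T1) = 1"
 proof -
  show "degree (S1 ^ 2 * T1) = 2 * p" using S1 T1 p by (simp add: degree_mult_eq degree_power_eq)
  have "lead_coeff (S1 ^ 2 * T1) = poly a v0 ^ 2 * (v0 / L)" unfolding lead_coeff_mult lead_coeff_power T1(2) using S1(1,2) by simp
  also have "\<dots> = 1" using L by (simp add: L_def power2_eq_square)
  finally show "lead_coeff (S1 ^ 2 * T1) = 1" .
 qed
 have rootN: "\<exists>r. poly N r = 0 & poly (pderiv N) r ~= 0"
 proof -
  define rh where "rh = al / v0 - be"
  have Ne: "N = smult v0 [:1, rh, 1:]" using v00 by (simp add: N_def rh_def algebra_simps)
  have "rh ~= 2"
  proof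
   assume "rh = 2"
   then have "al = v0 * (be + 2)" using v00 by (simp add: rh_def field_simps)
   then have "w1 = v0" using al1 al0 by (metis mult_cancel_right mult_zero_right)
   then show False using w by blast
  qed
  moreover have "rh ~= - 2"
  proof
   assume "rh = - 2"
   then have "al = v0 * (be - 2)" using v00 by (simp add: rh_def field_simps)
   then have "w2 = v0" using al2 al0 by (metis mult_cancel_right mult_zero_right)
   then show False using w by blast
  qed
  ultimately show ?thesis
   using quadratic_simple_roots[of rh] ex_quadratic_root[of rh] v00 unfolding Ne pderiv_smult poly_smult by (metis mult_eq_0_iff)
 qed
 have rootM: "\<exists>r. poly M r = 0 & poly (pderiv M) r ~= 0"
 proof -
  have "- be ~= 2"
  proof
   assume "- be = 2"
   then have "be + 2 = 0" by (simp add: eq_neg_iff_add_eq_0 add.commute neg_eq_iff_add_eq_0)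
   then show False using al0 al1 by simp
  qed
  moreover have "- be ~= - 2" using al0 al2 by auto
  ultimately show ?thesis unfolding M_def using quadratic_simple_roots ex_quadratic_root by blast
 qed
 show thesis
 proof (rule that[of S1 S2 T1 c T2])
  show "degree S1 = 2 * m" "degree (S1 ^ 2 * T1) = 2 * p" "lead_coeff (S1 ^ 2 * T1) = 1" by fact+
  have "H (m - 1) b ~= 0" using Hl[OF degb' bv] bv by auto
  then have "degree S2 = 2 * (m - 1) + 2" unfolding S2_def using Hd[OF degb' bv] by (subst degree_mult_eq) auto
  then show "degree S2 = 2 * m" using m1 by simp
  have "poly M 0 = 1" "poly N 0 = v0" by (simp_all add: M_def N_def)
  then have "poly S1 0 = poly a v0" using HM(1)[of 0] by (simp add: S1_def)
  then show "poly (S1 ^ 2 * T1) 0 ~= 0" using av L v00 \<open>poly N 0 = v0\<close> by (simp add: T1_def)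
  show "c ~= 0" using kp al0 L four_nz by (simp add: c_def)
  show "\<exists>r. poly T1 r = 0 & poly (pderiv T1) r ~= 0" using rootN L by (simp add: T1_def pderiv_smult)
  show "\<exists>r. poly T2 r = 0 & poly (pderiv T2) r ~= 0" using rootM L w by (simp add: T2_def pderiv_smult)
  show "pderiv (S1 ^ 2 * T1) ~= 0"
  proof
   assume 0: "pderiv (S1 ^ 2 * T1) = 0"
   obtain r where r: "poly N r = 0" "poly (pderiv N) r ~= 0" using rootN by blast
   have "poly M r ~= 0"
    using N[of r] N[of 0] r(1) al0 v00 \<open>poly M 0 = 1\<close> by (metis add_0 mult_eq_0_iff mult_zero_right add.right_neutral mult.right_neutral)
   then have "poly S1 r ~= 0" using HM(1)[of r] r(1) a0 ep by (simp add: S1_def)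
   moreover have "poly (pderiv (S1 ^ 2 * T1)) r = poly S1 r ^ 2 * (1 / L * poly (pderiv N) r)"
    unfolding pderiv_mult T1_def pderiv_smult using r(1) by simp
   ultimately show False using 0 r(2) L by simp
  qed
  have "poly (S2 ^ 2 * T2 - S1 ^ 2 * T1 - monom (4 * c) p) x = 0" if x: "x \<notin> {x. poly M x = 0}" for x
  proof -
   define \<mu> v where "\<mu> = poly M x" and "v = poly N x / poly M x"
   have \<mu>: "\<mu> ~= 0" "poly N x = \<mu> * v" using x by (simp_all add: \<mu>_def v_def)
   have nzx: "poly M x ~= 0" and q1: "poly [:- 1, 0, 1:] x = x * x - 1" using x by simp_all
   have s1: "poly S1 x = \<mu> ^ m * poly a v" by (simp only: S1_def HM(1)[OF nzx] \<mu>_def v_def)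
   have s2: "poly S2 x = \<mu> ^ (m - 1) * poly b v * (x * x - 1)" by (simp only: S2_def poly_mult q1 HM(2)[OF nzx] \<mu>_def v_def)
   have "(w1 * ((x + 1) * (x + 1))) * (w2 * ((x - 1) * (x - 1))) = (\<mu> * v - v1 * \<mu>) * (\<mu> * v - v2 * \<mu>)"
    unfolding Nv1[symmetric] Nv2[symmetric] \<mu>(2) \<mu>_def[symmetric] by simp
   also have "\<dots> = \<mu> * \<mu> * poly q v" by (simp add: qf algebra_simps)
   finally have e: "w1 * w2 * ((x * x - 1) * (x * x - 1)) = \<mu> * \<mu> * poly q v" by (simp add: algebra_simps)
   have mm: "\<mu> ^ m = \<mu> ^ (m - 1) * \<mu>" using m1 by (simp add: power_eq_if)
   have pp: "\<mu> ^ p = \<mu> ^ m * \<mu> ^ m * \<mu>" unfolding p by (simp add: power_add mult_2)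
   have "poly (S2 ^ 2 * T2) x = (\<mu> ^ (m - 1) * \<mu> ^ (m - 1) * \<mu> * (poly b v * poly b v)) * (w1 * w2 * ((x * x - 1) * (x * x - 1))) / L"
    by (simp add: s2 T2_def \<mu>_def[symmetric] power2_eq_square mult_ac)
   also have "\<dots> = \<mu> ^ p * (poly b v * poly b v * poly q v) / L" unfolding e pp mm by (simp add: mult_ac)
   finally have 1: "poly (S2 ^ 2 * T2) x = \<mu> ^ p * (poly b v * poly b v * poly q v) / L" .
   have 2: "poly (S1 ^ 2 * T1) x = \<mu> ^ p * (poly a v * poly a v * v) / L" by (simp add: s1 T1_def \<mu>(2) pp power2_eq_square mult_ac)
   have "poly (S2 ^ 2 * T2) x - poly (S1 ^ 2 * T1) x = - (\<mu> ^ p * (poly a v * poly a v * v - poly b v * poly b v * poly q v)) / L"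
    unfolding 1 2 by (simp add: diff_divide_distrib right_diff_distrib)
   also have "\<dots> = - (kp * (\<mu> * (v - v0)) ^ p) / L" unfolding polyD by (simp add: power_mult_distrib mult_ac)
   also have "\<mu> * (v - v0) = al * x" using N[of x] \<mu>(2) by (simp add: \<mu>_def[symmetric] algebra_simps)
   finally show ?thesis using four_nz by (simp add: c_def poly_monom power_mult_distrib)
  qed
  then have "S2 ^ 2 * T2 - S1 ^ 2 * T1 - monom (4 * c) p = 0" by (rule poly_eq_0_cofinite[OF poly_roots_finite[OF MN(1)]])
  then show "S2 ^ 2 * T2 - S1 ^ 2 * T1 = monom (4 * c) p" by simp
 qed
qed

end

section \<open>Square divisors, irreducibility and the reduction to closed strata\<close>

lemma linear_factors:
 fixes f :: "'a::alg_closed_field poly"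
 assumes "f ~= 0"
 obtains xs where "length xs = degree f" "f = smult (lead_coeff f) (\<Prod>x\<leftarrow>xs. [:- x, 1:])"
proof -
 obtain A where A: "size A = degree f" "f = smult (lead_coeff f) (\<Prod>x\<in>#A. [:- x, 1:])" using alg_closed_imp_factorization[OF assms] by blast
 obtain xs where "mset xs = A" using ex_mset by blast
 then show thesis using A that[of xs] by (auto simp: prod_mset_prod_list[symmetric])
qed

lemma prod_linear_root: "poly (\<Prod>x\<leftarrow>xs. [:- x, 1:]) r = 0 \<longleftrightarrow> r \<in> set xs" for r :: "'a::idom"
 by (induction xs) auto

lemma degree_prod_linear: "degree (\<Prod>x\<leftarrow>xs. [:- x, 1:]) = length xs" for xs :: "'a::idom list"
proof (induction xs)
 case (Cons x xs)
 have "(\<Prod>x\<leftarrow>xs. [:- x, 1:]) ~= 0" by (induction xs) (auto simp del: mult_pCons_left)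
 then show ?case using Cons by (simp del: mult_pCons_left add: degree_mult_eq)
qed simp

text \<open>Each root of \<open>S\<close> is a root of exactly one of the two factors, and at least
  a double one there; both copies are removed and the induction continues.\<close>

lemma square_split:
 fixes f1 f2 S :: "'a::alg_closed_field poly"
 assumes "S ~= 0" "S ^ 2 dvd f1 * f2" "!!r. \<not> (poly f1 r = 0 & poly f2 r = 0)" shows "\<exists>A B. S = A * B & A ^ 2 dvd f1 & B ^ 2 dvd f2"
 using assms
proof (induction "degree S" arbitrary: S f1 f2)
 case 0
 then have "S dvd 1" by (simp add: is_unit_iff_degree)
 then have "S ^ 2 dvd f1" by (metis dvd_trans one_dvd power_one dvd_power_same)
 then show ?case by (intro exI[of _ S] exI[of _ 1]) auto
next
 case (Suc n)
 obtain r where r: "poly S r = 0" using alg_closed_imp_poly_has_root[of S] Suc(2) by auto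
 define l where "l = [:- r, 1:]"
 have l0: "l ~= 0" and lr: "poly l r = 0" by (simp_all add: l_def)
 obtain S' where S': "S = l * S'" using root_factor[OF r] by (auto simp: l_def)
 have S'0: "S' ~= 0" using Suc(3) S' by auto
 have n: "n = degree S'" using Suc(2) S'0 l0 unfolding S' by (simp add: degree_mult_eq l_def del: mult_pCons_left)
 obtain t where t: "f1 * f2 = S ^ 2 * t" using Suc(4) by (auto elim: dvdE)
 have step: "\<exists>h. g1 = l ^ 2 * h & S' ^ 2 dvd h * g2" if g: "g1 * g2 = S ^ 2 * t" "poly g1 r = 0" "poly g2 r ~= 0" for g1 g2
 proof -
  obtain g where g1: "g1 = l * g" using root_factor[OF g(2)] by (auto simp: l_def)
  have "l * (g * g2) = l * (l * (S' ^ 2 * t))" using g(1) by (simp add: g1 S' power2_eq_square algebra_simps)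
  then have e: "g * g2 = l * (S' ^ 2 * t)" by (rule mult_left_cancel[THEN iffD1, OF l0])
  have "poly (g * g2) r = 0" unfolding e by (simp add: lr)
  then have "poly g r = 0" using g(3) by simp
  then obtain h where h: "g = l * h" using root_factor by (auto simp: l_def)
  have "l * (h * g2) = l * (S' ^ 2 * t)" using e by (simp add: h mult.assoc)
  then have "h * g2 = S' ^ 2 * t" by (rule mult_left_cancel[THEN iffD1, OF l0])
  then show ?thesis by (intro exI[of _ h]) (auto simp: g1 h power2_eq_square mult.assoc)
 qed
 have "poly (f1 * f2) r = 0" unfolding t S' by (simp add: lr)
 then consider "poly f1 r = 0" "poly f2 r ~= 0" | "poly f2 r = 0" "poly f1 r ~= 0" using Suc(5)[of r] by auto
 then show ?case
 proof cases
  case 1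
  then obtain h where h: "f1 = l ^ 2 * h" "S' ^ 2 dvd h * f2" using step[OF t] by blast
  have "\<not> (poly h r = 0 & poly f2 r = 0)" for r using Suc(5)[of r] by (auto simp: h(1) power2_eq_square)
  then obtain A B where "S' = A * B" "A ^ 2 dvd h" "B ^ 2 dvd f2" using Suc(1)[OF n S'0 h(2)] by blast
  then show ?thesis by (intro exI[of _ "l * A"] exI[of _ B]) (auto simp: S' h(1) power_mult_distrib mult.assoc intro: mult_dvd_mono)
 next
  case 2
  have "f2 * f1 = S ^ 2 * t" using t by (simp add: mult.commute)
  then obtain h where h: "f2 = l ^ 2 * h" "S' ^ 2 dvd h * f1" using step 2 by blast
  have "\<not> (poly f1 r = 0 & poly h r = 0)" for r using Suc(5)[of r] by (auto simp: h(1) power2_eq_square)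
  moreover have "S' ^ 2 dvd f1 * h" using h(2) by (simp add: mult.commute)
  ultimately obtain A B where "S' = A * B" "A ^ 2 dvd f1" "B ^ 2 dvd h" using Suc(1)[OF n S'0] by blast
  then show ?thesis by (intro exI[of _ A] exI[of _ "l * B"]) (auto simp: S' h(1) power_mult_distrib mult.left_commute intro: mult_dvd_mono)
 qed
qed

lemma no_common_root_mult_dvd:
 fixes A B x :: "'a::alg_closed_field poly"
 assumes "A ~= 0" "A dvd x" "B dvd x" "!!r. \<not> (poly A r = 0 & poly B r = 0)" shows "A * B dvd x" using assms
proof (induction "degree A" arbitrary: A x)
 case 0
 then have "A dvd 1" by (simp add: is_unit_iff_degree)
 then have "A * B dvd 1 * B" by (intro mult_dvd_mono) auto
 then show ?case using 0 by (metis dvd_trans mult_1)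
next
 case (Suc n)
 obtain r where r: "poly A r = 0" using alg_closed_imp_poly_has_root[of A] Suc(2) by auto
 define l where "l = [:- r, 1:]"
 have l0: "l ~= 0" by (simp add: l_def)
 obtain A' where A': "A = l * A'" using root_factor[OF r] by (auto simp: l_def)
 have A'0: "A' ~= 0" using Suc(3) A' by auto
 have n: "n = degree A'" using Suc(2) A'0 l0 unfolding A' by (simp add: degree_mult_eq l_def del: mult_pCons_left)
 obtain t where t: "x = B * t" using Suc(5) by (auto elim: dvdE)
 obtain u where u: "x = A * u" using Suc(4) by (auto elim: dvdE)
 have "poly (B * t) r = 0" using r u t by (metis mult_zero_left poly_mult)
 then have "poly t r = 0" using Suc(6)[of r] r by simp
 then obtain t' where t': "t = l * t'" using root_factor by (auto simp: l_def)
 have "B * t = A * u" using t u by simp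
 then have "l * (B * t') = l * (A' * u)" unfolding t' A' by (simp only: mult_ac)
 then have "B * t' = A' * u" by (rule mult_left_cancel[THEN iffD1, OF l0])
 then have d: "A' dvd B * t'" by simp
 have nc: "\<not> (poly A' r = 0 & poly B r = 0)" for r using Suc(6)[of r] by (auto simp: A')
 have "A' * B dvd B * t'" by (rule Suc(1)[OF n A'0 d dvd_triv_left nc])
 then have "l * (A' * B) dvd l * (B * t')" by (rule mult_dvd_mono[OF dvd_refl])
 moreover have "A * B = l * (A' * B)" "x = l * (B * t')" by (simp_all only: t t' A' mult_ac)
 ultimately show ?case by (simp only:)
qed

text \<open>The multiplicity of \<open>r\<close> is odd on the left of \<open>e\<close> and even on
  the right.\<close>

lemma simple_root_not_square:
 fixes S T E :: "'a::field poly"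
 assumes S: "S ~= 0" and r: "poly T r = 0" "poly (pderiv T) r ~= 0" and e: "S ^ 2 * T = smult t (E ^ 2)" shows False
proof -
 obtain q where q: "T = [:- r, 1:] * q" using root_factor[OF r(1)] by blast
 have "pderiv T = q + [:- r, 1:] * pderiv q" unfolding q pderiv_mult by (simp add: pderiv_pCons add.commute del: mult_pCons_left)
 then have qr: "poly q r ~= 0" using r(2) by simp
 then have T0: "T ~= 0" unfolding q by (metis mult_eq_0_iff poly_0 one_neq_zero pCons_eq_0_iff)
 have oT: "order r T = 1" using T0 order_power_n_n[of r 1] order_0I[OF qr] unfolding q by (subst order_mult) auto
 have ST: "S ^ 2 * T ~= 0" using S T0 by simp
 then have t: "t ~= 0" and E: "E ~= 0" using e by auto
 have "order r (S ^ 2 * T) = 2 * order r S + 1" using S T0 oT by (simp add: order_mult power2_eq_square)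
 moreover have "order r (smult t (E ^ 2)) = 2 * order r E" using t E by (simp add: order_smult order_mult power2_eq_square)
 ultimately show False unfolding e by presburger
qed

text \<open>The degrees force \<open>u\<close> to be constant, and monicity makes it cancel the
  square of the leading coefficient of \<open>E\<close>.\<close>

lemma square_factors:
 fixes f E u :: "'a::alg_closed_field poly"
 assumes f: "f = E ^ 2 * u" "degree f = 2 * degree E" "lead_coeff f = 1"
 obtains xs where "length xs = degree E" "f = (\<Prod>x\<leftarrow>xs @ xs. [:- x, 1:])"
proof -
 have f0: "f ~= 0" using f(3) by auto
 then have E0: "E ~= 0" "u ~= 0" using f(1) by auto
 have "degree f = 2 * degree E + degree u" using E0 by (simp add: f(1) degree_mult_eq degree_power_eq)
 then have "degree u = 0" using f(2) by simp
 then obtain t where t: "u = [:t:]" by (rule degree_eq_zeroE)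
 obtain xs where xs: "length xs = degree E" "E = smult (lead_coeff E) (\<Prod>x\<leftarrow>xs. [:- x, 1:])" using linear_factors[OF E0(1)] .
 define G where "G = (\<Prod>x\<leftarrow>xs @ xs. [:- x, 1:])"
 have "E ^ 2 = smult (lead_coeff E ^ 2) G" by (subst xs(2)) (simp add: G_def power2_eq_square)
 then have fG: "f = smult (t * lead_coeff E ^ 2) G" by (simp add: f(1) t)
 have "lead_coeff G = 1" unfolding G_def by (induction xs) (simp_all add: lead_coeff_mult del: mult_pCons_left)
 then have "t * lead_coeff E ^ 2 = 1" using f(3) unfolding fG lead_coeff_smult by simp
 then have "f = G" using fG by simp
 then show thesis using that xs(1) by (simp add: G_def)
qed

text \<open>A polynomial \<open>w\<close> with \<open>w * (w + PP) = - QQ\<close> divides a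
  monomial, so \<open>w\<close> and \<open>w + PP\<close> are monomials and \<open>PP\<close> has at
  most two terms; but its coefficients at \<open>0\<close>, \<open>j\<close> and
  \<open>2 * k\<close> are nonzero. A relation with general \<open>bt\<close> is reduced to constant
  \<open>bt\<close> by cancelling linear factors.\<close>

lemma (in good_curve) irr_curveI:
 assumes j: "0 < j" "j < 2 * k" "coeff PP j ~= 0" shows "irr_curve k A z"
proof unfold_locales
 have no_root: "w * (w + PP) ~= - QQ" for w :: "'a poly"
 proof
  assume w: "w * (w + PP) = - QQ"
  have mono: "\<exists>c i. f = monom c i" if "f * f' = - QQ" for f f' :: "'a poly"
  proof -
   have f0: "f ~= 0" using that QQ_nz by auto
   obtain xs where xs: "length xs = degree f" "f = smult (lead_coeff f) (\<Prod>x\<leftarrow>xs. [:- x, 1:])" using linear_factors[OF f0] .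
   have "x = 0" if x: "x \<in> set xs" for x
   proof -
    have "poly f x = 0" by (subst xs(2)) (use x prod_linear_root[of xs x] in simp)
    then have "poly (f * f') x = 0" by simp
    then have "ca * cb * x ^ (2 * k) = 0" unfolding \<open>f * f' = - QQ\<close> by (simp add: QQ_def poly_monom)
    then show ?thesis using ab_nz by simp
   qed
   then have "xs = replicate (degree f) 0" using xs(1) by (metis replicate_length_same)
   then have "(\<Prod>x\<leftarrow>xs. [:- x, 1:]) = monom 1 (degree f)" by (simp add: prod_list_replicate monom_altdef)
   then show ?thesis using xs(2) by (metis smult_monom)
  qed
  obtain c i where 1: "w = monom c i" using mono[OF w] by blast
  have "(w + PP) * w = - QQ" using w by (simp add: mult.commute)
  then obtain c' i' where 2: "w + PP = monom c' i'" using mono by blast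
  have "PP = monom c' i' - monom c i" using 2 unfolding 1 by (metis add_diff_cancel_left')
  then have PP: "coeff PP n = (if i' = n then c' else 0) - (if i = n then c else 0)" for n by simp
  have "coeff PP 0 ~= 0" "coeff PP (2 * k) ~= 0"
   using PP_0 degree_PP by (auto simp: poly_0_coeff_0) (metis degree_PP leading_coeff_0_iff PP_0 poly_0)
  then have "0 = i \<or> 0 = i'" "2 * k = i \<or> 2 * k = i'" "j = i \<or> j = i'"
   using PP[of 0] PP[of "2 * k"] PP[of j] j(3) by (auto split: if_splits)
  then show False using j by auto
 qed
 fix af bt assume rel: "CG.ev af + CG.ev bt * ww = 0"
 have N: "af * af - af * bt * PP + bt * bt * QQ = 0"
 proof -
  have "CG.ev (af * af - af * bt * PP + bt * bt * QQ) = (CG.ev af + CG.ev bt * ww) * (CG.ev af - CG.ev bt * CG.ev PP - CG.ev bt * ww) + CG.ev bt * CG.ev bt * (ww * ww + CG.ev PP * ww + CG.ev QQ)"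
   by (simp add: algebra_simps)
  also have "\<dots> = 0" unfolding rel ww_eq by simp
  finally show ?thesis using CG_ev_eq_0 by blast
 qed
 have "bt = 0" using N
 proof (induction "degree bt" arbitrary: af bt)
  case 0
  then obtain b where b: "bt = [:b:]" by (metis degree_eq_zeroE)
  show ?case
  proof (rule ccontr)
   assume "bt ~= 0"
   then have b0: "b ~= 0" by (simp add: b)
   define w where "w = smult (- inverse b) af"
   have a: "af = smult (- b) w" using b0 by (simp add: w_def)
   have "smult (b * b) (w * (w + PP) + QQ) = af * af - af * bt * PP + bt * bt * QQ" unfolding a b by (simp add: algebra_simps smult_add_right)
   then have "w * (w + PP) + QQ = 0" using 0(2) b0 by simp
   then show False using no_root[of w] by (simp add: eq_neg_iff_add_eq_0)
  qed
 next
  case (Suc n)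
  obtain r where r: "poly bt r = 0" using alg_closed_imp_poly_has_root[of bt] Suc(2) by auto
  define l where "l = [:- r, 1:]"
  have l0: "l ~= 0" by (simp add: l_def)
  obtain bt' where bt': "bt = l * bt'" using root_factor[OF r] by (auto simp: l_def)
  have "poly (af * af - af * bt * PP + bt * bt * QQ) r = 0" by (simp add: Suc(3))
  then have "poly af r = 0" using r by simp
  then obtain af' where af': "af = l * af'" using root_factor by (auto simp: l_def)
  have "l * l * (af' * af' - af' * bt' * PP + bt' * bt' * QQ) = 0" using Suc(3) by (simp add: af' bt' algebra_simps)
  then have "af' * af' - af' * bt' * PP + bt' * bt' * QQ = 0" using l0 by simp
  moreover have "n = degree bt'"
  proof -
   have "bt' ~= 0" using Suc(2) by (auto simp: bt')
   then show ?thesis using Suc(2) l0 unfolding bt' by (simp add: degree_mult_eq l_def del: mult_pCons_left)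
  qed
  ultimately have "bt' = 0" using Suc(1) by blast
  then show ?case by (simp add: bt')
 qed
 then show "af = 0 & bt = 0" using N by simp
qed

lemma (in kite_surface) severi_irr_topspace: "severi_irr g \<Delta> <= topspace (zariski A)" by (auto simp: severi_irr_def topspace_zariski A_def)

definition (in kite_surface) section_vector :: "'a::alg_closed_field poly => 'a => 'a => int \<times> int => 'a" where
 "section_vector f a b v = (if snd v = 0 & 0 \<le> fst v & fst v \<le> 2 * int k then coeff f (nat (fst v))
   else if v = (int k, 1) then a else if v = (int k, -1) then b else 0)"

lemma (in kite_surface) section_vector_good:
 assumes "degree f = 2 * k" "lead_coeff f = 1" "poly f 0 ~= 0" "a ~= 0" "b ~= 0"
 shows "good_curve k A (section_vector f a b)" "section_vector f a b \<in> chart_vectors"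
  "good_curve.PP k (section_vector f a b) = f"
  "section_vector f a b (int k, 1) = a" "section_vector f a b (int k, -1) = b"
proof -
 have off: "section_vector f a b v = 0" if "v \<notin> A" for v
  using that A_mem(1)[of "nat (fst v)"] A_mem(2,3) by (cases v) (auto simp: section_vector_def nat_le_iff)
 have on: "section_vector f a b (int i, 0) = coeff f i" if "i \<le> 2 * k" for i using that by (simp add: section_vector_def)
 show ab: "section_vector f a b (int k, 1) = a" "section_vector f a b (int k, -1) = b" by (simp_all add: section_vector_def)
 have "section_vector f a b (2 * int k, 0) = 1" using on[of "2 * k"] assms(1,2) by simp
 moreover have "section_vector f a b (0, 0) ~= 0" using on[of 0] assms(3) by (simp add: poly_0_coeff_0)
 ultimately show good: "good_curve k A (section_vector f a b)" using off ab assms(4,5) by unfold_locales (auto simp: vertices_def)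
 show "section_vector f a b \<in> chart_vectors" using off \<open>section_vector f a b (2 * int k, 0) = 1\<close> by (simp add: chart_vectors_def)
 interpret good_curve k A "section_vector f a b" by (rule good)
 show "PP = f" by (rule poly_eqI) (use assms(1) in \<open>auto simp: coeff_PP on coeff_eq_0\<close>)
qed

lemma map_nth_list: "length xs = n ==> map (%i. xs ! i) [0..<n] = xs" by (simp add: list_eq_iff_nth_eq)

text \<open>\<open>W0\<close> and \<open>W1\<close> give the closed set that the explicit curve
  avoids, \<open>W2\<close> the one without curves of genus zero. Closedness is needed only within
  the chart, where all curves of the Severi varieties have representatives.\<close>

lemma (in kite_surface) component_from_strata:
 fixes W0 W1 W2 :: "(int \<times> int => 'a::alg_closed_field) set"
 assumes W: "W0 <= chart_vectors" "W1 <= chart_vectors" "W2 <= chart_vectors"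
  and closed: "!!z. z \<in> chart_vectors ==> proj_point z \<in> zariski A closure_of (proj_point ` W0) ==> z \<in> W0"
   "!!z. z \<in> chart_vectors ==> proj_point z \<in> zariski A closure_of (proj_point ` W1) ==> z \<in> W1"
   "!!z. z \<in> chart_vectors ==> proj_point z \<in> zariski A closure_of (proj_point ` W2) ==> z \<in> W2"
  and one: "!!z. good_curve k A z ==> z \<in> chart_vectors ==> proj_point z \<in> severi_irr 1 \<Delta> ==> z \<in> W0 \<union> W1 \<union> W2"
  and zero: "!!z. good_curve k A z ==> z \<in> chart_vectors ==> z \<in> W2 ==> proj_point z \<in> severi_irr 0 \<Delta> ==> False"
  and ex: "\<exists>z\<in>chart_vectors. proj_point z \<in> severi_irr 1 \<Delta> & z \<notin> W0 & z \<notin> W1"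
 shows "\<exists>V :: (int \<times> int, 'a) ppoint set. irreducible_component (zariski A) (zariski A closure_of severi_irr 1 \<Delta>) V & V \<inter> severi_irr 0 \<Delta> = {}"
proof -
 define cl where "cl W = zariski A closure_of (proj_point ` W)" for W :: "(int \<times> int => 'a) set"
 have mem: "proj_point z \<in> cl W" if "W <= chart_vectors" "z \<in> W" for z W unfolding cl_def using that by (rule chart_closed(2))
 have incl: "severi_irr 1 \<Delta> <= (cl W0 \<union> cl W1) \<union> cl W2"
 proof
  fix q :: "(int \<times> int, 'a) ppoint" assume q: "q \<in> severi_irr 1 \<Delta>"
  obtain z where z: "q = proj_point z" "good_curve k A z" "z \<in> chart_vectors" using severi_irr_chart[OF q] .
  show "q \<in> (cl W0 \<union> cl W1) \<union> cl W2" using one[OF z(2,3)] q mem W unfolding z(1) by blast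
 qed
 have disj: "cl W2 \<inter> severi_irr 0 \<Delta> = {}"
 proof (rule ccontr)
  assume "cl W2 \<inter> severi_irr 0 \<Delta> ~= {}"
  then obtain q where q: "q \<in> cl W2" "q \<in> severi_irr 0 \<Delta>" by blast
  obtain z where z: "q = proj_point z" "good_curve k A z" "z \<in> chart_vectors" using severi_irr_chart[OF q(2)] .
  then show False using zero[OF z(2,3) closed(3)[OF z(3)]] q unfolding z(1) cl_def by blast
 qed
 obtain z where z: "z \<in> chart_vectors" "proj_point z \<in> severi_irr 1 \<Delta>" "z \<notin> W0" "z \<notin> W1" using ex by blast
 have "proj_point z \<notin> cl W0 \<union> cl W1" using closed(1,2) z by (auto simp: cl_def)
 moreover have "closedin (zariski A) (cl W0 \<union> cl W1)" "closedin (zariski A) (cl W2)"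
  unfolding cl_def using chart_closed(1) W by (auto intro: closedin_Un)
 ultimately show ?thesis using component_avoiding[OF severi_irr_topspace incl _ _ z(2) _ disj] by blast
qed

section \<open>Odd characteristic\<close>

locale odd_kite = kite_surface p A + odd_characteristic p m ty for p A m and ty :: "'a::alg_closed_field itself"
begin

lemma p_pos: "p > 0" "p ~= 2 * p" "p < 2 * p" using p by simp_all

text \<open>In characteristic \<open>p\<close> the power \<open>(x - r)^(p - 1)\<close> is the sum
  of all \<open>r^(p - 1 - i) x^i\<close>, because its product with \<open>x - r\<close> is
  \<open>x^p - r^p\<close>.\<close>

lemma coeff_power_linear_mult:
 fixes r :: 'a
 assumes "degree G \<le> p - 1" shows "coeff ([:- r, 1:] ^ (p - 1) * G) (p - 1) = poly G r"
proof -
 define l where "l = [:- r, 1:]"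
 define U where "U = (\<Sum>i<p. monom (r ^ (p - Suc i)) i)"
 have p0: "p > 0" using p by simp
 have "poly (l * U - l ^ p) x = 0" for x
 proof -
  have "poly (l * U) x = (x - r) * (\<Sum>i<p. r ^ (p - Suc i) * x ^ i)" by (simp add: l_def U_def poly_sum poly_monom left_diff_distrib)
  also have "\<dots> = x ^ p - r ^ p" by (rule power_diff_sumr2[symmetric])
  finally show ?thesis by (simp add: l_def diff_power_p)
 qed
 then have "l * U - l ^ p = 0" using poly_eq_0_cofinite[of "{}"] by blast
 then have "l * U = l * l ^ (p - 1)" using p0 by (simp add: power_eq_if)
 then have U: "l ^ (p - 1) = U" by (metis l_def mult_left_cancel pCons_eq_0_iff zero_neq_one)
 have cU: "coeff U i = r ^ (p - Suc i)" if "i \<le> p - 1" for i using that p0 by (auto simp: U_def coeff_sum)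
 have "coeff (U * G) (p - 1) = (\<Sum>i\<le>p - 1. r ^ (p - Suc i) * coeff G (p - 1 - i))" unfolding coeff_mult by (intro sum.cong) (auto simp: cU)
 also have "\<dots> = (\<Sum>j\<le>p - 1. coeff G j * r ^ j)"
  by (rule sum.reindex_bij_witness[of _ "%j. p - 1 - j" "%i. p - 1 - i"]) (use p0 in auto)
 also have "\<dots> = poly G r" by (rule poly_sum_upto[OF assms, symmetric])
 finally show ?thesis unfolding l_def[symmetric] U .
qed

text \<open>\<open>f\<close> is a constant times \<open>E^2\<close>, and its zero derivative makes
  \<open>E\<close> a constant times \<open>(x - r)^p\<close>. So all entries of \<open>xs\<close>
  equal \<open>r\<close>, and the coefficient is the product of the differences \<open>r - y\<close>
  for \<open>y\<close> in \<open>ys\<close>, which are nonzero.\<close>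

lemma genus0_coeff:
 fixes f g E :: "'a poly"
 assumes f: "E ^ 2 dvd f" "degree E = p" "degree f = 2 * p" "pderiv f = 0" and nc: "!!r. \<not> (poly f r = 0 & poly g r = 0)"
  and xs: "length xs = p - 1" "!!x. x \<in> set xs ==> poly f x = 0" and ys: "length ys = p - 1" "!!y. y \<in> set ys ==> poly g y = 0"
 shows "coeff (\<Prod>x\<leftarrow>xs @ ys. [:- x, 1:]) (p - 1) ~= 0"
proof -
 obtain u where u: "f = E ^ 2 * u" using f(1) by (auto elim: dvdE)
 have p0: "p > 0" using p by simp
 then have nz: "E ~= 0" "u ~= 0" using u f(2,3) by auto
 then have "degree u = 0" using f(2,3) by (simp add: u degree_mult_eq degree_power_eq)
 then obtain t where t: "u = [:t:]" by (rule degree_eq_zeroE)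
 have fE: "f = smult t (E * E)" by (simp add: u t power2_eq_square)
 have "t ~= 0" using nz t by auto
 then have "2 * (E * pderiv E) = 0" using f(4) unfolding fE pderiv_smult pderiv_mult by (simp add: mult.commute)
 moreover have "(2 :: 'a poly) ~= 0" using two_nz by (simp add: numeral_poly)
 ultimately have E': "pderiv E = 0" using nz by simp
 define e0 e1 where "e0 = coeff E 0" and "e1 = coeff E p"
 have e1: "e1 ~= 0" using f(2) nz by (auto simp: e1_def)
 obtain r where r: "r ^ p = - (e0 / e1)" using power_root_exists[OF p0] by blast
 have "E = monom e1 p + [:e0:]"
 proof (rule poly_eqI)
  fix i
  consider "i = 0" | "i = p" | "i > p" | "\<not> p dvd i" using dvd_imp_le[of p i] by (meson linorder_neqE_nat not_le neq0_conv)
  then show "coeff E i = coeff (monom e1 p + [:e0:]) i"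
  proof cases
   case 4
   then show ?thesis using coeff_pderiv_0[OF E', of i] by (cases i) (auto simp: coeff_pCons split: nat.splits)
  qed (use f(2) p0 in \<open>auto simp: e0_def e1_def coeff_eq_0 coeff_pCons split: nat.splits\<close>)
 qed
 then have E: "poly E x = e1 * (x - r) ^ p" for x using e1 by (simp add: diff_power_p r poly_monom field_simps)
 have fr: "poly f x = 0 \<longleftrightarrow> x = r" for x using E[of x] e1 p0 nz t by (simp add: u)
 have "xs = replicate (p - 1) r" using xs fr by (metis replicate_length_same)
 then have xs': "(\<Prod>x\<leftarrow>xs. [:- x, 1:]) = [:- r, 1:] ^ (p - 1)" by (simp add: prod_list_replicate)
 have "r \<notin> set ys" using ys(2) nc fr by blast
 then have "poly (\<Prod>x\<leftarrow>ys. [:- x, 1:]) r ~= 0" by (simp add: prod_linear_root)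
 moreover have "coeff (\<Prod>x\<leftarrow>xs @ ys. [:- x, 1:]) (p - 1) = poly (\<Prod>x\<leftarrow>ys. [:- x, 1:]) r"
  using coeff_power_linear_mult[of "\<Prod>x\<leftarrow>ys. [:- x, 1:]" r] ys(1) by (simp add: xs' degree_prod_linear)
 ultimately show ?thesis by simp
qed

text \<open>In terms of \<open>PP\<close>: the derivative is zero.\<close>

definition W0 :: "(int \<times> int => 'a) set" where
 "W0 = {z \<in> chart_vectors. \<forall>i\<le>2 * p. \<not> p dvd i --> z (int i, 0) = 0}"

text \<open>One of \<open>PP + 2 c x^p\<close> and \<open>PP - 2 c x^p\<close> is a square; since
  \<open>c\<close> may be either square root of \<open>ca * cb\<close>, one sign is enough.\<close>

definition W1 :: "(int \<times> int => 'a) set" where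
 "W1 = {z \<in> chart_vectors. \<exists>c xs. c ^ 2 = z (int p, 1) * z (int p, -1) & length xs = p &
   (\<forall>i\<le>2 * p. z (int i, 0) + (if i = p then 2 * c else 0) = coeff (\<Prod>x\<leftarrow>xs @ xs. [:- x, 1:]) i)}"

text \<open>\<open>xs\<close> and \<open>ys\<close> are meant to be the roots of \<open>E1\<close>
  and \<open>E2\<close> when both have degree \<open>p - 1\<close>. The last condition is what is
  kept of \<open>E1 * E2\<close> being proportional to a derivative, which has no term
  \<open>x^(p - 1)\<close> in characteristic \<open>p\<close>.\<close>

definition tangency :: "(int \<times> int => 'a) => 'a => 'a list => 'a list => bool" where
 "tangency z c xs ys \<longleftrightarrow> c ^ 2 = z (int p, 1) * z (int p, -1) & length xs = p - 1 & length ys = p - 1 &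
   (\<forall>x\<in>set xs. profile z x = 2 * c * x ^ p) & (\<forall>y\<in>set ys. profile z y = - (2 * c * y ^ p)) &
   coeff (\<Prod>x\<leftarrow>xs @ ys. [:- x, 1:]) (p - 1) = 0"

definition W2 :: "(int \<times> int => 'a) set" where
 "W2 = {z \<in> chart_vectors. \<exists>c xs ys. tangency z c xs ys}"

lemma W_chart: "W0 <= chart_vectors" "W1 <= chart_vectors" "W2 <= chart_vectors" by (auto simp: W0_def W1_def W2_def)

lemma W0_closed:
 assumes "z0 \<in> chart_vectors" "proj_point z0 \<in> zariski A closure_of (proj_point ` W0)" shows "z0 \<in> W0"
proof -
 obtain B e where "specialization W0 z0 B e" by (rule ex_specialization[OF W_chart(1) assms, of "[]"]) auto
 then interpret specialization W0 z0 B e .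
 have "z0 (int i, 0) = 0" if "i \<le> 2 * p" "\<not> p dvd i" for i
  using null[of "%ze. ze (int i, 0)"] that e_coord[of "(int i, 0)"] by (simp add: W0_def)
 then show ?thesis using assms(1) by (simp add: W0_def)
qed

lemma root_condition:
 fixes c :: 'a
 assumes "c ^ 2 = ab" "y = 2 * c * x ^ p \<or> y = - (2 * c * x ^ p)" shows "y ^ 2 = 4 * ab * x ^ (2 * p)"
 using assms by (auto simp: power_mult_distrib power_double power2_eq_square)

text \<open>\<open>c\<close> and the entries of \<open>xs\<close> are chosen as functions on
  \<open>W1\<close>. They are integral over the coordinates, so they take values at
  \<open>z0\<close> too, and the coefficient identities pass to these values.\<close>

lemma W1_closed:
 assumes "z0 \<in> chart_vectors" "proj_point z0 \<in> zariski A closure_of (proj_point ` W1)" shows "z0 \<in> W1"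
proof -
 have "\<forall>ze\<in>W1. \<exists>c xs. c ^ 2 = ze (int p, 1) * ze (int p, -1) & length xs = p &
   (\<forall>i\<le>2 * p. ze (int i, 0) + (if i = p then 2 * c else 0) = coeff (\<Prod>x\<leftarrow>xs @ xs. [:- x, 1:]) i)" by (simp add: W1_def)
 then obtain c xs where c: "!!ze. ze \<in> W1 ==> c ze ^ 2 = ze (int p, 1) * ze (int p, -1)" and xs: "!!ze. ze \<in> W1 ==> length (xs ze) = p"
  and co: "!!ze i. ze \<in> W1 ==> i \<le> 2 * p ==> ze (int i, 0) + (if i = p then 2 * c ze else 0) = coeff (\<Prod>x\<leftarrow>xs ze @ xs ze. [:- x, 1:]) i"
  by metis
 define tx where "tx = map (%i ze. xs ze ! i) [0..<p]"
 have tx: "map (%t. t ze) tx = xs ze" if "ze \<in> W1" for ze using map_nth_list[OF xs[OF that]] by (simp add: tx_def comp_def)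
 have root: "profile ze (t ze) ^ 2 = 4 * (ze (int p, 1) * ze (int p, -1)) * t ze ^ (2 * p)" if z: "ze \<in> W1" and t: "t \<in> set tx" for t ze
 proof (rule root_condition[OF c[OF z]])
  have "t ze \<in> set (xs ze)" unfolding tx[OF z, symmetric] using t by simp
  define G where "G = (\<Prod>x\<leftarrow>xs ze @ xs ze. [:- x, 1:])"
  have "poly G (t ze) = 0" unfolding G_def prod_linear_root using \<open>t ze \<in> set (xs ze)\<close> by simp
  moreover have "degree G \<le> 2 * p" unfolding G_def degree_prod_linear using xs[OF z] by simp
  ultimately have "0 = (\<Sum>i\<le>2 * p. coeff G i * t ze ^ i)" by (metis poly_sum_upto)
  also have "\<dots> = (\<Sum>i\<le>2 * p. (ze (int i, 0) + (if i = p then 2 * c ze else 0)) * t ze ^ i)"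
   using co[OF z, folded G_def] by (intro sum.cong) auto
  also have "\<dots> = profile ze (t ze) + 2 * c ze * t ze ^ p"
   by (simp add: profile_def distrib_right sum.distrib if_distrib[of "%x. x * _"] cong: if_cong)
  finally show "profile ze (t ze) = 2 * c ze * t ze ^ p \<or> profile ze (t ze) = - (2 * c ze * t ze ^ p)" by (simp add: eq_neg_iff_add_eq_0)
 qed
 obtain B e where "specialization W1 z0 B e" and ts: "set (c # tx) <= B"
 proof (rule ex_specialization[OF W_chart(2) assms, of "c # tx"])
  fix t assume "t \<in> set (c # tx)"
  then show "(\<forall>ze\<in>W1. t ze ^ 2 = ze (int p, 1) * ze (int p, -1)) \<or>
   (\<forall>ze\<in>W1. profile ze (t ze) ^ 2 = 4 * (ze (int p, 1) * ze (int p, -1)) * t ze ^ (2 * p))" using c root by auto qed blast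
 then interpret specialization W1 z0 B e by simp
 have cB: "c \<in> B" and tB: "set (tx @ tx) <= B" using ts by auto
 have "e c ^ 2 = z0 (int p, 1) * z0 (int p, -1)"
  using transfer[of "%ze. c ze ^ 2" "%ze. ze (int p, 1) * ze (int p, -1)"] c cB by (simp add: mem_intros e_simps)
 moreover have "z0 (int i, 0) + (if i = p then 2 * e c else 0) = coeff (\<Prod>x\<leftarrow>map e tx @ map e tx. [:- x, 1:]) i" if i: "i \<le> 2 * p" for i
 proof -
  have "(%ze. ze (int i, 0) + (if i = p then 2 * c ze else 0)) \<in> B &
   e (%ze. ze (int i, 0) + (if i = p then 2 * c ze else 0)) = z0 (int i, 0) + (if i = p then 2 * e c else 0)"
   using cB by (cases "i = p") (simp_all add: mem_intros e_simps)
  note left = this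
  have eq: "ze (int i, 0) + (if i = p then 2 * c ze else 0) = coeff (\<Prod>t\<leftarrow>tx @ tx. [:- t ze, 1:]) i" if "ze \<in> W1" for ze
  proof -
   have mp: "map (%t. [:- t ze, 1:]) (tx @ tx) = map (%x. [:- x, 1:]) (xs ze @ xs ze)" by (simp add: tx[OF that, symmetric])
   show ?thesis unfolding mp by (rule co[OF that i])
  qed
  have "z0 (int i, 0) + (if i = p then 2 * e c else 0) = coeff (\<Prod>t\<leftarrow>tx @ tx. [:- e t, 1:]) i"
   unfolding left[THEN conjunct2, symmetric] coeff_prod_linear(2)[OF tB, symmetric]
   by (rule transfer[OF left[THEN conjunct1] coeff_prod_linear(1)[OF tB] eq])
  then show ?thesis by (simp add: comp_def)
 qed
 ultimately show ?thesis using assms(1) unfolding W1_def by (intro CollectI conjI exI[of _ "e c"] exI[of _ "map e tx"]) (auto simp: tx_def)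
qed

lemma e_profile:
 assumes "specialization W z0 B e" "t \<in> B" shows "(%ze. profile ze (t ze)) \<in> B" "e (%ze. profile ze (t ze)) = profile z0 (e t)"
proof -
 interpret specialization W z0 B e by fact
 show "(%ze. profile ze (t ze)) \<in> B" "e (%ze. profile ze (t ze)) = profile z0 (e t)"
  unfolding profile_def using assms(2) by (simp_all add: mem_intros e_simps)
qed

lemma W2_closed:
 assumes "z0 \<in> chart_vectors" "proj_point z0 \<in> zariski A closure_of (proj_point ` W2)" shows "z0 \<in> W2"
proof -
 have "\<forall>ze\<in>W2. \<exists>c xs ys. tangency ze c xs ys" by (simp add: W2_def)
 then obtain c xs ys where "!!ze. ze \<in> W2 ==> tangency ze (c ze) (xs ze) (ys ze)" by metis
 note tan = this[unfolded tangency_def]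
 have c: "c ze ^ 2 = ze (int p, 1) * ze (int p, -1)" and xs: "length (xs ze) = p - 1" and ys: "length (ys ze) = p - 1"
  and rx: "x \<in> set (xs ze) ==> profile ze x = 2 * c ze * x ^ p" and ry: "x \<in> set (ys ze) ==> profile ze x = - (2 * c ze * x ^ p)"
  and co: "coeff (\<Prod>x\<leftarrow>xs ze @ ys ze. [:- x, 1:]) (p - 1) = 0" if "ze \<in> W2" for ze x using tan[OF that] by blast+
 define tx where "tx = map (%i ze. xs ze ! i) [0..<p - 1]"
 define ty where "ty = map (%i ze. ys ze ! i) [0..<p - 1]"
 have tx: "map (%t. t ze) tx = xs ze" and ty: "map (%t. t ze) ty = ys ze" if "ze \<in> W2" for ze
  using map_nth_list[OF xs[OF that]] map_nth_list[OF ys[OF that]] by (simp_all add: tx_def ty_def comp_def)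
 have rx': "profile ze (t ze) = 2 * c ze * t ze ^ p" if "ze \<in> W2" "t \<in> set tx" for t ze
  by (rule rx[OF that(1)]) (use that(2) in \<open>simp add: tx[OF that(1), symmetric]\<close>)
 have ry': "profile ze (t ze) = - (2 * c ze * t ze ^ p)" if "ze \<in> W2" "t \<in> set ty" for t ze
  by (rule ry[OF that(1)]) (use that(2) in \<open>simp add: ty[OF that(1), symmetric]\<close>)
 obtain B e where sp: "specialization W2 z0 B e" and ts: "set (c # tx @ ty) <= B"
 proof (rule ex_specialization[OF W_chart(3) assms, of "c # tx @ ty"])
  fix t assume "t \<in> set (c # tx @ ty)"
  then consider "t = c" | "t \<in> set tx" | "t \<in> set ty" by auto
  then show "(\<forall>ze\<in>W2. t ze ^ 2 = ze (int p, 1) * ze (int p, -1)) \<or>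
   (\<forall>ze\<in>W2. profile ze (t ze) ^ 2 = 4 * (ze (int p, 1) * ze (int p, -1)) * t ze ^ (2 * p))"
   using c root_condition[OF c] rx' ry' by cases blast+
 qed blast
 interpret specialization W2 z0 B e by (rule sp)
 have cB: "c \<in> B" and tB: "set (tx @ ty) <= B" using ts by auto
 have "e c ^ 2 = z0 (int p, 1) * z0 (int p, -1)"
  using transfer[of "%ze. c ze ^ 2" "%ze. ze (int p, 1) * ze (int p, -1)"] c cB by (simp add: mem_intros e_simps)
 moreover have "profile z0 (e t) = 2 * e c * e t ^ p" if t: "t \<in> set tx" for t
 proof -
  have "t \<in> B" using t tB by auto
  then show ?thesis using transfer[of "%ze. profile ze (t ze)" "%ze. 2 * c ze * t ze ^ p"] rx' t cB
   by (simp add: mem_intros e_simps e_profile[OF sp])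
 qed
 moreover have "profile z0 (e t) = - (2 * e c * e t ^ p)" if t: "t \<in> set ty" for t
 proof -
  have "t \<in> B" using t tB by auto
  then show ?thesis using null[of "%ze. profile ze (t ze) + 2 * c ze * t ze ^ p"] ry' t cB
   by (simp add: mem_intros e_simps e_profile[OF sp] eq_neg_iff_add_eq_0)
 qed
 moreover have "coeff (\<Prod>x\<leftarrow>map e tx @ map e ty. [:- x, 1:]) (p - 1) = 0"
 proof -
  have "coeff (\<Prod>t\<leftarrow>tx @ ty. [:- t ze, 1:]) (p - 1) = 0" if "ze \<in> W2" for ze
  proof -
   have mp: "map (%t. [:- t ze, 1:]) (tx @ ty) = map (%x. [:- x, 1:]) (xs ze @ ys ze)" by (simp add: tx[OF that, symmetric] ty[OF that, symmetric])
   show ?thesis unfolding mp by (rule co[OF that])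
  qed
  then show ?thesis
   using null[of "%ze. coeff (\<Prod>t\<leftarrow>tx @ ty. [:- t ze, 1:]) (p - 1)"] coeff_prod_linear(2)[OF tB, of "p - 1"] by (simp add: comp_def)
 qed
 ultimately show ?thesis using assms(1) unfolding W2_def tangency_def
  by (intro CollectI conjI exI[of _ "e c"] exI[of _ "map e tx"] exI[of _ "map e ty"]) (auto simp: tx_def ty_def)
qed

end

locale odd_curve = odd_kite p A m ty + good_curve p A z for p A m and ty :: "'a::alg_closed_field itself" and z :: "int \<times> int => 'a" +
 fixes c :: 'a
 assumes chart: "z \<in> chart_vectors" and c: "c ^ 2 = z (int p, 1) * z (int p, -1)"
begin

definition f1 where "f1 = PP - monom (2 * c) p"
definition f2 where "f2 = PP + monom (2 * c) p"

lemma c_nz: "c ~= 0" using c ab_nz by auto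

lemma f1_f2: "f1 * f2 = PP ^ 2 - 4 * QQ"
proof -
 have e: "2 * c * (2 * c) = 4 * (ca * cb)" "p + p = 2 * p" unfolding c[symmetric] by (simp_all add: power2_eq_square)
 have "4 * QQ = monom (2 * c) p * monom (2 * c) p" unfolding mult_monom e by (simp add: QQ_def numeral_poly smult_monom)
 then show ?thesis by (simp add: f1_def f2_def power2_eq_square algebra_simps)
qed

lemma no_common_root: "\<not> (poly f1 r = 0 & poly f2 r = 0)"
proof
 assume r: "poly f1 r = 0 & poly f2 r = 0"
 have "poly f2 r - poly f1 r = 4 * (c * r ^ p)" by (simp add: f1_def f2_def poly_monom)
 then have "4 * (c * r ^ p) = 0" using r by simp
 then have "r = 0" using four_nz c_nz by simp
 then show False using r PP_0 p_pos by (simp add: f1_def poly_monom)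
qed

lemma f_degree: "degree f1 = 2 * p" "degree f2 = 2 * p" "lead_coeff f1 = 1" "lead_coeff f2 = 1"
proof -
 have d: "degree (monom (2 * c) p) < degree PP" using p degree_PP degree_monom_le[of "2 * c" p] by simp
 then have "degree f1 = degree PP" "degree f2 = degree PP" unfolding f1_def f2_def diff_conv_add_uminus by (intro degree_add_eq_left; simp)+
 then show d1: "degree f1 = 2 * p" and d2: "degree f2 = 2 * p" using degree_PP by simp_all
 have "coeff PP (2 * p) = 1" "p ~= 2 * p" using chart p_pos by (simp_all add: coeff_PP chart_vectors_def)
 then have "coeff f1 (2 * p) = 1" "coeff f2 (2 * p) = 1" by (simp_all add: f1_def f2_def)
 then show "lead_coeff f1 = 1" "lead_coeff f2 = 1" by (simp_all only: d1 d2)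
qed

text \<open>\<open>x^p\<close> has derivative zero; here the choice \<open>k = p\<close>
  enters.\<close>

lemma pderiv_f: "pderiv f1 = pderiv PP" "pderiv f2 = pderiv PP" by (simp_all add: f1_def f2_def pderiv_diff pderiv_add pderiv_monom of_nat_p)

text \<open>\<open>f1\<close> and \<open>f2\<close> have no common root, so \<open>S\<close> splits
  along them. Each part divides the common derivative, and coprimality gives divisibility by the
  product.\<close>

lemma split:
 assumes S: "S ^ 2 dvd PP ^ 2 - 4 * QQ" "S ~= 0"
 obtains E1 E2 where "S = E1 * E2" "E1 ^ 2 dvd f1" "E2 ^ 2 dvd f2" "E1 * E2 dvd pderiv PP" "degree E1 \<le> p" "degree E2 \<le> p"
  "degree S = degree E1 + degree E2"
proof -
 obtain E1 E2 where E: "S = E1 * E2" "E1 ^ 2 dvd f1" "E2 ^ 2 dvd f2" using square_split[OF S(2), of f1 f2] S(1) no_common_root by (auto simp: f1_f2)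
 have nz: "E1 ~= 0" "E2 ~= 0" "f1 ~= 0" "f2 ~= 0" using E(1) S(2) f_degree(3,4) by auto
 have dv: "E dvd pderiv f" if Ef: "E ^ 2 dvd f" for E f :: "'a poly"
 proof -
  obtain t where "f = E ^ 2 * t" using Ef by (auto elim: dvdE)
  then show ?thesis by (simp add: power2_eq_square pderiv_mult)
 qed
 have rt: "poly f r = 0" if "E ^ 2 dvd f" "poly E r = 0" for E f :: "'a poly" and r using that by (auto elim!: dvdE)
 have "E1 * E2 dvd pderiv PP" using dv[OF E(2)] dv[OF E(3)] rt[OF E(2)] rt[OF E(3)] no_common_root
  by (intro no_common_root_mult_dvd[OF nz(1)]) (auto simp: pderiv_f)
 moreover have "degree (E1 ^ 2) \<le> 2 * p" "degree (E2 ^ 2) \<le> 2 * p"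
  using dvd_imp_degree_le[OF E(2) nz(3)] dvd_imp_degree_le[OF E(3) nz(4)] f_degree by simp_all
 moreover have "degree S = degree E1 + degree E2" using nz by (simp add: E(1) degree_mult_eq)
 ultimately show thesis using that[OF E] nz by (simp add: degree_power_eq)
qed

text \<open>The coefficient at \<open>x^(2 p - 1)\<close> carries the factor \<open>2 p\<close>,
  which is zero.\<close>

lemma degree_pderiv_PP: "degree (pderiv PP) \<le> 2 * p - 2"
proof (rule degree_le, intro allI impI)
 fix i assume "2 * p - 2 < i"
 then consider "i = 2 * p - 1" | "i \<ge> 2 * p" by linarith
 then show "coeff (pderiv PP) i = 0"
 proof cases
  case 1
  then have "Suc i = 2 * p" using p by simp
  then have "of_nat (Suc i) = (0 :: 'a)" by (simp add: of_nat_p del: of_nat_Suc)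
  then show ?thesis by (simp only: coeff_pderiv mult_zero_left)
 next
  case 2
  then show ?thesis using degree_PP by (simp add: coeff_pderiv coeff_eq_0)
 qed
qed

lemma poly_f: "poly f1 x = profile z x - 2 * c * x ^ p" "poly f2 x = profile z x + 2 * c * x ^ p"
proof -
 have "poly PP x = profile z x" by (simp add: PP_def profile_def poly_sum poly_monom)
 then show "poly f1 x = profile z x - 2 * c * x ^ p" "poly f2 x = profile z x + 2 * c * x ^ p" by (simp_all add: f1_def f2_def poly_monom)
qed

lemma genus1_cases:
 assumes "proj_point z \<in> severi_irr 1 \<Delta>" shows "z \<in> W0 \<union> W1 \<union> W2"
proof (cases "pderiv PP = 0")
 case True
 then have "z (int i, 0) = 0" if "i \<le> 2 * p" "\<not> p dvd i" for i using coeff_pderiv_0[OF True, of i] that by (auto simp: coeff_PP)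
 then show ?thesis using chart by (simp add: W0_def)
next
 case False
 obtain S s where S: "conductor PP QQ S s" "degree S < 2 * p" "1 = 2 * p - 1 - degree S" using assms unfolding severi_irr_iff by blast
 have dS: "degree S = 2 * p - 2" using S(2,3) by linarith
 obtain E1 E2 where E: "S = E1 * E2" "E1 ^ 2 dvd f1" "E2 ^ 2 dvd f2" "E1 * E2 dvd pderiv PP" "degree E1 \<le> p" "degree E2 \<le> p"
  "degree S = degree E1 + degree E2" using split[OF conductor_disc[OF S(1)]] S(1) by (auto simp: conductor_def)
 have nz: "E1 ~= 0" "E2 ~= 0" using E(1) S(1) by (auto simp: conductor_def)
 have w1: "z \<in> W1" if "d ^ 2 = c ^ 2" "PP + monom (2 * d) p = (\<Prod>x\<leftarrow>xs @ xs. [:- x, 1:])" "length xs = p" for d xs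
 proof -
  have "z (int i, 0) + (if i = p then 2 * d else 0) = coeff (\<Prod>x\<leftarrow>xs @ xs. [:- x, 1:]) i" if "i \<le> 2 * p" for i
   using that unfolding \<open>PP + monom (2 * d) p = _\<close>[symmetric] by (simp add: coeff_PP)
  then show ?thesis unfolding W1_def using that chart c by (intro CollectI conjI exI[of _ d] exI[of _ xs]) auto
 qed
 \<comment> \<open>The two degrees are at most \<open>p\<close> and add up to
   \<open>2 p - 2\<close>.\<close>
 consider "degree E1 = p" | "degree E2 = p" | "degree E1 = p - 1" "degree E2 = p - 1" using E(5-7) dS p by linarith
 then show ?thesis
 proof cases
  case 1
  obtain u where "f1 = E1 ^ 2 * u" using E(2) by (auto elim: dvdE)
  then obtain xs where "length xs = p" "f1 = (\<Prod>x\<leftarrow>xs @ xs. [:- x, 1:])" using square_factors[of f1 E1 u] f_degree 1 by metis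
  then show ?thesis using w1[of "- c" xs] by (simp add: f1_def minus_monom[symmetric])
 next
  case 2
  obtain u where "f2 = E2 ^ 2 * u" using E(3) by (auto elim: dvdE)
  then obtain xs where "length xs = p" "f2 = (\<Prod>x\<leftarrow>xs @ xs. [:- x, 1:])" using square_factors[of f2 E2 u] f_degree 2 by metis
  then show ?thesis using w1[of c xs] by (simp add: f2_def)
 next
  case 3
  obtain xs where xs: "length xs = p - 1" "E1 = smult (lead_coeff E1) (\<Prod>x\<leftarrow>xs. [:- x, 1:])"
   using linear_factors[OF nz(1)] 3 by metis
  obtain ys where ys: "length ys = p - 1" "E2 = smult (lead_coeff E2) (\<Prod>x\<leftarrow>ys. [:- x, 1:])"
   using linear_factors[OF nz(2)] 3 by metis
  obtain u where u: "pderiv PP = E1 * E2 * u" using E(4) by (auto elim: dvdE)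
  have "degree (pderiv PP) = 2 * p - 2 + degree u" using False nz dS E(7) unfolding u by (simp add: degree_mult_eq)
  then have "degree u = 0" using degree_pderiv_PP by simp
  then obtain t where t: "u = [:t:]" by (rule degree_eq_zeroE)
  define G where "G = (\<Prod>x\<leftarrow>xs @ ys. [:- x, 1:])"
  have "E1 * E2 = smult (lead_coeff E1 * lead_coeff E2) G" by (subst xs(2), subst ys(2)) (simp add: G_def mult.commute)
  then have PG: "pderiv PP = smult (t * (lead_coeff E1 * lead_coeff E2)) G" by (simp add: u t)
  have "Suc (p - 1) = p" using p by simp
  then have "coeff (pderiv PP) (p - 1) = 0" unfolding coeff_pderiv using of_nat_p by simp
  then have "coeff G (p - 1) = 0" using False unfolding PG by auto
  moreover have "profile z x = 2 * c * x ^ p" if "x \<in> set xs" for x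
  proof -
   have "poly E1 x = 0" by (subst xs(2)) (use that prod_linear_root[of xs x] in simp)
   then have "poly f1 x = 0" using E(2) by (auto elim!: dvdE)
   then show ?thesis by (simp add: poly_f)
  qed
  moreover have "profile z x = - (2 * c * x ^ p)" if "x \<in> set ys" for x
  proof -
   have "poly E2 x = 0" by (subst ys(2)) (use that prod_linear_root[of ys x] in simp)
   then have "poly f2 x = 0" using E(3) by (auto elim!: dvdE)
   then show ?thesis by (simp add: poly_f eq_neg_iff_add_eq_0)
  qed
  ultimately have "z \<in> W2"
   unfolding W2_def tangency_def using chart c xs(1) ys(1) by (intro CollectI conjI exI[of _ c] exI[of _ xs] exI[of _ ys]) (auto simp: G_def)
  then show ?thesis by blast
 qed
qed

text \<open>A conductor of degree \<open>2 p - 1\<close> cannot divide a nonzero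
  \<open>pderiv PP\<close>. So the derivative is zero, one of the two parts has degree
  \<open>p\<close>, and \<open>genus0_coeff\<close> applies to it.\<close>

lemma genus0_contradiction:
 assumes "proj_point z \<in> severi_irr 0 \<Delta>" and xs: "length xs = p - 1" "!!x. x \<in> set xs ==> profile z x = 2 * c * x ^ p"
  and ys: "length ys = p - 1" "!!x. x \<in> set ys ==> profile z x = - (2 * c * x ^ p)"
 shows "coeff (\<Prod>x\<leftarrow>xs @ ys. [:- x, 1:]) (p - 1) ~= 0"
proof -
 obtain S s where S: "conductor PP QQ S s" "degree S < 2 * p" "0 = 2 * p - 1 - degree S" using assms(1) unfolding severi_irr_iff by blast
 have dS: "degree S = 2 * p - 1" using S(2,3) by linarith
 obtain E1 E2 where E: "S = E1 * E2" "E1 ^ 2 dvd f1" "E2 ^ 2 dvd f2" "E1 * E2 dvd pderiv PP" "degree E1 \<le> p" "degree E2 \<le> p"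
  "degree S = degree E1 + degree E2" using split[OF conductor_disc[OF S(1)]] S(1) by (auto simp: conductor_def)
 have P': "pderiv PP = 0"
 proof (rule ccontr)
  assume "pderiv PP ~= 0"
  then have "degree S \<le> degree (pderiv PP)" using dvd_imp_degree_le E(1,4) by blast
  then show False using degree_pderiv_PP dS p by simp
 qed
 have fx: "poly f1 x = 0" if "x \<in> set xs" for x using xs(2)[OF that] by (simp add: poly_f)
 have fy: "poly f2 x = 0" if "x \<in> set ys" for x using ys(2)[OF that] by (simp add: poly_f)
 consider "degree E1 = p" | "degree E2 = p" using E(5-7) dS p by linarith
 then show ?thesis
 proof cases
  case 1
  then show ?thesis using genus0_coeff[OF E(2) 1 f_degree(1) _ no_common_root xs(1) fx ys(1) fy] P' pderiv_f by simp
 next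
  case 2
  have "coeff (\<Prod>x\<leftarrow>ys @ xs. [:- x, 1:]) (p - 1) ~= 0"
   using genus0_coeff[OF E(3) 2 f_degree(2) _ _ ys(1) fy xs(1) fx] no_common_root P' pderiv_f by auto
  then show ?thesis by (simp add: mult.commute)
 qed
qed

end

context odd_kite
begin

lemma odd_curveI:
 fixes z :: "int \<times> int => 'a"
 assumes "good_curve p A z" "z \<in> chart_vectors" "c ^ 2 = z (int p, 1) * z (int p, -1)" shows "odd_curve p A m z c"
 using assms odd_kite_axioms by (simp add: odd_curve_def odd_curve_axioms_def)

lemma ex_genus1:
 obtains z :: "int \<times> int => 'a" where "proj_point z \<in> severi_irr 1 \<Delta>" "z \<in> chart_vectors" "z \<notin> W0" "z \<notin> W1"
proof -
 obtain S1 S2 T1 T2 :: "'a poly" and c :: 'a where S: "degree S1 = 2 * m" "degree S2 = 2 * m"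
  and d: "degree (S1 ^ 2 * T1) = 2 * p" "lead_coeff (S1 ^ 2 * T1) = 1"
  and n0: "poly (S1 ^ 2 * T1) 0 ~= 0" "pderiv (S1 ^ 2 * T1) ~= 0" and c: "c ~= 0" and diff: "S2 ^ 2 * T2 - S1 ^ 2 * T1 = monom (4 * c) p"
  and roots: "\<exists>r. poly T1 r = 0 & poly (pderiv T1) r ~= 0" "\<exists>r. poly T2 r = 0 & poly (pderiv T2) r ~= 0" by (rule ex_tangent_pair)
 \<comment> \<open>Chosen so that \<open>f1\<close> is \<open>S1^2 * T1\<close>; then
   \<open>f2\<close>, which is \<open>f1 + 4 c x^p\<close>, comes out as
   \<open>S2^2 * T2\<close>.\<close>
 define P where "P = S1 ^ 2 * T1 + monom (2 * c) p"
 have dm: "degree (monom (2 * c) p) < degree (S1 ^ 2 * T1)" using p d(1) degree_monom_le[of "2 * c" p] by simp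
 have P: "degree P = 2 * p" "lead_coeff P = 1" "poly P 0 ~= 0"
 proof -
  show dP: "degree P = 2 * p" unfolding P_def using dm d(1) by (simp add: degree_add_eq_left)
  show "lead_coeff P = 1" using d p unfolding dP by (simp add: P_def)
  show "poly P 0 ~= 0" using n0(1) p by (simp add: P_def poly_monom)
 qed
 define z where "z = section_vector P 1 (c ^ 2)"
 have "c ^ 2 ~= 0" "(1 :: 'a) ~= 0" using c by simp_all
 note z = section_vector_good[OF P this(2,1), folded z_def]
 interpret odd_curve p A m ty z c using odd_curveI[OF z(1,2)] z(4,5) by simp
 have PP: "PP = P" by (rule z(3))
 have f: "f1 = S1 ^ 2 * T1" "f2 = S2 ^ 2 * T2"
 proof -
  show "f1 = S1 ^ 2 * T1" by (simp add: f1_def PP P_def)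
  have "f2 = S1 ^ 2 * T1 + (monom (2 * c) p + monom (2 * c) p)" by (simp add: f2_def PP P_def)
  also have "\<dots> = S2 ^ 2 * T2" using diff by (simp add: add_monom algebra_simps)
  finally show "f2 = S2 ^ 2 * T2" .
 qed
 have Snz: "S1 ~= 0" "S2 ~= 0" using S m1 by auto
 have P': "pderiv PP ~= 0" using n0(2) pderiv_f(1) f(1) by simp
 \<comment> \<open>A nonzero coefficient of the derivative gives a term of \<open>PP\<close> whose
   exponent is not divisible by \<open>p\<close>. It is the third term that
   \<open>irr_curveI\<close> asks for, and it keeps \<open>z\<close> out of
   \<open>W0\<close>.\<close>
 then obtain i where i: "coeff (pderiv PP) i ~= 0" by (metis leading_coeff_0_iff)
 have j: "of_nat (Suc i) ~= (0 :: 'a)" "coeff PP (Suc i) ~= 0" using i unfolding coeff_pderiv by auto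
 have "Suc i ~= 2 * p"
 proof
  assume "Suc i = 2 * p"
  then have "of_nat (Suc i) = (0 :: 'a)" by (simp add: of_nat_p del: of_nat_Suc)
  then show False using j(1) by blast
 qed
 moreover have "Suc i \<le> 2 * p" using le_degree[OF j(2)] degree_PP by simp
 ultimately have irr: "irr_curve p A z" using irr_curveI[of "Suc i"] j(2) by simp
 have "z \<notin> W0"
 proof
  assume "z \<in> W0"
  moreover have "\<not> p dvd Suc i" using j(1) of_nat_eq_0_iff_char_dvd[of "Suc i", where 'a = 'a] char by metis
  ultimately show False using j(2) \<open>Suc i \<le> 2 * p\<close> by (auto simp: W0_def coeff_PP)
 qed
 moreover have "z \<notin> W1"
 proof
  assume "z \<in> W1"
  then obtain d xs where dx: "d ^ 2 = z (int p, 1) * z (int p, -1)" "length xs = p"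
   "!!i. i \<le> 2 * p ==> z (int i, 0) + (if i = p then 2 * d else 0) = coeff (\<Prod>x\<leftarrow>xs @ xs. [:- x, 1:]) i" by (auto simp: W1_def)
  define G where "G = (\<Prod>x\<leftarrow>xs. [:- x, 1:])"
  have "PP + monom (2 * d) p = (\<Prod>x\<leftarrow>xs @ xs. [:- x, 1:])"
  proof (rule poly_eqI)
   fix i
   show "coeff (PP + monom (2 * d) p) i = coeff (\<Prod>x\<leftarrow>xs @ xs. [:- x, 1:]) i"
   proof (cases "i \<le> 2 * p")
    case True
    then show ?thesis unfolding dx(3)[OF True, symmetric] by (simp add: coeff_PP)
   next
    case False
    have "degree (\<Prod>x\<leftarrow>xs @ xs. [:- x, 1:]) < i" unfolding degree_prod_linear using dx(2) False by simp
    then show ?thesis using False by (simp add: coeff_eq_0 coeff_PP)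
   qed
  qed
  then have G: "PP + monom (2 * d) p = G ^ 2" by (simp add: G_def power2_eq_square)
  have "(d - c) * (d + c) = 0" using dx(1) unfolding z(4,5) by (simp add: power2_eq_square algebra_simps)
  then consider "d = c" | "d = - c" by (auto simp: eq_neg_iff_add_eq_0)
  then show False
  proof cases
   case 1
   then have "S2 ^ 2 * T2 = smult 1 (G ^ 2)" using G f(2) by (simp add: f2_def)
   then show False using simple_root_not_square[OF Snz(2)] roots(2) by blast
  next
   case 2
   then have "S1 ^ 2 * T1 = smult 1 (G ^ 2)" using G f(1) by (simp add: f1_def minus_monom[symmetric])
   then show False using simple_root_not_square[OF Snz(1)] roots(1) by blast
  qed
 qed
 moreover have "proj_point z \<in> severi_irr 1 \<Delta>" unfolding severi_irr_iff
 proof (intro conjI irr exI allI impI)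
  \<comment> \<open>Completing the square: with \<open>s = - PP / 2\<close> the conductor condition
    becomes divisibility of the discriminant by the square.\<close>
  define s where "s = smult (- inverse 2) PP"
  have s2: "PP + 2 * s = 0" using two_nz by (simp add: s_def numeral_poly)
  have sq: "4 * (s ^ 2 + PP * s + QQ) = - (PP ^ 2 - 4 * QQ)"
  proof -
   have P2: "PP = - (2 * s)" using s2 by (simp add: eq_neg_iff_add_eq_0)
   show ?thesis unfolding P2 by (simp add: power2_eq_square algebra_simps)
  qed
  have "(S1 * S2) ^ 2 dvd PP ^ 2 - 4 * QQ" unfolding f1_f2[symmetric] f by (simp add: power_mult_distrib mult_dvd_mono)
  then have "(S1 * S2) ^ 2 dvd - (PP ^ 2 - 4 * QQ)" by (simp only: dvd_minus_iff)
  then have "(S1 * S2) ^ 2 dvd smult 4 (s ^ 2 + PP * s + QQ)" unfolding sq[symmetric] by (simp add: numeral_poly)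
  then have "(S1 * S2) ^ 2 dvd s ^ 2 + PP * s + QQ" using four_nz by (simp add: dvd_smult_iff)
  then show "conductor PP QQ (S1 * S2) s" using Snz by (simp add: conductor_def s2)
  have dS: "degree (S1 * S2) = 2 * p - 2" using Snz S p by (simp add: degree_mult_eq)
  then show "degree (S1 * S2) < 2 * p" "1 = 2 * p - 1 - degree (S1 * S2)" using p m1 by simp_all
  fix S' s' assume "conductor PP QQ S' s'"
  then have "S' ^ 2 dvd PP ^ 2 - 4 * QQ" "S' ~= 0" using conductor_disc by (auto simp: conductor_def)
  then obtain E1 E2 where E: "E1 ^ 2 dvd f1" "E2 ^ 2 dvd f2" "degree E1 \<le> p" "degree E2 \<le> p"
   "degree S' = degree E1 + degree E2" using split by metis
  \<comment> \<open>Degree \<open>p\<close> would make \<open>f1\<close> a square, against the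
    simple root of \<open>T1\<close>. The same holds for \<open>E2\<close>, so no conductor has
    degree above \<open>2 p - 2\<close>.\<close>
  have "degree E1 ~= p"
  proof
   assume "degree E1 = p"
   moreover obtain u where "f1 = E1 ^ 2 * u" using E(1) by (auto elim: dvdE)
   ultimately obtain xs where "f1 = (\<Prod>x\<leftarrow>xs @ xs. [:- x, 1:])" using square_factors[of f1 E1 u] f_degree by metis
   then have "S1 ^ 2 * T1 = smult 1 ((\<Prod>x\<leftarrow>xs. [:- x, 1:]) ^ 2)" by (simp add: f power2_eq_square)
   then show False using simple_root_not_square[OF Snz(1)] roots(1) by blast
  qed
  moreover have "degree E2 ~= p"
  proof
   assume "degree E2 = p"
   moreover obtain u where "f2 = E2 ^ 2 * u" using E(2) by (auto elim: dvdE)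
   ultimately obtain xs where "f2 = (\<Prod>x\<leftarrow>xs @ xs. [:- x, 1:])" using square_factors[of f2 E2 u] f_degree by metis
   then have "S2 ^ 2 * T2 = smult 1 ((\<Prod>x\<leftarrow>xs. [:- x, 1:]) ^ 2)" by (simp add: f power2_eq_square)
   then show False using simple_root_not_square[OF Snz(2)] roots(2) by blast
  qed
  ultimately show "degree S' \<le> degree (S1 * S2)" using E(3-5) dS by linarith
 qed
 ultimately show thesis using that z(2) by blast
qed

theorem component_odd:
 "\<exists>V :: (int \<times> int, 'a) ppoint set. irreducible_component (zariski A) (zariski A closure_of severi_irr 1 \<Delta>) V & V \<inter> severi_irr 0 \<Delta> = {}"
proof (rule component_from_strata[OF W_chart W0_closed W1_closed W2_closed])
 fix z :: "int \<times> int => 'a" assume z: "good_curve p A z" "z \<in> chart_vectors"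
 obtain c where c: "c ^ 2 = z (int p, 1) * z (int p, -1)" using power_root_exists[of 2] by auto
 interpret odd_curve p A m ty z c by (rule odd_curveI[OF z c])
 show "z \<in> W0 \<union> W1 \<union> W2" if "proj_point z \<in> severi_irr 1 \<Delta>" using genus1_cases that by blast
next
 fix z assume z: "good_curve p A z" "z \<in> chart_vectors" "z \<in> W2" "proj_point z \<in> severi_irr 0 \<Delta>"
 then obtain c xs ys where *: "c ^ 2 = z (int p, 1) * z (int p, -1)" "length xs = p - 1" "length ys = p - 1"
  "!!x. x \<in> set xs ==> profile z x = 2 * c * x ^ p" "!!y. y \<in> set ys ==> profile z y = - (2 * c * y ^ p)"
  "coeff (\<Prod>x\<leftarrow>xs @ ys. [:- x, 1:]) (p - 1) = 0" by (auto simp: W2_def tangency_def)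
 interpret odd_curve p A m ty z c by (rule odd_curveI[OF z(1,2) *(1)])
 show False using genus0_contradiction[OF z(4) *(2,4,3,5)] *(6) by simp
next
 show "\<exists>z\<in>chart_vectors. proj_point (z :: int \<times> int => 'a) \<in> severi_irr 1 \<Delta> & z \<notin> W0 & z \<notin> W1"
  by (rule ex_genus1) blast
qed

end

section \<open>Characteristic two: divisibility and elimination\<close>

lemma char2_simps:
 fixes x y :: "'b::comm_ring_1"
 assumes "(2 :: 'b::comm_ring_1) = 0" shows "numeral (num.Bit0 n) = (0 :: 'b)" "numeral (num.Bit1 n) = (1 :: 'b)" "- x = x" "x - y = x + y"
proof -
 have d: "x + x = 0" for x :: 'b using assms by (metis mult_2 mult_zero_left)
 show "numeral (num.Bit0 n) = (0 :: 'b)" "numeral (num.Bit1 n) = (1 :: 'b)" by (simp_all add: numeral_Bit0 numeral_Bit1 d)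
 have neg: "- x = x" for x :: 'b using d[of x] by (metis eq_neg_iff_add_eq_0)
 show "- x = x" by (rule neg)
 show "x - y = x + y" by (metis diff_conv_add_uminus neg)
qed

text \<open>Suppose \<open>S\<close> had the full order \<open>j\<close> of \<open>P\<close> at
  \<open>r\<close>. Then \<open>(x - r)^(j + 1)\<close> divides \<open>S^2\<close>;
  \<open>s^2\<close> has even order at least the odd number \<open>j\<close>, so
  \<open>(x - r)^(j + 1)\<close> divides \<open>s^2\<close> and \<open>P * s\<close>, and hence
  \<open>u * P\<close>, whose order is only \<open>j\<close>.\<close>

lemma odd_order_root:
 fixes P S T s u :: "'a::field poly"
 assumes P: "P = S * T" "P ~= 0" and S: "S ^ 2 dvd s ^ 2 + P * s + u * P" and u: "poly u r ~= 0" and odd: "odd (order r P)" shows "poly T r = 0"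
proof (rule ccontr)
 assume T: "poly T r ~= 0"
 define l where "l = [:- r, 1:]"
 define j where "j = order r P"
 have od: "l ^ n dvd f \<longleftrightarrow> f = 0 \<or> n \<le> order r f" for n f unfolding l_def by (rule order_divides)
 have nz: "S ~= 0" "T ~= 0" using P by auto
 have "order r S = j" using order_mult[of S T r] P order_0I[OF T] by (simp add: j_def)
 then have lS: "l ^ j dvd S" by (simp add: od)
 have j: "j \<ge> 1" using odd by (auto simp: j_def elim: oddE)
 have "l ^ (j + 1) dvd l ^ (2 * j)" using j by (intro le_imp_power_dvd) simp
 also have "l ^ (2 * j) dvd S ^ 2" using lS by (metis dvd_power_same power_mult mult.commute)
 finally have lPh: "l ^ (j + 1) dvd s ^ 2 + P * s + u * P" using S dvd_trans by blast
 have lP: "l ^ j dvd P" by (simp add: od j_def)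
 have "l ^ j dvd s ^ 2 + P * s + u * P" using lPh by (metis dvd_trans le_add1 le_imp_power_dvd)
 then have "l ^ j dvd (s ^ 2 + P * s + u * P) - (P * s + u * P)" by (rule dvd_diff) (intro dvd_add dvd_mult2[OF lP] dvd_mult[OF lP])
 then have js: "l ^ j dvd s ^ 2" by simp
 have s2: "l ^ (j + 1) dvd s ^ 2 & l dvd s"
 proof (cases "s = 0")
  case False
  have "order r (s ^ 2) = 2 * order r s" using False by (simp add: power2_eq_square order_mult)
  then have "j \<le> 2 * order r s" using js False by (simp add: od)
  then have "j + 1 \<le> 2 * order r s" using odd by (cases "j = 2 * order r s") (auto simp: j_def)
  then have "l ^ (j + 1) dvd s ^ 2" "l ^ 1 dvd s" unfolding od \<open>order r (s ^ 2) = 2 * order r s\<close> using j by linarith+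
  then show ?thesis by simp
 qed simp
 then have "l ^ (j + 1) dvd P * s" using mult_dvd_mono[OF lP, of l s] by (simp add: mult.commute)
 with s2 have "l ^ (j + 1) dvd s ^ 2 + P * s" by (intro dvd_add) auto
 then have "l ^ (j + 1) dvd (s ^ 2 + P * s + u * P) - (s ^ 2 + P * s)" by (rule dvd_diff[OF lPh])
 then have "l ^ (j + 1) dvd u * P" by simp
 moreover have "u ~= 0" using u by auto
 moreover have "order r (u * P) = j" using \<open>u ~= 0\<close> P(2) order_0I[OF u] by (simp add: order_mult j_def)
 ultimately show False using P(2) unfolding od by auto
qed

lemma ex_squarefree_part:
 fixes P :: "'a::field poly"
 assumes "P ~= 0" shows "\<exists>q R. P = q * R ^ 2 & (\<forall>r. \<not> [:- r, 1:] ^ 2 dvd q)" using assms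
proof (induction "degree P" arbitrary: P rule: less_induct)
 case less
 show ?case
 proof (cases "\<exists>r. [:- r, 1:] ^ 2 dvd P")
  case True
  then obtain r P' where P': "P = [:- r, 1:] ^ 2 * P'" by (auto elim: dvdE)
  have "P' ~= 0" using less.prems P' by auto
  then have "degree P = 2 + degree P'" unfolding P' by (subst degree_mult_eq) (auto simp: degree_power_eq)
  then obtain q R where "P' = q * R ^ 2" "\<forall>r. \<not> [:- r, 1:] ^ 2 dvd q" using less.hyps[of P'] \<open>P' ~= 0\<close> by auto
  then show ?thesis unfolding P' by (intro exI[of _ q] exI[of _ "[:- r, 1:] * R"]) (simp only: power_mult_distrib mult_ac simp_thms)
 next
  case False
  then show ?thesis by (intro exI[of _ P] exI[of _ 1]) auto
 qed
qed

lemma order_squarefree_part: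
 fixes q R :: "'a::field poly"
 assumes "q * R ^ 2 ~= 0" "\<not> [:- r, 1:] ^ 2 dvd q" "poly q r = 0" shows "odd (order r (q * R ^ 2))"
proof -
 have nz: "q ~= 0" "R ~= 0" using assms(1) by auto
 have "\<not> 2 \<le> order r q" using order_divides[of r 2 q] assms(2) nz by auto
 moreover have "order r q ~= 0" using order_root[of q r] assms(3) nz by simp
 ultimately have "order r q = 1" by linarith
 then show ?thesis using nz by (simp add: order_mult power2_eq_square)
qed

lemma squarefree_dvd:
 fixes q T :: "'a::alg_closed_field poly"
 assumes "q ~= 0" "!!r. \<not> [:- r, 1:] ^ 2 dvd q" "!!r. poly q r = 0 ==> poly T r = 0" shows "q dvd T" using assms
proof (induction "degree q" arbitrary: q T)
 case 0
 then have "q dvd 1" by (simp add: is_unit_iff_degree)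
 then show ?case using dvd_trans one_dvd by blast
next
 case (Suc n)
 obtain r where r: "poly q r = 0" using alg_closed_imp_poly_has_root[of q] Suc(2) by auto
 define l where "l = [:- r, 1:]"
 have l0: "l ~= 0" by (simp add: l_def)
 obtain q' where q': "q = l * q'" using root_factor[OF r] by (auto simp: l_def)
 obtain T' where T': "T = l * T'" using root_factor[OF Suc(5)[OF r]] by (auto simp: l_def)
 have q'0: "q' ~= 0" using Suc(3) q' by auto
 have n: "n = degree q'" using Suc(2) q'0 l0 unfolding q' by (simp add: degree_mult_eq l_def del: mult_pCons_left)
 have qr: "poly q' r ~= 0"
 proof
  assume "poly q' r = 0"
  then obtain q'' where "q' = l * q''" using root_factor by (auto simp: l_def)
  then have "l ^ 2 dvd q" by (simp add: q' power2_eq_square mult.assoc[symmetric])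
  then show False using Suc(4)[of r] by (simp add: l_def)
 qed
 have "q' dvd T'"
 proof (rule Suc(1)[OF n q'0])
  show "\<not> [:- x, 1:] ^ 2 dvd q'" for x using Suc(4)[of x] unfolding q' by (metis dvd_mult)
  fix x assume x: "poly q' x = 0"
  then have "poly T x = 0" using Suc(5)[of x] by (simp add: q')
  moreover have "x ~= r" using x qr by auto
  ultimately show "poly T' x = 0" by (simp add: T' l_def)
 qed
 then show ?case unfolding q' T' by (rule mult_dvd_mono[OF dvd_refl])
qed

lemma square_dvd_square:
 fixes R t :: "'a::alg_closed_field poly"
 assumes "R ~= 0" "R ^ 2 dvd t ^ 2" shows "R dvd t" using assms
proof (induction "degree R" arbitrary: R t)
 case 0
 then have "R dvd 1" by (simp add: is_unit_iff_degree)
 then show ?case using dvd_trans one_dvd by blast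
next
 case (Suc n)
 obtain r where r: "poly R r = 0" using alg_closed_imp_poly_has_root[of R] Suc(2) by auto
 define l where "l = [:- r, 1:]"
 have l0: "l ~= 0" by (simp add: l_def)
 obtain R' where R': "R = l * R'" using root_factor[OF r] by (auto simp: l_def)
 obtain v where v: "t ^ 2 = R ^ 2 * v" using Suc(4) by (auto elim: dvdE)
 have "poly t r ^ 2 = 0" using arg_cong[OF v, of "%f. poly f r"] r by simp
 then obtain t' where t': "t = l * t'" using root_factor[of t r] by (auto simp: l_def)
 have R'0: "R' ~= 0" using Suc(3) R' by auto
 have n: "n = degree R'" using Suc(2) R'0 l0 unfolding R' by (simp add: degree_mult_eq l_def del: mult_pCons_left)
 have "l ^ 2 * t' ^ 2 = l ^ 2 * (R' ^ 2 * v)" using v unfolding R' t' by (simp only: power_mult_distrib mult.assoc)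
 then have "t' ^ 2 = R' ^ 2 * v" by (rule mult_left_cancel[THEN iffD1, OF power_not_zero[OF l0]])
 then have "R' dvd t'" using Suc(1)[OF n R'0] by simp
 then show ?case unfolding R' t' by (rule mult_dvd_mono[OF dvd_refl])
qed

lemma dvd_monom_mult_cancel:
 fixes R G :: "'a::alg_closed_field poly"
 assumes "R dvd monom c n * G" "c ~= 0" "poly R 0 ~= 0" shows "R dvd G"
proof -
 have "R * monom c n dvd monom c n * G"
 proof (rule no_common_root_mult_dvd)
  show "R ~= 0" using assms(3) by auto
  show "\<not> (poly R r = 0 & poly (monom c n) r = 0)" for r using assms(2,3) by (auto simp: poly_monom)
 qed (use assms in auto)
 then show ?thesis using assms(2) by (simp add: mult.commute[of R] monom_eq_0_iff)
qed

lemma dvd_small: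
 fixes R :: "'a::field poly"
 assumes "R dvd [:x, y:]" "degree R = 2" shows "x = 0 & y = 0"
proof (rule ccontr)
 assume "\<not> (x = 0 & y = 0)"
 then have "[:x, y:] ~= 0" by auto
 then have "degree R \<le> degree [:x, y:]" by (rule dvd_imp_degree_le[OF assms(1)])
 also have "\<dots> \<le> 1" by simp
 finally show False using assms(2) by simp
qed

text \<open>Here \<open>e\<close> and \<open>d\<close> are the sums of the linear and of the
  constant coefficients of two monic quadratics \<open>q\<close> and \<open>R\<close>.
  \<open>E1\<close> and \<open>E2\<close> arise from the remainder modulo \<open>R\<close> in
  \<open>conductor_equations\<close> by removing the factors \<open>R1^2\<close> and
  \<open>d\<close>; the case \<open>d = 0\<close> becomes a stratum of its own.\<close>

definition E1 :: "'a::field => 'a => 'a => 'a => 'a => 'a" where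
 "E1 c R0 R1 e d = (e ^ 3 + c) * (R1 * R0) + d * (e ^ 2 * R0 + d ^ 2)"

definition E2 :: "'a::field => 'a => 'a => 'a => 'a => 'a" where
 "E2 c R0 R1 e d = R1 ^ 3 * d ^ 2 + R1 * R0 ^ 2 * e ^ 2 + R1 * R0 * d ^ 2 + R0 * R1 ^ 2 * e * d + c * R0 * d"

locale characteristic_two =
 fixes ty :: "'a::alg_closed_field itself"
 assumes char: "CHAR('a) = 2"
begin

lemma two: "(2 :: 'a) = 0" and two_poly: "(2 :: 'a poly) = 0"
proof -
 show "(2 :: 'a) = 0" using of_nat_CHAR[where 'a = 'a] char by simp
 then show "(2 :: 'a poly) = 0" by (simp add: numeral_poly)
qed

lemmas c2 = char2_simps[OF two]
lemmas c2p = char2_simps[OF two_poly]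

lemma double: "x + x = (0 :: 'a)" and double_poly: "f + f = (0 :: 'a poly)" using c2(3)[of x] c2p(3)[of f] by (metis add.right_inverse)+

lemma add_0_eq: "x + y = 0 ==> x = y" for x y :: 'a
proof -
 assume "x + y = 0"
 then have "x = - y" by (simp add: eq_neg_iff_add_eq_0)
 then show ?thesis by (simp add: c2(3))
qed

lemma square_add: "(x + y) ^ 2 = x ^ 2 + y ^ 2" for x y :: 'a
proof -
 have "(x + y) ^ 2 = x ^ 2 + y ^ 2 + (x * y + x * y)" by (simp add: power2_eq_square algebra_simps)
 then show ?thesis by (simp only: double add_0_right)
qed

lemma square_add_poly: "(f + g) ^ 2 = f ^ 2 + g ^ 2" for f g :: "'a poly"
proof -
 have "(f + g) ^ 2 = f ^ 2 + g ^ 2 + (f * g + f * g)" by (simp add: power2_eq_square algebra_simps)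
 then show ?thesis by (simp only: double_poly add_0_right)
qed

lemma square_eq_poly:
 fixes f g :: "'a poly"
 assumes "f ^ 2 = g ^ 2" shows "f = g"
proof -
 have "(f + g) ^ 2 = 0" by (simp add: square_add_poly assms double_poly)
 then have "f = - g" by (simp add: eq_neg_iff_add_eq_0)
 then show ?thesis by (simp add: c2p(3))
qed

lemma pderiv_square: "pderiv (f ^ 2) = 0" for f :: "'a poly"
 using double_poly[of "f * pderiv f"] by (simp add: power2_eq_square pderiv_mult mult.commute)

lemma pderiv_X3: "pderiv (monom c 3) = monom c 2" for c :: 'a by (simp add: pderiv_monom c2)

lemma square_dvd_derivative:
 fixes R f :: "'a poly"
 assumes "R ^ 2 dvd f" shows "R dvd pderiv f"
proof -
 obtain v where "f = R ^ 2 * v" using assms by (auto elim: dvdE)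
 then have "pderiv f = R ^ 2 * pderiv v" by (simp add: pderiv_mult pderiv_square)
 then show ?thesis by (simp add: power2_eq_square mult.assoc)
qed

text \<open>Eliminating \<open>si\<close> from the congruence for \<open>si\<^sup>2 + f si + h\<close> and from its derivative.\<close>

lemma eliminate:
 fixes R g h si f :: "'a poly"
 assumes "R ^ 2 dvd si ^ 2 + R * f * si + h" shows "R dvd (pderiv R * f) ^ 2 * h + pderiv h ^ 2"
proof -
 define Ps where "Ps = si ^ 2 + R * f * si + h"
 have "R dvd Ps" using assms unfolding Ps_def power2_eq_square[of R] by (metis dvd_mult_left)
 then have 1: "R dvd Ps - R * (f * si)" by (intro dvd_diff) auto
 have "R dvd pderiv Ps - R * pderiv (f * si)" using square_dvd_derivative[OF assms] unfolding Ps_def by (intro dvd_diff) auto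
 moreover have "pderiv Ps - R * pderiv (f * si) = pderiv R * (f * si) + pderiv h"
  unfolding Ps_def pderiv_add pderiv_square mult.assoc pderiv_mult[of R] by (simp add: algebra_simps)
 ultimately have 2: "R dvd pderiv R * (f * si) + pderiv h" by simp
 have "R dvd (pderiv R * f) ^ 2 * (Ps - R * (f * si)) + (pderiv R * (f * si) + pderiv h) ^ 2"
  using 1 2 by (intro dvd_add dvd_mult) (auto simp: power2_eq_square)
 also have "(pderiv R * f) ^ 2 * (Ps - R * (f * si)) + (pderiv R * (f * si) + pderiv h) ^ 2 =
   ((pderiv R * f) ^ 2 * h + pderiv h ^ 2) + ((pderiv R * f * si) ^ 2 + (pderiv R * f * si) ^ 2)"
  unfolding square_add_poly Ps_def by (simp add: algebra_simps power_mult_distrib)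
 finally show ?thesis by (simp add: double_poly)
qed

text \<open>\<open>R\<close> divides \<open>s\<close>. After division by \<open>R^2\<close> the
  quotient \<open>si\<close> is eliminated, which leaves a divisibility by \<open>R\<close> in which
  \<open>x^3\<close> cancels because \<open>R0\<close> is nonzero. The remainder modulo
  \<open>R\<close> is linear with coefficients \<open>rh0\<close> and \<open>rh1\<close>, and both
  must vanish.\<close>

lemma conductor_equations:
 fixes R0 R1 q0 q1 c :: 'a and s :: "'a poly"
 assumes R0: "R0 ~= 0" and c: "c ~= 0" and R: "R = [:R0, R1, 1:]" and q: "q = [:q0, q1, 1:]"
  and dvd: "(R ^ 2) ^ 2 dvd s ^ 2 + q * R ^ 2 * s + monom c 3 * (q * R ^ 2)"
 shows "q0 + R0 = 0 \<or> E1 c R0 R1 (q1 + R1) (q0 + R0) = 0 & E2 c R0 R1 (q1 + R1) (q0 + R0) = 0"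
proof -
 define e d where "e = q1 + R1" and "d = q0 + R0"
 have Rnz: "R ~= 0" "degree R = 2" by (simp_all add: R)
 have "R ^ 2 dvd s ^ 2 + q * R ^ 2 * s + monom c 3 * (q * R ^ 2)" using dvd unfolding power2_eq_square[of "R ^ 2"] by (metis dvd_mult_left)
 then have "R ^ 2 dvd (s ^ 2 + q * R ^ 2 * s + monom c 3 * (q * R ^ 2)) - R ^ 2 * (q * s + monom c 3 * q)" by (intro dvd_diff) auto
 also have "(s ^ 2 + q * R ^ 2 * s + monom c 3 * (q * R ^ 2)) - R ^ 2 * (q * s + monom c 3 * q) = s ^ 2" by (simp add: algebra_simps)
 finally have "R dvd s" by (rule square_dvd_square[OF Rnz(1)])
 then obtain si where si: "s = R * si" by (auto elim: dvdE)
 have "R ^ 2 * R ^ 2 dvd R ^ 2 * (si ^ 2 + R * q * si + monom c 3 * q)" using dvd unfolding si by (simp add: power2_eq_square algebra_simps)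
 then have Ps: "R ^ 2 dvd si ^ 2 + R * q * si + monom c 3 * q" using Rnz(1) unfolding dvd_mult_cancel_left by simp
 have pR: "pderiv R = [:R1:]" by (simp add: R pderiv_pCons c2)
 have pq: "pderiv q = [:q1:]" by (simp add: q pderiv_pCons c2)
 have m: "monom c 3 = [:0, 0, 0, c:]" "monom c 2 = [:0, 0, c:]" by (simp_all add: numeral_3_eq_3 numeral_2_eq_2 monom_Suc monom_0)
 define l where "l = [:d, e:]"
 define N where "N = [:0, c:] * [:d, R1:] ^ 2 + [:R1:] ^ 2 * l ^ 3"
 have ql: "q = R + l" using double[of R0] double[of R1] two by (simp add: q R l_def d_def e_def algebra_simps c2)
 have ph: "pderiv (monom c 3 * q) = [:0, 0, c:] * (R + [:d, R1:])"
  unfolding pderiv_mult pderiv_X3 pq unfolding m by (simp add: q R d_def algebra_simps c2)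
 have "R dvd (pderiv R * q) ^ 2 * (monom c 3 * q) + pderiv (monom c 3 * q) ^ 2" by (rule eliminate[OF Ps])
 also have "\<dots> = monom c 3 * ([:R1:] ^ 2 * q ^ 3 + [:0, c:] * (R + [:d, R1:]) ^ 2)"
  unfolding ph pR unfolding m(1) by (simp add: power2_eq_square power3_eq_cube algebra_simps)
 finally have RG: "R dvd [:R1:] ^ 2 * q ^ 3 + [:0, c:] * (R + [:d, R1:]) ^ 2" by (rule dvd_monom_mult_cancel[OF _ c]) (simp add: R R0)
 have gen: "x ^ 2 * (R + l) ^ 3 + y * (R + w) ^ 2 = (y * w ^ 2 + x ^ 2 * l ^ 3) +
   R * (x ^ 2 * (R ^ 2 + 3 * R * l + 3 * l ^ 2) + y * (R + 2 * w))" for x y w :: "'a poly"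
  by (simp add: power2_eq_square power3_eq_cube algebra_simps)
 have "[:R1:] ^ 2 * q ^ 3 + [:0, c:] * (R + [:d, R1:]) ^ 2 = N + R * ([:R1:] ^ 2 * (R ^ 2 + 3 * R * l + 3 * l ^ 2) + [:0, c:] * (R + 2 * [:d, R1:]))"
  unfolding N_def ql by (rule gen)
 then have RN: "R dvd N" using RG by (metis dvd_add_left_iff dvd_triv_left)
 define rh0 rh1 where "rh0 = R1 ^ 2 * (e ^ 3 * R1 * R0 + e ^ 2 * d * R0 + d ^ 3) + c * R1 ^ 3 * R0"
  and "rh1 = R1 ^ 2 * (e ^ 3 * (R1 ^ 2 + R0) + e ^ 2 * d * R1 + e * d ^ 2) + c * (R1 ^ 2 * (R1 ^ 2 + R0) + d ^ 2)"
 define k3 where "k3 = c * R1 ^ 2 + R1 ^ 2 * e ^ 3"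
 have "N = R * [:R1 ^ 2 * e ^ 2 * d + k3 * R1, k3:] + [:rh0, rh1:]" unfolding N_def R l_def rh0_def rh1_def k3_def
  by (simp add: power2_eq_square power3_eq_cube algebra_simps c2)
 then have "R dvd [:rh0, rh1:]" using RN by (metis dvd_add_right_iff dvd_triv_left)
 then have rh: "rh0 = 0" "rh1 = 0" using dvd_small Rnz(2) by blast+
 show ?thesis
 proof (cases "d = 0")
  case False
  \<comment> \<open>For \<open>R1 = 0\<close> the second coefficient \<open>rh1\<close> would be
    \<open>c * d^2\<close>.\<close>
  have "R1 ~= 0" using rh(2) False c by (auto simp: rh1_def)
  moreover have "R1 ^ 2 * E1 c R0 R1 e d = rh0" by (simp add: E1_def rh0_def power2_eq_square power3_eq_cube algebra_simps)
  ultimately have 1: "E1 c R0 R1 e d = 0" using rh(1) by simp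
  have "d * E2 c R0 R1 e d = R0 * rh1 + R1 * (R1 ^ 2 + R0) * E1 c R0 R1 e d"
   by (simp add: E1_def E2_def rh1_def power2_eq_square power3_eq_cube algebra_simps c2)
  then show ?thesis using 1 rh(2) False by (simp add: e_def d_def)
 qed (simp add: d_def)
qed

text \<open>The case of genus zero: \<open>P\<close> is the square of \<open>l * g\<close> and the
  conductor is \<open>l * g^2\<close>, of degree five. The same elimination, modulo
  \<open>g\<close>, leaves a linear remainder whose two coefficients give the conclusion.\<close>

lemma rational_equations:
 fixes t kp c :: 'a and s :: "'a poly"
 assumes c: "c ~= 0" and rh0: "rh0 ~= 0" and g: "g = [:rh0, kp, 1:]" and l: "l = [:t, 1:]"
  and dvd: "(l * g ^ 2) ^ 2 dvd s ^ 2 + (l * g) ^ 2 * s + monom c 3 * (l * g) ^ 2" shows "kp ^ 3 = c & rh0 = t ^ 2"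
proof -
 have nz: "g ~= 0" "l ~= 0" "degree g = 2" by (simp_all add: g l)
 have "l * g ^ 2 dvd s ^ 2 + (l * g) ^ 2 * s + monom c 3 * (l * g) ^ 2" using dvd unfolding power2_eq_square[of "l * g ^ 2"] by (metis dvd_mult_left)
 then have "l * g ^ 2 dvd (s ^ 2 + (l * g) ^ 2 * s + monom c 3 * (l * g) ^ 2) - (l * g ^ 2) * (l * (s + monom c 3))" by (intro dvd_diff) auto
 also have "(s ^ 2 + (l * g) ^ 2 * s + monom c 3 * (l * g) ^ 2) - (l * g ^ 2) * (l * (s + monom c 3)) = s ^ 2"
  by (simp add: power2_eq_square algebra_simps)
 finally have ls: "l * g ^ 2 dvd s ^ 2" .
 then have "g dvd s" by (intro square_dvd_square[OF nz(1)]) (metis dvd_mult_right)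
 then obtain u where u: "s = g * u" by (auto elim: dvdE)
 have "g ^ 2 * l dvd g ^ 2 * u ^ 2" using ls unfolding u by (simp add: power_mult_distrib mult.commute)
 then have "l dvd u ^ 2" using nz(1) by simp
 then have "poly u (- t) ^ 2 = 0" by (auto simp: l elim!: dvdE simp flip: poly_power)
 then obtain si where "u = l * si" using root_factor[of u "- t"] by (auto simp: l)
 then have s: "s = g * l * si" by (simp add: u mult.assoc)
 have "(l * g) ^ 2 * g ^ 2 dvd (l * g) ^ 2 * (si ^ 2 + g * l * si + monom c 3)" using dvd unfolding s by (simp add: power2_eq_square algebra_simps)
 then have Ps: "g ^ 2 dvd si ^ 2 + g * l * si + monom c 3" using nz(1,2) unfolding dvd_mult_cancel_left by simp
 have pg: "pderiv g = [:kp:]" by (simp add: g pderiv_pCons c2)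
 have m: "monom c 3 = [:0, 0, 0, c:]" "monom c 2 = [:0, 0, c:]" by (simp_all add: numeral_3_eq_3 numeral_2_eq_2 monom_Suc monom_0)
 have "g dvd (pderiv g * l) ^ 2 * monom c 3 + pderiv (monom c 3) ^ 2" by (rule eliminate[OF Ps])
 also have "\<dots> = monom c 3 * (([:kp:] * l) ^ 2 + [:0, c:])" unfolding pg pderiv_X3 unfolding m by (simp add: l power2_eq_square algebra_simps)
 finally have "g dvd ([:kp:] * l) ^ 2 + [:0, c:]" by (rule dvd_monom_mult_cancel[OF _ c]) (simp add: g rh0)
 also have "([:kp:] * l) ^ 2 + [:0, c:] = g * [:kp ^ 2:] + [:kp ^ 2 * (rh0 + t ^ 2), c + kp ^ 3:]"
  by (simp add: l g power2_eq_square power3_eq_cube algebra_simps c2)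
 finally have "g dvd [:kp ^ 2 * (rh0 + t ^ 2), c + kp ^ 3:]" by (metis dvd_add_right_iff dvd_triv_left)
 then have "kp ^ 2 * (rh0 + t ^ 2) = 0" "c + kp ^ 3 = 0" using dvd_small nz(3) by blast+
 then have "c = kp ^ 3" "kp ~= 0" using c add_0_eq[of c "kp ^ 3"] by auto
 then show ?thesis using \<open>kp ^ 2 * (rh0 + t ^ 2) = 0\<close> add_0_eq[of rh0 "t ^ 2"] by simp
qed

text \<open>A curve of genus zero satisfying the equations would have
  \<open>P = (x + af)^2 R^2\<close>, so \<open>e = R1\<close> and \<open>d = af^2 + R0\<close>, and
  also \<open>P = (l g)^2\<close>. With \<open>v = t / af\<close>, comparison of coefficients and
  \<open>E1 = 0\<close> leave \<open>v = 1\<close> or \<open>1 + v + v^2 = 0\<close>. In both cases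
  \<open>d = 0\<close>, where \<open>E2\<close> is \<open>R1^3 R0^2\<close> and not zero.\<close>

lemma rational_excluded:
 fixes af t kp R0 R1 c :: 'a
 assumes c: "c ~= 0" "c = kp ^ 3" and t: "t ~= 0" and eq: "[:t, 1:] * [:t ^ 2, kp, 1:] = [:af, 1:] * [:R0, R1, 1:]"
  and E: "E1 c R0 R1 R1 (af ^ 2 + R0) = 0" "E2 c R0 R1 R1 (af ^ 2 + R0) = 0" shows False
proof -
 have e: "t ^ 3 = af * R0" "t ^ 2 + t * kp = R0 + af * R1" "kp + t = R1 + af"
  using eq by (simp_all add: power2_eq_square power3_eq_cube algebra_simps)
 have nz: "af ~= 0" "R0 ~= 0" using e(1) t by auto
 define v where "v = t / af"
 have tv: "t = af * v" using nz by (simp add: v_def)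
 have "af * R0 = af * (af ^ 2 * v ^ 3)" unfolding e(1)[symmetric] tv by (simp add: power2_eq_square power3_eq_cube)
 then have R0: "R0 = af ^ 2 * v ^ 3" using nz by simp
 have kp: "kp = R1 + af + t" using e(3) double[of t] by (metis add.assoc add.right_neutral)
 have v0: "v ~= 0" using t tv by auto
 have E2d: False if "af ^ 2 + R0 = 0" "R1 ~= 0" using E(2) that nz unfolding \<open>af ^ 2 + R0 = 0\<close> by (simp add: E2_def)
 have "t ^ 2 + t * (R1 + af + t) = t * R1 + t * af" by (simp add: power2_eq_square algebra_simps c2)
 then have t1: "t * R1 + t * af = R0 + af * R1" using e(2) unfolding kp by simp
 have "af * (1 + v) * R1 = (t * R1 + t * af) + (t * af + af * R1)" unfolding tv by (simp add: algebra_simps c2)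
 also have "\<dots> = R0 + t * af" unfolding t1 by (simp add: algebra_simps c2)
 also have "\<dots> = af * (1 + v) * (af * v * (1 + v))" unfolding R0 tv by (simp add: power2_eq_square power3_eq_cube algebra_simps c2)
 finally have "af * (1 + v) * R1 = af * (1 + v) * (af * v * (1 + v))" .
 then consider "1 + v = 0" | "R1 = af * v * (1 + v)" "1 + v ~= 0" using nz by auto
 then show False
 proof cases
  case 1
  then have v1: "v = 1" using add_0_eq[of 1 v] by simp
  have "R1 = kp" using kp tv v1 double[of af] by (simp add: add.assoc)
  then show False using E2d c double[of "af ^ 2"] by (auto simp: R0 v1)
 next
  case 2
  have kp': "kp = af * (1 + v) ^ 2" unfolding kp 2(1) tv by (simp add: power2_eq_square algebra_simps c2)
  have "E1 c R0 R1 R1 (af ^ 2 + R0) = af ^ 6 * ((1 + v) ^ 5 * (1 + v + v ^ 2))"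
   unfolding c(2) kp' R0 2(1) E1_def by (simp add: power2_eq_square power3_eq_cube eval_nat_numeral algebra_simps c2)
  then have s: "1 + v + v ^ 2 = 0" using E(1) nz 2(2) by simp
  have "af ^ 2 + R0 = af ^ 2 * ((1 + v) * (1 + v + v ^ 2))" unfolding R0 by (simp add: power2_eq_square power3_eq_cube algebra_simps c2)
  then have "af ^ 2 + R0 = 0" unfolding s by simp
  then show False using E2d 2 nz v0 by auto
 qed
qed

text \<open>The solutions of \<open>E1 = E2 = 0\<close> with \<open>q1 = R1 = 1\<close> and nonzero
  \<open>d\<close>: then \<open>e = 0\<close>, and the equations read \<open>c * R0 = d^3\<close>
  and \<open>R0 = 1 + d^2\<close>.\<close>

lemma ex_parameters:
 obtains d c :: 'a and si q R :: "'a poly" where "d ~= 0" "c ~= 0" "q = [:1 + d + d ^ 2, 1, 1:]" "R = [:(1 + d) ^ 2, 1, 1:]"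
  "1 + d + d ^ 2 ~= 0" "1 + d ~= 0" "R ^ 2 dvd si ^ 2 + q * R * si + monom c 3 * q"
proof -
 define bad where "bad = ([:0, 1:] * [:1, 1:] * [:1, 1, 1:] :: 'a poly)"
 have "bad ~= 0" by (simp add: bad_def)
 then have "\<exists>d. poly bad d ~= 0" using poly_eq_0_cofinite[of "{}" bad] by blast
 moreover have "poly bad d = d * (1 + d) * (1 + d + d ^ 2)" for d by (simp add: bad_def power2_eq_square algebra_simps)
 ultimately obtain d :: 'a where d: "d ~= 0" "1 + d ~= 0" "1 + d + d ^ 2 ~= 0" by (metis mult_eq_0_iff)
 define u where "u = inverse (1 + d)"
 have u: "u * (1 + d) = 1" using d by (simp add: u_def)
 define c where "c = d ^ 3 * u ^ 2"
 define q R where "q = [:1 + d + d ^ 2, 1, 1:]" and "R = [:(1 + d) ^ 2, 1, 1:]"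
 define L where "L = [:(1 + d) ^ 2, d:]"
 define si where "si = smult (d ^ 2 * u) L"
 have id: "smult (d ^ 2) (L ^ 2) + smult (1 + d) (q * R * L) + smult d ([:0, 0, 0, 1:] * q) = R ^ 2 * [:1 + d ^ 2 + d ^ 3, d ^ 2:]"
  unfolding q_def R_def L_def by (simp add: power2_eq_square power3_eq_cube algebra_simps c2)
 have m: "monom c 3 = smult c [:0, 0, 0, 1:]" by (simp add: numeral_3_eq_3 monom_Suc monom_0)
 have "si ^ 2 + q * R * si + monom c 3 * q = smult (d ^ 2 * u ^ 2) (smult (d ^ 2) (L ^ 2) + smult (1 + d) (q * R * L) + smult d ([:0, 0, 0, 1:] * q))"
 proof -
  have e1: "si ^ 2 = smult (d ^ 2 * u ^ 2 * d ^ 2) (L ^ 2)" by (simp add: si_def power2_eq_square mult_ac)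
  have ud: "d ^ 2 * u = d ^ 2 * u ^ 2 * (1 + d)" using u by (simp add: power2_eq_square mult.assoc)
  have e2: "q * R * si = smult (d ^ 2 * u ^ 2 * (1 + d)) (q * R * L)" unfolding si_def mult_smult_right ud[symmetric] ..
  have cd: "c = d ^ 2 * u ^ 2 * d" by (simp add: c_def power2_eq_square power3_eq_cube mult_ac)
  have e3: "monom c 3 * q = smult (d ^ 2 * u ^ 2 * d) ([:0, 0, 0, 1:] * q)" unfolding m mult_smult_left unfolding cd ..
  show ?thesis unfolding e1 e2 e3 smult_add_right smult_smult ..
 qed
 then have "R ^ 2 dvd si ^ 2 + q * R * si + monom c 3 * q" unfolding id by (simp only: mult_smult_right[symmetric] dvd_triv_left)
 moreover have "c ~= 0" using d u by (auto simp: c_def)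
 ultimately show thesis using that d q_def R_def by blast
qed

end

section \<open>Characteristic two: strata and curves for \<open>k = 3\<close>\<close>

locale kite_two = kite_surface k A + characteristic_two ty for k A and ty :: "'a::alg_closed_field itself" +
 assumes k3: "k = 3"
begin

lemma k_six: "2 * k = 6" by (simp add: k3)

text \<open>In terms of \<open>PP\<close>: a factorization into \<open>2 * k = 6\<close> linear
  factors, see \<open>sixfold_iff\<close>.\<close>

definition sixfold :: "(int \<times> int => 'a) => 'a list => bool" where
 "sixfold z xs \<longleftrightarrow> length xs = 2 * k & (\<forall>i\<le>2 * k. z (int i, 0) = coeff (\<Prod>x\<leftarrow>xs. [:- x, 1:]) i)"

text \<open>In terms of \<open>PP\<close>: it is a square.\<close>

definition W0 :: "(int \<times> int => 'a) set" where
 "W0 = {z \<in> chart_vectors. \<exists>xs. length xs = k & sixfold z (xs @ xs)}"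

text \<open>In terms of \<open>PP\<close>: it is \<open>q * R^2\<close> with monic quadratics
  \<open>q\<close> and \<open>R\<close> of equal constant term, the case \<open>d = 0\<close> of
  \<open>conductor_equations\<close>.\<close>

definition W1 :: "(int \<times> int => 'a) set" where
 "W1 = {z \<in> chart_vectors. \<exists>a1 a2 r1 r2. sixfold z [a1, a2, r1, r2, r1, r2] & a1 * a2 + r1 * r2 = 0}"

definition equations :: "'a => 'a => 'a => 'a => 'a => bool" where
 "equations c a1 a2 r1 r2 \<longleftrightarrow> E1 c (r1 * r2) (r1 + r2) (a1 + a2 + (r1 + r2)) (a1 * a2 + r1 * r2) = 0 &
   E2 c (r1 * r2) (r1 + r2) (a1 + a2 + (r1 + r2)) (a1 * a2 + r1 * r2) = 0"

definition W2 :: "(int \<times> int => 'a) set" where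
 "W2 = {z \<in> chart_vectors. \<exists>c a1 a2 r1 r2. c ^ 2 = z (int k, 1) * z (int k, -1) &
   sixfold z [a1, a2, r1, r2, r1, r2] & equations c a1 a2 r1 r2}"

lemma W_chart: "W0 <= chart_vectors" "W1 <= chart_vectors" "W2 <= chart_vectors" by (auto simp: W0_def W1_def W2_def)

lemma sixfold_root:
 assumes "sixfold z xs" "x \<in> set xs" shows "profile z x = 0"
proof -
 have "profile z x = (\<Sum>i\<le>2 * k. coeff (\<Prod>x\<leftarrow>xs. [:- x, 1:]) i * x ^ i)"
  unfolding profile_def using assms(1) by (intro sum.cong) (auto simp: sixfold_def)
 also have "\<dots> = poly (\<Prod>x\<leftarrow>xs. [:- x, 1:]) x"
  using assms(1) by (intro poly_sum_upto[symmetric]) (simp add: degree_prod_linear sixfold_def)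
 also have "\<dots> = 0" using assms(2) by (simp add: prod_linear_root)
 finally show ?thesis .
qed

text \<open>In characteristic two the discriminant is \<open>PP^2\<close>, so the roots of
  \<open>PP\<close> satisfy the integrality hypothesis of \<open>ex_specialization\<close>.\<close>

lemma sixfold_specialization:
 assumes W: "W <= chart_vectors" and z0: "z0 \<in> chart_vectors" "proj_point z0 \<in> zariski A closure_of (proj_point ` W)"
  and cs: "!!c ze. c \<in> set cs ==> ze \<in> W ==> c ze ^ 2 = ze (int k, 1) * ze (int k, -1)"
  and ts: "!!ze. ze \<in> W ==> sixfold ze (map (%t. t ze) ts)" and len: "length ts = 2 * k"
 obtains B e where "specialization W z0 B e" "set cs <= B" "set ts <= B" "sixfold z0 (map e ts)"
proof -
 obtain B e where B: "specialization W z0 B e" "set (cs @ ts) <= B"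
 proof (rule ex_specialization[OF W z0, of "cs @ ts"])
  fix t assume "t \<in> set (cs @ ts)"
  then consider "t \<in> set cs" | "t \<in> set ts" by auto
  then show "(\<forall>ze\<in>W. t ze ^ 2 = ze (int k, 1) * ze (int k, -1)) \<or>
   (\<forall>ze\<in>W. profile ze (t ze) ^ 2 = 4 * (ze (int k, 1) * ze (int k, -1)) * t ze ^ (2 * k))" proof cases case 2
   then have "profile ze (t ze) = 0" if "ze \<in> W" for ze by (intro sixfold_root[OF ts[OF that]]) auto
   then show ?thesis by (simp add: c2)
  qed (use cs in blast)
 qed blast
 interpret specialization W z0 B e by (rule B)
 have tB: "set ts <= B" using B(2) by simp
 have "z0 (int i, 0) = coeff (\<Prod>x\<leftarrow>map e ts. [:- x, 1:]) i" if i: "i \<le> 2 * k" for i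
 proof -
  have "e (%ze. ze (int i, 0)) = e (%ze. coeff (\<Prod>t\<leftarrow>ts. [:- t ze, 1:]) i)"
   using ts i by (intro transfer coord_mem coeff_prod_linear(1)[OF tB]) (simp add: sixfold_def comp_def)
  then show ?thesis by (simp add: e_coord coeff_prod_linear(2)[OF tB] comp_def)
 qed
 then have "sixfold z0 (map e ts)" using len by (simp add: sixfold_def)
 then show thesis using that B tB by simp
qed

lemma W0_closed:
 assumes z0: "z0 \<in> chart_vectors" "proj_point z0 \<in> zariski A closure_of (proj_point ` W0)" shows "z0 \<in> W0"
proof -
 have "\<forall>ze\<in>W0. \<exists>xs. length xs = k & sixfold ze (xs @ xs)" by (simp add: W0_def)
 then obtain xs where xs: "!!ze. ze \<in> W0 ==> length (xs ze) = k" "!!ze. ze \<in> W0 ==> sixfold ze (xs ze @ xs ze)" by metis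
 define tx where "tx = map (%i ze. xs ze ! i) [0..<k]"
 have tx: "map (%t. t ze) tx = xs ze" if "ze \<in> W0" for ze using map_nth_list[OF xs(1)[OF that]] by (simp add: tx_def comp_def)
 obtain B e where "sixfold z0 (map e (tx @ tx))"
  by (rule sixfold_specialization[OF W_chart(1) z0, of "[]" "tx @ tx"]) (auto simp: tx xs tx_def[THEN arg_cong[of _ _ length]])
 then show ?thesis unfolding W0_def using z0 by (intro CollectI conjI exI[of _ "map e tx"]) (auto simp: tx_def)
qed

lemma W1_closed:
 assumes z0: "z0 \<in> chart_vectors" "proj_point z0 \<in> zariski A closure_of (proj_point ` W1)" shows "z0 \<in> W1"
proof -
 have "\<forall>ze\<in>W1. \<exists>a1 a2 r1 r2. sixfold ze [a1, a2, r1, r2, r1, r2] & a1 * a2 + r1 * r2 = 0" by (simp add: W1_def)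
 then obtain a1 a2 r1 r2 where x: "!!ze. ze \<in> W1 ==> sixfold ze [a1 ze, a2 ze, r1 ze, r2 ze, r1 ze, r2 ze]"
  and d: "!!ze. ze \<in> W1 ==> a1 ze * a2 ze + r1 ze * r2 ze = 0" by metis
 obtain B e where sp: "specialization W1 z0 B e" and B: "set [a1, a2, r1, r2, r1, r2] <= B" and s: "sixfold z0 (map e [a1, a2, r1, r2, r1, r2])"
  by (rule sixfold_specialization[OF W_chart(2) z0, of "[]" "[a1, a2, r1, r2, r1, r2]"]) (auto simp: x k_six)
 interpret specialization W1 z0 B e by (rule sp)
 have "e a1 * e a2 + e r1 * e r2 = 0" using null[of "%ze. a1 ze * a2 ze + r1 ze * r2 ze"] d B by (simp add: mem_intros e_simps)
 then show ?thesis unfolding W1_def using z0 s by auto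
qed

lemma W2_closed:
 assumes z0: "z0 \<in> chart_vectors" "proj_point z0 \<in> zariski A closure_of (proj_point ` W2)" shows "z0 \<in> W2"
proof -
 have "\<forall>ze\<in>W2. \<exists>c a1 a2 r1 r2. c ^ 2 = ze (int k, 1) * ze (int k, -1) & sixfold ze [a1, a2, r1, r2, r1, r2] & equations c a1 a2 r1 r2"
  by (simp add: W2_def)
 then obtain c a1 a2 r1 r2 where c: "!!ze. ze \<in> W2 ==> c ze ^ 2 = ze (int k, 1) * ze (int k, -1)"
  and x: "!!ze. ze \<in> W2 ==> sixfold ze [a1 ze, a2 ze, r1 ze, r2 ze, r1 ze, r2 ze]"
  and eq: "!!ze. ze \<in> W2 ==> equations (c ze) (a1 ze) (a2 ze) (r1 ze) (r2 ze)" by metis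
 obtain B e where sp: "specialization W2 z0 B e" and B: "set [c] <= B" "set [a1, a2, r1, r2, r1, r2] <= B"
  and s: "sixfold z0 (map e [a1, a2, r1, r2, r1, r2])"
  by (rule sixfold_specialization[OF W_chart(3) z0, of "[c]" "[a1, a2, r1, r2, r1, r2]"]) (auto simp: x c k_six)
 interpret specialization W2 z0 B e by (rule sp)
 have "e c ^ 2 = z0 (int k, 1) * z0 (int k, -1)"
  using transfer[of "%ze. c ze ^ 2" "%ze. ze (int k, 1) * ze (int k, -1)"] c B by (simp add: mem_intros e_simps)
 moreover have "equations (e c) (e a1) (e a2) (e r1) (e r2)"
  using null[of "%ze. E1 (c ze) (r1 ze * r2 ze) (r1 ze + r2 ze) (a1 ze + a2 ze + (r1 ze + r2 ze)) (a1 ze * a2 ze + r1 ze * r2 ze)"]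
   null[of "%ze. E2 (c ze) (r1 ze * r2 ze) (r1 ze + r2 ze) (a1 ze + a2 ze + (r1 ze + r2 ze)) (a1 ze * a2 ze + r1 ze * r2 ze)"] eq B
  unfolding equations_def E1_def E2_def by (simp add: mem_intros e_simps)
 ultimately show ?thesis unfolding W2_def
  by (intro CollectI conjI exI[of _ "e c"] exI[of _ "e a1"] exI[of _ "e a2"] exI[of _ "e r1"] exI[of _ "e r2"]) (use z0 s in auto)
qed

end

locale curve_two = kite_two k A ty + good_curve k A z for k A and ty :: "'a::alg_closed_field itself" and z :: "int \<times> int => 'a" +
 fixes c :: 'a
 assumes chart: "z \<in> chart_vectors" and c: "c ^ 2 = z (int k, 1) * z (int k, -1)"
begin

lemma c_nz: "c ~= 0" using c ab_nz by auto

lemma degree_six: "degree PP = 6" unfolding degree_PP by (rule k_six)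

lemma PP_nz: "PP ~= 0" using PP_0 by auto

lemma PP_lead: "lead_coeff PP = 1" unfolding degree_PP using chart by (simp add: coeff_PP chart_vectors_def)

text \<open>\<open>QQ\<close> is the square of \<open>monom c k\<close>. Shifting \<open>s\<close>
  by this monomial therefore turns \<open>QQ\<close> into a multiple of \<open>PP\<close>.\<close>

lemma conductor_iff:
 "conductor PP QQ S s \<longleftrightarrow> S ~= 0 & S dvd PP & S ^ 2 dvd (s + monom c k) ^ 2 + PP * (s + monom c k) + monom c k * PP"
proof -
 have Q: "QQ = monom c k ^ 2" by (simp add: QQ_def c[symmetric] power2_eq_square mult_monom mult_2)
 have "(s + monom c k) ^ 2 + PP * (s + monom c k) + monom c k * PP = s ^ 2 + PP * s + QQ + (monom c k * PP + monom c k * PP)"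
  unfolding square_add_poly Q by (simp add: algebra_simps)
 then show ?thesis by (simp add: conductor_def double_poly two_poly)
qed

lemma sixfold_iff: "sixfold z xs \<longleftrightarrow> length xs = 2 * k & PP = (\<Prod>x\<leftarrow>xs. [:- x, 1:])"
proof
 assume s: "sixfold z xs"
 have "PP = (\<Prod>x\<leftarrow>xs. [:- x, 1:])"
 proof (rule poly_eqI)
  fix i
  show "coeff PP i = coeff (\<Prod>x\<leftarrow>xs. [:- x, 1:]) i"
  proof (cases "i \<le> 2 * k")
   case True
   then show ?thesis using s by (simp add: sixfold_def coeff_PP)
  next
   case False
   then show ?thesis using s by (simp add: sixfold_def coeff_PP coeff_eq_0 degree_prod_linear)
  qed
 qed
 then show "length xs = 2 * k & PP = (\<Prod>x\<leftarrow>xs. [:- x, 1:])" using s by (simp add: sixfold_def)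
next
 assume "length xs = 2 * k & PP = (\<Prod>x\<leftarrow>xs. [:- x, 1:])"
 then show "sixfold z xs" unfolding sixfold_def using coeff_PP by metis
qed

text \<open>\<open>q\<close> collects the roots of odd multiplicity of \<open>PP\<close>. By
  \<open>odd_order_root\<close> each of them survives in the cofactor \<open>T\<close>, so the
  degree of \<open>T\<close>, fixed by that of \<open>S\<close>, bounds the even degree of
  \<open>q\<close>.\<close>

lemma conductor_split:
 assumes S: "conductor PP QQ S s"
 obtains q R T where "PP = q * R ^ 2" "PP = S * T" "q dvd T" "degree q = 0 \<or> 2 \<le> degree q" "even (degree q)"
proof -
 have S': "S ~= 0" "S dvd PP" "S ^ 2 dvd (s + monom c k) ^ 2 + PP * (s + monom c k) + monom c k * PP" using S by (simp_all add: conductor_iff)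
 obtain T where T: "PP = S * T" using S'(2) by (auto elim: dvdE)
 obtain q R where q: "PP = q * R ^ 2" "!!r. \<not> [:- r, 1:] ^ 2 dvd q" using ex_squarefree_part[OF PP_nz] by blast
 have nz: "q ~= 0" "R ~= 0" using PP_nz q(1) by auto
 have "q dvd T"
 proof (rule squarefree_dvd[OF nz(1) q(2)])
  fix r assume r: "poly q r = 0"
  have "poly PP r = 0" using r by (simp add: q(1))
  then have "r ~= 0" using PP_0 by auto
  then have "poly (monom c k) r ~= 0" using c_nz by (simp add: poly_monom)
  then show "poly T r = 0" using odd_order_root[OF T PP_nz S'(3)] order_squarefree_part[of q R r] q r PP_nz by simp
 qed
 moreover have "2 * k = degree q + 2 * degree R" using nz unfolding degree_PP[symmetric] q(1) by (simp add: degree_mult_eq degree_power_eq)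
 then have "even (degree q)" by presburger
 then have "degree q = 0 \<or> 2 \<le> degree q" by presburger
 ultimately show thesis using that[OF q(1) T] \<open>even (degree q)\<close> by blast
qed

lemma square_case:
 assumes "PP = q * R ^ 2" "degree q = 0"
 obtains xs where "length xs = k" "PP = (\<Prod>x\<leftarrow>xs @ xs. [:- x, 1:])"
proof -
 have "q ~= 0" "R ~= 0" using PP_nz assms(1) by auto
 then have "2 * k = 2 * degree R" using assms(2) unfolding degree_PP[symmetric] assms(1) by (simp add: degree_mult_eq degree_power_eq)
 moreover have "PP = R ^ 2 * q" using assms(1) by (simp add: mult.commute)
 ultimately show thesis using square_factors[of PP R q] degree_PP PP_lead that by (metis mult_left_cancel zero_neq_numeral)
qed

lemma linear_pair: "[:- x, 1:] * [:- y, 1:] = [:x * y, x + y, 1:]" for x y :: 'a by (simp add: c2 add.commute)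

lemma two_linear_factors:
 fixes f :: "'a poly"
 assumes "degree f = 2"
 obtains x y where "f = smult (lead_coeff f) [:x * y, x + y, 1:]"
proof -
 have "f ~= 0" using assms by auto
 then obtain xs where xs: "length xs = 2" "f = smult (lead_coeff f) (\<Prod>x\<leftarrow>xs. [:- x, 1:])" using linear_factors assms by metis
 then obtain x y where "xs = [x, y]" by (auto simp: numeral_2_eq_2 length_Suc_conv)
 then have "(\<Prod>x\<leftarrow>xs. [:- x, 1:]) = [:x * y, x + y, 1:]" using linear_pair[of x y] by simp
 then show thesis using that xs(2) by metis
qed

lemma prod_six: "(\<Prod>x\<leftarrow>[a1, a2, r1, r2, r1, r2]. [:- x, 1:]) = [:a1 * a2, a1 + a2, 1:] * [:r1 * r2, r1 + r2, 1:] ^ 2" for a1 :: 'a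
 unfolding linear_pair[symmetric] by (simp only: list.map prod_list.Cons prod_list.Nil power2_eq_square mult_ac mult_1_right mult_1_left)

text \<open>The cofactor \<open>T\<close> has degree two, so \<open>q\<close> is constant, or it is
  quadratic and equals \<open>T\<close> up to a constant; in the second case \<open>S\<close> is
  \<open>R^2\<close> up to a constant and \<open>conductor_equations\<close> applies.\<close>

lemma genus1_cases:
 assumes "proj_point z \<in> severi_irr 1 \<Delta>" shows "z \<in> W0 \<union> W1 \<union> W2"
proof -
 obtain S s where S: "conductor PP QQ S s" "degree S < 2 * k" "1 = 2 * k - 1 - degree S" using assms unfolding severi_irr_iff by blast
 have dS: "degree S = 4" using S(2,3) k3 by simp
 obtain q R T where q: "PP = q * R ^ 2" "PP = S * T" "q dvd T" "degree q = 0 \<or> 2 \<le> degree q" "even (degree q)"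
  by (rule conductor_split[OF S(1)])
 have nz: "q ~= 0" "R ~= 0" "S ~= 0" "T ~= 0" using PP_nz q(1,2) by auto
 have dT: "degree T = 2" using nz dS degree_six by (simp add: q(2) degree_mult_eq)
 then have dq: "degree q \<le> 2" using dvd_imp_degree_le[OF q(3) nz(4)] by simp
 show ?thesis
 proof (cases "degree q = 0")
  case True
  then obtain xs where "length xs = k" "PP = (\<Prod>x\<leftarrow>xs @ xs. [:- x, 1:])" using square_case[OF q(1)] by blast
  then show ?thesis unfolding W0_def using chart sixfold_iff[of "xs @ xs"] by (intro UnI1 CollectI conjI exI[of _ xs]) auto
 next
  case False
  then have dq2: "degree q = 2" using dq q(4) by simp
  have "2 * k = degree q + 2 * degree R" using nz unfolding degree_PP[symmetric] q(1) by (simp add: degree_mult_eq degree_power_eq)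
  then have dR: "degree R = 2" using dq2 k3 by simp
  obtain a1 a2 where a: "q = smult (lead_coeff q) [:a1 * a2, a1 + a2, 1:]" using two_linear_factors[OF dq2] .
  obtain r1 r2 where r: "R = smult (lead_coeff R) [:r1 * r2, r1 + r2, 1:]" using two_linear_factors[OF dR] .
  define q' R' where "q' = [:a1 * a2, a1 + a2, 1:]" and "R' = [:r1 * r2, r1 + r2, 1:]"
  have l1: "lead_coeff q * lead_coeff R ^ 2 = 1" using PP_lead unfolding q(1) by (simp only: lead_coeff_mult lead_coeff_power)
  have "PP = smult (lead_coeff q * lead_coeff R ^ 2) (q' * R' ^ 2)"
   unfolding q(1) by (subst a, subst r) (simp only: q'_def R'_def smult_power mult_smult_left mult_smult_right smult_smult mult.commute)
  then have P: "PP = q' * R' ^ 2" by (simp only: l1 smult_1_left)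
  have six: "sixfold z [a1, a2, r1, r2, r1, r2]" unfolding sixfold_iff prod_six using P by (simp add: q'_def R'_def k3)
  obtain u where u: "T = q * u" using q(3) by (auto elim: dvdE)
  have "u ~= 0" using nz u by auto
  then have "degree u = 0" using dT dq2 nz by (simp add: u degree_mult_eq)
  then obtain t where t: "u = [:t:]" by (rule degree_eq_zeroE)
  have "q * (S * u) = q * R ^ 2" using q(1,2) by (simp add: u mult_ac)
  then have "S * u = R ^ 2" by (rule mult_left_cancel[THEN iffD1, OF nz(1)])
  then have "R ^ 2 = smult t S" by (simp add: t)
  then have "R ^ 2 dvd S" using t \<open>u ~= 0\<close> by (simp add: smult_dvd_iff)
  moreover have "R' dvd R" by (subst r, rule dvd_smult) (simp only: R'_def dvd_refl)
  then have "R' ^ 2 dvd R ^ 2" by (rule dvd_power_same)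
  ultimately have "(R' ^ 2) ^ 2 dvd S ^ 2" by (metis dvd_power_same dvd_trans)
  also have "S ^ 2 dvd (s + monom c k) ^ 2 + PP * (s + monom c k) + monom c k * PP" using S(1) by (simp add: conductor_iff)
  finally have dv: "(R' ^ 2) ^ 2 dvd (s + monom c k) ^ 2 + q' * R' ^ 2 * (s + monom c k) + monom c 3 * (q' * R' ^ 2)" unfolding P unfolding k3 .
  have "r1 * r2 ~= 0" using PP_0 by (auto simp: P R'_def)
  from conductor_equations[OF this c_nz R'_def q'_def dv]
  have "a1 * a2 + r1 * r2 = 0 \<or> equations c a1 a2 r1 r2" by (simp add: equations_def)
  then show ?thesis unfolding W1_def W2_def using chart c six by blast
 qed
qed

text \<open>The cofactor \<open>T\<close> is linear, so \<open>q\<close> is constant and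
  \<open>PP = G^2\<close>. The root of \<open>T\<close> is a root of \<open>G\<close>, which gives
  \<open>G = l * g\<close>, and \<open>S\<close> is \<open>l * g^2\<close> up to a constant. This is
  the situation of \<open>rational_equations\<close>.\<close>

lemma genus0_excluded:
 assumes "proj_point z \<in> severi_irr 0 \<Delta>" and six: "sixfold z [a1, a2, r1, r2, r1, r2]" and eq: "equations c a1 a2 r1 r2" shows False
proof -
 obtain S s where S: "conductor PP QQ S s" "degree S < 2 * k" "0 = 2 * k - 1 - degree S" using assms(1) unfolding severi_irr_iff by blast
 have dS: "degree S = 5" using S(2,3) k3 by simp
 obtain q R T where q: "PP = q * R ^ 2" "PP = S * T" "q dvd T" "degree q = 0 \<or> 2 \<le> degree q" "even (degree q)"
  by (rule conductor_split[OF S(1)])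
 have nz: "S ~= 0" "T ~= 0" using PP_nz q(2) by auto
 have dT: "degree T = 1" using nz dS degree_six by (simp add: q(2) degree_mult_eq)
 then have "degree q = 0" using dvd_imp_degree_le[OF q(3) nz(2)] q(4) by simp
 then obtain xs where xs: "length xs = k" "PP = (\<Prod>x\<leftarrow>xs @ xs. [:- x, 1:])" using square_case[OF q(1)] by blast
 define G where "G = (\<Prod>x\<leftarrow>xs. [:- x, 1:])"
 have PG: "PP = G ^ 2" by (simp add: xs(2) G_def power2_eq_square)
 obtain t where t: "poly T t = 0" using alg_closed_imp_poly_has_root[of T] dT by auto
 have "poly (G ^ 2) t = 0" unfolding PG[symmetric] q(2) by (simp add: t)
 then have "t \<in> set xs" by (simp add: G_def prod_linear_root)
 then obtain ys where ys: "mset xs = mset (t # ys)" by (metis ex_mset mset.simps(2) multi_member_split set_mset_mset)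
 then have "length ys = 2" using xs(1) k3 by (metis One_nat_def Suc_1 add_diff_cancel_left' length_Cons mset_eq_length numeral_3_eq_3 old.nat.inject)
 then obtain y1 y2 where "ys = [y1, y2]" by (auto simp: numeral_2_eq_2 length_Suc_conv)
 then have "G = [:- t, 1:] * ([:- y1, 1:] * [:- y2, 1:])"
  unfolding G_def using ys by (metis (no_types, lifting) list.simps(8) list.simps(9) mset_map prod_list.Cons prod_list.Nil prod_mset_prod_list mult_1_right)
 then have G: "G = [:t, 1:] * [:y1 * y2, y1 + y2, 1:]" by (simp only: linear_pair) (simp only: c2)
 define l g where "l = [:t, 1:]" and "g = [:y1 * y2, y1 + y2, 1:]"
 obtain T' where "T = [:- t, 1:] * T'" using root_factor[OF t] by blast
 then have T': "T = l * T'" by (simp add: l_def c2)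
 have "S * T = G ^ 2" using q(2) PG by simp
 then have "l * (S * T') = l * (l * g ^ 2)" unfolding T' G l_def[symmetric] g_def[symmetric] by (simp only: power2_eq_square mult_ac)
 then have ST': "S * T' = l * g ^ 2" by (rule mult_left_cancel[THEN iffD1, rotated]) (simp add: l_def)
 have "T' ~= 0" "l ~= 0" using nz T' by auto
 then have "degree T' = 0" using dT unfolding T' by (simp add: degree_mult_eq l_def del: mult_pCons_left)
 then obtain \<tau> where \<tau>: "T' = [:\<tau>:]" by (rule degree_eq_zeroE)
 then have "l * g ^ 2 = smult \<tau> S" using ST' by simp
 then have "l * g ^ 2 dvd S" using \<tau> \<open>T' ~= 0\<close> by (simp add: smult_dvd_iff)
 then have "(l * g ^ 2) ^ 2 dvd S ^ 2" by (rule dvd_power_same)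
 also have "S ^ 2 dvd (s + monom c k) ^ 2 + PP * (s + monom c k) + monom c k * PP" using S(1) by (simp add: conductor_iff)
 finally have dv: "(l * g ^ 2) ^ 2 dvd (s + monom c k) ^ 2 + (l * g) ^ 2 * (s + monom c k) + monom c 3 * (l * g) ^ 2"
  unfolding PG G l_def[symmetric] g_def[symmetric] unfolding k3 .
 have P0: "t ~= 0" "y1 * y2 ~= 0" using PP_0 by (auto simp: PG G)
 have res: "(y1 + y2) ^ 3 = c" "y1 * y2 = t ^ 2" using rational_equations[OF c_nz P0(2) g_def l_def dv] by simp_all
 have six': "PP = [:a1 * a2, a1 + a2, 1:] * [:r1 * r2, r1 + r2, 1:] ^ 2" using six unfolding sixfold_iff prod_six by blast
 \<comment> \<open>Otherwise \<open>a1\<close> would be a simple root of the factor complementary to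
   a square in \<open>PP = G^2\<close>.\<close>
 have "a1 = a2"
 proof (rule ccontr)
  assume "a1 ~= a2"
  have sq: "[:r1 * r2, r1 + r2, 1:] ^ 2 * ([:- a1, 1:] * [:- a2, 1:]) = smult 1 (G ^ 2)"
   unfolding linear_pair using six' PG by (simp only: smult_1_left mult.commute)
  have "poly (pderiv ([:- a1, 1:] * [:- a2, 1:])) a1 = a1 - a2" unfolding pderiv_mult by (simp add: pderiv_pCons)
  then show False using simple_root_not_square[OF _ _ _ sq, of a1] \<open>a1 ~= a2\<close> by simp
 qed
 have "G ^ 2 = ([:a1, 1:] * [:r1 * r2, r1 + r2, 1:]) ^ 2"
 proof -
  have "[:a1 * a2, a1 + a2, 1:] = [:a1, 1:] ^ 2" unfolding \<open>a1 = a2\<close> by (simp add: power2_eq_square)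
  then show ?thesis using six' PG by (simp only: power_mult_distrib)
 qed
 then have "[:t, 1:] * [:t ^ 2, y1 + y2, 1:] = [:a1, 1:] * [:r1 * r2, r1 + r2, 1:]" using square_eq_poly[of G] unfolding G res(2) by blast
 moreover have "E1 c (r1 * r2) (r1 + r2) (r1 + r2) (a1 ^ 2 + r1 * r2) = 0" "E2 c (r1 * r2) (r1 + r2) (r1 + r2) (a1 ^ 2 + r1 * r2) = 0"
  using eq unfolding equations_def \<open>a1 = a2\<close> double by (simp_all add: power2_eq_square)
 ultimately show False using rational_excluded[OF c_nz _ P0(1)] res(1) by blast
qed

end

context kite_two
begin

lemma curve_twoI:
 fixes z :: "int \<times> int => 'a"
 assumes "good_curve k A z" "z \<in> chart_vectors" "c ^ 2 = z (int k, 1) * z (int k, -1)" shows "curve_two k A z c"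
 using assms kite_two_axioms by (simp add: curve_two_def curve_two_axioms_def)

lemma ex_genus1:
 obtains z :: "int \<times> int => 'a" where "proj_point z \<in> severi_irr 1 \<Delta>" "z \<in> chart_vectors" "z \<notin> W0" "z \<notin> W1"
proof -
 obtain d c :: 'a and si q R :: "'a poly" where d: "d ~= 0" and c: "c ~= 0" and q: "q = [:1 + d + d ^ 2, 1, 1:]" and R: "R = [:(1 + d) ^ 2, 1, 1:]"
  and n: "1 + d + d ^ 2 ~= 0" "1 + d ~= 0" and dv: "R ^ 2 dvd si ^ 2 + q * R * si + monom c 3 * q" by (rule ex_parameters)
 define P where "P = q * R ^ 2"
 have nz: "q ~= 0" "R ~= 0" "degree q = 2" "degree R = 2" "lead_coeff q = 1" "lead_coeff R = 1" by (simp_all add: q R)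
 have P: "degree P = 2 * k" "lead_coeff P = 1" "poly P 0 ~= 0"
 proof -
  show "degree P = 2 * k" using nz(1-4) by (simp add: P_def degree_mult_eq degree_power_eq k3)
  show "lead_coeff P = 1" unfolding P_def lead_coeff_mult lead_coeff_power nz(5,6) by simp
  show "poly P 0 ~= 0" using n by (simp add: P_def q R)
 qed
 define z where "z = section_vector P 1 (c ^ 2)"
 have "c ^ 2 ~= 0" "(1 :: 'a) ~= 0" using c by simp_all
 note z = section_vector_good[OF P this(2,1), folded z_def]
 interpret curve_two k A ty z c using curve_twoI[OF z(1,2)] z(4,5) by simp
 have PP: "PP = q * R ^ 2" using z(3) by (simp add: P_def)
 have q_simple: "poly (pderiv q) b = 1" for b by (simp add: q pderiv_pCons c2)
 have qR: "poly R b ~= 0" if "poly q b = 0" for b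
 proof
  assume "poly R b = 0"
  then have "poly q b + poly R b = 0" using that by simp
  moreover have "poly q b + poly R b = d" by (simp add: q R power2_eq_square algebra_simps c2)
  ultimately show False using d by simp
 qed
 obtain b where b: "poly q b = 0" using alg_closed_imp_poly_has_root[of q] nz(3) by auto
 \<comment> \<open>The third nonzero coefficient required by \<open>irr_curveI\<close>.\<close>
 have "coeff PP 5 = 1" unfolding PP q R by (simp add: power2_eq_square eval_nat_numeral algebra_simps c2)
 then have irr: "irr_curve k A z" using irr_curveI[of 5] k3 by simp
 have "z \<notin> W0"
 proof
  assume "z \<in> W0"
  then obtain xs where "PP = (\<Prod>x\<leftarrow>xs @ xs. [:- x, 1:])" by (auto simp: W0_def sixfold_iff)
  then have sq: "R ^ 2 * q = smult 1 ((\<Prod>x\<leftarrow>xs. [:- x, 1:]) ^ 2)" by (simp add: PP power2_eq_square mult.commute)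
  show False by (rule simple_root_not_square[OF nz(2) b _ sq]) (simp add: q_simple)
 qed
 moreover have "z \<notin> W1"
 proof
  assume "z \<in> W1"
  then obtain a1 a2 r1 r2 where six: "sixfold z [a1, a2, r1, r2, r1, r2]" and 0: "a1 * a2 + r1 * r2 = 0" by (auto simp: W1_def)
  define q' R' where "q' = [:a1 * a2, a1 + a2, 1:]" and "R' = [:r1 * r2, r1 + r2, 1:]"
  have PP': "PP = q' * R' ^ 2" using six unfolding sixfold_iff prod_six q'_def R'_def by blast
  \<comment> \<open>At a root of \<open>q\<close> the derivative of \<open>PP\<close> is the square
    of \<open>poly R x\<close>, which is nonzero; so this simple root of \<open>PP\<close> cannot
    come from \<open>R'^2\<close>.\<close>
  have root: "poly q' x = 0" if x: "poly q x = 0" for x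
  proof (rule ccontr)
   assume "poly q' x ~= 0"
   moreover have "poly (q' * R' ^ 2) x = 0" unfolding PP'[symmetric] PP by (simp add: x)
   ultimately have R'x: "poly R' x = 0" by simp
   have "poly (pderiv (q * R ^ 2)) x = poly R x ^ 2" unfolding pderiv_mult pderiv_square by (simp add: q_simple)
   moreover have "poly (pderiv (q' * R' ^ 2)) x = 0" unfolding pderiv_mult pderiv_square by (simp add: R'x)
   ultimately show False using qR[OF x] PP PP' by simp
  qed
  have "q dvd q'"
  proof (rule squarefree_dvd[OF nz(1) _ root])
   fix r
   show "\<not> [:- r, 1:] ^ 2 dvd q"
   proof
    assume "[:- r, 1:] ^ 2 dvd q"
    from square_dvd_derivative[OF this] have "poly (pderiv q) r = 0" by (simp add: poly_eq_0_iff_dvd)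
    then show False using q_simple by simp
   qed
  qed
  then have "q dvd q' - q" by (intro dvd_diff) auto
  also have "q' - q = [:a1 * a2 - (1 + d + d ^ 2), a1 + a2 - 1:]" by (simp add: q'_def q)
  finally have "a1 * a2 - (1 + d + d ^ 2) = 0" "a1 + a2 - 1 = 0" using dvd_small nz(3) by blast+
  then have qq: "a1 * a2 = 1 + d + d ^ 2" "q' = q" by (simp_all add: q'_def q)
  then have "R' = R" using PP PP' nz(1) square_eq_poly[of R' R] by simp
  then have "r1 * r2 = (1 + d) ^ 2" by (simp add: R'_def R)
  then have "d = 0" using 0 qq(1) by (simp add: power2_eq_square algebra_simps c2)
  then show False using d by blast
 qed
 moreover have "proj_point z \<in> severi_irr 1 \<Delta>" unfolding severi_irr_iff
 proof (intro conjI irr exI allI impI)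
  define s where "s = R * si + monom c k"
  have s: "s + monom c k = R * si" unfolding s_def add.assoc double_poly by simp
  have "R ^ 2 * R ^ 2 dvd R ^ 2 * (si ^ 2 + q * R * si + monom c 3 * q)" by (rule mult_dvd_mono[OF dvd_refl dv])
  also have "\<dots> = (R * si) ^ 2 + PP * (R * si) + monom c k * PP" unfolding PP unfolding k3 by (simp add: power2_eq_square algebra_simps)
  finally show "conductor PP QQ (R ^ 2) s" unfolding conductor_iff s using nz by (simp add: PP power2_eq_square)
  show "degree (R ^ 2) < 2 * k" "1 = 2 * k - 1 - degree (R ^ 2)" using nz by (simp_all add: degree_power_eq k3)
  fix S' s' assume S': "conductor PP QQ S' s'"
  obtain q' R' T where T: "PP = q' * R' ^ 2" "PP = S' * T" "q' dvd T" "degree q' = 0 \<or> 2 \<le> degree q'" "even (degree q')"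
   by (rule conductor_split[OF S'])
  have nz': "q' ~= 0" "R' ~= 0" "S' ~= 0" "T ~= 0" using PP_nz T(1,2) by auto
  \<comment> \<open>A constant \<open>q'\<close> would make \<open>PP\<close> a square although
    \<open>b\<close> is a simple root of \<open>q\<close>. Hence every cofactor has degree at least
    two and no conductor has degree above four.\<close>
  have "degree q' ~= 0"
  proof
   assume "degree q' = 0"
   then obtain xs where "PP = (\<Prod>x\<leftarrow>xs @ xs. [:- x, 1:])" using square_case[OF T(1)] by blast
   then have sq: "R ^ 2 * q = smult 1 ((\<Prod>x\<leftarrow>xs. [:- x, 1:]) ^ 2)" by (simp add: PP power2_eq_square mult.commute)
   show False by (rule simple_root_not_square[OF nz(2) b _ sq]) (simp add: q_simple)
  qed
  then have "2 \<le> degree T" using T(4) dvd_imp_degree_le[OF T(3) nz'(4)] by simp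
  moreover have "degree S' + degree T = 6" using nz' degree_six by (simp add: T(2) degree_mult_eq)
  ultimately show "degree S' \<le> degree (R ^ 2)" using nz by (simp add: degree_power_eq)
 qed
 ultimately show thesis using that z(2) by blast
qed

theorem component_two:
 "\<exists>V :: (int \<times> int, 'a) ppoint set. irreducible_component (zariski A) (zariski A closure_of severi_irr 1 \<Delta>) V & V \<inter> severi_irr 0 \<Delta> = {}"
proof (rule component_from_strata[OF W_chart W0_closed W1_closed W2_closed])
 fix z :: "int \<times> int => 'a" assume z: "good_curve k A z" "z \<in> chart_vectors"
 obtain c where c: "c ^ 2 = z (int k, 1) * z (int k, -1)" using power_root_exists[of 2] by auto
 interpret curve_two k A ty z c by (rule curve_twoI[OF z c])
 show "z \<in> W0 \<union> W1 \<union> W2" if "proj_point z \<in> severi_irr 1 \<Delta>" using genus1_cases that by blast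
next
 fix z assume z: "good_curve k A z" "z \<in> chart_vectors" "z \<in> W2" "proj_point z \<in> severi_irr 0 \<Delta>"
 then obtain c a1 a2 r1 r2 where *: "c ^ 2 = z (int k, 1) * z (int k, -1)" "sixfold z [a1, a2, r1, r2, r1, r2]" "equations c a1 a2 r1 r2"
  by (auto simp: W2_def)
 interpret curve_two k A ty z c by (rule curve_twoI[OF z(1,2) *(1)])
 show False using genus0_excluded[OF z(4) *(2,3)] .
next
 show "\<exists>z\<in>chart_vectors. proj_point (z :: int \<times> int => 'a) \<in> severi_irr 1 \<Delta> & z \<notin> W0 & z \<notin> W1"
  by (rule ex_genus1) blast
qed

end

theorem proposition5p14:
  fixes p k k' :: nat
  assumes "CHAR('a::alg_closed_field) = p" and "p > 0"
    and "k = (if p = 2 then 3 else p)" and "k' = k"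
  shows "\<exists>V :: (int \<times> int, 'a) ppoint set.
    irreducible_component (zariski (lattice_points (kite k k')))
      (zariski (lattice_points (kite k k')) closure_of severi_irr 1 (kite k k')) V \<and>
    V \<inter> severi_irr 0 (kite k k') = {}"
proof (cases "p = 2")
  case True
  interpret kite_two k "lattice_points (kite k k)" "TYPE('a)"
    using assms True by unfold_locales auto
  show ?thesis
    using component_two by (simp only: assms(4))
next
  case False
  have k: "k = p"
    using assms(3) False by simp
  have "prime p"
    using prime_CHAR_semidom[where 'a = 'a] assms(1,2) by simp
  then have "odd p" "p > 2"
    using False prime_odd_nat[of p] prime_ge_2_nat[of p] by auto
  then have m: "p = 2 * (p div 2) + 1" "p div 2 \<ge> 1"
    by presburger+
  interpret odd_kite p "lattice_points (kite p p)" "p div 2" "TYPE('a)"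
    using assms(1,2) m by unfold_locales auto
  show ?thesis
    using component_odd by (simp only: assms(4) k)
qed

end
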